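(* Let $\Omega\subset\mathbb{R}^n$ be any smooth bounded and simply connected domain and let $g\in C^2(\overline{\Omega},\mathrm{Sym}_n^+)$ be a Riemannian metric. For any short immersion $\underline{u}\in C^1(\overline{\Omega},\mathbb{R}^{n+1})$, any $\epsilon>0$, and any Hölder exponent $$\alpha<\frac{1}{1+n^2-n},$$ there exists an immersion $u\in C^{1,\alpha}(\overline{\Omega},\mathbb{R}^{n+1})$ such that $$Du^tDu=g\quad\text{and}\quad \|u-\underline{u}\|_0<\epsilon .$$
   Context: $\mathrm{Sym}_n$ is the space of real symmetric $n\times n$ matrices and $\mathrm{Sym}_n^+$ its subset of positive definite matrices. For a map $u$ from a domain in $\mathbb{R}^n$ into $\mathbb{R}^{n+1}$, $Du$ is the $(n+1)\times n$ Jacobian matrix and $Du^t$ its transpose, so $(Du^tDu)_{ij}=\partial_iu\cdot\partial_ju$. An immersion $u$ is short (with respect to $g$) if $Du^tDu\le g$ in the sense of quadratic forms at every point. $\|\cdot\|_0$ is the supremum norm on $\overline\Omega$. Hölder exponents are positive, and $C^{1,\alpha}(\overline\Omega)$ is the usual Hölder space. *)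

theory Defs
  imports "HOL-Analysis.Analysis"
begin

section \<open>Derivatives up to the boundary\<close>

(* On the open set W this is f; at a boundary point of W it is the limit of f from inside W
   (an arbitrary value if that limit does not exist). *)
definition bdry_ext :: "'a::topological_space set \<Rightarrow> ('a \<Rightarrow> 'b::t2_space) \<Rightarrow> 'a \<Rightarrow> 'b" where
  "bdry_ext W f x = (if x \<in> W then f x else Lim (at x within W) f)"

definition pd :: "(real^'n) set \<Rightarrow> 'n \<Rightarrow> (real^'n \<Rightarrow> 'b::real_normed_vector) \<Rightarrow> real^'n \<Rightarrow> 'b" where
  "pd W i f = bdry_ext W (\<lambda>x. frechet_derivative f (at x) (axis i 1))"

definition Jac :: "(real^'n) set \<Rightarrow> (real^'n \<Rightarrow> real^'m) \<Rightarrow> real^'n \<Rightarrow> real^'n^'m" where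
  "Jac W u = bdry_ext W (\<lambda>x. jacobian u (at x))"

(* To be used with W open and W \<subseteq> S \<subseteq> closure W.  For S = W this is the space C^k(W);
   for S = closure W it is C^k(closure W): all partial derivatives of order at most k exist in W
   and extend continuously to closure W. *)
primrec Ck :: "nat \<Rightarrow> (real^'n) set \<Rightarrow> (real^'n) set \<Rightarrow> (real^'n \<Rightarrow> 'b::real_normed_vector) \<Rightarrow> bool" where
  "Ck 0 W S f \<longleftrightarrow> continuous_on S f"
| "Ck (Suc k) W S f \<longleftrightarrow>
     continuous_on S f \<and> (\<forall>x\<in>W. f differentiable (at x)) \<and> (\<forall>i. Ck k W S (pd W i f))"

abbreviation Ck_closure :: "nat \<Rightarrow> (real^'n) set \<Rightarrow> (real^'n \<Rightarrow> 'b::real_normed_vector) \<Rightarrow> bool" where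
  "Ck_closure k W f \<equiv> Ck k W (closure W) f"

definition smooth_on :: "(real^'n) set \<Rightarrow> (real^'n \<Rightarrow> 'b::real_normed_vector) \<Rightarrow> bool" where
  "smooth_on U f \<longleftrightarrow> (\<forall>k. Ck k U U f)"

definition holder_on :: "real \<Rightarrow> 'a::metric_space set \<Rightarrow> ('a \<Rightarrow> 'b::metric_space) \<Rightarrow> bool" where
  "holder_on \<alpha> S f \<longleftrightarrow> (\<exists>C. \<forall>x\<in>S. \<forall>y\<in>S. dist (f x) (f y) \<le> C * dist x y powr \<alpha>)"

definition C1_holder_closure :: "real \<Rightarrow> (real^'n) set \<Rightarrow> (real^'n \<Rightarrow> 'b::real_normed_vector) \<Rightarrow> bool" where
  "C1_holder_closure \<alpha> W f \<longleftrightarrow> Ck_closure 1 W f \<and> (\<forall>i. holder_on \<alpha> (closure W) (pd W i f))"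

section \<open>Smooth domains\<close>

(* The boundary can be locally straightened by diffeomorphisms P : U \<rightarrow> V of class C^\<infinity>;
   the flat direction is the j-th coordinate of V. *)
definition smooth_boundary :: "(real^'n) set \<Rightarrow> bool" where
  "smooth_boundary W \<longleftrightarrow>
     (\<forall>p\<in>frontier W. \<exists>U V (P :: real^'n \<Rightarrow> real^'n) Q j.
        open U \<and> p \<in> U \<and> open V \<and> homeomorphism U V P Q \<and> smooth_on U P \<and> smooth_on V Q \<and>
        P ` (U \<inter> W) = {y \<in> V. y $ j > 0} \<and>
        P ` (U \<inter> frontier W) = {y \<in> V. y $ j = 0})"

definition smooth_bounded_domain :: "(real^'n) set \<Rightarrow> bool" where
  "smooth_bounded_domain W \<longleftrightarrow>
     open W \<and> connected W \<and> W \<noteq> {} \<and> bounded W \<and> smooth_boundary W"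

section \<open>Metrics and immersions\<close>

definition Sym_pos :: "(real^'n^'n) set" where
  "Sym_pos = {A. transpose A = A \<and> (\<forall>v. v \<noteq> 0 \<longrightarrow> 0 < v \<bullet> (A *v v))}"

definition qf_le :: "real^'n^'n \<Rightarrow> real^'n^'n \<Rightarrow> bool" where
  "qf_le A B \<longleftrightarrow> (\<forall>v. v \<bullet> (A *v v) \<le> v \<bullet> (B *v v))"

definition C2_metric :: "(real^'n) set \<Rightarrow> (real^'n \<Rightarrow> real^'n^'n) \<Rightarrow> bool" where
  "C2_metric W g \<longleftrightarrow> Ck_closure 2 W g \<and> g ` closure W \<subseteq> Sym_pos"

definition immersion :: "(real^'n) set \<Rightarrow> (real^'n \<Rightarrow> real^'m) \<Rightarrow> bool" where
  "immersion W u \<longleftrightarrow> Ck_closure 1 W u \<and> (\<forall>x\<in>closure W. inj ((*v) (Jac W u x)))"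

definition induced :: "(real^'n) set \<Rightarrow> (real^'n \<Rightarrow> real^'m) \<Rightarrow> real^'n \<Rightarrow> real^'n^'n" where
  "induced W u x = transpose (Jac W u x) ** Jac W u x"

definition short :: "(real^'n) set \<Rightarrow> (real^'n \<Rightarrow> real^'n^'n) \<Rightarrow> (real^'n \<Rightarrow> real^'m) \<Rightarrow> bool" where
  "short W g u \<longleftrightarrow> (\<forall>x\<in>closure W. qf_le (induced W u x) (g x))"

end

theory Submission
 imports Defs "HOL-Analysis.Analysis"
begin

text \<open>The map is obtained by convex integration. The metric is extended to a Lipschitz function on the
  whole space (of class \<open>C\<^sup>1\<^sup>,\<^sup>1\<close> if \<open>n = 1\<close>), the short map is smoothed on a neighbourhood of the closed
  domain, and Nash spirals bring the metric defect close to \<open>s\<^sup>2 H\<close> for a small \<open>s\<close>, where \<open>H\<close> is the sum of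
  the squares of the forms \<open>x\<^sub>i\<close> and \<open>x\<^sub>i + x\<^sub>j\<close>, \<open>i < j\<close>. A stage mollifies the map and adds one
  oscillation per square. Modulo symmetrised gradients, which tangential displacements absorb,
  integration by parts turns the errors of the oscillations along the \<open>n\<close> coordinate axes into
  combinations of the other \<open>N = n (n - 1) / 2\<close> squares and an arbitrarily small remainder, and the slow
  quadratic errors are absorbed into the amplitudes by a fixed-point iteration (Kallen). Hence only \<open>N\<close>
  oscillations need a frequency jump that depends on the gain: a stage which multiplies the defect
  by \<open>\<kappa>\<^sup>-\<^sup>m\<close> multiplies the frequency by \<open>\<kappa>\<^sup>n\<^sup>+\<^sup>(\<^sup>m\<^sup>+\<^sup>1\<^sup>)\<^sup>N\<close>. For large \<open>m\<close> and doubly exponentially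
  decreasing defects the stages converge in \<open>C\<^sup>1\<^sup>,\<^sup>\<alpha>\<close> whenever \<open>\<alpha> (1 + 2 N) < 1\<close>.\<close>

text \<open>The threshold 1 + 2N is an exponent count. Let \<open>s^2\<close> be the defect and
  \<open>\<mu>\<close> the frequency entering a stage, \<open>s'\<close> and \<open>\<mu>'\<close>
  those of the next. Gradients must be nearly constant at the mollification length
  \<open>1 / \<mu>\<close>, so a stage tolerates second derivatives of about \<open>s \<mu>\<close>;
  it multiplies them by its frequency factor, which is \<open>(s / s')^(2N)\<close> up to powers of
  \<open>\<kappa>\<close> that do not grow with \<open>m\<close>. Closing the loop takes
  \<open>\<mu>' / \<mu>\<close> above \<open>(s / s')^(1 + 2N)\<close>, that is
  \<open>\<mu> = s^-d\<close> with \<open>d > 1 + 2N\<close>, while the gradient increments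
  O(\<open>s\<close>) sum up in a Hoelder class if \<open>\<alpha> d < 1\<close>. The mollified
  metric must be accurate to \<open>s'^2\<close>: Lipschitz is enough for n > 1, where
  \<open>d > 3\<close>, but not for n = 1, where only \<open>d > 1\<close> is known.
  \<open>H\<close> is used because its coefficients in the squares are all 1, so all amplitudes are
  roots bounded away from 0. Moving by \<open>s f\<close> along the normal and by
  \<open>s^2 w\<close> tangentially changes the metric by \<open>s^2\<close> times an expression of
  flat space up to O(\<open>s^3\<close>), and \<open>s \<kappa>^(m+1) <= 1\<close> keeps the cubic
  term below the next defect.\<close>

type_synonym 'n rfun = "real^'n => real"

abbreviation sum_univ :: "('a::finite => 'b::comm_monoid_add) => 'b" (binder "SU " 10) where
 "sum_univ f == sum f UNIV"

abbreviation diff_at :: "('a::real_normed_vector => 'b::real_normed_vector) => 'a => bool" (infix "dif" 50) where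
 "f dif x == f differentiable (at x)"

abbreviation quad :: "('n::finite => 'n => real) => real^'n => real" where
 "quad M v == SUM j:UNIV. SUM k:UNIV. v $ j * v $ k * M j k"

abbreviation lcomb :: "real^'n => ('n => 'a::real_vector) => 'a" where
 "lcomb v X == SUM i:UNIV. v $ i *\<^sub>R X i"

section \<open>Calculus of partial derivatives of scalar functions\<close>

definition pder :: "'n => 'n::finite rfun => 'n rfun" where
 "pder i f x = frechet_derivative f (at x) (axis i 1)"

abbreviation gram :: "('m::finite => 'n::finite rfun) => 'n => 'n => 'n rfun" where
 "gram u j k x == SUM a:UNIV. pder j (u a) x * pder k (u a) x"

lemma pder_eq:
 assumes "(f has_derivative f') (at x)"
 shows "pder i f x = f' (axis i 1)" using frechet_derivative_at[OF assms] by (simp add: pder_def)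

lemma pder_works:
 assumes "f dif x"
 shows "(f has_derivative (%v. SU i. v $ i * pder i f x)) (at x)"
proof -
 have d: "(f has_derivative frechet_derivative f (at x)) (at x)"
  using assms frechet_derivative_works by blast
 hence l: "linear (frechet_derivative f (at x))" using has_derivative_linear by blast
 have "frechet_derivative f (at x) v = (SU i. v $ i * pder i f x)" for v
 proof -
  have "frechet_derivative f (at x) v = frechet_derivative f (at x) (SU i. v $ i *\<^sub>R axis i 1)"
   by (simp add: basis_expansion flip: scalar_mult_eq_scaleR)
  also have "... = (SU i. v $ i * pder i f x)"
   by (simp add: linear_sum[OF l] linear_scale[OF l] pder_def)
  finally show ?thesis .
 qed
 hence "frechet_derivative f (at x) = (%v. SU i. v $ i * pder i f x)" by blast
 with d show ?thesis by simp
qed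

text \<open>Both sides are chosen by the same predicate \<open>has_derivative\<close>, so the
  equality extends to points where no derivative exists and \<open>pder\<close> is an arbitrary
  value.\<close>

lemma pder_cong:
 assumes "open S" "x:S" "!!y. y:S ==> f y = g y"
 shows "pder i f x = pder i g x"
proof -
 have "(f has_derivative D) (at x) \<longleftrightarrow> (g has_derivative D) (at x)" for D
  using has_derivative_transform_within_open[of f D x UNIV S g]
   has_derivative_transform_within_open[of g D x UNIV S f] assms by auto
 thus ?thesis by (simp add: pder_def frechet_derivative_def)
qed

lemma differentiable_cong_open:
 assumes "open S" "x:S" "!!y. y:S ==> f y = g y"
 shows "f dif x \<longleftrightarrow> g dif x" unfolding differentiable_def
 using has_derivative_transform_within_open[of f _ x UNIV S g]
   has_derivative_transform_within_open[of g _ x UNIV S f] assms by auto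

lemma pder_const [simp]: "pder i (%x. c) x = 0"
 by (rule pder_eq[THEN trans]) (auto intro!: derivative_eq_intros)

lemma pder_const' [simp]: "pder i (%x. c) = (%x. 0)" by (rule ext) simp

lemma
 assumes "f dif x" "g dif x"
 shows pder_add: "pder i (%x. f x + g x) x = pder i f x + pder i g x"
  and pder_diff: "pder i (%x. f x - g x) x = pder i f x - pder i g x"
  and pder_mult: "pder i (%x. f x * g x) x = pder i f x * g x + f x * pder i g x"
proof -
 note d = assms[unfolded frechet_derivative_works]
 show "pder i (%x. f x + g x) x = pder i f x + pder i g x"
  by (subst pder_eq[OF has_derivative_add[OF d]]) (simp add: pder_def)
 show "pder i (%x. f x - g x) x = pder i f x - pder i g x"
  by (subst pder_eq[OF has_derivative_diff[OF d]]) (simp add: pder_def)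
 show "pder i (%x. f x * g x) x = pder i f x * g x + f x * pder i g x"
  by (subst pder_eq[OF has_derivative_mult[OF d]]) (simp add: pder_def)
qed

lemma pder_cmult: "f dif x ==> pder i (%x. c * f x) x = c * pder i f x" by (simp add: pder_mult)

lemma pder_sum:
 assumes "finite I" "!!j. j:I ==> f j dif x"
 shows "pder i (%x. SUM j:I. f j x) x = (SUM j:I. pder i (f j) x)"
 using assms by (induction I) (simp_all add: pder_add)

text \<open>The derivative is written through \<open>sqrt\<close> and \<open>inverse\<close>
  themselves, so that bounds on \<open>sqrt (f p x)\<close> up to some order return bounds of the
  same order on the derivative factor in \<open>symb_compose\<close>.\<close>

lemma DERIV_sqrt_inverse: "0 < y ==> (sqrt has_real_derivative 1/2 * (sqrt y * inverse y)) (at y)"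
proof -
 assume y: "0 < y"
 hence "inverse (sqrt y) / 2 = 1/2 * (sqrt y * inverse y)"
  by (simp add: divide_simps power2_eq_square[symmetric])
 thus ?thesis using DERIV_real_sqrt[OF y] by metis
qed

lemma pder_compose:
 assumes "f dif x" "(\<phi> has_real_derivative d) (at (f x))"
 shows "(%x. \<phi> (f x)) dif x" "pder i (%x. \<phi> (f x)) x = d * pder i f x"
proof -
 have h: "((%x. \<phi> (f x)) has_derivative (%v. frechet_derivative f (at x) v * d)) (at x)"
  using DERIV_compose_FDERIV[where f=\<phi> and g=f, OF assms(2)] assms(1)
  unfolding frechet_derivative_works by blast
 show "(%x. \<phi> (f x)) dif x" using h by (auto simp: differentiable_def)
 show "pder i (%x. \<phi> (f x)) x = d * pder i f x" using pder_eq[OF h] by (simp add: pder_def)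
qed

lemma trig_derivs:
 shows "(%x. sin (a * (x \<bullet> \<xi>))) dif x" "(%x. cos (a * (x \<bullet> \<xi>))) dif x"
  "pder i (%x. sin (a * (x \<bullet> \<xi>))) = (%x. a * \<xi> $ i * cos (a * (x \<bullet> \<xi>)))"
  "pder i (%x. cos (a * (x \<bullet> \<xi>))) = (%x. - (a * \<xi> $ i * sin (a * (x \<bullet> \<xi>))))"
proof -
 have s: "((%x. sin (a * (x \<bullet> \<xi>))) has_derivative (%v. a * (v \<bullet> \<xi>) * cos (a * (x \<bullet> \<xi>)))) (at x)" for x
  by (auto intro!: derivative_eq_intros)
 have c: "((%x. cos (a * (x \<bullet> \<xi>))) has_derivative (%v. - (a * (v \<bullet> \<xi>) * sin (a * (x \<bullet> \<xi>))))) (at x)" for x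
  by (auto intro!: derivative_eq_intros)
 show "(%x. sin (a * (x \<bullet> \<xi>))) dif x" "(%x. cos (a * (x \<bullet> \<xi>))) dif x"
  using s c by (auto simp: differentiable_def)
 show "pder i (%x. sin (a * (x \<bullet> \<xi>))) = (%x. a * \<xi> $ i * cos (a * (x \<bullet> \<xi>)))"
  "pder i (%x. cos (a * (x \<bullet> \<xi>))) = (%x. - (a * \<xi> $ i * sin (a * (x \<bullet> \<xi>))))"
  by (simp_all add: fun_eq_iff pder_eq[OF s] pder_eq[OF c] inner_axis')
qed

section \<open>Symbol classes\<close>

text \<open>The functions depend on a parameter \<open>p\<close> and estimates hold eventually along the filter \<open>F\<close>:
  \<open>symb A l f\<close> means \<open>D\<^sup>k f = O(A l\<^sup>k)\<close> on \<open>U p\<close> for every \<open>k\<close>.\<close>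

locale symbols =
 fixes F :: "'p filter" and U :: "'p => (real^'n) set"
 assumes ev_open: "\<forall>\<^sub>F p in F. open (U p)"
begin

abbreviation ev :: "('p => real^'n => bool) => bool" where
 "ev P == \<forall>\<^sub>F p in F. ALL x:U p. P p x"

text \<open>The absolute value on the weight admits weights of either sign, so that
  \<open>symb_scale\<close> works for arbitrary factors \<open>c p\<close>.\<close>

definition bdd0 :: "('p => real) => ('p => 'n::finite rfun) => bool" where
 "bdd0 A f \<longleftrightarrow> (EX C. ev (%p x. \<bar>f p x\<bar> <= C * \<bar>A p\<bar>))"

primrec bddk :: "nat => ('p => real) => ('p => real) => ('p => 'n::finite rfun) => bool" where
 "bddk 0 A l f \<longleftrightarrow> bdd0 A f"
| "bddk (Suc k) A l f \<longleftrightarrow> bdd0 A f & ev (%p x. f p dif x) &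
  (ALL i. bddk k (%p. A p * l p) l (%p. pder i (f p)))"

definition symb :: "('p => real) => ('p => real) => ('p => 'n::finite rfun) => bool" where
 "symb A l f \<longleftrightarrow> (ALL k. bddk k A l f)"

lemma bdd0E:
 assumes "bdd0 A f"
 obtains C where "C > 0" "ev (%p x. \<bar>f p x\<bar> <= C * \<bar>A p\<bar>)"
proof -
 obtain C where C: "ev (%p x. \<bar>f p x\<bar> <= C * \<bar>A p\<bar>)"
  using assms by (auto simp: bdd0_def)
 have "ev (%p x. \<bar>f p x\<bar> <= (\<bar>C\<bar> + 1) * \<bar>A p\<bar>)" using C
 proof eventually_elim
  case (elim p)
  have "C * \<bar>A p\<bar> <= (\<bar>C\<bar> + 1) * \<bar>A p\<bar>" by (intro mult_right_mono) auto
  thus ?case using elim by force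
 qed
 thus ?thesis by (rule that[rotated]) simp
qed

lemma bdd0_cong:
 assumes "ev (%p x. f p x = g p x)" "bdd0 A f"
 shows "bdd0 A g"
proof -
 obtain C where C: "ev (%p x. \<bar>f p x\<bar> <= C * \<bar>A p\<bar>)"
  using assms by (auto simp: bdd0_def)
 have "ev (%p x. \<bar>g p x\<bar> <= C * \<bar>A p\<bar>)" using C assms(1) by eventually_elim simp
 thus ?thesis by (auto simp: bdd0_def)
qed

lemma bddk_cong:
 "ev (%p x. f p x = g p x) ==> bddk k A l f ==> bddk k A l g"
proof (induction k arbitrary: f g A)
 case 0
 thus ?case using bdd0_cong by simp
next
 case (Suc k)
 have d: "ev (%p x. g p dif x)"
 proof -
  have "ev (%p x. f p dif x)" using Suc by simp
  thus ?thesis using Suc(2) ev_open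
   proof eventually_elim
   case (elim p)
   thus ?case using differentiable_cong_open[of "U p" _ "f p" "g p"] by auto
  qed
 qed
 have e: "ev (%p x. pder i (f p) x = pder i (g p) x)" for i
  using Suc(2) ev_open proof eventually_elim
  case (elim p)
  thus ?case using pder_cong[of "U p" _ "f p" "g p"] by auto
 qed
 have "bddk k (%p. A p * l p) l (%p. pder i (f p))" for i using Suc.prems(2) by simp
 hence "bddk k (%p. A p * l p) l (%p. pder i (g p))" for i by (rule Suc.IH[OF e])
 moreover have "bdd0 A g" using bdd0_cong Suc.prems by auto
 ultimately show ?case using d by simp
qed

lemma bdd0_mono:
 assumes "bdd0 A f" "\<forall>\<^sub>F p in F. \<bar>A p\<bar> <= c * \<bar>A' p\<bar>"
 shows "bdd0 A' f"
proof -
 obtain C where C: "C > 0" "ev (%p x. \<bar>f p x\<bar> <= C * \<bar>A p\<bar>)"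
  using assms(1) by (rule bdd0E)
 have "ev (%p x. \<bar>f p x\<bar> <= (C * c) * \<bar>A' p\<bar>)" using C(2) assms(2)
 proof eventually_elim
  case (elim p)
  have "C * \<bar>A p\<bar> <= C * (c * \<bar>A' p\<bar>)" using elim C by simp
  thus ?case using elim by (fastforce simp: mult.assoc)
 qed
 thus ?thesis by (auto simp: bdd0_def)
qed

lemma bddk_mono:
 assumes "\<forall>\<^sub>F p in F. \<bar>l p\<bar> <= d * \<bar>l' p\<bar>"
 shows "bddk k A l f ==> \<forall>\<^sub>F p in F. \<bar>A p\<bar> <= c * \<bar>A' p\<bar> ==> bddk k A' l' f"
proof (induction k arbitrary: f A A' c)
 case 0
 thus ?case using bdd0_mono by auto
next
 case (Suc k)
 have *: "\<forall>\<^sub>F p in F. \<bar>A p * l p\<bar> <= (c * d) * \<bar>A' p * l' p\<bar>"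
  using Suc(3) assms
 proof eventually_elim
  case (elim p)
  hence "\<bar>A p\<bar> * \<bar>l p\<bar> <= (c * \<bar>A' p\<bar>) * (d * \<bar>l' p\<bar>)"
   by (intro mult_mono) (auto intro: order_trans[OF abs_ge_zero])
  thus ?case by (simp add: abs_mult algebra_simps)
 qed
 show ?case using Suc.IH[OF _ *] Suc.prems bdd0_mono by auto
qed

lemma bddk_Suc_D: "bddk (Suc k) A l f ==> bddk k A l f" by (induction k arbitrary: A f) auto

lemma bdd0_add:
 assumes "bdd0 A f" "bdd0 A g"
 shows "bdd0 A (%p x. f p x + g p x)"
proof -
 obtain C where C: "ev (%p x. \<bar>f p x\<bar> <= C * \<bar>A p\<bar>)"
  using assms by (auto simp: bdd0_def)
 obtain D where D: "ev (%p x. \<bar>g p x\<bar> <= D * \<bar>A p\<bar>)"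
  using assms by (auto simp: bdd0_def)
 have "ev (%p x. \<bar>f p x + g p x\<bar> <= (C + D) * \<bar>A p\<bar>)"
  using C D by eventually_elim (fastforce simp: distrib_right)
 thus ?thesis by (auto simp: bdd0_def)
qed

lemma bdd0_mult:
 assumes "bdd0 A f" "bdd0 B g"
 shows "bdd0 (%p. A p * B p) (%p x. f p x * g p x)"
proof -
 obtain C where C: "ev (%p x. \<bar>f p x\<bar> <= C * \<bar>A p\<bar>)"
  using assms by (auto simp: bdd0_def)
 obtain D where D: "ev (%p x. \<bar>g p x\<bar> <= D * \<bar>B p\<bar>)"
  using assms by (auto simp: bdd0_def)
 have "ev (%p x. \<bar>f p x * g p x\<bar> <= (C * D) * \<bar>A p * B p\<bar>)" using C D
 proof eventually_elim
  case (elim p)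
  have "\<bar>f p x\<bar> * \<bar>g p x\<bar> <= (C * \<bar>A p\<bar>) * (D * \<bar>B p\<bar>)" if "x:U p" for x
   using elim that by (intro mult_mono) (auto intro: order_trans[OF abs_ge_zero])
  thus ?case by (simp add: abs_mult algebra_simps)
 qed
 thus ?thesis by (auto simp: bdd0_def)
qed

lemma bdd0_const: "bdd0 (%p. A p) (%p x. A p)" unfolding bdd0_def by (rule exI[of _ 1]) simp

lemma bdd0_zero: "bdd0 A (%p x. 0)" unfolding bdd0_def by (rule exI[of _ 0]) simp

lemma bddk_zero: "bddk k A l (%p x. 0)" by (induction k arbitrary: A) (simp_all add: bdd0_zero)

lemma bddk_const: "bddk k A l (%p x. A p)" using bdd0_const bddk_zero by (cases k) auto

lemma bddk_add:
 "bddk k A l f ==> bddk k A l g ==> bddk k A l (%p x. f p x + g p x)"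
proof (induction k arbitrary: A f g)
 case 0
 thus ?case using bdd0_add by auto
next
 case (Suc k)
 hence d: "ev (%p x. f p dif x)"
  "ev (%p x. g p dif x)" by auto
 have "ev (%p x. (%x. f p x + g p x) dif x)" using d by eventually_elim auto
 moreover have "bddk k (%p. A p * l p) l (%p. pder i (%x. f p x + g p x))" for i
 proof (rule bddk_cong)
  show "ev (%p x. pder i (f p) x + pder i (g p) x = pder i (%x. f p x + g p x) x)"
   using d by eventually_elim (simp add: pder_add)
  show "bddk k (%p. A p * l p) l (%p x. pder i (f p) x + pder i (g p) x)" using Suc by auto
 qed
 ultimately show ?case using Suc bdd0_add by auto
qed

lemma bddk_mult:
 "bddk k A l f ==> bddk k B l g ==> bddk k (%p. A p * B p) l (%p x. f p x * g p x)"
proof (induction k arbitrary: A B f g)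
 case 0
 thus ?case using bdd0_mult by auto
next
 case (Suc k)
 hence d: "ev (%p x. f p dif x)"
  "ev (%p x. g p dif x)" by auto
 have "ev (%p x. (%x. f p x * g p x) dif x)" using d by eventually_elim auto
 moreover have "bddk k (%p. A p * B p * l p) l (%p. pder i (%x. f p x * g p x))" for i
 proof (rule bddk_cong)
  show "ev (%p x. pder i (f p) x * g p x + f p x * pder i (g p) x = pder i (%x. f p x * g p x) x)"
   using d by eventually_elim (simp add: pder_mult)
  have 1: "bddk k (%p. A p * l p) l (%p. pder i (f p))" "bddk k B l g"
   "bddk k A l f" "bddk k (%p. B p * l p) l (%p. pder i (g p))" using Suc bddk_Suc_D by auto
  have "bddk k (%p. A p * B p * l p) l (%p x. pder i (f p) x * g p x)"
   using Suc.IH[OF 1(1,2)] by (simp add: mult_ac)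
  moreover have "bddk k (%p. A p * B p * l p) l (%p x. f p x * pder i (g p) x)"
   using Suc.IH[OF 1(3,4)] by (simp add: mult_ac)
  ultimately show "bddk k (%p. A p * B p * l p) l (%p x. pder i (f p) x * g p x + f p x * pder i (g p) x)"
   by (rule bddk_add)
 qed
 ultimately show ?case using Suc bdd0_mult by auto
qed

lemma symb_bdd0: "symb A l f ==> bdd0 A f" unfolding symb_def using bddk.simps(1) by blast

lemma symbE:
 assumes "symb A l f"
 obtains C where "C > 0" "ev (%p x. \<bar>f p x\<bar> <= C * \<bar>A p\<bar>)"
 by (rule bdd0E[OF symb_bdd0[OF assms]]) (rule that)

lemma symb_differentiable: "symb A l f ==> ev (%p x. f p dif x)"
 unfolding symb_def by (drule spec[of _ "Suc 0"]) simp

lemma symb_pder: "symb A l f ==> symb (%p. A p * l p) l (%p. pder i (f p))" unfolding symb_def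
proof
 fix k assume "ALL k. bddk k A l f"
 hence "bddk (Suc k) A l f" ..
 thus "bddk k (%p. A p * l p) l (%p. pder i (f p))" by simp
qed

lemma symb_cong:
 "symb A l f ==> ev (%p x. f p x = g p x) ==> symb A l g"
 unfolding symb_def by (intro allI bddk_cong[of f g]) auto

lemma symb_mono:
 assumes "symb A l f" "\<forall>\<^sub>F p in F. \<bar>A p\<bar> <= c * \<bar>A' p\<bar>" "\<forall>\<^sub>F p in F. \<bar>l p\<bar> <= d * \<bar>l' p\<bar>"
 shows "symb A' l' f" unfolding symb_def
proof
 fix k show "bddk k A' l' f"
  using assms(1) by (intro bddk_mono[OF assms(3) _ assms(2)]) (simp add: symb_def)
qed

lemma symb_zero: "symb A l (%p x. 0)" by (simp add: symb_def bddk_zero)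

lemma symb_const: "symb A l (%p x. A p)" by (simp add: symb_def bddk_const)

lemma symb_add: "symb A l f ==> symb A l g ==> symb A l (%p x. f p x + g p x)"
 by (simp add: symb_def bddk_add)

lemma symb_mult: "symb A l f ==> symb B l g ==> symb (%p. A p * B p) l (%p x. f p x * g p x)"
 by (simp add: symb_def bddk_mult)

lemma symb_scale: "symb A l f ==> symb (%p. c p * A p) l (%p x. c p * f p x)"
 using symb_mult[OF symb_const] .

lemma symb_cmult: "symb A l f ==> symb A l (%p x. c * f p x)"
 by (rule symb_mono[OF symb_scale[where c="%p. c"], where c="\<bar>c\<bar>" and d=1])
  (auto simp: abs_mult intro!: always_eventually)

lemma symb_uminus: "symb A l f ==> symb A l (%p x. - f p x)" using symb_cmult[of A l f "-1"] by simp

lemma symb_diff: "symb A l f ==> symb A l g ==> symb A l (%p x. f p x - g p x)"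
 using symb_add[OF _ symb_uminus] by simp

lemma symb_sum: "(!!i. i:I ==> symb A l (f i)) ==> symb A l (%p x. SUM i:I. f i p x)"
 by (induction I rule: infinite_finite_induct) (auto simp: symb_zero symb_add)

lemma symb_mult1: "symb (%p. 1) l f ==> symb B l g ==> symb B l (%p x. f p x * g p x)"
 using symb_mult[of "%p. 1"] by simp

lemma symb_mult2: "symb B l f ==> symb (%p. 1) l g ==> symb B l (%p x. f p x * g p x)"
 using symb_mult[of B l f "%p. 1"] by simp

lemma symb_const1: "symb (%p. 1) l (%p x. c)"
 using symb_cmult[OF symb_const[of "%p. 1"], of l c] by simp

lemma symb_prod: "(!!i. i:I ==> symb (%p. 1) l (f i)) ==> symb (%p. 1) l (%p x. PROD i:I. f i p x)"
 by (induction I rule: infinite_finite_induct) (auto simp: symb_const1 symb_mult1)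

text \<open>A bootstrap: the derivative of \<open>\<phi> (f p x)\<close> is \<open>d p x\<close>
  times a derivative of \<open>f\<close>, and \<open>d\<close> is itself built from
  \<open>\<phi> (f p x)\<close>. Bounds of order \<open>k\<close> on the composition thus give
  bounds of order \<open>k + 1\<close>; the last assumption expresses this self-reference.\<close>

lemma symb_compose:
 assumes f: "symb (%p. 1) l f" and b0: "bdd0 (%p. 1) (%p x. \<phi> (f p x))"
  and D: "ev (%p x. (\<phi> has_real_derivative d p x) (at (f p x)))"
  and d: "!!k. bddk k (%p. 1) l (%p x. \<phi> (f p x)) ==> bddk k (%p. 1) l d"
 shows "symb (%p. 1) l (%p x. \<phi> (f p x))" unfolding symb_def
proof
 fix k show "bddk k (%p. 1) l (%p x. \<phi> (f p x))"
 proof (induction k)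
  case (Suc k)
  have *: "ev (%p x. (%x. \<phi> (f p x)) dif x & (ALL i. pder i (%x. \<phi> (f p x)) x = d p x * pder i (f p) x))"
   using D symb_differentiable[OF f] by eventually_elim (use pder_compose in blast)
  have "bddk k (%p. 1 * l p) l (%p. pder i (%x. \<phi> (f p x)))" for i
  proof (rule bddk_cong)
   show "ev (%p x. d p x * pder i (f p) x = pder i (%x. \<phi> (f p x)) x)" using * by eventually_elim simp
   have "bddk k (%p. 1 * l p) l (%p. pder i (f p))"
    using f[unfolded symb_def, rule_format, of "Suc k"] by simp
   from bddk_mult[OF d[OF Suc] this] show "bddk k (%p. 1 * l p) l (%p x. d p x * pder i (f p) x)" by simp
  qed
  moreover have "ev (%p x. (%x. \<phi> (f p x)) dif x)" using * by eventually_elim blast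
  ultimately show ?case using b0 by simp
 qed (use b0 in simp)
qed

lemma symb_inverse:
 assumes "symb (%p. 1) l f" "c > 0" "ev (%p x. c <= f p x)"
 shows "symb (%p. 1) l (%p x. inverse (f p x))"
proof (rule symb_compose[where f=f and \<phi>=inverse and d="%p x. - 1 * (inverse (f p x) * inverse (f p x))"])
 show "bdd0 (%p. 1) (%p x. inverse (f p x))" unfolding bdd0_def
 proof
  show "ev (%p x. \<bar>inverse (f p x)\<bar> <= inverse c * \<bar>1\<bar>)" using assms(3)
  proof eventually_elim
   case (elim p)
   show ?case
   proof
    fix x assume x: "x:U p"
    hence "0 < f p x" using assms(2) elim by force
    thus "\<bar>inverse (f p x)\<bar> <= inverse c * \<bar>1\<bar>"
     using le_imp_inverse_le[of c "f p x"] x elim assms(2) by simp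
   qed
  qed
 qed
 show "ev (%p x. (inverse has_real_derivative - 1 * (inverse (f p x) * inverse (f p x))) (at (f p x)))"
  using assms(3)
 proof eventually_elim
  case (elim p)
  show ?case
  proof
   fix x assume x: "x:U p"
   hence nz: "f p x ~= 0" using assms(2) elim by force
   show "(inverse has_real_derivative - 1 * (inverse (f p x) * inverse (f p x))) (at (f p x))"
    using DERIV_inverse[OF nz] by (simp add: power2_eq_square numeral_2_eq_2)
  qed
 qed
 show "bddk k (%p. 1) l (%p x. - 1 * (inverse (f p x) * inverse (f p x)))"
  if "bddk k (%p. 1) l (%p x. inverse (f p x))" for k
  using bddk_mult[OF bddk_const[of k "%p. - 1"] bddk_mult[OF that that]]
  by (rule bddk_mono[where c=1 and d=1, rotated]) simp_all
qed (rule assms(1))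

lemma symb_sqrt:
 assumes "symb (%p. 1) l f" "c > 0" "ev (%p x. c <= f p x)"
 shows "symb (%p. 1) l (%p x. sqrt (f p x))"
proof (rule symb_compose[where f=f and \<phi>=sqrt and d="%p x. 1/2 * (sqrt (f p x) * inverse (f p x))"])
 show "bdd0 (%p. 1) (%p x. sqrt (f p x))"
 proof -
  obtain C where C: "ev (%p x. \<bar>f p x\<bar> <= C * \<bar>1\<bar>)"
   using symb_bdd0[OF assms(1)] by (auto simp: bdd0_def)
  have "ev (%p x. \<bar>sqrt (f p x)\<bar> <= sqrt C * \<bar>1\<bar>)" using C assms(3)
  proof eventually_elim
   case (elim p)
   have "sqrt (f p x) <= sqrt C" "0 <= f p x" if "x:U p" for x
    using elim that assms(2) by fastforce+
   thus ?case by simp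
  qed
  thus ?thesis by (auto simp: bdd0_def)
 qed
 show "ev (%p x. (sqrt has_real_derivative 1/2 * (sqrt (f p x) * inverse (f p x))) (at (f p x)))"
  using assms(3) by eventually_elim (intro ballI DERIV_sqrt_inverse, use assms(2) in force)
 show "bddk k (%p. 1) l (%p x. 1/2 * (sqrt (f p x) * inverse (f p x)))"
  if "bddk k (%p. 1) l (%p x. sqrt (f p x))" for k
  using bddk_mult[OF bddk_const[of k "%p. 1/2"] bddk_mult[OF that symb_inverse[OF assms, unfolded symb_def, rule_format]]]
  by (rule bddk_mono[where c=1 and d=1, rotated]) simp_all
qed (rule assms(1))

text \<open>Differentiation exchanges sine and cosine, so one induction estimates both. The factor
  \<open>c\<close> admits the doubled frequency that arises when an oscillation is squared.\<close>

lemma symb_sin_cos: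
 shows "symb (%p. 1) l (%p x. sin (c * l p * (x \<bullet> \<xi>)))"
  and "symb (%p. 1) l (%p x. cos (c * l p * (x \<bullet> \<xi>)))"
proof -
 have b0: "bdd0 (%p. 1) (%p x. sin (c * l p * (x \<bullet> \<xi>)))" "bdd0 (%p. 1) (%p x. cos (c * l p * (x \<bullet> \<xi>)))"
  unfolding bdd0_def by (rule exI[of _ 1], simp)+
 have *: "bddk k (%p. 1) l (%p x. sin (c * l p * (x \<bullet> \<xi>))) &
  bddk k (%p. 1) l (%p x. cos (c * l p * (x \<bullet> \<xi>)))" for k
 proof (induction k)
  case 0
  thus ?case using b0 by simp
 next
  case (Suc k)
  hence IH: "bddk k (%p. 1) l (%p x. sin (c * l p * (x \<bullet> \<xi>)))"
   "bddk k (%p. 1) l (%p x. cos (c * l p * (x \<bullet> \<xi>)))" by auto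
  have A: "bddk k (%p. l p) l (%p x. c * l p * \<xi> $ i * f p x)" if "bddk k (%p. 1) l f" for i f
  proof (rule bddk_mono[where d=1 and c="\<bar>c * \<xi> $ i\<bar>"])
   show "bddk k (%p. c * l p * \<xi> $ i * 1) l (%p x. c * l p * \<xi> $ i * f p x)"
    by (rule bddk_mult[OF bddk_const that])
  qed (simp_all add: abs_mult)
  have N: "bddk k (%p. l p) l (%p x. - f p x)" if "bddk k (%p. l p) l f" for f
   using bddk_mono[where c=1 and d=1, OF _ bddk_mult[OF bddk_const[of k "%p. -1"] that], where A'=l and l'=l] by simp
  show ?case using b0 A[OF IH(2)] N[OF A[OF IH(1)]] by (simp add: trig_derivs)
 qed
 show "symb (%p. 1) l (%p x. sin (c * l p * (x \<bullet> \<xi>)))"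
  and "symb (%p. 1) l (%p x. cos (c * l p * (x \<bullet> \<xi>)))" using * by (auto simp: symb_def)
qed

end

section \<open>Oscillations and integration by parts\<close>

lemma phi_pder:
 fixes a :: "'n::finite rfun"
 assumes "a dif x" "l ~= 0"
 shows "(%x. 1 / l * (a x * sin (l * (x \<bullet> \<xi>)))) dif x"
  "pder i (%x. 1 / l * (a x * sin (l * (x \<bullet> \<xi>)))) x
   = a x * \<xi> $ i * cos (l * (x \<bullet> \<xi>)) + 1 / l * (pder i a x * sin (l * (x \<bullet> \<xi>)))"
proof -
 have d: "(%x. a x * sin (l * (x \<bullet> \<xi>))) dif x"
  using assms(1) trig_derivs(1) by (rule differentiable_mult)
 thus "(%x. 1 / l * (a x * sin (l * (x \<bullet> \<xi>)))) dif x"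
  by (rule differentiable_mult[OF differentiable_const])
 show "pder i (%x. 1 / l * (a x * sin (l * (x \<bullet> \<xi>)))) x
   = a x * \<xi> $ i * cos (l * (x \<bullet> \<xi>)) + 1 / l * (pder i a x * sin (l * (x \<bullet> \<xi>)))"
  unfolding pder_cmult[OF d] pder_mult[OF assms(1) trig_derivs(1)] trig_derivs using assms(2)
  by (simp add: field_simps)
qed

text \<open>The corrector \<open>w\<close> removes the term of order one with frequency \<open>2 * l\<close>.\<close>

lemma osc_expand:
 fixes a :: "'n::finite rfun" and \<xi> :: "real^'n"
 assumes a: "a dif x" and l: "l ~= 0"
 defines "\<phi> == %x. 1 / l * (a x * sin (l * (x \<bullet> \<xi>)))"
  and "w == %k x. \<xi> $ k / 4 * (1 / (2 * l) * (a x * a x * sin (2 * l * (x \<bullet> \<xi>))))"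
 shows "pder j \<phi> x * pder k \<phi> x - 2 * \<phi> x * b =
  (a x)\<^sup>2 / 2 * (\<xi> $ j * \<xi> $ k) + pder j a x * pder k a x / (2 * l^2)
  + (pder j (w k) x + pder k (w j) x)
  + cos (2 * l * (x \<bullet> \<xi>)) * (- (pder j a x * pder k a x) / (2 * l^2))
  + sin (2 * l * (x \<bullet> \<xi>)) * (a x / (4 * l) * (\<xi> $ j * pder k a x + \<xi> $ k * pder j a x))
  + sin (l * (x \<bullet> \<xi>)) * (- 2 * a x * b / l)"
proof -
 define s c where "s = sin (l * (x \<bullet> \<xi>))" and "c = cos (l * (x \<bullet> \<xi>))"
 have s2: "sin (2 * l * (x \<bullet> \<xi>)) = 2 * s * c" and c2: "cos (2 * l * (x \<bullet> \<xi>)) = c^2 - s^2"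
  using sin_double[of "l * (x \<bullet> \<xi>)"] cos_double[of "l * (x \<bullet> \<xi>)"]
  by (simp_all add: s_def c_def mult.assoc)
 \<comment> \<open>With the slow terms multiplied by this 1, the claim becomes a polynomial identity
   in \<open>c\<close> and \<open>s\<close>.\<close>
 have one: "1 = c^2 + s^2" by (simp add: s_def c_def)
 have aa: "(%x. a x * a x) dif x" using a a by (rule differentiable_mult)
 have wd: "pder j (w k) x = \<xi> $ k / 4 * (a x ^ 2 * \<xi> $ j * (c^2 - s^2) + 2 / (2 * l) * (a x * pder j a x * (2 * s * c)))" for j k
 proof -
  have l2: "2 * l ~= 0" using l by simp
  note P = phi_pder[where a="%x. a x * a x" and \<xi>=\<xi>, OF aa l2]
  show ?thesis unfolding w_def pder_cmult[OF P(1)] P(2) pder_mult[OF a a] s2 c2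
   using l by (simp add: power2_eq_square field_simps)
 qed
 have fd: "pder j \<phi> x = a x * \<xi> $ j * c + 1 / l * (pder j a x * s)" for j
  unfolding \<phi>_def c_def s_def by (rule phi_pder[OF a l])
 have f0: "\<phi> x = 1 / l * (a x * s)" by (simp add: \<phi>_def s_def)
 define q where "q = 1 / l"
 define u v A Y Z where "u = \<xi> $ j" and "v = \<xi> $ k" and "A = a x" and "Y = pder j a x" and "Z = pder k a x"
 have "(A * u * c + q * (Y * s)) * (A * v * c + q * (Z * s)) - 2 * (q * (A * s)) * b
  = (c^2 + s^2) * (A^2 / 2 * (u * v) + Y * Z * q^2 / 2)
  + (v / 4 * (A^2 * u * (c^2 - s^2) + q * (A * Y * (2 * s * c))) + u / 4 * (A^2 * v * (c^2 - s^2) + q * (A * Z * (2 * s * c))))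
  + (c^2 - s^2) * (- (Y * Z) * q^2 / 2)
  + (2 * s * c) * (A * q / 4 * (u * Z + v * Y)) + s * (- 2 * A * b * q)"
  by (simp add: power2_eq_square field_simps)
 thus ?thesis
  unfolding fd f0 wd s2 c2 s_def[symmetric] u_def[symmetric] v_def[symmetric] A_def[symmetric] Y_def[symmetric] Z_def[symmetric]
  unfolding one[symmetric] q_def by (simp add: power_divide field_simps)
qed

text \<open>For symmetric \<open>c\<close>, entry \<open>j k\<close> of the sum over unordered pairs
  of distinct axes of \<open>c a b\<close> times the square of the form \<open>x_a + x_b\<close>
  (see \<open>sum_pairs_Lam\<close>). Off the diagonal only the pair of \<open>j\<close> and
  \<open>k\<close> contributes, on it every pair containing \<open>j\<close>; the diagonal of
  \<open>c\<close> does not enter.\<close>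

definition Lam :: "('n::finite => 'n => real) => 'n => 'n => real" where
 "Lam c j k = (if j = k then SUM a:UNIV - {j}. c j a else c j k)"

lemma Lam_add: "Lam (%a b. c a b + d a b) j k = Lam c j k + Lam d j k"
 by (simp add: Lam_def sum.distrib)

lemma Lam_diff: "Lam (%a b. c a b - d a b) j k = Lam c j k - Lam d j k"
 by (simp add: Lam_def sum_subtractf)

lemma Lam_cmult: "Lam (%a b. t * c a b) j k = t * Lam c j k" by (simp add: Lam_def sum_distrib_left)

text \<open>Modulo the span of the symmetric products with a fixed axis, every symmetric matrix is
  a combination of squares of sums of two distinct axes.\<close>

definition dec_r :: "'n::finite => ('n => 'n => real) => 'n => 'n => real" where
 "dec_r i M j k = (if j = i then M k k - (SUM a:UNIV - {i,k}. M k a)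
  else if k = i then M j j - (SUM a:UNIV - {i,j}. M j a) else M j k)"

definition dec_m :: "'n::finite => ('n => 'n => real) => 'n => real" where
 "dec_m i M k = (if k = i then 1/2 * (M i i - (SUM a:UNIV - {i}. dec_r i M i a)) else M i k - dec_r i M i k)"

lemma dec_r_sym: "(!!j k. M j k = M k j) ==> dec_r i M j k = dec_r i M k j" by (simp add: dec_r_def)

text \<open>Off row and column \<open>i\<close>, the off-diagonal entries of \<open>M\<close> force
  the coefficients. Those of pairs containing \<open>i\<close> are still free and are spent on the
  diagonal entries \<open>k k\<close> with \<open>k\<close> distinct from \<open>i\<close>. Row
  \<open>i\<close> is then matched by the product with \<open>axis i 1\<close>, which counts the
  entry \<open>i i\<close> twice; hence the half in \<open>dec_m\<close>.\<close>

lemma dec: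
 assumes sym: "!!j k. M j k = M k j"
 shows "M j k = axis i 1 $ j * dec_m i M k + axis i 1 $ k * dec_m i M j + Lam (dec_r i M) j k"
proof -
 consider "j = i" "k = i" | "j = i" "k ~= i" | "j ~= i" "k = i" | "j ~= i" "k ~= i" "j ~= k" | "j ~= i" "j = k" by blast
 thus ?thesis
 proof cases
  case 1
  thus ?thesis by (simp add: axis_def dec_m_def Lam_def)
 next
  case 2
  thus ?thesis by (simp add: axis_def dec_m_def Lam_def)
 next
  case 3
  thus ?thesis using sym[of j k] dec_r_sym[of M i j i, OF sym] by (simp add: axis_def dec_m_def Lam_def)
 next
  case 4
  thus ?thesis by (simp add: axis_def Lam_def dec_r_def)
 next
  case 5
  have "(SUM a:UNIV - {j}. dec_r i M j a) = dec_r i M j i + (SUM a:UNIV - {j} - {i}. dec_r i M j a)"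
   using 5 by (intro sum.remove) auto
  also have "(SUM a:UNIV - {j} - {i}. dec_r i M j a) = (SUM a:UNIV - {i,j}. M j a)"
   using 5 by (intro sum.cong) (auto simp: dec_r_def)
  finally show ?thesis using 5 by (simp add: axis_def Lam_def dec_r_def)
 qed
qed

text \<open>The Boolean lets one induction treat both trigonometric functions:
  \<open>sg b * tg (~ b) t\<close> is an antiderivative of \<open>tg b t\<close>.\<close>

definition tg :: "bool => real => real" where
 "tg b t = (if b then sin t else cos t)"

definition sg :: "bool => real" where
 "sg b = (if b then -1 else 1)"

lemma tg_pder:
 assumes "m dif x" "l ~= 0"
 shows "(%x. sg b / l * (tg (~ b) (l * (x \<bullet> \<xi>)) * m x)) dif x"
  "pder j (%x. sg b / l * (tg (~ b) (l * (x \<bullet> \<xi>)) * m x)) x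
   = tg b (l * (x \<bullet> \<xi>)) * (\<xi> $ j * m x) + sg b / l * (tg (~ b) (l * (x \<bullet> \<xi>)) * pder j m x)"
proof -
 have t: "(%x. tg (~ b) (l * (x \<bullet> \<xi>))) dif x"
  by (cases b) (simp_all add: tg_def trig_derivs)
 have d: "(%x. tg (~ b) (l * (x \<bullet> \<xi>)) * m x) dif x"
  using t assms(1) by (rule differentiable_mult)
 thus "(%x. sg b / l * (tg (~ b) (l * (x \<bullet> \<xi>)) * m x)) dif x"
  by (rule differentiable_mult[OF differentiable_const])
 have "pder j (%x. tg (~ b) (l * (x \<bullet> \<xi>))) x = sg b * l * \<xi> $ j * tg b (l * (x \<bullet> \<xi>))"
  by (cases b) (simp_all add: tg_def sg_def trig_derivs)
 thus "pder j (%x. sg b / l * (tg (~ b) (l * (x \<bullet> \<xi>)) * m x)) x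
   = tg b (l * (x \<bullet> \<xi>)) * (\<xi> $ j * m x) + sg b / l * (tg (~ b) (l * (x \<bullet> \<xi>)) * pder j m x)"
  unfolding pder_cmult[OF d] pder_mult[OF t assms(1)] using assms(2)
  by (cases b) (simp_all add: sg_def field_simps)
qed

context symbols
begin

lemma symb_mono1: "symb A l f ==> \<forall>\<^sub>F p in F. \<bar>A p\<bar> <= \<bar>A' p\<bar> ==> \<forall>\<^sub>F p in F. \<bar>l p\<bar> <= \<bar>l' p\<bar> ==> symb A' l' f"
 by (rule symb_mono[where c=1 and d=1]) simp_all

lemma symb_tg: "symb (%p. 1) l (%p x. tg b (l p * (x \<bullet> \<xi>)))"
 using symb_sin_cos[where c=1] by (cases b) (simp_all add: tg_def)

lemma symb_dec_r:
 assumes "!!j k. symb A l (M j k)"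
 shows "symb A l (%p x. dec_r i (%a b. M a b p x) j k)"
 by (cases "j = i"; cases "k = i") (simp_all add: dec_r_def assms symb_diff symb_sum)

lemma symb_dec_m:
 assumes "!!j k. symb A l (M j k)"
 shows "symb A l (%p x. dec_m i (%a b. M a b p x) k)"
proof (cases "k = i")
 case True
 thus ?thesis unfolding dec_m_def
  using assms by (simp del: times_divide_eq_left mult_1_left) (intro symb_cmult symb_diff symb_sum symb_dec_r assms)
next
 case False
 thus ?thesis unfolding dec_m_def using assms by (auto intro!: symb_diff symb_dec_r)
qed

text \<open>Every integration by parts in the direction of the oscillation gains a factor \<open>s / l\<close>.\<close>

lemma ibp:
 assumes l: "\<forall>\<^sub>F p in F. 0 < l p" and sl: "\<forall>\<^sub>F p in F. \<bar>s p\<bar> <= l p"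
 shows "(!!j k. symb A s (M j k)) ==> (!!j k. M j k = M k j) ==>
 EX w c E. (ALL k. symb (%p. A p / l p) l (w k)) & (ALL j k. symb A l (c j k) & c j k = c k j) &
  (ALL j k. symb (%p. A p * (s p / l p) ^ J) l (E j k)) &
  ev (%p x. ALL j k. tg b (l p * (x \<bullet> axis i 1)) * M j k p x
    = pder j (w k p) x + pder k (w j p) x + Lam (%a b. c a b p x) j k + E j k p x)"
proof (induction J arbitrary: A M b)
 case 0
 have sl': "\<forall>\<^sub>F p in F. \<bar>s p\<bar> <= \<bar>l p\<bar>" using sl by eventually_elim simp
 have "symb A l (M j k)" for j k by (rule symb_mono1[OF 0(1) _ sl']) simp
 hence "symb A l (%p x. tg b (l p * (x \<bullet> axis i 1)) * M j k p x)" for j k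
  by (rule symb_mult1[OF symb_tg])
 thus ?case
  by (intro exI[of _ "%k p x. 0"] exI[of _ "%j k p x. 0"] exI[of _ "%j k p x. tg b (l p * (x \<bullet> axis i 1)) * M j k p x"])
   (simp add: symb_zero Lam_def)
next
 case (Suc J)
 let ?\<xi> = "axis i 1 :: real^'n"
 have sl': "\<forall>\<^sub>F p in F. \<bar>s p\<bar> <= \<bar>l p\<bar>" using sl by eventually_elim simp
 define m where "m = (%k p x. dec_m i (%a b. M a b p x) k)"
 define r where "r = (%j k p x. dec_r i (%a b. M a b p x) j k)"
 \<comment> \<open>The remainder of one integration by parts is \<open>tg (~ b)\<close> times this
   matrix. It is symmetric like \<open>M\<close> and smaller by the factor \<open>s / l\<close>, so
   the induction hypothesis for \<open>~ b\<close> takes over.\<close>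
 define M' where "M' = (%j k p x. - sg b / l p * (pder j (m k p) x + pder k (m j p) x))"
 have m: "symb A s (m k)" for k unfolding m_def by (rule symb_dec_m) (rule Suc.prems)
 have r: "symb A s (r j k)" for j k unfolding r_def by (rule symb_dec_r) (rule Suc.prems)
 have M'sym: "M' j k = M' k j" for j k by (simp add: M'_def add.commute)
 have M': "symb (%p. A p * (s p / l p)) s (M' j k)" for j k unfolding M'_def
  by (rule symb_mono1[OF symb_scale[where c="%p. - sg b / l p", OF symb_add[OF symb_pder[OF m] symb_pder[OF m]]]])
   (auto intro!: always_eventually simp: sg_def)
 have "EX w c E. (ALL k. symb (%p. A p * (s p / l p) / l p) l (w k)) & (ALL j k. symb (%p. A p * (s p / l p)) l (c j k) & c j k = c k j) &
  (ALL j k. symb (%p. A p * (s p / l p) * (s p / l p) ^ J) l (E j k)) &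
  ev (%p x. ALL j k. tg (~ b) (l p * (x \<bullet> axis i 1)) * M' j k p x
    = pder j (w k p) x + pder k (w j p) x + Lam (%a b. c a b p x) j k + E j k p x)"
  by (rule Suc.IH[OF M' M'sym])
 then obtain w c E where w: "!!k. symb (%p. A p * (s p / l p) / l p) l (w k)"
  and c: "!!j k. symb (%p. A p * (s p / l p)) l (c j k)" "!!j k. c j k = c k j"
  and E: "!!j k. symb (%p. A p * (s p / l p) * (s p / l p) ^ J) l (E j k)"
  and eq: "ev (%p x. ALL j k. tg (~ b) (l p * (x \<bullet> ?\<xi>)) * M' j k p x
    = pder j (w k p) x + pder k (w j p) x + Lam (%a b. c a b p x) j k + E j k p x)" by blast
 define w0 where "w0 = (%k p x. sg b / l p * (tg (~ b) (l p * (x \<bullet> ?\<xi>)) * m k p x))"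
 have w0: "symb (%p. A p / l p) l (w0 k)" for k unfolding w0_def
  by (rule symb_mono1[OF symb_scale[where c="%p. sg b / l p", OF symb_mult1[OF symb_tg symb_mono1[OF m _ sl']]]])
   (auto intro!: always_eventually simp: sg_def)
 have small: "\<forall>\<^sub>F p in F. \<bar>A p * (s p / l p)\<bar> <= \<bar>A p\<bar>" using sl l
 proof eventually_elim
  case (elim p)
  have "\<bar>s p / l p\<bar> <= 1" using elim by simp
  hence "\<bar>A p\<bar> * \<bar>s p / l p\<bar> <= \<bar>A p\<bar> * 1" by (intro mult_left_mono) auto
  thus ?case by (simp add: abs_mult)
 qed
 have small2: "\<forall>\<^sub>F p in F. \<bar>A p * (s p / l p) / l p\<bar> <= \<bar>A p / l p\<bar>"
  using small l by eventually_elim (simp add: divide_right_mono abs_divide[of _ "l _"] del: times_divide_eq_right)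
 define c' where "c' = (%j k p x. tg b (l p * (x \<bullet> ?\<xi>)) * r j k p x + c j k p x)"
 define w' where "w' = (%k p x. w0 k p x + w k p x)"
 have w': "symb (%p. A p / l p) l (w' k)" for k
  unfolding w'_def by (intro symb_add w0 symb_mono1[OF w small2]) auto
 have c': "symb A l (c' j k)" "c' j k = c' k j" for j k
 proof -
  show "symb A l (c' j k)" unfolding c'_def
   by (intro symb_add symb_mult1 symb_tg symb_mono1[OF r _ sl'] symb_mono1[OF c(1) small]) auto
  show "c' j k = c' k j"
   unfolding c'_def r_def using Suc.prems(2) c(2)[of j k] by (subst dec_r_sym) auto
 qed
 have E': "symb (%p. A p * (s p / l p) ^ Suc J) l (E j k)" for j k
  using E[of j k] by (simp add: mult.assoc)
 have "\<forall>\<^sub>F p in F. ALL k. ALL x:U p. m k p dif x"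
  by (intro eventually_all_finite symb_differentiable[OF m])
 moreover have "\<forall>\<^sub>F p in F. ALL k. ALL x:U p. w k p dif x"
  by (intro eventually_all_finite symb_differentiable[OF w])
 ultimately have "ev (%p x. ALL j k. tg b (l p * (x \<bullet> ?\<xi>)) * M j k p x
    = pder j (w' k p) x + pder k (w' j p) x + Lam (%a b. c' a b p x) j k + E j k p x)" using eq l
 proof eventually_elim
  case (elim p)
  show ?case
  proof (intro ballI allI)
   fix x j k assume x: "x:U p"
   define t where "t = tg b (l p * (x \<bullet> ?\<xi>))"
   define t' where "t' = tg (~ b) (l p * (x \<bullet> ?\<xi>))"
   have l0: "l p ~= 0" using elim by simp
   have dm: "m k p dif x" and dw: "w k p dif x" for k using elim x by auto
   have dw0: "w0 k p dif x"
    and pw0: "pder j (w0 k p) x = t * (?\<xi> $ j * m k p x) + sg b / l p * (t' * pder j (m k p) x)" for j k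
    unfolding w0_def t_def t'_def using tg_pder[OF dm l0] by blast+
   have pw: "pder j (w' k p) x = pder j (w0 k p) x + pder j (w k p) x" for j k
    unfolding w'_def by (rule pder_add[OF dw0 dw])
   have M: "M j k p x = ?\<xi> $ j * m k p x + ?\<xi> $ k * m j p x + Lam (%a b. r a b p x) j k"
    unfolding m_def r_def using dec[of "%a b. M a b p x" j k i] Suc.prems(2) by metis
   have Lc: "Lam (%a b. c' a b p x) j k = t * Lam (%a b. r a b p x) j k + Lam (%a b. c a b p x) j k"
    unfolding c'_def t_def by (simp add: Lam_add Lam_cmult)
   have e: "t' * M' j k p x = pder j (w k p) x + pder k (w j p) x + Lam (%a b. c a b p x) j k + E j k p x"
    using elim x by (simp add: t'_def)
   have "t' * M' j k p x = - (sg b / l p * (t' * pder j (m k p) x) + sg b / l p * (t' * pder k (m j p) x))"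
    by (simp add: M'_def algebra_simps)
   with e show "tg b (l p * (x \<bullet> ?\<xi>)) * M j k p x
    = pder j (w' k p) x + pder k (w' j p) x + Lam (%a b. c' a b p x) j k + E j k p x"
    unfolding t_def[symmetric] M pw pw0 Lc by (simp add: distrib_left)
  qed
 qed
 thus ?case using w' c' E' by blast
qed

end

lemma half_square_le: "0 <= q ==> q <= 1 ==> q * q / 2 <= (q::real)"
 using mult_left_mono[of q 1 q] by simp

text \<open>Leading part, divided by \<open>s^2\<close>, of the change of the induced metric when
  the map moves by \<open>s f\<close> along the normal and by \<open>s^2 w\<close> tangentially;
  \<open>B\<close> is the second fundamental form divided by \<open>s\<close>. See
  \<open>geo_step\<close>.\<close>

definition TT :: "('n => 'n => 'p => 'n::finite rfun) => ('p => 'n rfun) => ('n => 'p => 'n rfun)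
  => 'n => 'n => 'p => 'n rfun" where
 "TT B f w j k p x = pder j (w k p) x + pder k (w j p) x - 2 * f p x * B j k p x + pder j (f p) x * pder k (f p) x"

lemma TT_diff:
 assumes "!!k. w k p dif x" "!!k. v k p dif x"
 shows "TT B f (%k p x. w k p x - v k p x) j k p x = TT B f w j k p x - (pder j (v k p) x + pder k (v j p) x)"
 using assms by (simp add: TT_def pder_diff)

text \<open>The corrector \<open>\<phi> * pder k f\<close> cancels the mixed products of derivatives
  of \<open>f\<close> and \<open>\<phi>\<close>. In exchange the Hessian of \<open>f\<close> is
  added to \<open>B\<close>; it appears symmetrised because \<open>w\<close> enters through its
  symmetrised gradient.\<close>

lemma TT_step:
 assumes f: "f p dif x" and w: "!!k. w k p dif x"
  and f': "!!k. pder k (f p) dif x" and \<phi>: "\<phi> p dif x"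
 shows "TT B (%p x. f p x + \<phi> p x) (%k p x. w k p x - \<phi> p x * pder k (f p) x) j k p x
  = TT B f w j k p x + (pder j (\<phi> p) x * pder k (\<phi> p) x
   - 2 * \<phi> p x * (B j k p x + (pder j (pder k (f p)) x + pder k (pder j (f p)) x) / 2))"
proof -
 have m: "(%x. \<phi> p x * pder k (f p) x) dif x" for k
  using \<phi> f' by (rule differentiable_mult)
 show ?thesis unfolding TT_def pder_add[OF f \<phi>] pder_diff[OF w m] pder_mult[OF \<phi> f']
  by (simp add: algebra_simps)
qed

context symbols
begin

text \<open>The first derivative is free, as for an oscillation of amplitude \<open>1 / l\<close>
  and frequency \<open>l\<close>; only further derivatives cost a factor \<open>l\<close>.\<close>

definition adm :: "('p => real) => ('p => 'n::finite rfun) => bool" where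
 "adm l f \<longleftrightarrow> symb (%p. 1) l f & (ALL i. symb (%p. 1) l (%p. pder i (f p)))"

lemma adm_symb: "adm l f ==> symb (%p. 1) l f"
 and adm_pder: "adm l f ==> symb (%p. 1) l (%p. pder i (f p))" by (simp_all add: adm_def)

lemma adm_mono: "adm l f ==> \<forall>\<^sub>F p in F. \<bar>l p\<bar> <= \<bar>l' p\<bar> ==> adm l' f"
 unfolding adm_def using symb_mono1[of "%p. 1" l _ "%p. 1" l'] by simp

lemma adm_inv:
 assumes "symb A l f" "\<forall>\<^sub>F p in F. 1 <= l p" "\<forall>\<^sub>F p in F. \<bar>A p\<bar> <= 1 / l p"
 shows "adm l f" unfolding adm_def
proof (intro conjI allI)
 have "\<forall>\<^sub>F p in F. \<bar>A p\<bar> <= 1"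
  using assms(2,3) by eventually_elim (smt (verit) divide_le_eq_1)
 thus "symb (%p. 1) l f" by (intro symb_mono1[OF assms(1)]) auto
 fix i
 have "\<forall>\<^sub>F p in F. \<bar>A p * l p\<bar> <= 1"
  using assms(2,3) by eventually_elim (simp add: abs_mult pos_le_divide_eq)
 thus "symb (%p. 1) l (%p. pder i (f p))" by (intro symb_mono1[OF symb_pder[OF assms(1)]]) auto
qed

lemma adm_add:
 assumes "adm l f" "adm l g"
 shows "adm l (%p x. f p x + g p x)" unfolding adm_def
proof (intro conjI allI)
 show "symb (%p. 1) l (%p x. f p x + g p x)" using assms by (intro symb_add adm_symb)
 fix i
 have "ev (%p x. pder i (f p) x + pder i (g p) x = pder i (%x. f p x + g p x) x)"
  using symb_differentiable[OF adm_symb[OF assms(1)]] symb_differentiable[OF adm_symb[OF assms(2)]]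
  by eventually_elim (simp add: pder_add)
 thus "symb (%p. 1) l (%p. pder i (%x. f p x + g p x))"
  using assms by (intro symb_cong[OF symb_add[OF adm_pder adm_pder]])
qed

lemma adm_diff:
 assumes "adm l f" "adm l g"
 shows "adm l (%p x. f p x - g p x)" unfolding adm_def
proof (intro conjI allI)
 show "symb (%p. 1) l (%p x. f p x - g p x)" using assms by (intro symb_diff adm_symb)
 fix i
 have "ev (%p x. pder i (f p) x - pder i (g p) x = pder i (%x. f p x - g p x) x)"
  using symb_differentiable[OF adm_symb[OF assms(1)]] symb_differentiable[OF adm_symb[OF assms(2)]]
  by eventually_elim (simp add: pder_diff)
 thus "symb (%p. 1) l (%p. pder i (%x. f p x - g p x))"
  using assms by (intro symb_cong[OF symb_diff[OF adm_pder adm_pder]])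
qed

lemma adm_zero: "adm l (%p x. 0)" by (simp add: adm_def symb_zero)

lemma ev_diff_all: "(!!k. symb (A k) (l k) (w k)) ==> \<forall>\<^sub>F p in F. ALL k::'k::finite. ALL x:U p. w k p dif x"
 by (intro eventually_all_finite symb_differentiable)

abbreviation step_eq where
 "step_eq B f w f' w' a \<xi> \<omega> R == ev (%p x. ALL j k. TT B f' w' j k p x = TT B f w j k p x
  + a p x ^ 2 / 2 * (\<xi> $ j * \<xi> $ k) + pder j (a p) x * pder k (a p) x / (2 * \<omega> p ^ 2) + R j k p x)"

abbreviation fast where
 "fast \<xi> \<omega> M1 M2 M3 j k p x == tg False (2 * \<omega> p * (x \<bullet> \<xi>)) * M1 j k p x
  + tg True (2 * \<omega> p * (x \<bullet> \<xi>)) * M2 j k p x + tg True (\<omega> p * (x \<bullet> \<xi>)) * M3 j k p x"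

abbreviation decomposed where
 "decomposed q \<omega> \<xi> b M w c E == ev (%p x. ALL j k. tg b (q * \<omega> p * (x \<bullet> \<xi>)) * M j k p x
  = pder j (w k p) x + pder k (w j p) x + Lam (%a b. c a b p x) j k + E j k p x)"

context
 fixes \<Lambda> \<omega> :: "'p => real" and a f :: "'p => 'n::finite rfun" and w :: "'n => 'p => 'n rfun" and B :: "'n => 'n => 'p => 'n rfun"
 assumes L1: "\<forall>\<^sub>F p in F. 1 <= \<Lambda> p" and LL: "\<forall>\<^sub>F p in F. \<Lambda> p <= \<omega> p"
  and a: "symb (%p. 1) \<Lambda> a" and f: "adm \<Lambda> f" and w: "!!k. adm \<Lambda> (w k)"
  and B: "!!j k. symb (%p. 1) (%p. 1) (B j k)" and Bsym: "!!j k. B j k = B k j"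
begin

lemma freq_ge_1: "\<forall>\<^sub>F p in F. 1 <= \<omega> p" using L1 LL by eventually_elim simp

lemma freq_mono: "\<forall>\<^sub>F p in F. \<bar>\<Lambda> p\<bar> <= \<bar>\<omega> p\<bar>" using L1 LL by eventually_elim simp

lemma quad_small: "\<bar>c\<bar> <= 1 ==> \<forall>\<^sub>F p in F. \<bar>c / (2 * \<omega> p ^ 2) * (1 * \<Lambda> p * (1 * \<Lambda> p))\<bar> <= \<bar>\<Lambda> p / \<omega> p\<bar>"
 using LL L1
proof eventually_elim
 case (elim p)
 have q: "0 <= \<Lambda> p / \<omega> p" "\<Lambda> p / \<omega> p <= 1" using elim by auto
 have "\<bar>c / (2 * \<omega> p ^ 2) * (1 * \<Lambda> p * (1 * \<Lambda> p))\<bar> = \<bar>c\<bar> * ((\<Lambda> p / \<omega> p) * (\<Lambda> p / \<omega> p) / 2)"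
  using elim by (simp add: power2_eq_square abs_mult)
 also have "... <= 1 * ((\<Lambda> p / \<omega> p) * (\<Lambda> p / \<omega> p) / 2)" using elim by (intro mult_right_mono) auto
 also have "... <= (\<Lambda> p / \<omega> p) * 1" using half_square_le[OF q] by simp
 finally show ?case using abs_ge_self[of "\<Lambda> p / \<omega> p"] by (metis mult_1_right order_trans)
qed

text \<open>\<open>TT_step\<close> adds the oscillation and \<open>osc_expand\<close> computes its
  effect. The three remainders have frequency \<open>\<omega>\<close> or \<open>2 \<omega>\<close>,
  but their coefficients still vary at the slow scale \<open>\<Lambda>\<close>, which is what
  \<open>ibp\<close> exploits. Each coefficient has size \<open>\<Lambda> / \<omega>\<close>: it
  contains a derivative of \<open>a\<close> or, in \<open>M3\<close>, the Hessian of
  \<open>f\<close>.\<close>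

lemma step:
 fixes \<xi> :: "real^'n"
 shows "EX f' w' M1 M2 M3. adm \<omega> f' & (ALL k. adm \<omega> (w' k)) &
  (ALL j k. symb (%p. \<Lambda> p / \<omega> p) \<Lambda> (M1 j k) & symb (%p. \<Lambda> p / \<omega> p) \<Lambda> (M2 j k) & symb (%p. \<Lambda> p / \<omega> p) \<Lambda> (M3 j k)
   & M1 j k = M1 k j & M2 j k = M2 k j & M3 j k = M3 k j) &
  step_eq B f w f' w' a \<xi> \<omega> (fast \<xi> \<omega> M1 M2 M3)"
proof -
 define \<phi> where "\<phi> = (%p x. 1 / \<omega> p * (a p x * sin (\<omega> p * (x \<bullet> \<xi>))))"
 define w0 where "w0 = (%k p x. \<xi> $ k / 4 * (1 / (2 * \<omega> p) * (a p x * a p x * sin (2 * \<omega> p * (x \<bullet> \<xi>)))))"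
 define B' where "B' = (%j k p x. B j k p x + (pder j (pder k (f p)) x + pder k (pder j (f p)) x) / 2)"
 define M1 where "M1 = (%j k p x. - 1 / (2 * \<omega> p ^ 2) * (pder j (a p) x * pder k (a p) x))"
 define M2 where "M2 = (%j k p x. 1 / (4 * \<omega> p) * (a p x * (\<xi> $ j * pder k (a p) x + \<xi> $ k * pder j (a p) x)))"
 define M3 where "M3 = (%j k p x. - 2 / \<omega> p * (a p x * B' j k p x))"
 define w1 where "w1 = (%k p x. w k p x - \<phi> p x * pder k (f p) x)"
 define f' where "f' = (%p x. f p x + \<phi> p x)"
 define w' where "w' = (%k p x. w1 k p x - w0 k p x)"
 have a\<omega>: "symb (%p. 1) \<omega> a" using a by (rule symb_mono1[OF _ _ freq_mono]) simp
 have \<phi>s: "symb (%p. 1 / \<omega> p) \<omega> \<phi>"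
  unfolding \<phi>_def using symb_scale[OF symb_mult1[OF a\<omega> symb_sin_cos(1)[where c=1]], of "%p. 1 / \<omega> p" \<xi>] by simp
 have w0s: "symb (%p. 1 / \<omega> p) \<omega> (w0 k)" for k unfolding w0_def
  by (intro symb_cmult symb_mono1[OF symb_scale[OF symb_mult1[OF symb_mult1[OF a\<omega> a\<omega>] symb_sin_cos(1)[where c=2]]]])
   (auto intro!: always_eventually simp: divide_simps)
 have f2: "symb \<Lambda> \<Lambda> (%p. pder j (pder k (f p)))" for j k
  using symb_pder[OF adm_pder[OF f]] by simp
 have B's: "symb \<Lambda> \<Lambda> (B' j k)" for j k
 proof -
  have "\<forall>\<^sub>F p in F. \<bar>1\<bar> <= \<bar>\<Lambda> p\<bar>" using L1 by eventually_elim simp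
  hence "symb \<Lambda> \<Lambda> (B j k)" by (intro symb_mono1[OF B])
  thus ?thesis
   unfolding B'_def using symb_add[OF _ symb_cmult[OF symb_add[OF f2 f2], of "1/2"]] by simp
 qed
 have M1s: "symb (%p. \<Lambda> p / \<omega> p) \<Lambda> (M1 j k)" for j k unfolding M1_def
  by (rule symb_mono1[OF symb_scale[OF symb_mult[OF symb_pder[OF a] symb_pder[OF a]]]]) (use quad_small[of "- 1"] in auto)
 have M2s: "symb (%p. \<Lambda> p / \<omega> p) \<Lambda> (M2 j k)" for j k unfolding M2_def
  by (intro symb_mono1[OF symb_scale[OF symb_mult1[OF a symb_add[OF symb_cmult[OF symb_pder[OF a]] symb_cmult[OF symb_pder[OF a]]]]]])
   (auto intro!: always_eventually simp: divide_simps mult_le_cancel_right1 abs_mult)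
 have M3s: "symb (%p. \<Lambda> p / \<omega> p) \<Lambda> (M3 j k)" for j k unfolding M3_def
  by (intro symb_mono[OF symb_scale[OF symb_mult1[OF a B's]], where c=2 and d=1])
   (auto intro!: always_eventually simp: divide_simps abs_mult)
 have Msym: "M1 j k = M1 k j" "M2 j k = M2 k j" "M3 j k = M3 k j" for j k
  using Bsym[of j k] by (simp_all add: M1_def M2_def M3_def B'_def mult.commute add.commute)
 have inv: "\<forall>\<^sub>F p in F. \<bar>1 / \<omega> p\<bar> <= 1 / \<omega> p"
  using freq_ge_1 by eventually_elim simp
 have "adm \<omega> f'"
  unfolding f'_def using adm_add[OF adm_mono[OF f freq_mono] adm_inv[OF \<phi>s freq_ge_1 inv]] .
 moreover have "adm \<omega> (w' k)" for k
 proof -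
  have "symb (%p. 1 / \<omega> p) \<omega> (%p x. \<phi> p x * pder k (f p) x)"
   by (intro symb_mult2[OF \<phi>s] symb_mono1[OF adm_pder[OF f] _ freq_mono]) simp
  thus ?thesis unfolding w'_def w1_def
   by (intro adm_diff adm_mono[OF w freq_mono] adm_inv[OF w0s freq_ge_1 inv] adm_inv[OF _ freq_ge_1 inv])
 qed
 moreover have "step_eq B f w f' w' a \<xi> \<omega> (fast \<xi> \<omega> M1 M2 M3)"
  using freq_ge_1 symb_differentiable[OF a] symb_differentiable[OF \<phi>s] symb_differentiable[OF adm_symb[OF f]]
   ev_diff_all[where w=w0, OF w0s] ev_diff_all[where w=w, OF adm_symb[OF w]] ev_diff_all[where w="%k p. pder k (f p)", OF adm_pder[OF f]]
 proof eventually_elim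
  case (elim p)
  show ?case
  proof (intro ballI allI)
   fix x j k assume x: "x:U p"
   have l0: "\<omega> p ~= 0" using elim by simp
   have d: "a p dif x" "f p dif x" "\<phi> p dif x"
    "!!k. w0 k p dif x" "!!k. w k p dif x" "!!k. pder k (f p) dif x" using elim x by auto
   have w1d: "w1 k p dif x" for k
    unfolding w1_def by (intro differentiable_diff d differentiable_mult)
   have "TT B f' w' j k p x = TT B f' w1 j k p x - (pder j (w0 k p) x + pder k (w0 j p) x)"
    unfolding w'_def by (rule TT_diff[where w=w1 and v=w0, OF w1d d(4)])
   also have "TT B f' w1 j k p x = TT B f w j k p x + (pder j (\<phi> p) x * pder k (\<phi> p) x - 2 * \<phi> p x * B' j k p x)"
    unfolding f'_def w1_def B'_def by (rule TT_step) (use d in auto)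
   also have "pder j (\<phi> p) x * pder k (\<phi> p) x - 2 * \<phi> p x * B' j k p x = a p x ^ 2 / 2 * (\<xi> $ j * \<xi> $ k) + pder j (a p) x * pder k (a p) x / (2 * \<omega> p ^ 2)
  + (pder j (w0 k p) x + pder k (w0 j p) x)
  + cos (2 * \<omega> p * (x \<bullet> \<xi>)) * (- (pder j (a p) x * pder k (a p) x) / (2 * \<omega> p ^ 2))
  + sin (2 * \<omega> p * (x \<bullet> \<xi>)) * (a p x / (4 * \<omega> p) * (\<xi> $ j * pder k (a p) x + \<xi> $ k * pder j (a p) x))
  + sin (\<omega> p * (x \<bullet> \<xi>)) * (- 2 * a p x * B' j k p x / \<omega> p)"
    unfolding \<phi>_def w0_def by (rule osc_expand[OF d(1) l0])
   finally show "TT B f' w' j k p x = TT B f w j k p x + a p x ^ 2 / 2 * (\<xi> $ j * \<xi> $ k) + pder j (a p) x * pder k (a p) x / (2 * \<omega> p ^ 2) + fast \<xi> \<omega> M1 M2 M3 j k p x"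
    by (simp add: M1_def M2_def M3_def tg_def)
  qed
 qed
 ultimately show ?thesis using M1s M2s M3s Msym
  by (intro exI[of _ f'] exI[of _ w'] exI[of _ M1] exI[of _ M2] exI[of _ M3]) blast
qed

text \<open>Along a coordinate axis \<open>ibp\<close> splits every fast term into a symmetrised
  gradient, which is moved into \<open>w'\<close>, a \<open>Lam\<close> part left to the later
  squares, and an error of any prescribed order. The accuracy is thus governed by \<open>J\<close>
  and not by the ratio of the frequencies. The slow product of derivatives of \<open>a\<close>
  carries no oscillating factor and stays.\<close>

lemma free_step:
 shows "EX f' w' c E. adm \<omega> f' & (ALL k. adm \<omega> (w' k)) &
  (ALL j k. symb (%p. \<Lambda> p / \<omega> p) \<omega> (c j k) & c j k = c k j) &
  (ALL j k. symb (%p. (\<Lambda> p / \<omega> p) ^ Suc J) \<omega> (E j k)) &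
  step_eq B f w f' w' a (axis i 1) \<omega> (%j k p x. Lam (%a b. c a b p x) j k + E j k p x)"
proof -
 let ?\<xi> = "axis i 1 :: real^'n"
 have l0: "\<forall>\<^sub>F p in F. 0 < \<omega> p" using freq_ge_1 by eventually_elim simp
 have sl: "\<forall>\<^sub>F p in F. \<bar>\<Lambda> p\<bar> <= \<omega> p" using LL L1 by eventually_elim simp
 obtain f1 w1 M1 M2 M3 where f1: "adm \<omega> f1" and w1: "!!k. adm \<omega> (w1 k)"
  and M: "!!j k. symb (%p. \<Lambda> p / \<omega> p) \<Lambda> (M1 j k)" "!!j k. symb (%p. \<Lambda> p / \<omega> p) \<Lambda> (M2 j k)" "!!j k. symb (%p. \<Lambda> p / \<omega> p) \<Lambda> (M3 j k)"
  and Ms: "!!j k. M1 j k = M1 k j" "!!j k. M2 j k = M2 k j" "!!j k. M3 j k = M3 k j"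
  and eq: "step_eq B f w f1 w1 a ?\<xi> \<omega> (fast ?\<xi> \<omega> M1 M2 M3)"
  using step[of "?\<xi>"] by blast
 \<comment> \<open>\<open>ibp\<close> at the frequency \<open>q \<omega>\<close>, with all weights
   restated in terms of \<open>\<omega>\<close>; it is used for \<open>q = 2\<close> and
   \<open>q = 1\<close>.\<close>
 have ibp': "EX w c E. (ALL k. adm \<omega> (w k)) & (ALL j k. symb (%p. \<Lambda> p / \<omega> p) \<omega> (c j k) & c j k = c k j) &
  (ALL j k. symb (%p. (\<Lambda> p / \<omega> p) ^ Suc J) \<omega> (E j k)) &
  decomposed q \<omega> ?\<xi> b M w c E"
  if q: "1 <= q" and M: "!!j k. symb (%p. \<Lambda> p / \<omega> p) \<Lambda> (M j k)" and Ms: "!!j k. M j k = M k j" for b q M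
 proof -
  have ql0: "\<forall>\<^sub>F p in F. 0 < q * \<omega> p" using l0 by eventually_elim (use q in simp)
  have l01: "\<omega> p <= q * \<omega> p" if "1 <= \<omega> p" for p using q that mult_right_mono[of 1 q "\<omega> p"] by simp
  have qsl: "\<forall>\<^sub>F p in F. \<bar>\<Lambda> p\<bar> <= q * \<omega> p"
   using sl freq_ge_1 by eventually_elim (use l01 order_trans in blast)
  have "EX w c E. (ALL k. symb (%p. \<Lambda> p / \<omega> p / (q * \<omega> p)) (%p. q * \<omega> p) (w k)) &
   (ALL j k. symb (%p. \<Lambda> p / \<omega> p) (%p. q * \<omega> p) (c j k) & c j k = c k j) &
  (ALL j k. symb (%p. \<Lambda> p / \<omega> p * (\<Lambda> p / (q * \<omega> p)) ^ J) (%p. q * \<omega> p) (E j k)) &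
  decomposed q \<omega> ?\<xi> b M w c E" by (rule ibp[OF ql0 qsl M Ms])
  then obtain w c E where w: "!!k. symb (%p. \<Lambda> p / \<omega> p / (q * \<omega> p)) (%p. q * \<omega> p) (w k)"
   and c: "!!j k. symb (%p. \<Lambda> p / \<omega> p) (%p. q * \<omega> p) (c j k)" "!!j k. c j k = c k j"
   and E: "!!j k. symb (%p. \<Lambda> p / \<omega> p * (\<Lambda> p / (q * \<omega> p)) ^ J) (%p. q * \<omega> p) (E j k)"
   and eq: "decomposed q \<omega> ?\<xi> b M w c E" by blast
  have ql: "\<forall>\<^sub>F p in F. \<bar>q * \<omega> p\<bar> <= q * \<bar>\<omega> p\<bar>"
   using q by (simp add: abs_mult)
  have r1: "\<Lambda> p / (q * \<omega> p) <= \<Lambda> p / \<omega> p & 0 <= \<Lambda> p / (q * \<omega> p) & \<Lambda> p / \<omega> p <= 1" if "1 <= \<Lambda> p" "1 <= \<omega> p" "\<Lambda> p <= \<omega> p" for p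
   using l01[OF that(2)] that q by (auto intro!: divide_left_mono divide_nonneg_nonneg)
  have wa: "symb (%p. 1 / \<omega> p) \<omega> (w k)" for k
  proof (rule symb_mono[OF w _ ql, where c=1])
   show "\<forall>\<^sub>F p in F. \<bar>\<Lambda> p / \<omega> p / (q * \<omega> p)\<bar> <= 1 * \<bar>1 / \<omega> p\<bar>"
    using L1 LL freq_ge_1
   proof eventually_elim
    case (elim p)
    hence "0 <= \<Lambda> p / (q * \<omega> p)" "\<Lambda> p / (q * \<omega> p) <= 1" using r1[of p] by linarith+
    hence "\<bar>\<Lambda> p / (q * \<omega> p)\<bar> <= 1" by (metis abs_of_nonneg)
    hence "\<bar>\<Lambda> p / (q * \<omega> p)\<bar> * \<bar>1 / \<omega> p\<bar> <= 1 * \<bar>1 / \<omega> p\<bar>" by (intro mult_right_mono) auto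
    thus ?case by (simp add: abs_mult mult.commute)
   qed
  qed
  have wa': "adm \<omega> (w k)" for k
   by (rule adm_inv[OF wa freq_ge_1]) (use freq_ge_1 in \<open>auto elim!: eventually_mono\<close>)
  have ca: "symb (%p. \<Lambda> p / \<omega> p) \<omega> (c j k)" for j k
   by (rule symb_mono[OF c(1) _ ql, where c=1]) auto
  have Ea: "symb (%p. (\<Lambda> p / \<omega> p) ^ Suc J) \<omega> (E j k)" for j k
  proof (rule symb_mono[OF E _ ql, where c=1])
   show "\<forall>\<^sub>F p in F. \<bar>\<Lambda> p / \<omega> p * (\<Lambda> p / (q * \<omega> p)) ^ J\<bar> <= 1 * \<bar>(\<Lambda> p / \<omega> p) ^ Suc J\<bar>"
    using L1 LL freq_ge_1
   proof eventually_elim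
    case (elim p)
    have "(\<Lambda> p / (q * \<omega> p)) ^ J <= (\<Lambda> p / \<omega> p) ^ J" using elim r1[of p] by (intro power_mono) auto
    moreover have "0 <= (\<Lambda> p / (q * \<omega> p)) ^ J" "0 <= \<Lambda> p / \<omega> p" using elim r1[of p] by auto
    ultimately show ?case
     using mult_left_mono[of "(\<Lambda> p / (q * \<omega> p)) ^ J" "(\<Lambda> p / \<omega> p) ^ J" "\<Lambda> p / \<omega> p"] elim by (simp add: abs_mult)
   qed
  qed
  show ?thesis using wa' ca c(2) Ea eq by blast
 qed
 obtain v1 c1 E1 where 1: "!!k. adm \<omega> (v1 k)" "!!j k. symb (%p. \<Lambda> p / \<omega> p) \<omega> (c1 j k)" "!!j k. c1 j k = c1 k j"
  "!!j k. symb (%p. (\<Lambda> p / \<omega> p) ^ Suc J) \<omega> (E1 j k)"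
  and eq1: "decomposed 2 \<omega> ?\<xi> False M1 v1 c1 E1"
  using ibp'[of 2 M1 False, OF one_le_numeral M(1) Ms(1)] by blast
 obtain v2 c2 E2 where 2: "!!k. adm \<omega> (v2 k)" "!!j k. symb (%p. \<Lambda> p / \<omega> p) \<omega> (c2 j k)" "!!j k. c2 j k = c2 k j"
  "!!j k. symb (%p. (\<Lambda> p / \<omega> p) ^ Suc J) \<omega> (E2 j k)"
  and eq2: "decomposed 2 \<omega> ?\<xi> True M2 v2 c2 E2"
  using ibp'[of 2 M2 True, OF one_le_numeral M(2) Ms(2)] by blast
 obtain v3 c3 E3 where 3: "!!k. adm \<omega> (v3 k)" "!!j k. symb (%p. \<Lambda> p / \<omega> p) \<omega> (c3 j k)" "!!j k. c3 j k = c3 k j"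
  "!!j k. symb (%p. (\<Lambda> p / \<omega> p) ^ Suc J) \<omega> (E3 j k)"
  and eq3: "decomposed 1 \<omega> ?\<xi> True M3 v3 c3 E3"
  using ibp'[of 1 M3 True, OF order_refl M(3) Ms(3)] by blast
 define w' where "w' = (%k p x. w1 k p x - v1 k p x - v2 k p x - v3 k p x)"
 define c where "c = (%j k p x. c1 j k p x + c2 j k p x + c3 j k p x)"
 define E where "E = (%j k p x. E1 j k p x + E2 j k p x + E3 j k p x)"
 have "adm \<omega> (w' k)" for k unfolding w'_def by (intro adm_diff w1 1 2 3)
 moreover have "symb (%p. \<Lambda> p / \<omega> p) \<omega> (c j k) & c j k = c k j" for j k
  unfolding c_def using 1(3)[of j k] 2(3)[of j k] 3(3)[of j k] by (auto intro!: symb_add 1(2) 2(2) 3(2))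
 moreover have "symb (%p. (\<Lambda> p / \<omega> p) ^ Suc J) \<omega> (E j k)" for j k
  unfolding E_def by (intro symb_add 1(4) 2(4) 3(4))
 moreover have "step_eq B f w f1 w' a ?\<xi> \<omega> (%j k p x. Lam (%a b. c a b p x) j k + E j k p x)"
  using eq eq1 eq2 eq3 ev_diff_all[where w=w1, OF adm_symb[OF w1]] ev_diff_all[where w=v1, OF adm_symb[OF 1(1)]]
   ev_diff_all[where w=v2, OF adm_symb[OF 2(1)]] ev_diff_all[where w=v3, OF adm_symb[OF 3(1)]]
 proof eventually_elim
  case (elim p)
  show ?case
  proof (intro ballI allI)
   fix x j k assume x: "x:U p"
   have d: "!!k. w1 k p dif x" "!!k. v1 k p dif x"
    "!!k. v2 k p dif x" "!!k. v3 k p dif x" using elim x by auto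
   have "TT B f1 w' j k p x = TT B f1 w1 j k p x - (pder j (v1 k p) x + pder k (v1 j p) x)
    - (pder j (v2 k p) x + pder k (v2 j p) x) - (pder j (v3 k p) x + pder k (v3 j p) x)"
    unfolding w'_def by (subst TT_diff, intro differentiable_diff d, rule d)+ simp
   thus "TT B f1 w' j k p x = TT B f w j k p x
   + a p x ^ 2 / 2 * (?\<xi> $ j * ?\<xi> $ k) + pder j (a p) x * pder k (a p) x / (2 * \<omega> p ^ 2)
   + (Lam (%a b. c a b p x) j k + E j k p x)" using elim x by (simp add: c_def E_def Lam_add)
  qed
 qed
 ultimately show ?thesis using f1 by blast
qed

text \<open>No integration by parts here: all remainders together count as an error of size
  \<open>\<Lambda> / \<omega>\<close>, so accuracy is bought with frequency.\<close>

lemma costly_step: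
 fixes \<xi> :: "real^'n"
 shows "EX f' w' E. adm \<omega> f' & (ALL k. adm \<omega> (w' k)) &
  (ALL j k. symb (%p. \<Lambda> p / \<omega> p) \<omega> (E j k)) &
  ev (%p x. ALL j k. TT B f' w' j k p x = TT B f w j k p x
   + a p x ^ 2 / 2 * (\<xi> $ j * \<xi> $ k) + E j k p x)"
proof -
 obtain f1 w1 M1 M2 M3 where f1: "adm \<omega> f1" and w1: "!!k. adm \<omega> (w1 k)"
  and M: "!!j k. symb (%p. \<Lambda> p / \<omega> p) \<Lambda> (M1 j k)" "!!j k. symb (%p. \<Lambda> p / \<omega> p) \<Lambda> (M2 j k)" "!!j k. symb (%p. \<Lambda> p / \<omega> p) \<Lambda> (M3 j k)"
  and eq: "step_eq B f w f1 w1 a \<xi> \<omega> (fast \<xi> \<omega> M1 M2 M3)"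
  using step[of "\<xi>"] by blast
 define E where "E = (%j k p x. 1 / (2 * \<omega> p ^ 2) * (pder j (a p) x * pder k (a p) x)
   + fast \<xi> \<omega> M1 M2 M3 j k p x)"
 have t: "symb (%p. 1) \<omega> (%p x. tg b (2 * \<omega> p * (x \<bullet> \<xi>)))" for b
  using symb_sin_cos[where c=2 and l=\<omega>] by (cases b) (simp_all add: tg_def)
 have Ma: "symb (%p. \<Lambda> p / \<omega> p) \<omega> (M1 j k)" "symb (%p. \<Lambda> p / \<omega> p) \<omega> (M2 j k)" "symb (%p. \<Lambda> p / \<omega> p) \<omega> (M3 j k)" for j k
  by (rule symb_mono1[OF M(1) _ freq_mono], simp) (rule symb_mono1[OF M(2) _ freq_mono], simp, rule symb_mono1[OF M(3) _ freq_mono], simp)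
 have A: "symb (%p. \<Lambda> p / \<omega> p) \<omega> (%p x. 1 / (2 * \<omega> p ^ 2) * (pder j (a p) x * pder k (a p) x))" for j k
  by (rule symb_mono1[OF symb_scale[OF symb_mult[OF symb_pder[OF a] symb_pder[OF a]]] _ freq_mono]) (use quad_small[of 1] in auto)
 have "symb (%p. \<Lambda> p / \<omega> p) \<omega> (E j k)" for j k
  unfolding E_def by (intro symb_add symb_mult1 t Ma A symb_tg)
 moreover have "ev (%p x. ALL j k. TT B f1 w1 j k p x = TT B f w j k p x
   + a p x ^ 2 / 2 * (\<xi> $ j * \<xi> $ k) + E j k p x)"
  using eq by eventually_elim (simp add: E_def)
 ultimately show ?thesis using f1 w1 by blast
qed

end

end

section \<open>Layers of oscillations\<close>

text \<open>The ranking \<open>r\<close> selects one order of each pair. By symmetry twice the sum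
  runs over all ordered pairs of distinct indices, where the products of axis sums expand into four
  Kronecker terms.\<close>

lemma sum_pairs_Lam:
 fixes C :: "'n::finite => 'n => real" and r :: "'n => nat"
 assumes inj: "inj r" and sym: "!!a b. C a b = C b a"
 shows "(SUM (a,b):{(a,b). r a < r b}. C a b * ((axis a 1 + axis b 1) $ j * (axis a 1 + axis b 1) $ k)) = Lam C j k"
proof -
 define t where "t = (%a b. C a b * ((axis a 1 + axis b 1 :: real^'n) $ j * (axis a 1 + axis b 1 :: real^'n) $ k))"
 let ?P = "{(a,b). r a < r b}" and ?Q = "{(a,b). r b < r a}"
 have tsym: "t a b = t b a" for a b using sym[of a b] by (simp add: t_def add.commute)
 have fin: "finite X" for X :: "('n \<times> 'n) set" by (rule finite_subset[of _ UNIV]) auto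
 have PQ: "(SUM (a,b):?P. t a b) = (SUM (a,b):?Q. t a b)"
  by (rule sum.reindex_bij_witness[of _ "%(a,b). (b,a)" "%(a,b). (b,a)"]) (auto simp: tsym)
 have U: "?P \<union> ?Q = (SIGMA a:UNIV. UNIV - {a})" using inj by (auto simp: inj_def neq_iff)
 have "2 * (SUM (a,b):?P. t a b) = (SUM (a,b):?P \<union> ?Q. t a b)"
  using PQ by (subst sum.union_disjoint) (auto simp: fin)
 also have "... = (SU a. SUM b:UNIV - {a}. t a b)" unfolding U by (subst sum.Sigma) auto
 also have "... = (SU a. SU b. if b = a then 0 else t a b)"
  by (intro sum.cong refl sum.mono_neutral_cong_left) auto
 also have "... = (SU a. SUM b:UNIV.
   (if a = j then if a = k then if b = a then 0 else C a b else 0 else 0)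
  + (if b = k then if a = j then if b = a then 0 else C a b else 0 else 0)
  + (if b = j then if a = k then if b = a then 0 else C a b else 0 else 0)
  + (if b = j then if b = k then if b = a then 0 else C a b else 0 else 0))"
  by (intro sum.cong refl) (auto simp: t_def axis_def)
 also have "... = 2 * Lam C j k"
 proof (cases "j = k")
  case True
  have s: "(SU b. if b = k then 0 else C k b) = (SUM b:UNIV - {k}. C k b)"
   by (rule sum.mono_neutral_cong_right) auto
  have s': "(SU b. if k = b then 0 else C b k) = (SUM b:UNIV - {k}. C k b)"
   by (rule sum.mono_neutral_cong_right) (auto simp: sym[of k])
  let ?R = "SUM b:UNIV - {k}. C k b"
  have t1: "(SU a. SU b. if a = k then if a = k then if b = a then 0 else C a b else 0 else 0) = ?R"
  proof -
   have "(SU a. SU b. if a = k then if a = k then if b = a then 0 else C a b else 0 else 0)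
     = (SU a. if a = k then ?R else 0)" by (intro sum.cong refl) (auto simp: s[symmetric])
   thus ?thesis by simp
  qed
  have t4: "(SU a. SU b. if b = k then if b = k then if b = a then 0 else C a b else 0 else 0) = ?R"
   by (simp add: s')
  have z: "(SU a. SU b. if b = k then if a = k then if b = a then 0 else C a b else 0 else 0) = 0"
   by (intro sum.neutral ballI) auto
  show ?thesis unfolding True sum.distrib t1 t4 z by (simp add: Lam_def)
 next
  case False
  hence z: "(SU a. SU b. if a = j then if a = k then if b = a then 0 else C a b else 0 else 0) = 0"
   by (intro sum.neutral ballI) auto
  show ?thesis using False sym[of j k] by (simp add: sum.distrib Lam_def z)
 qed
 finally show ?thesis by (simp add: t_def)
qed

lemma card_pairs:
 fixes r :: "'n::finite => nat"
 assumes inj: "inj r"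
 shows "2 * card {(a,b). r a < r b} = CARD('n) * (CARD('n) - 1)"
proof -
 let ?P = "{(a,b). r a < r b}" and ?Q = "{(a,b). r b < r a}"
 have fin: "finite X" for X :: "('n \<times> 'n) set" by (rule finite_subset[of _ UNIV]) auto
 have "bij_betw (%(a,b). (b,a)) ?P ?Q" by (rule bij_betw_byWitness[where f'="%(a,b). (b,a)"]) auto
 hence "card ?P = card ?Q" by (rule bij_betw_same_card)
 hence "2 * card ?P = card (?P \<union> ?Q)" by (subst card_Un_disjoint) (auto simp: fin)
 also have U: "?P \<union> ?Q = (SIGMA a:UNIV. UNIV - {a})"
  using inj by (auto simp: inj_def neq_iff)
 also have "card ... = CARD('n) * (CARD('n) - 1)"
  by (subst card_SigmaI) (auto simp: card_Diff_singleton)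
 finally show ?thesis .
qed

locale flat = symbols F U for F :: "'p filter" and U :: "'p => (real^'n) set" +
 fixes \<kappa> :: "'p => real"
 assumes kap: "filterlim \<kappa> at_top F"
begin

abbreviation e :: "'p => real" where "e p == inverse (\<kappa> p)"

lemma ev_k: "\<forall>\<^sub>F p in F. c <= \<kappa> p" using kap by (auto simp: filterlim_at_top)

lemma ev_kpow: "\<forall>\<^sub>F p in F. 1 <= \<kappa> p ^ a"
 using ev_k[of 1] by eventually_elim simp

lemma ev_kpow_mono: "a <= b ==> \<forall>\<^sub>F p in F. \<kappa> p ^ a <= \<kappa> p ^ b"
 using ev_k[of 1] by (auto elim!: eventually_mono intro: power_increasing)

lemma ev_kpow_abs: "a <= b ==> \<forall>\<^sub>F p in F. \<bar>\<kappa> p ^ a\<bar> <= \<bar>\<kappa> p ^ b\<bar>"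
 by (rule eventually_mono[OF eventually_conj[OF ev_kpow_mono ev_kpow[of a]]]) auto

lemma ev_epow_abs: "b <= a ==> \<forall>\<^sub>F p in F. \<bar>e p ^ a\<bar> <= \<bar>e p ^ b\<bar>"
 using ev_k[of 1] by (auto elim!: eventually_mono intro!: power_decreasing simp: power_abs inverse_le_1_iff)

lemma symb_kpow: "symb A (%p. \<kappa> p ^ a) f ==> a <= b ==> symb A (%p. \<kappa> p ^ b) f"
 by (erule symb_mono1) (simp, erule ev_kpow_abs)

lemma symb_one_kpow: "symb A (%p. 1) f ==> symb A (%p. \<kappa> p ^ b) f"
 using symb_kpow[of A 0 f b] by simp

lemma symb_epow: "symb (%p. e p ^ a) l f ==> b <= a ==> symb (%p. e p ^ b) l f"
 by (erule symb_mono1) (erule ev_epow_abs, simp)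

text \<open>This disposes of unspecified constants: a quantity with a spare factor \<open>e\<close>
  eventually falls below any threshold.\<close>

lemma symb_small:
 assumes "symb e l f" "0 < c"
 shows "ev (%p x. \<bar>f p x\<bar> <= c)"
proof -
 obtain C where C: "0 < C" "ev (%p x. \<bar>f p x\<bar> <= C * \<bar>e p\<bar>)"
  using symbE[OF assms(1)] .
 have "\<forall>\<^sub>F p in F. C * \<bar>e p\<bar> <= c" using ev_k[of "C / c"] ev_k[of 1]
 proof eventually_elim
  case (elim p)
  thus ?case using assms(2) by (simp add: divide_simps mult.commute)
 qed
 with C(2) show ?thesis by eventually_elim force
qed

abbreviation free_layers where
 "free_layers \<rho> a B J r f w c E == adm (%p. \<kappa> p ^ r) f & (ALL k. adm (%p. \<kappa> p ^ r) (w k)) &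
  (ALL j k. symb e (%p. \<kappa> p ^ r) (c j k) & c j k = c k j) &
  (ALL j k. symb (%p. e p ^ Suc J) (%p. \<kappa> p ^ r) (E j k)) &
  ev (%p x. ALL j k. TT B f w j k p x =
   (\<Sum>i | \<rho> i <= r. a i p x ^ 2 / 2 * (axis i 1 $ j * axis i 1 $ k)
    + pder j (a i p) x * pder k (a i p) x / (2 * (\<kappa> p ^ \<rho> i)\<^sup>2))
   + Lam (%a b. c a b p x) j k + E j k p x)"

abbreviation costly_layers where
 "costly_layers b \<xi> B q l r f w f' w' E == adm l f' & (ALL k. adm l (w' k)) &
  (ALL j k. symb (%p. e p ^ q) l (E j k)) & ev (%p x. ALL j k. TT B f' w' j k p x = TT B f w j k p x
   + (SUM s<r. b s p x ^ 2 / 2 * (\<xi> s $ j * \<xi> s $ k)) + E j k p x)"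

text \<open>The axes are treated in the order given by \<open>\<rho>\<close>, at the frequencies
  \<open>\<kappa>, ..., \<kappa>^n\<close>; a ratio \<open>\<kappa>\<close> serves for every
  \<open>J\<close>. The accumulated \<open>Lam\<close> coefficients are of size \<open>e\<close>,
  but they vary at the last frequency reached.\<close>

lemma free_loop:
 fixes \<rho> :: "'n => nat"
 assumes a: "!!i. symb (%p. 1) (%p. 1) (a i)"
  and B: "!!j k. symb (%p. 1) (%p. 1) (B j k)" and Bsym: "!!j k. B j k = B k j"
  and \<rho>: "bij_betw \<rho> UNIV {1..n}"
 shows "r <= n ==> EX f w c E. free_layers \<rho> a B J r f w c E"
proof (induction r)
 case 0
 have "\<rho> i:{1..n}" for i using \<rho> by (rule bij_betwE[THEN bspec]) simp
 hence "0 < \<rho> i" for i by (metis One_nat_def Suc_le_lessD atLeastAtMost_iff)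
 hence Z: "sum g {i. \<rho> i <= 0} = 0" for g :: "'n => real" by (intro sum.neutral ballI) (metis mem_Collect_eq not_le)
 thus ?case by (intro exI[of _ "%p x. 0"] exI[of _ "%k p x. 0"] exI[of _ "%j k p x. 0"])
   (simp add: adm_zero symb_zero TT_def Lam_def Z del: le_zero_eq)
next
 case (Suc r)
 have "EX f w c E. free_layers \<rho> a B J r f w c E" using Suc by simp
 then obtain f w c E where f: "adm (%p. \<kappa> p ^ r) f" and w: "!!k. adm (%p. \<kappa> p ^ r) (w k)"
  and c: "!!j k. symb e (%p. \<kappa> p ^ r) (c j k)" "!!j k. c j k = c k j"
  and E: "!!j k. symb (%p. e p ^ Suc J) (%p. \<kappa> p ^ r) (E j k)"
  and eq: "ev (%p x. ALL j k. TT B f w j k p x =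
   (\<Sum>i | \<rho> i <= r. a i p x ^ 2 / 2 * (axis i 1 $ j * axis i 1 $ k)
    + pder j (a i p) x * pder k (a i p) x / (2 * (\<kappa> p ^ \<rho> i)\<^sup>2))
   + Lam (%a b. c a b p x) j k + E j k p x)" by blast
 obtain i where i: "\<rho> i = Suc r"
  using bij_betw_imp_surj_on[OF \<rho>] Suc.prems by (metis Suc_le_mono atLeastAtMost_iff imageE le0 One_nat_def)
 have set: "{i. \<rho> i <= Suc r} = insert i {i. \<rho> i <= r}" "i ~: {i. \<rho> i <= r}"
  using i \<rho> by (auto simp: bij_betw_def inj_def le_Suc_eq)
 let ?L = "%p. \<kappa> p ^ r" and ?l = "%p. \<kappa> p ^ Suc r"
 have ar: "symb (%p. 1) ?L (a i)" using a by (rule symb_one_kpow)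
 have "EX f' w' c E. adm ?l f' & (ALL k. adm ?l (w' k)) &
  (ALL j k. symb (%p. ?L p / ?l p) ?l (c j k) & c j k = c k j) &
  (ALL j k. symb (%p. (?L p / ?l p) ^ Suc J) ?l (E j k)) &
  step_eq B f w f' w' (a i) (axis i 1) ?l (%j k p x. Lam (%a b. c a b p x) j k + E j k p x)"
  by (rule free_step[OF ev_kpow ev_kpow_mono ar f w B Bsym]) simp
 then obtain f' w' c' E' where f': "adm ?l f'" and w': "!!k. adm ?l (w' k)"
  and c': "!!j k. symb (%p. ?L p / ?l p) ?l (c' j k)" "!!j k. c' j k = c' k j"
  and E': "!!j k. symb (%p. (?L p / ?l p) ^ Suc J) ?l (E' j k)"
  and eq': "step_eq B f w f' w' (a i) (axis i 1) ?l (%j k p x. Lam (%a b. c' a b p x) j k + E' j k p x)"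
  by blast
 have q: "\<forall>\<^sub>F p in F. ?L p / ?l p = e p"
  using ev_k[of 1] by eventually_elim (simp add: divide_simps)
 have c'e: "symb e ?l (c' j k)" for j k
  by (rule symb_mono1[OF c'(1) eventually_mono[OF q]]) (simp_all only: order_refl eventually_True)
 have E'e: "symb (%p. e p ^ Suc J) ?l (E' j k)" for j k
  by (rule symb_mono1[OF E' eventually_mono[OF q]]) (simp_all only: order_refl eventually_True)
 have "symb e ?l (%p x. c j k p x + c' j k p x) & (%p x. c j k p x + c' j k p x) = (%p x. c k j p x + c' k j p x)" for j k
  using c(2)[of j k] c'(2)[of j k] by (auto intro!: symb_add symb_kpow[OF c(1)] c'e simp del: power_Suc)
 moreover have "symb (%p. e p ^ Suc J) ?l (%p x. E j k p x + E' j k p x)" for j k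
  by (intro symb_add E'e symb_kpow[OF E]) simp
 moreover have "ev (%p x. ALL j k. TT B f' w' j k p x =
   (\<Sum>i | \<rho> i <= Suc r. a i p x ^ 2 / 2 * (axis i 1 $ j * axis i 1 $ k)
    + pder j (a i p) x * pder k (a i p) x / (2 * (\<kappa> p ^ \<rho> i)\<^sup>2))
   + Lam (%a b. c a b p x + c' a b p x) j k + (E j k p x + E' j k p x))"
  using eq eq' by eventually_elim (simp add: set i Lam_add)
 ultimately show ?case using f' w'
  by (intro exI[of _ f'] exI[of _ w'] exI[of _ "%j k p x. c j k p x + c' j k p x"] exI[of _ "%j k p x. E j k p x + E' j k p x"]) blast
qed

text \<open>Each step multiplies the frequency by \<open>\<kappa>^q\<close>, which makes its error
  of size \<open>e^q\<close>. The loop starts at \<open>\<kappa>^n\<close> because the amplitudes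
  \<open>b\<close> will contain the oscillating coefficients left behind by
  \<open>free_loop\<close>.\<close>

lemma costly_loop:
 fixes \<xi> :: "nat => real^'n"
 assumes b: "!!s. symb (%p. 1) (%p. \<kappa> p ^ n) (b s)"
  and f: "adm (%p. \<kappa> p ^ n) f" and w: "!!k. adm (%p. \<kappa> p ^ n) (w k)"
  and B: "!!j k. symb (%p. 1) (%p. 1) (B j k)" and Bsym: "!!j k. B j k = B k j"
 shows "EX f' w' E. costly_layers b \<xi> B q (%p. \<kappa> p ^ (n + q * r)) r f w f' w' E"
proof (induction r)
 case 0
 thus ?case using f w
  by (intro exI[of _ f] exI[of _ w] exI[of _ "%j k p x. 0"]) (simp add: symb_zero)
next
 case (Suc r)
 let ?L = "%p. \<kappa> p ^ (n + q * r)" and ?l = "%p. \<kappa> p ^ (n + q * Suc r)"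
 from Suc obtain f1 w1 E1 where f1: "adm ?L f1" and w1: "!!k. adm ?L (w1 k)"
  and E1: "!!j k. symb (%p. e p ^ q) ?L (E1 j k)"
  and eq1: "ev (%p x. ALL j k. TT B f1 w1 j k p x = TT B f w j k p x
   + (SUM s<r. b s p x ^ 2 / 2 * (\<xi> s $ j * \<xi> s $ k)) + E1 j k p x)" by blast
 have br: "symb (%p. 1) ?L (b r)" using b by (rule symb_kpow) simp
 have "EX f' w' E. adm ?l f' & (ALL k. adm ?l (w' k)) &
  (ALL j k. symb (%p. ?L p / ?l p) ?l (E j k)) &
  ev (%p x. ALL j k. TT B f' w' j k p x = TT B f1 w1 j k p x
   + b r p x ^ 2 / 2 * (\<xi> r $ j * \<xi> r $ k) + E j k p x)"
  by (rule costly_step[OF ev_kpow ev_kpow_mono br f1 w1 B Bsym]) simp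
 then obtain f' w' E' where f': "adm ?l f'" and w': "!!k. adm ?l (w' k)"
  and E': "!!j k. symb (%p. ?L p / ?l p) ?l (E' j k)"
  and eq': "ev (%p x. ALL j k. TT B f' w' j k p x = TT B f1 w1 j k p x
   + b r p x ^ 2 / 2 * (\<xi> r $ j * \<xi> r $ k) + E' j k p x)" by blast
 have qe: "\<forall>\<^sub>F p in F. ?L p / ?l p = e p ^ q"
  using ev_k[of 1] by eventually_elim (simp add: power_add power_inverse divide_simps)
 have E'e: "symb (%p. e p ^ q) ?l (E' j k)" for j k
  by (rule symb_mono1[OF E' eventually_mono[OF qe]]) (simp_all only: order_refl eventually_True)
 have "symb (%p. e p ^ q) ?l (%p x. E1 j k p x + E' j k p x)" for j k
  by (intro symb_add E'e symb_kpow[OF E1]) simp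
 moreover have "ev (%p x. ALL j k. TT B f' w' j k p x = TT B f w j k p x
   + (SUM s<Suc r. b s p x ^ 2 / 2 * (\<xi> s $ j * \<xi> s $ k)) + (E1 j k p x + E' j k p x))"
  using eq1 eq' by eventually_elim simp
 ultimately show ?case using f' w'
  by (intro exI[of _ f'] exI[of _ w'] exI[of _ "%j k p x. E1 j k p x + E' j k p x"]) blast
qed

end

text \<open>Coefficient of the square of \<open>x_i\<close> in the expansion of \<open>h\<close>
  into squares; the off-diagonal entries are the coefficients of the other squares
  (\<open>Ldiag_decomp\<close>).\<close>

definition Ldiag :: "'n::finite => ('n => 'n => real) => real" where
 "Ldiag i h = h i i - (SUM k:UNIV - {i}. h i k)"

lemma Ldiag_decomp:
 "h j k = (SU i. Ldiag i h * (axis i 1 $ j * axis i 1 $ k)) + Lam h j k" for h :: "'n::finite => 'n => real"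
proof -
 have "(SU i. Ldiag i h * (axis i 1 $ j * axis i 1 $ k)) = (SU i. if i = j then if j = k then Ldiag j h else 0 else 0)"
  by (intro sum.cong) (auto simp: axis_def)
 also have "... = (if j = k then Ldiag j h else 0)" by simp
 finally show ?thesis by (simp add: Lam_def Ldiag_def)
qed

lemma Ldiag_diff: "Ldiag i (%a b. h a b - g a b) = Ldiag i h - Ldiag i g"
 by (simp add: Ldiag_def sum_subtractf)

context flat
begin

text \<open>The slow terms that the free steps with frequencies \<open>\<mu> i\<close> and
  amplitudes \<open>a i\<close> leave in the metric.\<close>

definition SS :: "('n => 'p => real) => ('n => 'p => 'n::finite rfun) => 'n => 'n => 'p => 'n rfun" where
 "SS \<mu> a j k p x = (SU i. 1 / (2 * \<mu> i p ^ 2) * (pder j (a i p) x * pder k (a i p) x))"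

lemma symb_Ldiag: "(!!j k. symb A l (h j k)) ==> symb A l (%p x. Ldiag i (%j k. h j k p x))"
 unfolding Ldiag_def by (intro symb_diff symb_sum)

lemma mu_small:
 assumes "\<forall>\<^sub>F p in F. \<kappa> p <= \<mu> p"
 shows "\<forall>\<^sub>F p in F. \<bar>1 / (2 * \<mu> p ^ 2) * c p\<bar> <= \<bar>e p * c p\<bar>"
 using assms ev_k[of 1]
proof eventually_elim
 case (elim p)
 have "\<kappa> p * 1 <= \<mu> p * \<mu> p" using elim by (intro mult_mono) auto
 hence "\<kappa> p <= 2 * \<mu> p ^ 2" using elim by (simp add: power2_eq_square)
 hence "1 / (2 * \<mu> p ^ 2) <= e p" using elim by (simp add: divide_simps)
 hence "\<bar>1 / (2 * \<mu> p ^ 2)\<bar> * \<bar>c p\<bar> <= \<bar>e p\<bar> * \<bar>c p\<bar>" using elim by (intro mult_right_mono) auto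
 thus ?case by (simp add: abs_mult)
qed

lemma SS_symb:
 assumes \<mu>: "!!i. \<forall>\<^sub>F p in F. \<kappa> p <= \<mu> i p" and a: "!!i. symb (%p. 1) (%p. 1) (a i)"
 shows "symb e (%p. 1) (SS \<mu> a j k)"
proof -
 have pd: "symb (%p. 1) (%p. 1) (%p. pder j (a i p))" for i j using symb_pder[OF a] by simp
 have "symb e (%p. 1) (%p x. 1 / (2 * \<mu> i p ^ 2) * (pder j (a i p) x * pder k (a i p) x))" for i
  by (rule symb_mono1[OF symb_scale[OF symb_mult1[OF pd pd]]]) (use mu_small[OF \<mu>, of i "%_. 1"] in simp_all)
 thus ?thesis unfolding SS_def by (intro symb_sum)
qed

text \<open>Bilinearity: a difference of products is a sum of products with one factor differenced,
  and the frequencies in the denominator supply one more \<open>e\<close>.\<close>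

lemma SS_diff:
 assumes \<mu>: "!!i. \<forall>\<^sub>F p in F. \<kappa> p <= \<mu> i p" and a: "!!i. symb (%p. 1) (%p. 1) (a i)" and a': "!!i. symb (%p. 1) (%p. 1) (a' i)"
  and d: "!!i. symb (%p. e p ^ r) (%p. 1) (%p x. a' i p x - a i p x)"
 shows "symb (%p. e p ^ Suc r) (%p. 1) (%p x. SS \<mu> a' j k p x - SS \<mu> a j k p x)"
proof -
 have pd: "symb (%p. 1) (%p. 1) (%p. pder j (a i p))" "symb (%p. 1) (%p. 1) (%p. pder j (a' i p))" for i j
  using symb_pder[OF a] symb_pder[OF a'] by simp_all
 have dd: "symb (%p. e p ^ r) (%p. 1) (%p x. pder j (a' i p) x - pder j (a i p) x)" for i j
 proof (rule symb_cong)
  show "symb (%p. e p ^ r) (%p. 1) (%p. pder j (%x. a' i p x - a i p x))"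
   using symb_pder[OF d] by simp
  show "ev (%p x. pder j (%x. a' i p x - a i p x) x = pder j (a' i p) x - pder j (a i p) x)"
   using symb_differentiable[OF a[of i]] symb_differentiable[OF a'[of i]] by eventually_elim (simp add: pder_diff)
 qed
 have "symb (%p. e p ^ r) (%p. 1) (%p x. (pder j (a' i p) x - pder j (a i p) x) * pder k (a' i p) x
   + pder j (a i p) x * (pder k (a' i p) x - pder k (a i p) x))" for i
  by (intro symb_add symb_mult1[OF pd(1) dd] symb_mult2[OF dd pd(2)])
 hence "symb (%p. e p ^ Suc r) (%p. 1) (%p x. 1 / (2 * \<mu> i p ^ 2) * ((pder j (a' i p) x - pder j (a i p) x) * pder k (a' i p) x
   + pder j (a i p) x * (pder k (a' i p) x - pder k (a i p) x)))" for i
  by (rule symb_mono1[OF symb_scale]) (use mu_small[OF \<mu>, of i "%p. e p ^ r"] in simp_all)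
 hence "symb (%p. e p ^ Suc r) (%p. 1) (%p x. SU i. 1 / (2 * \<mu> i p ^ 2) * ((pder j (a' i p) x - pder j (a i p) x) * pder k (a' i p) x
   + pder j (a i p) x * (pder k (a' i p) x - pder k (a i p) x)))" by (intro symb_sum)
 thus ?thesis
  by (rule symb_cong) (intro always_eventually ballI allI, simp add: SS_def flip: sum_subtractf, intro sum.cong, simp_all add: algebra_simps diff_divide_distrib add_divide_distrib)
qed

text \<open>The slow quadratic terms of the derivatives of the amplitudes cannot be integrated by
  parts; they are absorbed in the choice of the amplitudes by a finite fixed-point iteration,
  each round of which gains a factor \<open>\<kappa>\<close>.\<close>

abbreviation kallen_pair where
 "kallen_pair \<mu> h c r a a' == (ALL i. symb (%p. 1) (%p. 1) (a i)) & (ALL i. symb (%p. 1) (%p. 1) (a' i)) &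
  (ALL i. ev (%p x. sqrt c <= a i p x)) & (ALL i. ev (%p x. sqrt c <= a' i p x)) &
  (ALL i. ev (%p x. (a' i p x)\<^sup>2 / 2 = Ldiag i (%j k. h j k p x - SS \<mu> a j k p x))) &
  (ALL i. symb (%p. e p ^ r) (%p. 1) (%p x. a' i p x - a i p x))"

lemma kallen:
 fixes h :: "'n => 'n => 'p => 'n::finite rfun"
 assumes \<mu>: "!!i. \<forall>\<^sub>F p in F. \<kappa> p <= \<mu> i p" and h: "!!j k. symb (%p. 1) (%p. 1) (h j k)"
  and c: "0 < c" and L: "!!i. ev (%p x. c <= Ldiag i (%j k. h j k p x))"
 shows "EX a a'. kallen_pair \<mu> h c r a a'"
proof (induction r)
 \<comment> \<open>One round of the iteration: the amplitudes whose squares match \<open>h\<close>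
   minus the slow terms that the previous amplitudes \<open>a\<close> would create.\<close>
 define rt where "rt = (%a i p x. sqrt (2 * Ldiag i (%j k. h j k p x - SS \<mu> a j k p x)))"
 have hS: "symb (%p. 1) (%p. 1) (%p x. h j k p x - SS \<mu> a j k p x)"
  if "!!i. symb (%p. 1) (%p. 1) (a i)" for a j k
  using symb_epow[of 1 _ _ 0] SS_symb[where a=a, OF \<mu> that] by (intro symb_diff h) simp
 have low: "ev (%p x. c / 2 <= Ldiag i (%j k. h j k p x - SS \<mu> a j k p x))"
  if "!!i. symb (%p. 1) (%p. 1) (a i)" for a i
 proof -
  have "ev (%p x. \<bar>Ldiag i (%j k. SS \<mu> a j k p x)\<bar> <= c / 2)"
   by (rule symb_small[where l="%p. 1", OF symb_Ldiag[OF SS_symb[where a=a, OF \<mu> that]]]) (use c in simp)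
  thus ?thesis using L[of i]
  proof eventually_elim
   case (elim p)
   show ?case unfolding Ldiag_diff using elim by fastforce
  qed
 qed
 have rt: "!!i. symb (%p. 1) (%p. 1) (rt a i)" "!!i. ev (%p x. sqrt c <= rt a i p x)"
  "!!i. ev (%p x. rt a i p x ^ 2 / 2 = Ldiag i (%j k. h j k p x - SS \<mu> a j k p x))"
  if a: "!!i. symb (%p. 1) (%p. 1) (a i)" for a
 proof -
  have c2: "ev (%p x. c <= 2 * Ldiag i (%j k. h j k p x - SS \<mu> a j k p x))" for i
   using low[OF a, of i] by eventually_elim (auto simp: field_simps)
  show "symb (%p. 1) (%p. 1) (rt a i)" for i
   unfolding rt_def by (rule symb_sqrt[OF symb_cmult[OF symb_Ldiag[OF hS[OF a]]] c c2])
  show "ev (%p x. sqrt c <= rt a i p x)" for i using c2[of i] by eventually_elim (simp add: rt_def)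
  show "ev (%p x. rt a i p x ^ 2 / 2 = Ldiag i (%j k. h j k p x - SS \<mu> a j k p x))" for i
   using c2[of i]
  proof eventually_elim
   case (elim p)
   show ?case
   proof
    fix x assume "x:U p"
    hence "0 <= 2 * Ldiag i (%j k. h j k p x - SS \<mu> a j k p x)" using elim c by fastforce
    thus "rt a i p x ^ 2 / 2 = Ldiag i (%j k. h j k p x - SS \<mu> a j k p x)" by (simp add: rt_def)
   qed
  qed
 qed
 {
  case 0
  define a where "a = rt (%i p x. 0)"
  have z: "!!i::'n. symb (%p. 1) (%p. 1) (%p x. 0)" by (rule symb_zero)
  have a: "!!i. symb (%p. 1) (%p. 1) (a i)" "!!i. ev (%p x. sqrt c <= a i p x)"
   unfolding a_def by (rule rt(1)[OF z], rule rt(2)[OF z])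
  have a': "!!i. symb (%p. 1) (%p. 1) (rt a i)" "!!i. ev (%p x. sqrt c <= rt a i p x)"
  "!!i. ev (%p x. rt a i p x ^ 2 / 2 = Ldiag i (%j k. h j k p x - SS \<mu> a j k p x))"
   by (rule rt(1)[OF a(1)], rule rt(2)[OF a(1)], rule rt(3)[OF a(1)])
  have dd: "symb (%p. e p ^ 0) (%p. 1) (%p x. rt a i p x - a i p x)" for i
   using symb_diff[OF a'(1) a(1)] by simp
  show ?case by (rule exI[of _ a], rule exI[of _ "rt a"]) (intro conjI allI a a' dd)
 next
  case (Suc r)
  then obtain a a' where a: "!!i. symb (%p. 1) (%p. 1) (a i)" and a': "!!i. symb (%p. 1) (%p. 1) (a' i)"
   and lo: "!!i. ev (%p x. sqrt c <= a' i p x)"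
   and sq: "!!i. ev (%p x. (a' i p x)\<^sup>2 / 2 = Ldiag i (%j k. h j k p x - SS \<mu> a j k p x))"
   and d: "!!i. symb (%p. e p ^ r) (%p. 1) (%p x. a' i p x - a i p x)" by blast
  have a'': "!!i. symb (%p. 1) (%p. 1) (rt a' i)" "!!i. ev (%p x. sqrt c <= rt a' i p x)"
  "!!i. ev (%p x. rt a' i p x ^ 2 / 2 = Ldiag i (%j k. h j k p x - SS \<mu> a' j k p x))"
   by (rule rt(1)[OF a'], rule rt(2)[OF a'], rule rt(3)[OF a'])
  \<comment> \<open>A difference of roots is the difference of squares divided by the sum. The
    squares differ by a difference of two \<open>SS\<close>, which by \<open>SS_diff\<close> gains
    the next factor \<open>e\<close>.\<close>
  have dd: "symb (%p. e p ^ Suc r) (%p. 1) (%p x. rt a' i p x - a' i p x)" for i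
  proof (rule symb_cong)
   have s: "ev (%p x. 2 * sqrt c <= rt a' i p x + a' i p x)"
    using a''(2)[of i] lo[of i] by eventually_elim force
   have inv: "symb (%p. 1) (%p. 1) (%p x. inverse (rt a' i p x + a' i p x))"
    by (rule symb_inverse[OF symb_add[OF a''(1) a'] _ s]) (use c in simp)
   show "symb (%p. e p ^ Suc r) (%p. 1) (%p x. -2 * Ldiag i (%j k. SS \<mu> a' j k p x - SS \<mu> a j k p x) * inverse (rt a' i p x + a' i p x))"
    by (rule symb_mult2[OF symb_cmult[OF symb_Ldiag[OF SS_diff[OF \<mu> a a' d]]] inv])
   show "ev (%p x. -2 * Ldiag i (%j k. SS \<mu> a' j k p x - SS \<mu> a j k p x) * inverse (rt a' i p x + a' i p x)
     = rt a' i p x - a' i p x)" using s sq[of i] a''(3)[of i]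
   proof eventually_elim
    case (elim p)
    show ?case
    proof
     fix x assume x: "x:U p"
     have "0 < 2 * sqrt c" using c by simp
     hence p: "0 < rt a' i p x + a' i p x" using bspec[OF elim(1) x] by linarith
     have "(a' i p x)\<^sup>2 / 2 = Ldiag i (%j k. h j k p x) - Ldiag i (%j k. SS \<mu> a j k p x)"
      "rt a' i p x ^ 2 / 2 = Ldiag i (%j k. h j k p x) - Ldiag i (%j k. SS \<mu> a' j k p x)"
      using elim x unfolding Ldiag_diff by blast+
     hence "-2 * Ldiag i (%j k. SS \<mu> a' j k p x - SS \<mu> a j k p x) = rt a' i p x ^ 2 - (a' i p x)\<^sup>2"
      unfolding Ldiag_diff by (simp add: field_simps)
     also have "... = (rt a' i p x - a' i p x) * (rt a' i p x + a' i p x)"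
      by (simp add: power2_eq_square algebra_simps)
     finally show "-2 * Ldiag i (%j k. SS \<mu> a' j k p x - SS \<mu> a j k p x) * inverse (rt a' i p x + a' i p x)
      = rt a' i p x - a' i p x" using p by simp
    qed
   qed
  qed
  show ?case by (rule exI[of _ a'], rule exI[of _ "rt a'"]) (intro conjI allI a' lo a'' dd)
 }
qed

text \<open>The squares of \<open>a'\<close> give the axis part of \<open>h - SS \<mu> a\<close>,
  the free steps add \<open>SS \<mu> a'\<close> and \<open>Lam\<close> of \<open>d1\<close>, and the
  costly steps supply the \<open>Lam\<close> part of \<open>h - SS \<mu> a - d1\<close>. The sum is
  \<open>h\<close>, up to the errors of the steps and \<open>SS \<mu> a' - SS \<mu> a\<close>, which
  is of size \<open>e^(m+1)\<close> since \<open>kallen\<close> brings \<open>a'\<close> within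
  \<open>e^m\<close> of \<open>a\<close>.\<close>

theorem flat_stage:
 fixes h B :: "'n => 'n => 'p => 'n::finite rfun"
 assumes h: "!!j k. symb (%p. 1) (%p. 1) (h j k)" and hsym: "!!j k. h j k = h k j"
  and B: "!!j k. symb (%p. 1) (%p. 1) (B j k)" and Bsym: "!!j k. B j k = B k j"
  and c: "0 < c" and L: "!!i. ev (%p x. c <= Ldiag i (%j k. h j k p x))"
  and off: "!!j k. j ~= k ==> ev (%p x. c <= h j k p x)"
  and n: "n = CARD('n)" and N: "2 * N = n * (n - 1)"
 shows "EX f w E. adm (%p. \<kappa> p ^ (n + Suc m * N)) f & (ALL k. adm (%p. \<kappa> p ^ (n + Suc m * N)) (w k)) &
  (ALL j k. symb (%p. e p ^ Suc m) (%p. \<kappa> p ^ (n + Suc m * N)) (E j k)) &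
  ev (%p x. ALL j k. TT B f w j k p x = h j k p x + E j k p x)"
proof -
 obtain \<rho>' :: "nat => 'n" where \<rho>': "bij_betw \<rho>' {1..n} UNIV"
  using finite_same_card_bij[of "{1..n}" "UNIV::'n set"] n by auto
 define \<rho> where "\<rho> = inv_into {1..n} \<rho>'"
 have \<rho>: "bij_betw \<rho> UNIV {1..n}" unfolding \<rho>_def by (rule bij_betw_inv_into[OF \<rho>'])
 have inj: "inj \<rho>" using \<rho> by (simp add: bij_betw_def)
 have \<rho>r: "\<rho> i:{1..n}" for i using \<rho> by (rule bij_betwE[THEN bspec]) simp
 let ?P = "{(a,b). \<rho> a < \<rho> b}"
 have fin: "finite ?P" by (rule finite_subset[of _ UNIV]) auto
 have "2 * card ?P = 2 * N" using card_pairs[OF inj] n N by simp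
 hence cP: "card ?P = N" by simp
 obtain pr where pr: "bij_betw pr {..<N} ?P"
  using finite_same_card_bij[of "{..<N}" ?P] fin cP by auto
 let ?K = "%p. \<kappa> p ^ (n + Suc m * N)" and ?\<xi> = "%s. axis (fst (pr s)) 1 + axis (snd (pr s)) 1 :: real^'n"
 define \<mu> where "\<mu> = (%i p. \<kappa> p ^ \<rho> i)"
 have \<mu>: "\<forall>\<^sub>F p in F. \<kappa> p <= \<mu> i p" for i
  using ev_kpow_mono[of 1 "\<rho> i"] \<rho>r[of i] by (simp add: \<mu>_def)
 have "EX a a'. kallen_pair \<mu> h c m a a'" by (rule kallen[OF \<mu> h c L])
 then obtain a a' where a: "!!i. symb (%p. 1) (%p. 1) (a i)" and a': "!!i. symb (%p. 1) (%p. 1) (a' i)"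
   and sq: "!!i. ev (%p x. (a' i p x)\<^sup>2 / 2 = Ldiag i (%j k. h j k p x - SS \<mu> a j k p x))"
   and d: "!!i. symb (%p. e p ^ m) (%p. 1) (%p x. a' i p x - a i p x)" by blast
 have "EX f w c E. free_layers \<rho> a' B m n f w c E"
  by (rule free_loop[OF a' B Bsym \<rho>]) simp
 then obtain f w d1 E where f: "adm (%p. \<kappa> p ^ n) f" and w: "!!k. adm (%p. \<kappa> p ^ n) (w k)"
  and d1: "!!j k. symb e (%p. \<kappa> p ^ n) (d1 j k)" "!!j k. d1 j k = d1 k j"
  and E: "!!j k. symb (%p. e p ^ Suc m) (%p. \<kappa> p ^ n) (E j k)"
  and eq: "ev (%p x. ALL j k. TT B f w j k p x =
   (\<Sum>i | \<rho> i <= n. (a' i p x)\<^sup>2 / 2 * (axis i 1 $ j * axis i 1 $ k)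
    + pder j (a' i p) x * pder k (a' i p) x / (2 * (\<kappa> p ^ \<rho> i)\<^sup>2))
   + Lam (%a b. d1 a b p x) j k + E j k p x)" by blast
 define A where "A = (%j k p x. h j k p x - SS \<mu> a j k p x - d1 j k p x)"
 have S0: "symb (%p. 1) (%p. 1) (SS \<mu> a j k)" for j k
  using symb_epow[of 1 _ _ 0] SS_symb[where a=a, OF \<mu> a] by simp
 have d10: "symb (%p. 1) (%p. \<kappa> p ^ n) (d1 j k)" for j k
  using symb_epow[of 1 _ _ 0] d1 by simp
 have A: "symb (%p. 1) (%p. \<kappa> p ^ n) (A j k)" for j k
  unfolding A_def by (intro symb_diff d10 symb_one_kpow[OF h] symb_one_kpow[OF S0])
 have Asym: "A j k p x = A k j p x" for j k p x
  using hsym[of j k] d1(2)[of j k] by (simp add: A_def SS_def mult.commute)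
 have Alow: "ev (%p x. c / 2 <= A j k p x)" if "j ~= k" for j k
 proof -
  have "ev (%p x. \<bar>SS \<mu> a j k p x + d1 j k p x\<bar> <= c / 2)"
  proof (rule symb_small[where l="%p. \<kappa> p ^ n"])
   show "symb e (%p. \<kappa> p ^ n) (%p x. SS \<mu> a j k p x + d1 j k p x)"
    by (intro symb_add d1 symb_one_kpow SS_symb \<mu> a)
  qed (use c in simp)
  thus ?thesis using off[OF that]
  proof eventually_elim
   case (elim p)
   show ?case
   proof
    fix x assume "x:U p"
    hence "\<bar>SS \<mu> a j k p x + d1 j k p x\<bar> <= c / 2" "c <= h j k p x" using elim by auto
    thus "c / 2 <= A j k p x" unfolding A_def by argo
   qed
  qed
 qed
 define b where "b = (%s p x. sqrt (2 * A (fst (pr s)) (snd (pr s)) p x))"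
 \<comment> \<open>Extended by zero beyond \<open>N\<close>, since \<open>costly_loop\<close> takes
   an amplitude for every index.\<close>
 define b' where "b' = (%s. if s < N then b s else (%p x. 0))"
 have prne: "fst (pr s) ~= snd (pr s)" if "s < N" for s
  using bij_betwE[OF pr, THEN bspec, of s] that by (auto split: prod.splits)
 have low2: "ev (%p x. c <= 2 * A (fst (pr s)) (snd (pr s)) p x)" if "s < N" for s
  using Alow[OF prne[OF that]] by eventually_elim (auto simp: field_simps)
 have b': "symb (%p. 1) (%p. \<kappa> p ^ n) (b' s)" for s
  unfolding b'_def b_def using symb_sqrt[OF symb_cmult[OF A] c low2, of s] by (simp add: symb_zero)
 have "EX f' w' E. costly_layers b' ?\<xi> B (Suc m) ?K N f w f' w' E"
  by (rule costly_loop[OF b' f w B Bsym])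
 then obtain f' w' E' where f': "adm ?K f'" and w': "!!k. adm ?K (w' k)"
  and E': "!!j k. symb (%p. e p ^ Suc m) ?K (E' j k)"
  and eq': "ev (%p x. ALL j k. TT B f' w' j k p x = TT B f w j k p x
   + (SUM s<N. (b' s p x)\<^sup>2 / 2 * (?\<xi> s $ j * ?\<xi> s $ k)) + E' j k p x)" by blast
 define E2 where "E2 = (%j k p x. (SS \<mu> a' j k p x - SS \<mu> a j k p x) + E j k p x + E' j k p x)"
 have E2: "symb (%p. e p ^ Suc m) ?K (E2 j k)" for j k unfolding E2_def
  by (intro symb_add E' symb_kpow[OF E] symb_one_kpow[OF SS_diff[OF \<mu> a a' d]]) simp
 have sq': "\<forall>\<^sub>F p in F. ALL i. ALL x:U p. (a' i p x)\<^sup>2 / 2 = Ldiag i (%j k. h j k p x - SS \<mu> a j k p x)"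
  by (intro eventually_all_finite sq)
 have Apos: "\<forall>\<^sub>F p in F. ALL s:{..<N}. ALL x:U p. c <= 2 * A (fst (pr s)) (snd (pr s)) p x"
  by (intro eventually_ball_finite ballI low2) auto
 have "ev (%p x. ALL j k. TT B f' w' j k p x = h j k p x + E2 j k p x)" using eq eq' sq' Apos
 proof eventually_elim
  case (elim p)
  show ?case
  proof (intro ballI allI)
   fix x j k assume x: "x:U p"
   have all: "{i. \<rho> i <= n} = UNIV" using \<rho>r by auto
   let ?g = "%j k. h j k p x - SS \<mu> a j k p x"
   have 1: "TT B f w j k p x = (SU i. Ldiag i ?g * (axis i 1 $ j * axis i 1 $ k)) + SS \<mu> a' j k p x + Lam (%a b. d1 a b p x) j k + E j k p x"
    using elim x by (simp add: all SS_def \<mu>_def sum.distrib mult.commute)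
   have "(SUM s<N. (b' s p x)\<^sup>2 / 2 * (?\<xi> s $ j * ?\<xi> s $ k)) = (SUM s<N. (%(a,b). A a b p x * ((axis a 1 + axis b 1 :: real^'n) $ j * (axis a 1 + axis b 1 :: real^'n) $ k)) (pr s))"
   proof (intro sum.cong refl)
    fix s assume s: "s:{..<N}"
    hence "c <= 2 * A (fst (pr s)) (snd (pr s)) p x" using elim(4) x by blast
    hence "0 <= 2 * A (fst (pr s)) (snd (pr s)) p x" using c by linarith
    hence "(b' s p x)\<^sup>2 = 2 * A (fst (pr s)) (snd (pr s)) p x" using s by (simp add: b'_def b_def)
    thus "(b' s p x)\<^sup>2 / 2 * (?\<xi> s $ j * ?\<xi> s $ k)
     = (%(a,b). A a b p x * ((axis a 1 + axis b 1 :: real^'n) $ j * (axis a 1 + axis b 1 :: real^'n) $ k)) (pr s)"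
     by (simp add: split_beta)
   qed
   also have "... = (SUM (a,b):?P. A a b p x * ((axis a 1 + axis b 1 :: real^'n) $ j * (axis a 1 + axis b 1 :: real^'n) $ k))"
    by (rule sum.reindex_bij_betw[OF pr])
   also have "... = Lam (%a b. A a b p x) j k" by (rule sum_pairs_Lam[OF inj]) (rule Asym)
   also have "... = Lam ?g j k - Lam (%a b. d1 a b p x) j k" unfolding A_def by (rule Lam_diff)
   finally have 2: "TT B f' w' j k p x = TT B f w j k p x + (Lam ?g j k - Lam (%a b. d1 a b p x) j k) + E' j k p x"
    using elim x by simp
   show "TT B f' w' j k p x = h j k p x + E2 j k p x"
    unfolding 2 1 E2_def using Ldiag_decomp[of ?g j k] by simp
  qed
 qed
 thus ?thesis by (intro exI[of _ f'] exI[of _ w'] exI[of _ E2] conjI allI f' w' E2)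
qed

end

section \<open>Normal and tangential frames\<close>

lemma det_row_expand:
 fixes y :: "real^'m" and c :: "'m => real^'m"
 shows "det (\<chi> r. if r = k then y else c r) = (SU a. y $ a * det (\<chi> r. if r = k then axis a 1 else c r))"
proof -
 have "det (\<chi> r. if r = k then y else c r) = det (\<chi> r. if r = k then SU a. y $ a *s axis a 1 else c r)"
  by (simp only: basis_expansion)
 also have "... = (SU a. det (\<chi> r. if r = k then y $ a *s axis a 1 else c r))"
  by (rule det_linear_row_sum) simp
 also have "... = (SU a. y $ a * det (\<chi> r. if r = k then axis a 1 else c r))"
  by (simp add: det_row_mul)
 finally show ?thesis .
qed

text \<open>A bijection \<open>\<psi>\<close> of the codomain indices with \<open>'n option\<close>
  arranges the vectors \<open>X i\<close> and one further vector, in the row of \<open>None\<close>,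
  as a square matrix.\<close>

definition rows :: "('m => 'n option) => ('n => real^'m) => real^'m => real^'m^'m" where
 "rows \<psi> X y = (\<chi> r. case \<psi> r of None => y | Some i => X i)"

text \<open>The generalised cross product of the \<open>X i\<close>: its inner product with
  \<open>y\<close> is the determinant with \<open>y\<close> in the remaining row
  (\<open>nrm_inner\<close>).\<close>

definition nrm :: "('m => 'n option) => ('n => real^'m) => real^'m" where
 "nrm \<psi> X = (\<chi> a. det (rows \<psi> X (axis a 1)))"

definition nu :: "('m => 'n option) => ('n => real^'m) => real^'m" where
 "nu \<psi> X = inverse (norm (nrm \<psi> X)) *\<^sub>R nrm \<psi> X"

text \<open>Cramer's rule: with \<open>y\<close> in place of \<open>X i\<close>, the determinant of
  \<open>X\<close> completed by \<open>nrm\<close> reads off the \<open>i\<close>-th coefficient of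
  \<open>y\<close>. So this is the dual basis of the tangent space, as polynomials in
  \<open>X\<close> over the squared length of \<open>nrm\<close>, a form that passes through the
  symbol calculus.\<close>

definition cotan :: "('m => 'n option) => ('n => real^'m) => 'n => real^'m" where
 "cotan \<psi> X i = inverse ((norm (nrm \<psi> X))\<^sup>2) *\<^sub>R (\<chi> a. det (rows \<psi> (X(i := axis a 1)) (nrm \<psi> X)))"

context
 fixes \<psi> :: "'m::finite => 'n::finite option"
 assumes \<psi>: "bij \<psi>"
begin

lemma rows_None: "rows \<psi> X y = (\<chi> r. if r = inv \<psi> None then y else (case \<psi> r of None => 0 | Some i => X i))"
 using \<psi> by (auto simp: rows_def vec_eq_iff bij_inv_eq_iff split: option.splits)

lemma rows_Some: "rows \<psi> (X(i := y)) z = (\<chi> r. if r = inv \<psi> (Some i) then y else (case \<psi> r of None => z | Some i => X i))"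
proof -
 have "r = inv \<psi> (Some i) \<longleftrightarrow> \<psi> r = Some i" for r using \<psi> by (metis bij_inv_eq_iff)
 thus ?thesis by (auto simp: rows_def vec_eq_iff split: option.splits)
qed

lemma nrm_inner: "nrm \<psi> X \<bullet> y = det (rows \<psi> X y)"
 unfolding nrm_def rows_None by (subst (2) det_row_expand) (simp add: inner_vec_def mult.commute)

lemma cotan_inner: "cotan \<psi> X i \<bullet> y = det (rows \<psi> (X(i := y)) (nrm \<psi> X)) / (norm (nrm \<psi> X))\<^sup>2"
 unfolding cotan_def rows_Some by (subst (2) det_row_expand) (simp add: inner_vec_def sum_distrib_left mult_ac divide_inverse)

lemma rows_nth: "rows \<psi> X y $ inv \<psi> None = y" "rows \<psi> X y $ inv \<psi> (Some i) = X i"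
 using \<psi> by (simp_all add: rows_def bij_is_surj surj_f_inv_f)

lemma det_rows_0:
 assumes "y = X i"
 shows "det (rows \<psi> X y) = 0"
proof -
 have "inv \<psi> None ~= inv \<psi> (Some i)"
  using \<psi> by (metis bij_inv_eq_iff option.distinct(1))
 moreover have "rows \<psi> X y $ inv \<psi> None = rows \<psi> X y $ inv \<psi> (Some i)"
  using assms by (simp add: rows_nth)
 ultimately show ?thesis
  by (intro det_identical_rows[of "inv \<psi> None" "inv \<psi> (Some i)"]) (simp_all add: row_def vec_eq_iff)
qed

lemma det_rows_0':
 assumes "X i = X j" "i ~= j"
 shows "det (rows \<psi> X y) = 0"
proof -
 have "inv \<psi> (Some i) ~= inv \<psi> (Some j)"
  using \<psi> assms(2) by (metis bij_inv_eq_iff option.inject)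
 moreover have "rows \<psi> X y $ inv \<psi> (Some i) = rows \<psi> X y $ inv \<psi> (Some j)"
  using assms by (simp add: rows_nth)
 ultimately show ?thesis
  by (intro det_identical_rows[of "inv \<psi> (Some i)" "inv \<psi> (Some j)"]) (simp_all add: row_def vec_eq_iff)
qed

lemma nrm_orth: "nrm \<psi> X \<bullet> X i = 0" by (simp add: nrm_inner det_rows_0)

lemma
 assumes "nrm \<psi> X ~= 0"
 shows nu_unit: "nu \<psi> X \<bullet> nu \<psi> X = 1"
  and nu_orth: "nu \<psi> X \<bullet> X i = 0"
  and cotan_dual: "cotan \<psi> X i \<bullet> X j = (if i = j then 1 else 0)"
  and cotan_nu: "cotan \<psi> X i \<bullet> nu \<psi> X = 0"
proof -
 show "nu \<psi> X \<bullet> nu \<psi> X = 1" using assms by (simp add: nu_def dot_square_norm power2_eq_square)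
 show "nu \<psi> X \<bullet> X i = 0" by (simp add: nu_def nrm_orth)
 show "cotan \<psi> X i \<bullet> X j = (if i = j then 1 else 0)"
 proof (cases "i = j")
  case True
  have "det (rows \<psi> X (nrm \<psi> X)) = (norm (nrm \<psi> X))\<^sup>2"
   by (simp add: nrm_inner[symmetric] dot_square_norm)
  thus ?thesis using True assms by (simp add: cotan_inner)
 next
  case False
  thus ?thesis using det_rows_0'[of "X(i := X j)" i j] by (simp add: cotan_inner)
 qed
 show "cotan \<psi> X i \<bullet> nu \<psi> X = 0"
  using det_rows_0[of "nrm \<psi> X" "X(i := nrm \<psi> X)" i] by (simp add: nu_def cotan_inner)
qed

text \<open>If the cross product vanished, the determinant would be 0 for some \<open>y\<close>
  outside the span of the \<open>X i\<close>. The resulting linear relation of the rows cannot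
  involve \<open>y\<close>, so it is one among the \<open>X i\<close>, against their
  independence.\<close>

lemma nrm_nonzero:
 assumes inj: "!!v::real^'n. (SU i. v $ i *\<^sub>R X i) = 0 ==> v = 0"
 shows "nrm \<psi> X ~= 0"
proof
 assume 0: "nrm \<psi> X = 0"
 have card: "CARD('m) = CARD('n) + 1"
  using bij_betw_same_card[OF \<psi>] by (simp add: card_UNIV_option)
 have "dim (range X) <= card (range X)" by (rule dim_le_card) (auto simp: span_superset)
 also have "... <= CARD('n)" by (rule card_image_le) simp
 finally have "dim (range X) < DIM(real^'m)" using card by simp
 hence "span (range X) ~= UNIV" by (metis dim_UNIV dim_span less_irrefl)
 then obtain y where y: "y ~: span (range X)" by auto
 have "det (rows \<psi> X y) = 0" using 0 nrm_inner[of X y] by simp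
 hence "~ invertible (transpose (rows \<psi> X y))" by (simp add: invertible_det_nz)
 then obtain c where c: "transpose (rows \<psi> X y) *v c = 0" "c ~= 0"
  by (metis invertible_left_inverse matrix_left_invertible_ker)
 define d where "d = (\<chi> i. c $ inv \<psi> (Some i))"
 have "(SU r. c $ r *\<^sub>R rows \<psi> X y $ r) = 0"
  using c(1) by (simp add: vec_eq_iff matrix_vector_mult_def transpose_def mult.commute)
 moreover have "(SU r. c $ r *\<^sub>R rows \<psi> X y $ r) = (SU q. c $ inv \<psi> q *\<^sub>R rows \<psi> X y $ inv \<psi> q)"
  using \<psi> by (intro sum.reindex_bij_betw[symmetric] bij_betw_inv_into)
 moreover have "... = c $ inv \<psi> None *\<^sub>R y + (SU i. d $ i *\<^sub>R X i)"
  by (simp add: UNIV_option_conv sum.reindex rows_nth d_def)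
 ultimately have eq: "c $ inv \<psi> None *\<^sub>R y + (SU i. d $ i *\<^sub>R X i) = 0" by simp
 have s: "(SU i. d $ i *\<^sub>R X i):span (range X)" by (intro span_sum span_scale span_base) simp
 have c0: "c $ inv \<psi> None = 0"
 proof (rule ccontr)
  assume n: "c $ inv \<psi> None ~= 0"
  have "y = (- inverse (c $ inv \<psi> None)) *\<^sub>R (SU i. d $ i *\<^sub>R X i)"
  proof -
   have "c $ inv \<psi> None *\<^sub>R y = - (SU i. d $ i *\<^sub>R X i)" using eq by (simp add: eq_neg_iff_add_eq_0)
   hence "inverse (c $ inv \<psi> None) *\<^sub>R c $ inv \<psi> None *\<^sub>R y = inverse (c $ inv \<psi> None) *\<^sub>R - (SU i. d $ i *\<^sub>R X i)" by simp
   thus ?thesis using n by simp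
  qed
  moreover have "(- inverse (c $ inv \<psi> None)) *\<^sub>R (SU i. d $ i *\<^sub>R X i):span (range X)"
   using s by (rule span_scale)
  ultimately show False using y by simp
 qed
 hence "d = 0" using eq inj by simp
 hence "d $ i = 0" for i by simp
 hence "c $ inv \<psi> q = 0" for q using c0 by (cases q) (auto simp: d_def)
 moreover have "inv \<psi> (\<psi> r) = r" for r using \<psi> by (simp add: bij_is_inj inv_f_f)
 ultimately have "c $ r = 0" for r by metis
 hence "c = 0" by (simp add: vec_eq_iff)
 thus False using c(2) by simp
qed

text \<open>Compactness: the frames obeying both bounds form a compact set, on which the length of
  \<open>nrm\<close> is continuous and positive. The constant depends only on \<open>\<psi>\<close>,
  \<open>\<gamma>\<close> and \<open>\<Gamma>\<close>, so it can serve all stages.\<close>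

lemma nrm_lower:
 assumes "0 < \<gamma>"
 shows "EX c>0. ALL X. (ALL v::real^'n. \<gamma> * norm v <= norm (lcomb v X)) --> (ALL i. norm (X i) <= \<Gamma>)
  --> c <= norm (nrm \<psi> X)"
proof -
 define K where "K = {Y :: real^'m^'n. (ALL v::real^'n. \<gamma> * norm v <= norm (lcomb v (%i. Y $ i))) & (ALL i. norm (Y $ i) <= \<Gamma>)}"
 have "closed K"
 proof -
  have 1: "closed {Y :: real^'m^'n. \<gamma> * norm v <= norm (lcomb v (%i. Y $ i))}" for v :: "real^'n"
   by (intro closed_Collect_le continuous_intros)
  have 2: "closed {Y :: real^'m^'n. norm (Y $ i) <= \<Gamma>}" for i
   by (intro closed_Collect_le continuous_intros)
  show ?thesis unfolding K_def Collect_conj_eq Collect_all_eq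
   by (intro closed_Int closed_INT ballI 1 2)
 qed
 moreover have "bounded K"
 proof -
  have "norm Y <= (SUM i:(UNIV::'n set). \<Gamma>)" if "Y:K" for Y
  proof -
   have "norm Y <= (SU i. norm (Y $ i))" by (simp add: norm_vec_def L2_set_le_sum)
   also have "... <= (SUM i:(UNIV::'n set). \<Gamma>)" using that by (intro sum_mono) (simp add: K_def)
   finally show ?thesis .
  qed
  thus ?thesis unfolding bounded_iff by blast
 qed
 ultimately have K: "compact K" by (simp add: compact_eq_bounded_closed)
 define g where "g = (%Y :: real^'m^'n. norm (nrm \<psi> (%i. Y $ i)))"
 have "continuous_on K g"
 proof -
  have e: "continuous_on K (%Y. rows \<psi> (%i. Y $ i) (axis a 1) $ r $ s)" for a r s
   unfolding rows_def by (cases "\<psi> r") (auto intro!: continuous_intros)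
  have "continuous_on K (%Y. det (rows \<psi> (%i. Y $ i) (axis a 1)))" for a
   unfolding det_def by (intro continuous_on_sum continuous_on_mult continuous_on_const continuous_on_prod e)
  thus ?thesis unfolding g_def nrm_def by (intro continuous_on_norm continuous_on_vec_lambda)
 qed
 moreover have pos: "0 < g Y" if "Y:K" for Y
 proof -
  have "v = 0" if "(SU i. v $ i *\<^sub>R Y $ i) = 0" for v :: "real^'n"
  proof -
   have "\<gamma> * norm v <= norm (lcomb v (%i. Y $ i))" using \<open>Y:K\<close> unfolding K_def by blast
   thus ?thesis using that assms by (simp add: mult_le_0_iff)
  qed
  thus ?thesis unfolding g_def using nrm_nonzero[of "%i. Y $ i"] by simp
 qed
 ultimately have "EX c>0. ALL Y:K. c <= g Y"
 proof (cases "K = {}")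
  case True
  thus ?thesis by (intro exI[of _ 1]) simp
 next
  case False
  then obtain Y where "Y:K" "ALL Z:K. g Y <= g Z"
   using continuous_attains_inf[OF K _ \<open>continuous_on K g\<close>] by blast
  thus ?thesis using pos by blast
 qed
 then obtain c where c: "c > 0" "!!Y. Y:K ==> c <= g Y" by blast
 show ?thesis
 proof (intro exI[of _ c] conjI c(1) allI impI)
  fix X :: "'n => real^'m"
  assume "ALL v::real^'n. \<gamma> * norm v <= norm (lcomb v X)" "ALL i. norm (X i) <= \<Gamma>"
  hence "(\<chi> i. X i):K" by (simp add: K_def)
  moreover have "($) (vec_lambda X) = X" by (rule ext) simp
  ultimately show "c <= norm (nrm \<psi> X)" using c(2)[of "\<chi> i. X i"] by (simp add: g_def)
 qed
qed

end

text \<open>Here \<open>V j\<close> is the \<open>j\<close>-th derivative of \<open>u + (\<Sum>i. w i *\<^sub>R T i) + f *\<^sub>R \<nu>\<close>, where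
  \<open>X j\<close> is that of \<open>u\<close>, \<open>T\<close> is the tangential frame dual to \<open>X\<close> and \<open>\<nu>\<close> the unit normal.\<close>

lemma gram_expand:
 fixes X T \<nu>' :: "'n::finite => 'a::real_inner" and T' :: "'n => 'n => 'a"
 assumes T: "!!i j. T i \<bullet> X j = (if i = j then 1 else 0)" "!!i. T i \<bullet> \<nu> = 0"
  and \<nu>: "\<nu> \<bullet> \<nu> = 1" "!!i. \<nu> \<bullet> X i = 0"
  and P: "!!j. P j = (SU i. w' i j *\<^sub>R T i)"
  and Z: "!!j. Z j = W j + f *\<^sub>R \<nu>' j"
  and V: "!!j. V j = X j + P j + Z j + f' j *\<^sub>R \<nu>"
 shows "V j \<bullet> V k = X j \<bullet> X k + (w' k j + w' j k + f * (\<nu>' j \<bullet> X k + \<nu>' k \<bullet> X j) + f' j * f' k)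
  + ((W j \<bullet> X k + W k \<bullet> X j) + f' j * (\<nu> \<bullet> Z k) + f' k * (\<nu> \<bullet> Z j) + (P j + Z j) \<bullet> (P k + Z k))"
proof -
 have PX: "P j \<bullet> X k = w' k j" for j k
  by (simp add: P inner_sum_left T if_distrib cong: if_cong)
 have P\<nu>: "P j \<bullet> \<nu> = 0" for j by (simp add: P inner_sum_left T)
 have WX: "W j \<bullet> X k + f * (\<nu>' j \<bullet> X k) = Z j \<bullet> X k" for j k by (simp add: Z inner_add_left)
 have "V j \<bullet> V k = X j \<bullet> X k + (P j \<bullet> X k + P k \<bullet> X j) + (Z j \<bullet> X k + Z k \<bullet> X j) + f' j * f' k
  + f' j * (\<nu> \<bullet> Z k) + f' k * (\<nu> \<bullet> Z j) + (P j + Z j) \<bullet> (P k + Z k)"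
 proof -
  have c: "X j \<bullet> P k = P k \<bullet> X j" "X j \<bullet> \<nu> = 0" "\<nu> \<bullet> P k = 0" "Z j \<bullet> \<nu> = \<nu> \<bullet> Z j" "X j \<bullet> Z k = Z k \<bullet> X j" for j k
   using \<nu>(2)[of j] P\<nu>[of k] by (metis inner_commute)+
  show ?thesis
   by (simp add: V inner_add_left inner_add_right \<nu> P\<nu> c) (simp add: algebra_simps)
 qed
 thus ?thesis unfolding PX WX[symmetric] by (simp add: algebra_simps)
qed

context symbols
begin

text \<open>The gradient of a mollified map is of this kind: bounded, with derivatives of size
  \<open>s\<close>. The class is stable under the algebra that defines the normal and the dual
  frame; their derivatives are then O(\<open>s\<close>) as well, and the second fundamental form
  divided by \<open>s\<close> stays bounded.\<close>

definition slow :: "('p => real) => ('p => 'n::finite rfun) => bool" where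
 "slow s f \<longleftrightarrow> symb (%p. 1) (%p. 1) f & (ALL i. symb s (%p. 1) (%p. pder i (f p)))"

lemma slow_symb: "slow s f ==> symb (%p. 1) (%p. 1) f"
 and slow_pder: "slow s f ==> symb s (%p. 1) (%p. pder i (f p))" by (simp_all add: slow_def)

lemma slowI:
 assumes "symb (%p. 1) (%p. 1) f" "!!i. symb s (%p. 1) (g i)"
  "!!i. ev (%p x. g i p x = pder i (f p) x)"
 shows "slow s f" unfolding slow_def by (intro conjI allI assms(1) symb_cong[OF assms(2,3)])

lemma slow_const: "slow s (%p x. c)"
 by (rule slowI[where g="%i p x. 0"]) (simp_all add: symb_const1 symb_zero)

lemma slow_add:
 assumes f: "slow s f" and g: "slow s g"
 shows "slow s (%p x. f p x + g p x)"
proof (rule slowI[where g="%i p x. pder i (f p) x + pder i (g p) x"])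
 show "ev (%p x. pder i (f p) x + pder i (g p) x = pder i (%x. f p x + g p x) x)" for i
  using symb_differentiable[OF slow_symb[OF f]] symb_differentiable[OF slow_symb[OF g]]
  by eventually_elim (simp add: pder_add)
qed (intro symb_add slow_symb[OF f] slow_symb[OF g] slow_pder[OF f] slow_pder[OF g])+

lemma slow_mult:
 assumes f: "slow s f" and g: "slow s g"
 shows "slow s (%p x. f p x * g p x)"
proof (rule slowI[where g="%i p x. pder i (f p) x * g p x + f p x * pder i (g p) x"])
 show "ev (%p x. pder i (f p) x * g p x + f p x * pder i (g p) x = pder i (%x. f p x * g p x) x)" for i
  using symb_differentiable[OF slow_symb[OF f]] symb_differentiable[OF slow_symb[OF g]]
  by eventually_elim (simp add: pder_mult)
 show "symb s (%p. 1) (%p x. pder i (f p) x * g p x + f p x * pder i (g p) x)" for i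
  by (intro symb_add symb_mult1[OF slow_symb[OF f]] symb_mult2[OF _ slow_symb[OF g]] slow_pder[OF f] slow_pder[OF g])
 show "symb (%p. 1) (%p. 1) (%p x. f p x * g p x)"
  by (intro symb_mult1 slow_symb[OF f] slow_symb[OF g])
qed

lemma slow_cmult: "slow s f ==> slow s (%p x. c * f p x)" by (rule slow_mult[OF slow_const])

lemma slow_sum: "(!!i. i:I ==> slow s (f i)) ==> slow s (%p x. SUM i:I. f i p x)"
 by (induction I rule: infinite_finite_induct) (auto simp: slow_const slow_add)

lemma slow_prod: "(!!i. i:I ==> slow s (f i)) ==> slow s (%p x. PROD i:I. f i p x)"
 by (induction I rule: infinite_finite_induct) (auto simp: slow_const slow_mult)

lemma slow_compose:
 assumes f: "slow s f" and \<phi>: "symb (%p. 1) (%p. 1) (%p x. \<phi> (f p x))" "symb (%p. 1) (%p. 1) (%p x. \<phi>' (f p x))"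
  and d: "ev (%p x. (\<phi> has_real_derivative \<phi>' (f p x)) (at (f p x)))"
 shows "slow s (%p x. \<phi> (f p x))"
proof (rule slowI[where g="%i p x. \<phi>' (f p x) * pder i (f p) x"])
 show "ev (%p x. \<phi>' (f p x) * pder i (f p) x = pder i (%x. \<phi> (f p x)) x)" for i
  using symb_differentiable[OF slow_symb[OF f]] d
 proof eventually_elim
  case (elim p)
  show ?case
  proof
   fix x assume "x:U p"
   thus "\<phi>' (f p x) * pder i (f p) x = pder i (%x. \<phi> (f p x)) x"
    using pder_compose(2)[where f="f p" and x=x and \<phi>=\<phi> and d="\<phi>' (f p x)" and i=i] elim by simp
  qed
 qed
 show "symb s (%p. 1) (%p x. \<phi>' (f p x) * pder i (f p) x)" for i
  by (rule symb_mult1[OF \<phi>(2) slow_pder[OF f]])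
qed (rule \<phi>)

lemma slow_inverse:
 assumes f: "slow s f" and c: "0 < c" "ev (%p x. c <= f p x)"
 shows "slow s (%p x. inverse (f p x))"
proof (rule slow_compose[OF f, where \<phi>'="%t. - (inverse t * inverse t)"])
 show s: "symb (%p. 1) (%p. 1) (%p x. inverse (f p x))" by (rule symb_inverse[OF slow_symb[OF f] c])
 show "symb (%p. 1) (%p. 1) (%p x. - (inverse (f p x) * inverse (f p x)))"
  by (intro symb_uminus symb_mult1 s)
 show "ev (%p x. (inverse has_real_derivative - (inverse (f p x) * inverse (f p x))) (at (f p x)))"
  using c(2)
 proof eventually_elim
  case (elim p)
  show ?case
  proof
   fix x assume "x:U p"
   hence "f p x ~= 0" using elim c(1) by force
   thus "(inverse has_real_derivative - (inverse (f p x) * inverse (f p x))) (at (f p x))"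
    using DERIV_inverse[of "f p x" UNIV] by (simp add: numeral_2_eq_2)
  qed
 qed
qed

lemma slow_sqrt:
 assumes f: "slow s f" and c: "0 < c" "ev (%p x. c <= f p x)"
 shows "slow s (%p x. sqrt (f p x))"
proof (rule slow_compose[OF f, where \<phi>'="%t. 1/2 * (sqrt t * inverse t)"])
 show s: "symb (%p. 1) (%p. 1) (%p x. sqrt (f p x))" by (rule symb_sqrt[OF slow_symb[OF f] c])
 show "symb (%p. 1) (%p. 1) (%p x. 1/2 * (sqrt (f p x) * inverse (f p x)))"
  by (intro symb_cmult symb_mult1 s symb_inverse[OF slow_symb[OF f] c])
 show "ev (%p x. (sqrt has_real_derivative 1/2 * (sqrt (f p x) * inverse (f p x))) (at (f p x)))"
  using c(2) by eventually_elim (intro ballI DERIV_sqrt_inverse, use c(1) in force)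
qed

lemma slow_det:
 fixes A :: "'p => real^'n => real^'m^'m"
 assumes "!!r c. slow s (%p x. A p x $ r $ c)"
 shows "slow s (%p x. det (A p x))" unfolding det_def by (intro slow_sum slow_cmult slow_prod assms)

text \<open>Both frames are made of determinants, one square root and reciprocals; the lower bound
  on \<open>nrm\<close> keeps the root and the reciprocals away from their singularity.\<close>

lemma slow_frame:
 fixes X :: "'k::finite => 'p => real^'n => real^'m" and \<psi> :: "'m => 'k option"
 assumes X: "!!i a. slow s (%p x. X i p x $ a)" and c: "0 < c"
  and low: "ev (%p x. c <= norm (nrm \<psi> (%i. X i p x)))"
 shows "slow s (%p x. nu \<psi> (%i. X i p x) $ a)" "slow s (%p x. cotan \<psi> (%i. X i p x) i $ a)"
proof -
 have n: "slow s (%p x. nrm \<psi> (%i. X i p x) $ a)" for a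
 proof -
  have "slow s (%p x. rows \<psi> (%i. X i p x) (axis a 1) $ r $ b)" for r b
   unfolding rows_def by (cases "\<psi> r") (simp_all add: X slow_const)
  thus ?thesis unfolding nrm_def by (simp add: slow_det)
 qed
 have sq: "(norm (nrm \<psi> (%i. X i p x)))\<^sup>2 = (SU a. nrm \<psi> (%i. X i p x) $ a * nrm \<psi> (%i. X i p x) $ a)" for p x
  by (simp add: power2_norm_eq_inner inner_vec_def)
 have s2: "slow s (%p x. (norm (nrm \<psi> (%i. X i p x)))\<^sup>2)"
  unfolding sq by (intro slow_sum slow_mult n)
 have low2: "ev (%p x. c^2 <= (norm (nrm \<psi> (%i. X i p x)))\<^sup>2)"
  using low by eventually_elim (use c in \<open>auto intro: power_mono\<close>)
 have c2: "0 < c^2" using c by simp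
 have nn: "slow s (%p x. norm (nrm \<psi> (%i. X i p x)))" using slow_sqrt[OF s2 c2 low2] by simp
 show "slow s (%p x. nu \<psi> (%i. X i p x) $ a)"
  unfolding nu_def using slow_mult[OF slow_inverse[OF nn c low] n] by simp
 have "slow s (%p x. rows \<psi> ((%i. X i p x)(i := axis a 1)) (nrm \<psi> (%i. X i p x)) $ r $ b)" for r b
 proof (cases "\<psi> r")
  case None
  thus ?thesis by (simp add: rows_def n)
 next
  case (Some k)
  thus ?thesis by (cases "k = i") (simp_all add: rows_def X slow_const)
 qed
 hence "slow s (%p x. det (rows \<psi> ((%i. X i p x)(i := axis a 1)) (nrm \<psi> (%i. X i p x))))"
  by (rule slow_det)
 from slow_mult[OF slow_inverse[OF s2 c2 low2] this]
 show "slow s (%p x. cotan \<psi> (%i. X i p x) i $ a)" unfolding cotan_def by simp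
qed

end

definition grad :: "('m::finite => 'p => 'n::finite rfun) => 'n => 'p => real^'n => real^'m" where
 "grad u i p x = (\<chi> a. pder i (u a p) x)"

text \<open>The second fundamental form divided by \<open>s\<close>, in Weingarten form: derivatives
  of the normal against those of the map, symmetrised.\<close>

definition secff :: "('m::finite => 'n::finite option) => ('m => 'p => 'n rfun) => ('p => real) => 'n => 'n => 'p => 'n rfun" where
 "secff \<psi> u s j k p x = - 1/2 * (inverse (s p) * (SUM a:UNIV.
  pder j (%x. nu \<psi> (%i. grad u i p x) $ a) x * pder k (u a p) x +
  pder k (%x. nu \<psi> (%i. grad u i p x) $ a) x * pder j (u a p) x))"

lemma secff_sym: "secff \<psi> u s j k = secff \<psi> u s k j"
 by (simp add: secff_def fun_eq_iff add.commute)

context symbols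
begin

lemma symb_slow: "slow s f ==> \<forall>\<^sub>F p in F. 1 <= L p ==> symb (%p. 1) L f"
 by (rule symb_mono1[OF slow_symb]) (auto elim!: eventually_mono)

lemma symb_weak: "symb A (%p. 1) f ==> \<forall>\<^sub>F p in F. 1 <= L p ==> symb A L f"
 by (erule symb_mono1) (auto elim!: eventually_mono)

context
 fixes u :: "'m::finite => 'p => 'n::finite rfun" and s :: "'p => real" and \<psi> :: "'m => 'n option" and c :: real
 assumes \<psi>: "bij \<psi>" and s: "\<forall>\<^sub>F p in F. 0 < s p & s p <= 1"
  and ud: "!!a. ev (%p x. u a p dif x)"
  and u: "!!a i. slow s (%p. pder i (u a p))"
  and c: "0 < c" and low: "ev (%p x. c <= norm (nrm \<psi> (%i. grad u i p x)))"
begin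

lemma frame_slow:
 shows "slow s (%p x. nu \<psi> (%i. grad u i p x) $ a)" "slow s (%p x. cotan \<psi> (%i. grad u i p x) i $ a)"
 by (rule slow_frame[OF _ c low], simp add: grad_def u)+

lemma secff_symb: "symb (%p. 1) (%p. 1) (secff \<psi> u s j k)"
proof -
 have "symb s (%p. 1) (%p x. SUM a:UNIV.
  pder j (%x. nu \<psi> (%i. grad u i p x) $ a) x * pder k (u a p) x +
  pder k (%x. nu \<psi> (%i. grad u i p x) $ a) x * pder j (u a p) x)"
  by (intro symb_sum symb_add symb_mult2[OF slow_pder[OF frame_slow(1)] slow_symb[OF u]])
 hence "symb (%p. 1) (%p. 1) (%p x. inverse (s p) * (SUM a:UNIV.
  pder j (%x. nu \<psi> (%i. grad u i p x) $ a) x * pder k (u a p) x +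
  pder k (%x. nu \<psi> (%i. grad u i p x) $ a) x * pder j (u a p) x))"
  by (rule symb_mono1[OF symb_scale]) (use s in \<open>auto elim!: eventually_mono\<close>)
 from symb_cmult[OF this, of "-1/2"] show ?thesis unfolding secff_def by simp
qed

text \<open>The displacement is \<open>s f\<close> along the normal and \<open>s^2 w\<close> in the
  dual frame. The term of order \<open>s\<close> drops out because the normal is orthogonal to the
  tangent vectors. The order \<open>s^2\<close> is exactly \<open>TT\<close>, the derivatives of the
  normal being O(\<open>s\<close>) themselves. In everything else a derivative of the frame or a
  further displacement gives a third factor \<open>s\<close>.\<close>

lemma geo_step:
 assumes L: "\<forall>\<^sub>F p in F. 1 <= L p" and f: "adm L f" and w: "!!k. adm L (w k)"
 shows "EX v E. (ALL a. symb s L (%p x. v a p x - u a p x)) &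
  (ALL a i. symb s L (%p x. pder i (v a p) x - pder i (u a p) x)) &
  (ALL j k. symb (%p. s p ^ 3) L (E j k)) & ev (%p x. (ALL a. v a p dif x) &
   (ALL j k. gram (%a. v a p) j k x = gram (%a. u a p) j k x
    + s p ^ 2 * TT (secff \<psi> u s) f w j k p x + E j k p x))"
proof -
 let ?X = "%i p x. grad u i p x"
 define N where "N = (%a p x. nu \<psi> (%i. ?X i p x) $ a)"
 define T where "T = (%i a p x. cotan \<psi> (%i. ?X i p x) i $ a)"
 have N: "slow s (N a)" for a unfolding N_def by (rule frame_slow)
 have T: "slow s (T i a)" for i a unfolding T_def by (rule frame_slow)
 define g where "g = (%a p x. s p ^ 2 * (SU i. w i p x * T i a p x) + s p * (f p x * N a p x))"
 define v where "v = (%a p x. u a p x + g a p x)"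
 define P where "P = (%j a p x. s p ^ 2 * (SU i. pder j (w i p) x * T i a p x))"
 define W where "W = (%j a p x. s p ^ 2 * (SU i. w i p x * pder j (T i a p) x))"
 define Z where "Z = (%j a p x. W j a p x + s p * (f p x * pder j (N a p) x))"
 define E where "E = (%j k p x. (SU a. W j a p x * pder k (u a p) x + W k a p x * pder j (u a p) x)
  + s p * pder j (f p) x * (SU a. N a p x * Z k a p x) + s p * pder k (f p) x * (SU a. N a p x * Z j a p x)
  + (SU a. (P j a p x + Z j a p x) * (P k a p x + Z k a p x)))"
 have s1: "\<forall>\<^sub>F p in F. \<bar>(s p)\<^sup>2\<bar> <= \<bar>s p\<bar>"
  using s by eventually_elim (simp add: power2_eq_square mult_left_le)
 have s3: "\<forall>\<^sub>F p in F. \<bar>(s p)\<^sup>2 * s p\<bar> <= \<bar>s p ^ 3\<bar>" "\<forall>\<^sub>F p in F. \<bar>s p * s p ^ 2\<bar> <= \<bar>s p ^ 3\<bar>"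
  by (simp_all add: power3_eq_cube power2_eq_square mult.assoc)
 have s4: "\<forall>\<^sub>F p in F. \<bar>(s p)\<^sup>2 * s p ^ 2\<bar> <= \<bar>s p ^ 3\<bar>"
  using s
 proof eventually_elim
  case (elim p)
  have "s p ^ 4 <= s p ^ 3" using elim by (intro power_decreasing) auto
  thus ?case using elim by (simp add: power4_eq_xxxx power2_eq_square mult.assoc)
 qed
 have LL: "symb A L h" if "symb A L h" for A h using that .
 have Ts: "symb (%p. 1) L (T i a)" and Ns: "symb (%p. 1) L (N a)" for i a
  by (rule symb_slow[OF T L], rule symb_slow[OF N L])
 have Td: "symb s L (%p. pder j (T i a p))" and Nd: "symb s L (%p. pder j (N a p))" for i j a
  by (rule symb_weak[OF slow_pder[OF T] L], rule symb_weak[OF slow_pder[OF N] L])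
 note wf = adm_symb[OF w] adm_pder[OF w] adm_symb[OF f] adm_pder[OF f]
 have us: "symb (%p. 1) L (%p. pder j (u a p))" for j a by (rule symb_slow[OF u L])
 have Ps: "symb (%p. s p ^ 2) L (P j a)" for j a
  unfolding P_def using symb_scale[OF symb_sum[where I=UNIV, OF symb_mult1[OF wf(2) Ts]], of "%p. s p ^ 2"] by simp
 have Ws0: "symb (%p. s p ^ 2 * s p) L (W j a)" for j a
  unfolding W_def by (rule symb_scale[OF symb_sum[OF symb_mult1[OF wf(1) Td]]])
 have Ws3: "symb (%p. s p ^ 3) L (W j a)" for j a by (rule symb_mono1[OF Ws0 s3(1)]) simp
 have "\<forall>\<^sub>F p in F. \<bar>(s p)\<^sup>2 * s p\<bar> <= \<bar>(s p)\<^sup>2\<bar>"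
  using s by eventually_elim (simp add: abs_mult mult_left_le)
 hence Ws2: "symb (%p. s p ^ 2) L (W j a)" for j a by (intro symb_mono1[OF Ws0]) simp_all
 have Zs: "symb (%p. s p ^ 2) L (Z j a)" for j a
  unfolding Z_def using symb_add[OF Ws2 symb_scale[OF symb_mult1[OF wf(3) Nd], of "%p. s p", unfolded power2_eq_square[symmetric]]] .
 have Es: "symb (%p. s p ^ 3) L (E j k)" for j k
 proof -
  have 1: "symb (%p. s p ^ 3) L (%p x. SU a. W j a p x * pder k (u a p) x + W k a p x * pder j (u a p) x)" for j k
   by (intro symb_sum symb_add symb_mult2[OF Ws3 us])
  have 2: "symb (%p. s p ^ 3) L (%p x. s p * pder j (f p) x * (SU a. N a p x * Z k a p x))" for j k
  proof (rule symb_mono1[OF _ s3(2)])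
   have "symb s L (%p x. s p * pder j (f p) x)" using symb_scale[OF wf(4), of s] by simp
   thus "symb (%p. s p * s p ^ 2) L (%p x. s p * pder j (f p) x * (SU a. N a p x * Z k a p x))"
    by (rule symb_mult[OF _ symb_sum[OF symb_mult1[OF Ns Zs]]])
  qed simp
  have 3: "symb (%p. s p ^ 3) L (%p x. SU a. (P j a p x + Z j a p x) * (P k a p x + Z k a p x))"
   by (rule symb_sum, rule symb_mono1[OF symb_mult[OF symb_add[OF Ps Zs] symb_add[OF Ps Zs]] s4]) simp
  show ?thesis unfolding E_def by (intro symb_add 1 2 3)
 qed
 have gs: "symb s L (g a)" for a
 proof -
  have "symb (%p. s p ^ 2) L (%p x. s p ^ 2 * (SU i. w i p x * T i a p x))"
   using symb_scale[OF symb_sum[where I=UNIV, OF symb_mult1[OF wf(1) Ts]], of "%p. s p ^ 2"] by simp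
  hence "symb s L (%p x. s p ^ 2 * (SU i. w i p x * T i a p x))" by (rule symb_mono1[OF _ s1]) simp
  moreover have "symb s L (%p x. s p * (f p x * N a p x))"
   using symb_scale[OF symb_mult1[OF wf(3) Ns], of s] by simp
  ultimately show ?thesis unfolding g_def by (rule symb_add)
 qed
 define Q where "Q = (%j a p x. P j a p x + Z j a p x + s p * pder j (f p) x * N a p x)"
 have Qs: "symb s L (Q j a)" for j a
 proof -
  have "symb s L (%p x. P j a p x + Z j a p x)" by (rule symb_mono1[OF symb_add[OF Ps Zs] s1]) simp
  moreover have "symb s L (%p x. s p * pder j (f p) x * N a p x)"
   using symb_mult2[OF symb_scale[OF wf(4), of s] Ns] by simp
  ultimately show ?thesis unfolding Q_def by (rule symb_add)
 qed
 have fd: "ev (%p x. f p dif x)" by (rule symb_differentiable[OF wf(3)])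
 have wd: "\<forall>\<^sub>F p in F. ALL i. ALL x:U p. w i p dif x"
  by (intro eventually_all_finite symb_differentiable[OF wf(1)])
 have Td': "\<forall>\<^sub>F p in F. ALL i. ALL a. ALL x:U p. T i a p dif x"
  by (intro eventually_all_finite symb_differentiable[OF Ts])
 have Nd': "\<forall>\<^sub>F p in F. ALL a. ALL x:U p. N a p dif x"
  by (intro eventually_all_finite symb_differentiable[OF Ns])
 have ud': "\<forall>\<^sub>F p in F. ALL a. ALL x:U p. u a p dif x"
  by (intro eventually_all_finite ud)
 have der: "ev (%p x. ALL a. v a p dif x & (ALL j. pder j (v a p) x = pder j (u a p) x + Q j a p x))"
  using fd wd Td' Nd' ud'
 proof eventually_elim
  case (elim p)
  show ?case
  proof (intro ballI allI)
   fix x a assume x: "x:U p"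
   have d: "f p dif x" "N a p dif x" "u a p dif x"
    "!!i. w i p dif x" "!!i. T i a p dif x" using elim x by auto
   have wT: "(%x. w i p x * T i a p x) dif x" for i by (intro differentiable_mult d)
   have sum: "(%x. SU i. w i p x * T i a p x) dif x" by (intro differentiable_sum finite ballI wT)
   have fN: "(%x. f p x * N a p x) dif x" by (intro differentiable_mult d)
   have d1: "(%x. s p ^ 2 * (SU i. w i p x * T i a p x)) dif x"
    and d2: "(%x. s p * (f p x * N a p x)) dif x"
    by (rule differentiable_mult[OF differentiable_const sum], rule differentiable_mult[OF differentiable_const fN])
   have gd: "g a p dif x" unfolding g_def by (rule differentiable_add[OF d1 d2])
   have gp: "pder j (g a p) x = Q j a p x" for j
    unfolding g_def pder_add[OF d1 d2] pder_cmult[OF sum] pder_cmult[OF fN] pder_mult[OF d(1,2)]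
     pder_sum[OF finite wT] pder_mult[OF d(4,5)] Q_def P_def Z_def W_def
    by (simp add: sum.distrib algebra_simps)
   show "v a p dif x & (ALL j. pder j (v a p) x = pder j (u a p) x + Q j a p x)"
    unfolding v_def using differentiable_add[OF d(3) gd] pder_add[OF d(3) gd] gp by simp
  qed
 qed
 have vu: "symb s L (%p x. v a p x - u a p x)" for a using gs[of a] by (simp add: v_def)
 have vud: "symb s L (%p x. pder i (v a p) x - pder i (u a p) x)" for a i
  by (rule symb_cong[OF Qs[of i a]]) (use der in eventually_elim, simp)
 have gram: "ev (%p x. (ALL a. v a p dif x) &
   (ALL j k. gram (%a. v a p) j k x = gram (%a. u a p) j k x
    + s p ^ 2 * TT (secff \<psi> u s) f w j k p x + E j k p x))" using der low s
 proof eventually_elim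
  case (elim p)
  show ?case
  proof (intro ballI conjI allI)
   fix x assume x: "x:U p"
   show "v a p dif x" for a using elim x by simp
   fix j k
   let ?Xp = "%i. grad u i p x"
   have s0: "s p ~= 0" using elim by simp
   have n0: "nrm \<psi> ?Xp ~= 0" using elim(2) x c by force
   have in1: "(\<chi> a. F a) \<bullet> (\<chi> a. G a) = (SU a. F a * G a)" for F G :: "'m => real"
    by (simp add: inner_vec_def)
   define V where "V = (%j. (\<chi> a. pder j (v a p) x))"
   define Pv where "Pv = (%j. (\<chi> a. P j a p x))"
   define Zv where "Zv = (%j. (\<chi> a. Z j a p x))"
   define Wv where "Wv = (%j. (\<chi> a. W j a p x))"
   define Nv where "Nv = (\<chi> a. N a p x)"
   define N'v where "N'v = (%j. (\<chi> a. pder j (N a p) x))"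
   have Nvnu: "Nv = nu \<psi> ?Xp" by (simp add: Nv_def N_def)
   have "V j \<bullet> V k = ?Xp j \<bullet> ?Xp k + (s p ^ 2 * pder j (w k p) x + s p ^ 2 * pder k (w j p) x
     + (s p * f p x) * (N'v j \<bullet> ?Xp k + N'v k \<bullet> ?Xp j) + (s p * pder j (f p) x) * (s p * pder k (f p) x))
    + ((Wv j \<bullet> ?Xp k + Wv k \<bullet> ?Xp j) + s p * pder j (f p) x * (Nv \<bullet> Zv k) + s p * pder k (f p) x * (Nv \<bullet> Zv j)
     + (Pv j + Zv j) \<bullet> (Pv k + Zv k))"
   proof (rule gram_expand[where T="cotan \<psi> ?Xp" and w'="%i j. s p ^ 2 * pder j (w i p) x"])
    show "cotan \<psi> ?Xp i \<bullet> ?Xp j = (if i = j then 1 else 0)" for i j by (rule cotan_dual[OF \<psi> n0])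
    show "cotan \<psi> ?Xp i \<bullet> Nv = 0" for i unfolding Nvnu by (rule cotan_nu[OF \<psi> n0])
    show "Nv \<bullet> Nv = 1" unfolding Nvnu by (rule nu_unit[OF \<psi> n0])
    show "Nv \<bullet> ?Xp i = 0" for i unfolding Nvnu by (rule nu_orth[OF \<psi> n0])
    show "Pv j = (SU i. (s p ^ 2 * pder j (w i p) x) *\<^sub>R cotan \<psi> ?Xp i)" for j
     by (simp add: Pv_def P_def T_def vec_eq_iff sum_distrib_left mult.assoc)
    show "Zv j = Wv j + (s p * f p x) *\<^sub>R N'v j" for j
     by (simp add: Zv_def Wv_def Z_def N'v_def vec_eq_iff mult.assoc)
    show "V j = ?Xp j + Pv j + Zv j + (s p * pder j (f p) x) *\<^sub>R Nv" for j
     using elim(1) x by (simp add: V_def Pv_def Zv_def Nv_def grad_def Q_def vec_eq_iff)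
   qed
   moreover have "N'v j \<bullet> ?Xp k + N'v k \<bullet> ?Xp j = -2 * s p * secff \<psi> u s j k p x"
    unfolding N'v_def grad_def in1 secff_def N_def using s0 by (simp add: sum.distrib grad_def)
   moreover have "V j \<bullet> V k = gram (%a. v a p) j k x"
    "?Xp j \<bullet> ?Xp k = gram (%a. u a p) j k x" unfolding V_def grad_def in1 by (rule refl)+
   moreover have "(Wv j \<bullet> ?Xp k + Wv k \<bullet> ?Xp j) + s p * pder j (f p) x * (Nv \<bullet> Zv k) + s p * pder k (f p) x * (Nv \<bullet> Zv j)
     + (Pv j + Zv j) \<bullet> (Pv k + Zv k) = E j k p x"
    by (simp add: E_def Wv_def Zv_def Pv_def Nv_def grad_def inner_vec_def sum.distrib)
   ultimately show "gram (%a. v a p) j k x = gram (%a. u a p) j k x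
    + s p ^ 2 * TT (secff \<psi> u s) f w j k p x + E j k p x"
    by (simp add: TT_def power2_eq_square algebra_simps)
  qed
 qed
 show ?thesis by (rule exI[of _ v], rule exI[of _ E]) (intro conjI allI vu vud Es gram)
qed

end

end

section \<open>Mollification\<close>

text \<open>The flat function \<open>exp (- 1 / t)\<close> times \<open>t^-j\<close>. The powers
  make the family closed under differentiation up to linear combinations (\<open>fle_deriv\<close>),
  so smoothness and bounds come by one induction.\<close>

definition fle :: "nat => real => real" where
 "fle j t = (if 0 < t then inverse t ^ j / exp (inverse t) else 0)"

text \<open>A single term of the exponential series at \<open>1 / t\<close> is at most the whole
  series.\<close>

lemma fle_bound: "\<bar>fle j t\<bar> <= fact j"
proof (cases "0 < t")
 case True
 define y where "y = inverse t"
 have y: "0 < y" using True by (simp add: y_def)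
 have "(%n. y ^ n /\<^sub>R fact n) sums exp y" by (rule exp_converges)
 hence "(SUM n:{j}. y ^ n /\<^sub>R fact n) <= exp y"
  using y by (metis (no_types, lifting) finite.emptyI finite.insertI inverse_nonnegative_iff_nonnegative fact_ge_zero less_imp_le scaleR_nonneg_nonneg sum_le_suminf sums_iff zero_le_power)
 hence "y ^ j <= fact j * exp y" by (simp add: field_simps)
 hence "y ^ j / exp y <= fact j" by (simp add: divide_le_eq)
 thus ?thesis using True y by (simp add: fle_def flip: y_def)
qed (simp add: fle_def)

lemma fle_lim: "((%t. fle j t) \<longlongrightarrow> 0) (at_right 0)"
proof -
 have "((%t. inverse t ^ j / exp (inverse t)) \<longlongrightarrow> 0) (at_right (0::real))"
  by (rule filterlim_compose[OF tendsto_power_div_exp_0 filterlim_inverse_at_top_right])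
 thus ?thesis by (rule Lim_transform_eventually) (auto simp: fle_def eventually_at_filter)
qed

lemma fle_deriv: "(fle j has_real_derivative (fle (j + 2) t - j * fle (j + 1) t)) (at t)"
proof -
 consider "t < 0" | "t > 0" | "t = 0" by linarith
 thus ?thesis
 proof cases
  case 1
  have "((%_. 0) has_real_derivative 0) (at t)" by simp
  hence "(fle j has_real_derivative 0) (at t)"
   by (rule has_field_derivative_transform_within_open[of _ _ _ "{..<0}"]) (use 1 in \<open>auto simp: fle_def\<close>)
  thus ?thesis using 1 by (simp add: fle_def)
 next
  case 2
  have "((%t. inverse t ^ j / exp (inverse t)) has_real_derivative (fle (j + 2) t - j * fle (j + 1) t)) (at t)"
   using 2 by (auto intro!: derivative_eq_intros simp: fle_def divide_simps)
    (cases j; simp add: field_simps power2_eq_square)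
  thus ?thesis
   by (rule has_field_derivative_transform_within_open[of _ _ _ "{0<..}"]) (use 2 in \<open>auto simp: fle_def\<close>)
 next
  case 3
  have "((%h. (fle j h - fle j 0) / h) \<longlongrightarrow> 0) (at 0)"
  proof (rule filterlim_split_at)
   show "((%h. (fle j h - fle j 0) / h) \<longlongrightarrow> 0) (at_left 0)"
    by (rule tendsto_eventually) (auto simp: eventually_at_filter fle_def)
   \<comment> \<open>On the right the difference quotient at 0 is \<open>fle (Suc j)\<close>
     itself.\<close>
   show "((%h. (fle j h - fle j 0) / h) \<longlongrightarrow> 0) (at_right 0)"
    by (rule Lim_transform_eventually[OF fle_lim[of "Suc j"]]) (auto simp: eventually_at_filter fle_def divide_simps)
  qed
  thus ?thesis using 3 by (simp add: has_field_derivative_iff fle_def)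
 qed
qed

text \<open>One parameter value and the whole space: with weights 1, \<open>symb\<close> just says
  that every derivative is bounded.\<close>

interpretation Un: symbols "principal {()}" "%_::unit. UNIV :: (real^'n) set" by unfold_locales simp

definition smb :: "'n::finite rfun => bool" where
 "smb f \<longleftrightarrow> Un.symb (%_. 1) (%_. 1) (%_. f)"

lemma smb_bound: "smb f ==> EX C>0. ALL x. \<bar>f x\<bar> <= C"
 unfolding smb_def by (erule Un.symbE) (auto simp: eventually_principal)

lemma smb_diff: "smb f ==> f dif x"
 unfolding smb_def using Un.symb_differentiable by (fastforce simp: eventually_principal)

lemma smb_pder: "smb f ==> smb (pder i f)"
 unfolding smb_def using Un.symb_pder[of "%_. 1" "%_. 1" "%_. f" i] by simp

lemma smb_cont: "smb f ==> continuous_on S f"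
 by (simp add: continuous_at_imp_continuous_on differentiable_imp_continuous_within smb_diff)

lemma smb_mult: "smb f ==> smb g ==> smb (%x. f x * g x)" unfolding smb_def by (rule Un.symb_mult1)

lemma smb_cmult: "smb f ==> smb (%x. c * f x)" unfolding smb_def by (rule Un.symb_cmult)

lemma smb_prod: "(!!i. i:I ==> smb (f i)) ==> smb (%x. PROD i:I. f i x)"
 unfolding smb_def by (rule Un.symb_prod)

lemma smb_fle:
 fixes i :: "'n::finite"
 shows "smb (%x::real^'n. fle j (c + d * x $ i))"
proof -
 have dd: "(%x::real^'n. fle j (c + d * x $ i)) dif x"
  "pder k (%x::real^'n. fle j (c + d * x $ i)) = (%x. (d * axis i 1 $ k) * (fle (j + 2) (c + d * x $ i) - j * fle (j + 1) (c + d * x $ i)))" for j k x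
 proof -
  have l: "((%x::real^'n. c + d * x $ i) has_derivative (%v. d * v $ i)) (at x)" for x
   by (auto intro!: derivative_eq_intros bounded_linear_imp_has_derivative bounded_linear_vec_nth)
  have "((%x::real^'n. fle j (c + d * x $ i)) has_derivative (%v. (d * v $ i) * (fle (j + 2) (c + d * x $ i) - j * fle (j + 1) (c + d * x $ i)))) (at x)" for x
   by (rule DERIV_compose_FDERIV[where f="fle j" and g="%x::real^'n. c + d * x $ i", OF fle_deriv l])
  note h = this
  show "(%x::real^'n. fle j (c + d * x $ i)) dif x" using h by (auto simp: differentiable_def)
  show "pder k (%x::real^'n. fle j (c + d * x $ i)) = (%x. (d * axis i 1 $ k) * (fle (j + 2) (c + d * x $ i) - j * fle (j + 1) (c + d * x $ i)))"
   by (rule ext) (simp add: pder_eq[OF h] axis_def eq_commute)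
 qed
 have b: "Un.bdd0 (%_. 1) (%_ x::real^'n. fle j (c + d * x $ i))" for j
  unfolding Un.bdd0_def using fle_bound by (auto simp: eventually_principal)
 have "Un.bddk k (%_. 1) (%_. 1) (%_ x::real^'n. fle j (c + d * x $ i))" for k j
 proof (induction k arbitrary: j)
  case 0
  thus ?case using b by simp
 next
  case (Suc k)
  have "Un.bddk k (%_. 1) (%_. 1) (%_ x. (d * axis i 1 $ q) * (fle (j + 2) (c + d * x $ i) - j * fle (j + 1) (c + d * x $ i)))" for q
  proof -
   have c: "Un.bddk k (%_. 1) (%_. 1) (%_ x. r * f x)" if "Un.bddk k (%_. 1) (%_. 1) (%_::unit. f)" for r and f :: "'n rfun"
   proof -
    have "Un.bddk k (%_. 1) (%_. 1) (%_ x::real^'n. r)"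
     by (rule Un.bddk_mono[where A="%_. r" and l="%_. 1" and c="\<bar>r\<bar>" and d=1, OF _ Un.bddk_const]) (auto simp: eventually_principal)
    from Un.bddk_mult[OF this that] show ?thesis by simp
   qed
   have "Un.bddk k (%_. 1) (%_. 1) (%_ x. fle (j + 2) (c + d * x $ i) + (- real j) * fle (j + 1) (c + d * x $ i))"
    by (intro Un.bddk_add c Suc)
   from c[OF this] show ?thesis by simp
  qed
  thus ?case using b dd by simp
 qed
 thus ?thesis by (simp add: smb_def Un.symb_def)
qed

text \<open>Cubes take the place of balls throughout the mollification, because they are boxes for
  the integral.\<close>

definition bx :: "real => (real^'n) set" where
 "bx r = cbox (vec (- r)) (vec r)"

definition nb :: "real^'n => real => (real^'n) set" where
 "nb x r = cbox (x - vec r) (x + vec r)"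

lemma mem_bx: "t:bx r \<longleftrightarrow> (ALL i. \<bar>t $ i\<bar> <= r)"
 by (auto simp: bx_def mem_box_cart abs_le_iff minus_le_iff)

lemma mem_nb: "y:nb x r \<longleftrightarrow> (ALL i. \<bar>y $ i - x $ i\<bar> <= r)"
 by (auto simp: nb_def mem_box_cart abs_le_iff algebra_simps)

lemma closed_bx: "closed (bx r)" and closed_nb: "closed (nb x r)"
 by (simp_all add: bx_def nb_def closed_cbox)

definition kern :: "'n::finite rfun => bool" where
 "kern \<psi> \<longleftrightarrow> smb \<psi> & (ALL x. x ~: bx (1/2) --> \<psi> x = 0)"

lemma kern_smb: "kern \<psi> ==> smb \<psi>" by (simp add: kern_def)

lemma kern_0: "kern \<psi> ==> x ~: bx 1 ==> \<psi> x = 0"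
proof -
 assume k: "kern \<psi>" and "x ~: bx 1"
 then obtain i where "1 < \<bar>x $ i\<bar>" by (auto simp: mem_bx not_le)
 hence "~ \<bar>x $ i\<bar> <= 1/2" by linarith
 hence "x ~: bx (1/2)" by (auto simp: mem_bx)
 thus ?thesis using k by (simp add: kern_def)
qed

lemma kern_pder: 
 assumes "kern \<psi>" shows "kern (pder i \<psi>)"
proof -
 let ?S = "- bx (1/2) :: (real^'n) set"
 have "pder i \<psi> x = 0" if "x:?S" for x
  using pder_cong[of ?S x \<psi> "%x. 0" i] that assms by (simp add: kern_def open_Compl closed_bx)
 thus ?thesis using assms smb_pder by (auto simp: kern_def)
qed

lemma ex_mollifier:
 obtains \<phi> :: "'n::finite rfun" where "kern \<phi>" "!!x. 0 <= \<phi> x" "!!x. \<phi> (- x) = \<phi> x"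
  "(\<phi> has_integral 1) (bx 1)"
proof -
 define B :: "'n rfun" where "B = (%x. PROD i:UNIV. fle 0 (1/2 + (-1) * x $ i) * fle 0 (1/2 + 1 * x $ i))"
 have s: "smb B" unfolding B_def by (intro smb_prod smb_mult smb_fle)
 have n: "0 <= B x" for x unfolding B_def by (intro prod_nonneg) (simp add: fle_def)
 have z: "B x = 0" if nin: "x ~: bx (1/2)" for x
 proof -
  obtain i where "~ \<bar>x $ i\<bar> <= 1/2" using nin unfolding mem_bx by blast
  hence "x $ i < -1/2 | 1/2 < x $ i" by linarith
  hence "fle 0 (1/2 + (-1) * x $ i) * fle 0 (1/2 + 1 * x $ i) = 0" by (auto simp: fle_def)
  thus ?thesis unfolding B_def by (intro prod_zero) auto
 qed
 have e: "B (- x) = B x" for x unfolding B_def by (intro prod.cong) (simp_all add: mult.commute)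
 let ?C = "bx 1 :: (real^'n) set"
 have c: "continuous_on ?C B" by (rule smb_cont[OF s])
 have C: "?C = cbox (vec (-1)) (vec 1)" by (simp add: bx_def)
 have i: "B integrable_on ?C" using c unfolding C by (rule integrable_continuous)
 define I where "I = integral ?C B"
 have hi: "(B has_integral I) ?C" unfolding I_def using i by (rule integrable_integral)
 have "I ~= 0"
 proof
  assume "I = 0"
  hence "B 0 = 0"
   using has_integral_0_cbox_imp_0[OF c[unfolded C] n, of 0] hi by (auto simp: C mem_box_cart interval_ne_empty_cart)
  moreover have "B 0 ~= 0" by (simp add: B_def fle_def)
  ultimately show False by simp
 qed
 moreover have "0 <= I" unfolding I_def by (rule integral_nonneg[OF i n])
 ultimately have I: "0 < I" by simp
 show ?thesis
 proof (rule that[of "%x. inverse I * B x"])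
  show "kern (%x. inverse I * B x)" using s z smb_cmult by (auto simp: kern_def)
  show "((%x. inverse I * B x) has_integral 1) ?C"
   using has_integral_mult_right[OF hi, of "inverse I"] I by simp
 qed (use n e I in simp_all)
qed

definition conv :: "'n::finite rfun => 'n rfun => 'n rfun" where
 "conv \<psi> f x = integral (bx 1) (%t. \<psi> t * f (x - t))"

lemma minus_in_box: "t:bx 1 ==> x - t:nb x 1" by (simp add: mem_bx mem_nb)

lemma conv_integrable:
 assumes "kern \<psi>" "continuous_on (nb x 1) f"
 shows "(%t. \<psi> t * f (x - t)) integrable_on bx 1"
proof -
 have "continuous_on (bx 1) (%t. f (x - t))"
  by (rule continuous_on_compose2[OF assms(2)]) (auto intro!: continuous_intros minus_in_box)
 from continuous_on_mult[OF smb_cont[OF kern_smb[OF assms(1)]] this] show ?thesis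
  unfolding bx_def by (rule integrable_continuous)
qed

text \<open>The substitution moves \<open>x\<close> into the kernel and makes the domain of
  integration the same for all \<open>x\<close> near \<open>x0\<close>, so that differentiation
  under the integral acts on the kernel alone.\<close>

lemma conv_yform:
 fixes x0 :: "real^'n"
 assumes k: "kern \<psi>" and f: "continuous_on (nb x0 2) f"
  and x: "x:nb x0 1"
 shows "conv \<psi> f x = integral (nb x0 2) (%y. \<psi> (x - y) * f y)"
proof -
 have sub: "nb x 1 \<subseteq> nb x0 2"
 proof
  fix y assume y: "y:nb x 1"
  have "\<bar>y $ i - x0 $ i\<bar> <= 2" for i
   using x y abs_triangle_ineq4 unfolding mem_nb by (smt (verit))
  thus "y:nb x0 2" by (simp add: mem_nb)
 qed
 have "((%t. \<psi> t * f (x - t)) has_integral conv \<psi> f x) (bx 1)"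
  unfolding conv_def by (rule integrable_integral[OF conv_integrable[OF k continuous_on_subset[OF f sub]]])
 from has_integral_affinity[OF this[unfolded bx_def], of "-1" x, folded bx_def]
 have "((%y. \<psi> (x - y) * f y) has_integral conv \<psi> f x) ((%t. x - t) ` bx 1)"
  by (simp add: algebra_simps)
 also have "(%t. x - t) ` bx 1 = nb x 1"
 proof (rule set_eqI)
  fix y show "y:(%t. x - t) ` bx 1 \<longleftrightarrow> y:nb x 1"
  proof
   assume "y:nb x 1"
   hence "x - y:bx 1" by (simp add: mem_bx mem_nb abs_minus_commute)
   thus "y:(%t. x - t) ` bx 1" by (intro image_eqI[of _ _ "x - y"]) auto
  qed (auto intro: minus_in_box)
 qed
 finally have "((%y. \<psi> (x - y) * f y) has_integral conv \<psi> f x) (nb x0 2)"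
 proof (rule has_integral_on_superset[OF _ _ sub])
  fix y assume "y ~: nb x 1"
  hence "x - y ~: bx 1" by (simp add: mem_bx mem_nb abs_minus_commute)
  thus "\<psi> (x - y) * f y = 0" using kern_0[OF k] by simp
 qed
 thus ?thesis by (simp add: integral_unique)
qed

lemma leibniz_pder:
 fixes k :: "real^'n => 'n rfun"
 assumes V: "open V" "convex V" "x0:V"
  and d: "!!x t. x:V ==> t:cbox a b ==> ((%x. k x t) has_derivative (%v. SU i. v $ i * K i x t)) (at x)"
  and i: "!!x. x:V ==> k x integrable_on cbox a b"
  and c: "!!i. continuous_on (V \<times> cbox a b) (%(x,t). K i x t)"
 shows "(%x. integral (cbox a b) (k x)) dif x0"
  "pder i (%x. integral (cbox a b) (k x)) x0 = integral (cbox a b) (K i x0)"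
proof -
 define D where "D = (%x t. SU i. K i x t *\<^sub>R blinfun_inner_left (axis i 1 :: real^'n))"
 have Da: "blinfun_apply (D x t) = (%v. SU i. v $ i * K i x t)" for x t
  unfolding D_def by (auto simp: blinfun.sum_left blinfun.scaleR_left inner_axis mult.commute)
 have cD: "continuous_on (V \<times> cbox a b) (%(x,t). D x t)"
  unfolding D_def split_beta by (intro continuous_on_sum continuous_on_scaleR continuous_on_const c[unfolded split_beta])
 have "((%x. integral (cbox a b) (k x)) has_derivative integral (cbox a b) (D x0)) (at x0 within V)"
 proof (rule leibniz_rule[OF _ i cD V(3,2)])
  fix x t assume "x:V" "t:cbox a b"
  thus "((%x. k x t) has_derivative blinfun_apply (D x t)) (at x within V)"
   unfolding Da using has_derivative_at_withinI[OF d] by simp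
 qed
 hence h: "((%x. integral (cbox a b) (k x)) has_derivative integral (cbox a b) (D x0)) (at x0)"
  by (simp only: at_within_open[OF V(3,1)])
 thus "(%x. integral (cbox a b) (k x)) dif x0" by (rule differentiableI)
 have cx: "continuous_on (cbox a b) (D x0)"
 proof -
  have "continuous_on (cbox a b) (%t. (x0, t))" by (rule continuous_on_Pair) (rule continuous_on_const continuous_on_id)+
  from continuous_on_compose2[OF cD this] show ?thesis using V by auto
 qed
 have "blinfun_apply (integral (cbox a b) (D x0)) (axis i 1) = integral (cbox a b) (%t. D x0 t (axis i 1))"
  by (rule blinfun_apply_integral[OF integrable_continuous[OF cx]])
 also have "(%t. blinfun_apply (D x0 t) (axis i 1)) = K i x0"
  unfolding Da by (auto simp: axis_def if_distrib[of "%q. q * _"] cong: if_cong)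
 finally show "pder i (%x. integral (cbox a b) (k x)) x0 = integral (cbox a b) (K i x0)"
  using pder_eq[OF h] by simp
qed

lemma nb_mono: "r <= r' ==> nb x r \<subseteq> nb x r'"
 unfolding mem_nb[abs_def] subset_eq by (meson order_trans mem_nb)

lemma ball_nb: "ball x r \<subseteq> nb x r"
proof
 fix y assume "y:ball x r"
 hence "norm (y - x) <= r" by (simp add: dist_norm norm_minus_commute)
 hence "\<bar>y $ i - x $ i\<bar> <= r" for i using component_le_norm_cart[of "y - x" i] by simp
 thus "y:nb x r" by (simp add: mem_nb)
qed

lemma has_derivative_shift: "((%x. x - y) has_derivative (%v. v)) (at x)"
 by (auto intro!: derivative_eq_intros)

lemma conv_pder_ker:
 fixes x0 :: "real^'n"
 assumes k: "kern \<psi>" and f: "continuous_on (nb x0 2) f"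
 shows "conv \<psi> f dif x0" "pder i (conv \<psi> f) x0 = conv (pder i \<psi>) f x0"
proof -
 let ?K = "nb x0 2"
 have eq: "conv \<psi> f x = integral ?K (%y. \<psi> (x - y) * f y)" if "x:ball x0 1" for x
  by (rule conv_yform[OF k f]) (use that ball_nb in blast)
 have eq': "conv (pder i \<psi>) f x0 = integral ?K (%y. pder i \<psi> (x0 - y) * f y)"
  by (rule conv_yform[OF kern_pder[OF k] f]) (simp add: mem_nb)
 have d: "((%x. \<psi> (x - y) * f y) has_derivative (%v. SU i. v $ i * (pder i \<psi> (x - y) * f y))) (at x)" for x y
 proof -
  have "((%x. \<psi> (x - y)) has_derivative (%v. SU i. v $ i * pder i \<psi> (x - y))) (at x)"
   by (rule has_derivative_compose[where f="%x. x - y" and g=\<psi> and x=x and s=UNIV, OF has_derivative_shift pder_works[OF smb_diff[OF kern_smb[OF k]]]])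
  from has_derivative_mult_left[OF this, of "f y"] show ?thesis
   by (simp add: sum_distrib_right mult.assoc)
 qed
 have c: "continuous_on (ball x0 1 \<times> ?K) (%(x,y). pder i \<psi> (x - y) * f y)" for i
  unfolding split_beta
  by (intro continuous_on_mult continuous_on_compose2[OF smb_cont[OF smb_pder[OF kern_smb[OF k]], of UNIV i]]
    continuous_on_compose2[OF f]) (auto intro!: continuous_intros)
 have i: "(%y. \<psi> (x - y) * f y) integrable_on ?K" for x unfolding nb_def
  by (intro integrable_continuous continuous_on_mult continuous_on_compose2[OF smb_cont[OF kern_smb[OF k], of UNIV]] f[unfolded nb_def])
   (auto intro!: continuous_intros)
 note L = leibniz_pder[where V="ball x0 1" and ?x0.0=x0 and k="%x y. \<psi> (x - y) * f y" and K="%i x y. pder i \<psi> (x - y) * f y"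
   and a="x0 - vec 2" and b="x0 + vec 2", folded nb_def, OF open_ball convex_ball _ d i c]
 have "(%x. integral ?K (%y. \<psi> (x - y) * f y)) dif x0" by (rule L(1)) simp
 thus "conv \<psi> f dif x0"
  using differentiable_cong_open[of "ball x0 1" x0 "conv \<psi> f", OF _ _ eq] by simp
 have "pder i (%x. integral ?K (%y. \<psi> (x - y) * f y)) x0 = integral ?K (%y. pder i \<psi> (x0 - y) * f y)"
  by (rule L(2)) simp
 thus "pder i (conv \<psi> f) x0 = conv (pder i \<psi>) f x0"
  using pder_cong[of "ball x0 1" x0 "conv \<psi> f", OF _ _ eq] eq' by simp
qed

text \<open>Companion of \<open>conv_pder_ker\<close>. The first derivative may stay on
  \<open>f\<close>, so the gradient of a mollified map is the mollified gradient; later derivatives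
  go to the kernel.\<close>

lemma conv_pder_fun:
 fixes x0 :: "real^'n"
 assumes k: "kern \<psi>" and f: "!!y. y:nb x0 2 ==> f dif y"
  and c: "!!i. continuous_on (nb x0 2) (pder i f)"
 shows "pder i (conv \<psi> f) x0 = conv \<psi> (pder i f) x0"
proof -
 have sub: "x - t:nb x0 2" if "x:ball x0 1" "t:bx 1" for x t
 proof -
  have "x:nb x0 1" using that ball_nb by blast
  hence "\<bar>(x - t) $ i - x0 $ i\<bar> <= 2" for i
  proof -
   have "\<bar>x $ i - x0 $ i\<bar> <= 1" "\<bar>t $ i\<bar> <= 1" using \<open>x:nb x0 1\<close> that(2) by (simp_all add: mem_nb mem_bx)
   thus ?thesis by simp
  qed
  thus ?thesis by (simp add: mem_nb)
 qed
 have cf: "continuous_on (nb x0 2) f"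
  by (intro continuous_at_imp_continuous_on ballI differentiable_imp_continuous_within f)
 have d: "((%x. \<psi> t * f (x - t)) has_derivative (%v. SU i. v $ i * (\<psi> t * pder i f (x - t)))) (at x)"
  if "x:ball x0 1" "t:bx 1" for x t
 proof -
  have "((%x. f (x - t)) has_derivative (%v. SU i. v $ i * pder i f (x - t))) (at x)"
   by (rule has_derivative_compose[where f="%x. x - t" and g=f and x=x and s=UNIV, OF has_derivative_shift pder_works[OF f[OF sub[OF that]]]])
  from has_derivative_mult_right[OF this, of "\<psi> t"] show ?thesis
   by (simp add: sum_distrib_left mult.left_commute)
 qed
 have kc: "continuous_on (ball x0 1 \<times> bx 1) (%(x,t). \<psi> t * pder i f (x - t))" for i
  unfolding split_beta
  by (intro continuous_on_mult continuous_on_compose2[OF smb_cont[OF kern_smb[OF k], of UNIV]]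
    continuous_on_compose2[OF c]) (auto intro!: continuous_intros sub)
 have i: "(%t. \<psi> t * f (x - t)) integrable_on bx 1" if "x:ball x0 1" for x
 proof -
  have "continuous_on (bx 1) (%t. \<psi> t * f (x - t))"
   by (intro continuous_on_mult smb_cont[OF kern_smb[OF k]] continuous_on_compose2[OF cf])
    (auto intro!: continuous_intros sub that)
  thus ?thesis unfolding bx_def by (rule integrable_continuous)
 qed
 have "pder i (%x. integral (bx 1) (%t. \<psi> t * f (x - t))) x0 = integral (bx 1) (%t. \<psi> t * pder i f (x0 - t))"
  by (rule leibniz_pder(2)[where V="ball x0 1" and ?x0.0=x0 and k="%x t. \<psi> t * f (x - t)" and K="%i x t. \<psi> t * pder i f (x - t)"
   and a="vec (-1)" and b="vec 1", folded bx_def, OF open_ball convex_ball _ d i kc]) simp_all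
 thus ?thesis by (simp add: conv_def[abs_def])
qed

lemma conv_bound:
 fixes \<psi> :: "'n::finite rfun"
 assumes k: "kern \<psi>"
 obtains C where "C > 0" "!!f x A. continuous_on (nb x 1) f ==> (!!y. y:nb x 1 ==> \<bar>f y\<bar> <= A) ==> \<bar>conv \<psi> f x\<bar> <= C * A"
proof -
 obtain M where M: "M > 0" "!!x. \<bar>\<psi> x\<bar> <= M" using smb_bound[OF kern_smb[OF k]] by blast
 let ?c = "measure lborel (cbox (vec (-1)) (vec 1 :: real^'n))"
 have "\<bar>conv \<psi> f x\<bar> <= (M * (?c + 1)) * A"
  if c: "continuous_on (nb x 1) f" and A: "!!y. y:nb x 1 ==> \<bar>f y\<bar> <= A" for f x A
 proof -
  have A0: "0 <= A" using A[of x] by (simp add: mem_nb)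
  have "norm (conv \<psi> f x) <= M * A * ?c" unfolding conv_def bx_def
  proof (rule integrable_bound[OF _ conv_integrable[OF k c, unfolded bx_def]])
   show "0 <= M * A" using M A0 by simp
   fix t assume "t:cbox (vec (-1)) (vec 1 :: real^'n)"
   hence "x - t:nb x 1" by (intro minus_in_box) (simp add: bx_def)
   thus "norm (\<psi> t * f (x - t)) <= M * A"
    using A M(2)[of t] by (auto simp: abs_mult intro!: mult_mono)
  qed
  also have "... <= M * (?c + 1) * A" using M A0 by (simp add: algebra_simps)
  finally show ?thesis by simp
 qed
 thus ?thesis using that[of "M * (?c + 1)"] M by (simp add: add_nonneg_pos content_pos_le)
qed

lemma conv_linear:
 assumes k: "kern \<psi>" and "continuous_on (nb x 1) f" "continuous_on (nb x 1) g"
 shows "conv \<psi> (%y. f y + g y) x = conv \<psi> f x + conv \<psi> g x"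
  "conv \<psi> (%y. f y - g y) x = conv \<psi> f x - conv \<psi> g x" unfolding conv_def
 using integral_add[OF conv_integrable[OF k assms(2)] conv_integrable[OF k assms(3)]]
  integral_diff[OF conv_integrable[OF k assms(2)] conv_integrable[OF k assms(3)]]
 by (simp_all add: algebra_simps)

lemma conv_cmult: "conv \<psi> (%y. c * f y) x = c * conv \<psi> f x"
 unfolding conv_def by (subst integral_mult_right[symmetric]) (simp add: mult.left_commute)

lemma conv_const: "(\<psi> has_integral 1) (bx 1) ==> conv \<psi> (%y. c) x = c"
 unfolding conv_def by (simp add: integral_unique has_integral_mult_left)

lemma kern_integral_le:
 fixes h :: "'n::finite rfun"
 assumes p: "!!x. 0 <= \<psi> x" and 1: "(\<psi> has_integral 1) (bx 1)"
  and h: "((%t. \<psi> t * h t) has_integral I) (bx 1)" and A: "!!t. t:bx 1 ==> \<bar>h t\<bar> <= A"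
 shows "\<bar>I\<bar> <= A"
proof -
 have "norm I <= integral (bx 1) (%t. \<psi> t * A)" unfolding integral_unique[OF h, symmetric]
 proof (rule integral_norm_bound_integral)
  show "(%t. \<psi> t * h t) integrable_on bx 1" using h by blast
  show "(%t. \<psi> t * A) integrable_on bx 1" using has_integral_mult_left[OF 1] by blast
  fix t :: "real^'n" assume "t:bx 1"
  thus "norm (\<psi> t * h t) <= \<psi> t * A" using A p[of t] by (simp add: abs_mult mult_left_mono)
 qed
 also have "... = A" by (simp only: integral_unique[OF has_integral_mult_left[OF 1, of A]] mult_1)
 finally show ?thesis by simp
qed

lemma conv_le:
 fixes f :: "'n::finite rfun"
 assumes k: "kern \<psi>" and p: "!!x. 0 <= \<psi> x" and 1: "(\<psi> has_integral 1) (bx 1)"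
  and c: "continuous_on (nb x 1) f" and A: "!!y. y:nb x 1 ==> \<bar>f y\<bar> <= A"
 shows "\<bar>conv \<psi> f x\<bar> <= A"
 unfolding conv_def by (rule kern_integral_le[OF p 1 integrable_integral[OF conv_integrable[OF k c]]]) (use A minus_in_box in blast)

text \<open>Averaging the integrals over \<open>t\<close> and \<open>- t\<close> turns first
  differences of \<open>f\<close> into second differences. This is where a metric of class
  \<open>C^{1,1}\<close> is better than a Lipschitz one.\<close>

lemma conv_even:
 fixes f :: "'n::finite rfun"
 assumes k: "kern \<psi>" and p: "!!x. 0 <= \<psi> x" and e: "!!x. \<psi> (- x) = \<psi> x" and 1: "(\<psi> has_integral 1) (bx 1)"
  and c: "continuous_on (nb x 1) f"
  and A: "!!t. t:bx 1 ==> \<bar>f (x + t) + f (x - t) - 2 * f x\<bar> <= A"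
 shows "\<bar>conv \<psi> f x - f x\<bar> <= A"
proof -
 have h1: "((%t. \<psi> t * f (x - t)) has_integral conv \<psi> f x) (bx 1)"
  unfolding conv_def by (rule integrable_integral[OF conv_integrable[OF k c]])
 have im: "(%t::real^'n. - t) ` bx 1 = bx 1" by (auto simp: mem_bx intro!: image_eqI[of _ _ "- _"])
 have h2: "((%t. \<psi> t * f (x + t)) has_integral conv \<psi> f x) (bx 1)"
  using has_integral_affinity[OF h1[unfolded bx_def], of "-1" 0, folded bx_def] im by (simp add: e)
 have h3: "((%t. \<psi> t * (f (x + t) + f (x - t) - 2 * f x)) has_integral (2 * conv \<psi> f x - 2 * f x)) (bx 1)"
  using has_integral_diff[OF has_integral_add[OF h2 h1] has_integral_mult_left[OF 1, of "2 * f x"]] by (simp add: algebra_simps)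
 have "\<bar>2 * conv \<psi> f x - 2 * f x\<bar> <= A" by (rule kern_integral_le[OF p 1 h3 A])
 thus ?thesis by linarith
qed

text \<open>All derivatives fall on the kernel, so a sup bound on \<open>f\<close> gives the
  estimates of every order, at length scale 1.\<close>

lemma (in symbols) symb_conv:
 assumes A: "ev (%p x. continuous_on (nb x 2) (f p) & (ALL y:nb x 2. \<bar>f p y\<bar> <= C * \<bar>A p\<bar>))"
  and k: "kern \<psi>"
 shows "symb A (%p. 1) (%p. conv \<psi> (f p))"
proof -
 have b: "bdd0 A (%p. conv \<psi> (f p))" if kk: "kern \<psi>" for \<psi>
 proof -
  obtain D where D: "D > 0" "!!f x A. continuous_on (nb x 1) f ==> (!!y. y:nb x 1 ==> \<bar>f y\<bar> <= A) ==> \<bar>conv \<psi> f x\<bar> <= D * A"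
   using conv_bound[OF kk] by blast
  have "ev (%p x. \<bar>conv \<psi> (f p) x\<bar> <= (D * C) * \<bar>A p\<bar>)" using A
  proof eventually_elim
   case (elim p)
   show ?case
   proof
    fix x assume "x:U p"
    hence "\<bar>conv \<psi> (f p) x\<bar> <= D * (C * \<bar>A p\<bar>)"
     using elim nb_mono[of 1 2 x] by (intro D(2)) (auto intro: continuous_on_subset)
    thus "\<bar>conv \<psi> (f p) x\<bar> <= (D * C) * \<bar>A p\<bar>" by (simp add: mult.assoc)
   qed
  qed
  thus ?thesis unfolding bdd0_def by blast
 qed
 have "bddk j A (%p. 1) (%p. conv \<psi> (f p))" for j using k
 proof (induction j arbitrary: \<psi>)
  case 0
  thus ?case using b by simp
 next
  case (Suc j)
  have "ev (%p x. conv \<psi> (f p) dif x)"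
   using A by eventually_elim (use conv_pder_ker(1)[OF Suc.prems] in blast)
  moreover have "bddk j A (%p. 1) (%p. pder i (conv \<psi> (f p)))" for i
  proof (rule bddk_cong)
   show "bddk j A (%p. 1) (%p. conv (pder i \<psi>) (f p))" by (rule Suc.IH[OF kern_pder[OF Suc.prems]])
   show "ev (%p x. conv (pder i \<psi>) (f p) x = pder i (conv \<psi> (f p)) x)"
    using A by eventually_elim (use conv_pder_ker(2)[OF Suc.prems] in metis)
  qed
  ultimately show ?case using b[OF Suc.prems] by simp
 qed
 thus ?thesis by (simp add: symb_def)
qed

section \<open>The stage\<close>

context symbols
begin

text \<open>Localisation: a family indexed also by a base point \<open>x\<^sub>0\<close> and restricted to a neighbourhood
  of it may be estimated after subtracting its value at \<open>x\<^sub>0\<close>.\<close>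

definition locF :: "('p \<times> (real^'n)) filter" where
 "locF = inf (filtercomap fst F) (principal {q. snd q:U (fst q)})"

definition locU :: "'p \<times> (real^'n) => (real^'n) set" where
 "locU q = ball (snd q) 1 \<inter> U (fst q)"

lemma eventually_locF: "eventually P locF \<longleftrightarrow> ev (%p x. P (p, x))"
 unfolding locF_def eventually_inf_principal eventually_filtercomap
proof
 assume "EX Q. eventually Q F & (ALL x. Q (fst x) --> x:{q. snd q:U (fst q)} --> P x)"
 then obtain Q where "eventually Q F" "ALL x. Q (fst x) --> x:{q. snd q:U (fst q)} --> P x" by blast
 thus "ev (%p x. P (p, x))" by (auto elim!: eventually_mono)
next
 assume "ev (%p x. P (p, x))"
 thus "EX Q. eventually Q F & (ALL x. Q (fst x) --> x:{q. snd q:U (fst q)} --> P x)"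
  by (intro exI[of _ "%p. ALL x:U p. P (p, x)"]) auto
qed

lemma symbols_loc: "symbols locF locU"
proof
 show "\<forall>\<^sub>F q in locF. open (locU q)"
  unfolding eventually_locF locU_def using ev_open by eventually_elim auto
qed

text \<open>A point belongs to its own neighbourhood, so the bounds of the family based at
  \<open>x\<close> can be read off at \<open>x\<close>; their constants do not depend on the base
  point.\<close>

lemma symb_localize:
 assumes "symbols.symb locF locU (%q. A (fst q)) (%q. l (fst q)) (%q. f (fst q))"
 shows "symb A l f"
proof -
 interpret loc: symbols locF locU by (rule symbols_loc)
 have b: "loc.bdd0 (%q. A (fst q)) (%q. f (fst q)) ==> bdd0 A f" for A f
  unfolding loc.bdd0_def bdd0_def eventually_locF
 proof (elim exE)
  fix C assume "ev (%p x. ALL y:locU (p, x). \<bar>f (fst (p, x)) y\<bar> <= C * \<bar>A (fst (p, x))\<bar>)"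
  hence "ev (%p x. \<bar>f p x\<bar> <= C * \<bar>A p\<bar>)"
   by eventually_elim (auto simp: locU_def)
  thus "EX C. ev (%p x. \<bar>f p x\<bar> <= C * \<bar>A p\<bar>)" by blast
 qed
 have "loc.bddk k (%q. A (fst q)) (%q. l (fst q)) (%q. f (fst q)) ==> bddk k A l f" for k
 proof (induction k arbitrary: A f)
  case 0
  thus ?case using b by simp
 next
  case (Suc k)
  have "\<forall>\<^sub>F q in locF. ALL x:locU q. f (fst q) dif x" using Suc.prems by simp
  hence "ev (%p x. f p dif x)" unfolding eventually_locF by eventually_elim (auto simp: locU_def)
  moreover have "bddk k (%p. A p * l p) l (%p. pder i (f p))" for i
   using Suc.prems by (intro Suc.IH) simp
  moreover have "bdd0 A f" using Suc.prems b by simp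
  ultimately show ?case by simp
 qed
 thus ?thesis using assms by (simp add: symb_def loc.symb_def)
qed

end

lemma conv_sum:
 assumes k: "kern \<psi>" and f: "!!a. a:I ==> continuous_on (nb x 1) (f a)" and "finite I"
 shows "conv \<psi> (%y. SUM a:I. f a y) x = (SUM a:I. conv \<psi> (f a) x)" unfolding conv_def
 by (subst integral_sum[symmetric]) (use assms in \<open>auto simp: sum_distrib_left intro!: conv_integrable\<close>)

text \<open>The commutator of mollification and multiplication ignores constants added to the
  factors. If \<open>a\<close> and \<open>b\<close> are values at a nearby point, both factors
  become oscillations, and the commutator is quadratic in them.\<close>

lemma conv_comm:
 assumes k: "kern \<psi>" and 1: "(\<psi> has_integral 1) (bx 1)"
  and f: "continuous_on (nb x 1) f" and g: "continuous_on (nb x 1) g"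
 shows "conv \<psi> (%y. (f y - a) * (g y - b)) x - conv \<psi> (%y. f y - a) x * conv \<psi> (%y. g y - b) x
  = conv \<psi> (%y. f y * g y) x - conv \<psi> f x * conv \<psi> g x"
proof -
 have fg: "continuous_on (nb x 1) (%y. f y * g y)" by (intro continuous_intros f g)
 have ag: "continuous_on (nb x 1) (%y. a * g y)" and bf: "continuous_on (nb x 1) (%y. b * f y)"
  by (intro continuous_intros f g)+
 have e: "(%y. (f y - a) * (g y - b)) = (%y. (f y * g y + a * b) - (a * g y + b * f y))"
  by (simp add: fun_eq_iff algebra_simps)
 have 1: "conv \<psi> (%y. (f y - a) * (g y - b)) x = (conv \<psi> (%y. f y * g y) x + a * b) - (a * conv \<psi> g x + b * conv \<psi> f x)"
  unfolding e
  by (simp add: conv_linear[OF k] fg ag bf continuous_on_add conv_cmult conv_const[OF 1])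
 show ?thesis unfolding 1
  by (simp add: conv_linear[OF k] f g conv_const[OF \<open>(\<psi> has_integral 1) (bx 1)\<close>] algebra_simps)
qed

text \<open>The matrix of \<open>H\<close>: the square of \<open>x_i\<close> and the
  \<open>n - 1\<close> squares of sums containing \<open>x_i\<close> make up the diagonal entry
  \<open>n\<close>. In terms of the squares all its coefficients are 1.\<close>

definition H0 :: "'n::finite => 'n => real" where
 "H0 j k = (if j = k then real CARD('n) else 1)"

lemma Ldiag_H0: "Ldiag i (H0 :: 'n::finite => 'n => real) = 1"
proof -
 have "(SUM k:UNIV - {i}. H0 i k) = (SUM k:UNIV - {i}. 1)" by (intro sum.cong) (auto simp: H0_def)
 also have "... = real CARD('n) - 1" by (simp add: card_Diff_singleton of_nat_diff)
 finally show ?thesis by (simp add: Ldiag_def H0_def)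
qed

lemma Ldiag_close:
 fixes h :: "'n::finite => 'n => real" and t :: real
 assumes "!!j k. \<bar>h j k - H0 j k\<bar> <= t"
 shows "1 - CARD('n) * t <= Ldiag i h"
proof -
 have "\<bar>SUM k:UNIV - {i}. (h i k - H0 i k)\<bar> <= (SUM k:UNIV - {i}. t)"
  using assms by (intro order_trans[OF sum_abs] sum_mono)
 also have "... = (real CARD('n) - 1) * t" by (simp add: card_Diff_singleton of_nat_diff)
 finally have "\<bar>SUM k:UNIV - {i}. (h i k - H0 i k)\<bar> <= (real CARD('n) - 1) * t" .
 moreover have "\<bar>h i i - H0 i i\<bar> <= t" by (rule assms)
 moreover have "Ldiag i h = 1 + (h i i - H0 i i) - (SUM k:UNIV - {i}. (h i k - H0 i k))"
  using Ldiag_H0[of i] by (simp add: Ldiag_def sum_subtractf)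
 moreover have "CARD('n) * t = (real CARD('n) - 1) * t + t" by (simp add: algebra_simps)
 ultimately show ?thesis by linarith
qed

text \<open>The mollification length is \<open>1 / \<mu>\<close>. Of the margin
  \<open>3 / \<mu>\<close>, two units are for differentiated convolutions and one for the
  localisation. Over it the gradient oscillates by at most \<open>s / \<kappa>\<close>, so the
  commutator is of size \<open>s^2 / \<kappa>^2\<close>. The last inequality puts \<open>s^3\<close>
  a factor \<open>\<kappa>\<close> below the next defect \<open>s^2 / \<kappa>^m\<close>.\<close>

definition stage_data :: "nat => real => real => real => (real^'n) set => (real^'n) set => ('m::finite => 'n rfun)
  => ('n => 'n => 'n rfun) => real => real => real => bool" where
 "stage_data m \<gamma> \<Gamma> \<sigma> U D u g s \<kappa> \<mu> \<longleftrightarrow>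
  0 < \<mu> & open U & (ALL x:U. nb x (3 / \<mu>) \<subseteq> D) &
  (ALL a. ALL x:D. u a dif x) & (ALL a i. continuous_on D (pder i (u a))) &
  (ALL a i. ALL x:U. ALL y:nb x (3 / \<mu>). \<bar>pder i (u a) y - pder i (u a) x\<bar> <= s / \<kappa>) &
  (ALL a i. ALL x:D. \<bar>pder i (u a) x\<bar> <= \<Gamma>) &
  (ALL x:D. ALL v::real^'n. \<gamma> * norm v <= norm (lcomb v (%i. \<chi> a. pder i (u a) x))) &
  (ALL j k. continuous_on D (g j k)) & (ALL j k. g j k = g k j) &
  (ALL x:D. ALL j k. \<bar>g j k x - gram u j k x - s^2 * H0 j k\<bar> <= \<sigma> * s^2) &
  (ALL x:U. ALL t:bx (1 / \<mu>). ALL j k. \<bar>g j k (x + t) + g j k (x - t) - 2 * g j k x\<bar> <= \<sigma> / 4 * (s^2 * inverse \<kappa> ^ m)) &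
  0 < s & s * \<kappa> ^ Suc m <= 1"

lemma conv_close:
 fixes f :: "'n::finite rfun"
 assumes k: "kern \<psi>" and p: "!!x. 0 <= \<psi> x" and 1: "(\<psi> has_integral 1) (bx 1)"
  and c: "continuous_on (nb x 1) f" and A: "!!y. y:nb x 1 ==> \<bar>f y - f x\<bar> <= A"
 shows "\<bar>conv \<psi> f x - f x\<bar> <= A"
proof -
 have c': "continuous_on (nb x 1) (%y. f y - f x)" by (intro continuous_intros c)
 have "conv \<psi> (%y. f y - f x) x = conv \<psi> f x - f x"
  using conv_linear(2)[OF k c, of "%y. f x"] conv_const[OF 1] by simp
 thus ?thesis using conv_le[OF k p 1 c' A] by simp
qed

lemma mean_value_convex:
 fixes u :: "'n::finite rfun" and G :: real
 assumes S: "convex S" and d: "!!y. y:S ==> u dif y" and b: "!!y i. y:S ==> \<bar>pder i u y\<bar> <= G"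
  and x: "x:S" "y:S"
 shows "\<bar>u y - u x\<bar> <= CARD('n) * G * norm (y - x)"
proof -
 have "norm (u y - u x) <= CARD('n) * G * norm (y - x)"
 proof (rule differentiable_bound[where S=S and f'="%y v. SU i. v $ i * pder i u y"])
  fix z assume z: "z:S"
  show "(u has_derivative (%v. SU i. v $ i * pder i u z)) (at z within S)"
   by (rule has_derivative_at_withinI[OF pder_works[OF d[OF z]]])
  show "onorm (%v. SU i. v $ i * pder i u z) <= CARD('n) * G"
  proof (rule onorm_le)
   fix v :: "real^'n"
   have "norm (SU i. v $ i * pder i u z) <= (SUM i:(UNIV::'n set). norm v * G)"
    using b[OF z] component_le_norm_cart[of v]
    by (intro sum_norm_le) (auto simp: abs_mult intro!: mult_mono)
   thus "norm (SU i. v $ i * pder i u z) <= CARD('n) * G * norm v" by (simp add: mult_ac)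
  qed
 qed (use x S in auto)
 thus ?thesis by simp
qed

lemma mean_value_nb:
 fixes u :: "'n::finite rfun" and G :: real
 assumes d: "!!y. y:nb x r ==> u dif y" and b: "!!y i. y:nb x r ==> \<bar>pder i u y\<bar> <= G"
  and y: "y:nb x r"
 shows "\<bar>u y - u x\<bar> <= CARD('n) * G * norm (y - x)"
proof -
 have x: "x:nb x r" using y abs_ge_zero[of "y $ _ - x $ _"] by (auto simp: mem_nb intro: order_trans)
 show ?thesis by (rule mean_value_convex[OF _ d b x y]) (simp_all add: nb_def)
qed

lemma norm_nb: "y:nb x r ==> norm (y - x) <= real CARD('n) * r" for x y :: "real^'n"
proof -
 assume y: "y:nb x r"
 have "norm (y - x) <= (SU i. \<bar>(y - x) $ i\<bar>)" by (rule norm_le_l1_cart)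
 also have "... <= (SUM i:(UNIV::'n set). r)" using y by (intro sum_mono) (simp add: mem_nb)
 finally show ?thesis by simp
qed

lemma (in symbols) symb_uniform:
 fixes f :: "'k::finite => 'p => 'n::finite rfun"
 assumes "!!a. symb A l (f a)"
 shows "EX C>0. ev (%p x. ALL a. \<bar>f a p x\<bar> <= C * \<bar>A p\<bar>)"
proof -
 have "EX C. C > 0 & ev (%p x. \<bar>f a p x\<bar> <= C * \<bar>A p\<bar>)" for a
 proof -
  obtain C where "C > 0" "ev (%p x. \<bar>f a p x\<bar> <= C * \<bar>A p\<bar>)" by (rule symbE[OF assms[of a]])
  thus ?thesis by (intro exI[of _ C] conjI)
 qed
 hence "ALL a. EX C. C > 0 & ev (%p x. \<bar>f a p x\<bar> <= C * \<bar>A p\<bar>)" by (rule allI)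
 from choice[OF this] obtain C where C0: "ALL a. C a > 0 & ev (%p x. \<bar>f a p x\<bar> <= C a * \<bar>A p\<bar>)" ..
 have C: "C a > 0" "ev (%p x. \<bar>f a p x\<bar> <= C a * \<bar>A p\<bar>)" for a
  using spec[OF C0, of a] by (rule conjunct1, rule conjunct2)
 have le: "C a <= sum C UNIV" for a using member_le_sum[of a UNIV C] C(1) by (simp add: less_imp_le)
 have "\<forall>\<^sub>F p in F. ALL a. ALL x:U p. \<bar>f a p x\<bar> <= C a * \<bar>A p\<bar>"
  by (intro eventually_all_finite C(2))
 hence "ev (%p x. ALL a. \<bar>f a p x\<bar> <= sum C UNIV * \<bar>A p\<bar>)"
 proof eventually_elim
  case (elim p)
  show ?case
  proof (intro ballI allI)
   fix x a assume "x:U p"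
   hence "\<bar>f a p x\<bar> <= C a * \<bar>A p\<bar>" using elim by blast
   also have "... <= sum C UNIV * \<bar>A p\<bar>" using le by (intro mult_right_mono) auto
   finally show "\<bar>f a p x\<bar> <= sum C UNIV * \<bar>A p\<bar>" .
  qed
 qed
 moreover have "sum C UNIV > 0" using C(1) by (intro sum_pos) auto
 ultimately show ?thesis by blast
qed

abbreviation improves :: "real => (real^'n) set => ('n => 'n => 'n rfun) => ('m::finite => 'n rfun)
  => real => real => real => real => ('m => 'n rfun) => bool" where
 "improves \<sigma> U g u C0 C1 C2 T v == ALL x:U.
  (ALL a. v a dif x & \<bar>v a x - u a x\<bar> <= C0 &
    (ALL i. pder i (v a) dif x & \<bar>pder i (v a) x - pder i (u a) x\<bar> <= C1 &
     (ALL k. \<bar>pder k (pder i (v a)) x\<bar> <= C2))) &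
  (ALL j k. \<bar>g j k x - gram v j k x - T * H0 j k\<bar> <= \<sigma> * T)"

context flat
begin

text \<open>The mollified map \<open>U'\<close> has slow gradients, so its normal and dual frame can
  carry the oscillations. Its defect, minus the part \<open>s^2 e^m H0\<close> kept for the next
  stage and divided by \<open>s^2\<close>, is the matrix \<open>h\<close> for
  \<open>flat_stage\<close>; it is within \<open>2 \<sigma>\<close> of \<open>H0\<close>, so its
  coefficients are positive. \<open>geo_step\<close> turns the flat solution into a map.\<close>

lemma stage:
 fixes D :: "'p => (real^'n) set" and u :: "'m::finite => 'p => 'n rfun"
  and g :: "'n => 'n => 'p => 'n rfun" and s :: "'p => real" and \<psi> :: "'m => 'n option"
 assumes data: "\<forall>\<^sub>F p in F. stage_data m \<gamma> \<Gamma> \<sigma> (U p) (D p) (%a. u a p) (%j k. g j k p) (s p) (\<kappa> p) 1"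
  and \<psi>: "bij \<psi>" and \<gamma>: "0 < \<gamma>" and \<sigma>: "0 < \<sigma>" "\<sigma> <= 1 / (4 * CARD('n))" and m: "0 < m"
  and gsym: "!!j k. g j k = g k j"
  and n: "n = CARD('n)" and N: "2 * N = n * (n - 1)"
 shows "EX C. \<forall>\<^sub>F p in F. EX v. improves \<sigma> (U p) (%j k. g j k p) (%a. u a p) C (C * s p) (C * s p * \<kappa> p ^ (n + Suc m * N)) (s p ^ 2 * inverse (\<kappa> p) ^ m) v"
proof -
 obtain \<phi> :: "'n rfun" where \<phi>: "kern \<phi>" "!!x. 0 <= \<phi> x" "!!x. \<phi> (- x) = \<phi> x" "(\<phi> has_integral 1) (bx 1)"
  using ex_mollifier by blast
 define A where "A = (%i a p. pder i (u a p))"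
 define U' where "U' = (%a p. conv \<phi> (u a p))"
 have s01: "\<forall>\<^sub>F p in F. 0 < s p & s p <= 1 & s p <= e p ^ Suc m" using data ev_k[of 1]
 proof eventually_elim
  case (elim p)
  hence h: "0 < s p" "s p * \<kappa> p ^ Suc m <= 1" "1 <= \<kappa> p" by (auto simp: stage_data_def)
  hence k: "1 <= \<kappa> p ^ Suc m" by (intro one_le_power)
  have "s p <= e p ^ Suc m" using h(2) k by (simp add: power_inverse field_simps del: power_Suc)
  moreover have "s p * 1 <= s p * \<kappa> p ^ Suc m" using h(1) k by (intro mult_left_mono) auto
  ultimately show ?case using h by linarith
 qed
 have s1: "\<forall>\<^sub>F p in F. 0 < s p & s p <= 1" using s01 by eventually_elim simp
 have dU: "ev (%p x. nb x 3 \<subseteq> D p)" and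
  dd: "\<forall>\<^sub>F p in F. ALL a. ALL x:D p. u a p dif x" and
  dc: "\<forall>\<^sub>F p in F. ALL i a. continuous_on (D p) (A i a p)" and
  dosc: "\<forall>\<^sub>F p in F. ALL i a. ALL x:U p. ALL y:nb x 3. \<bar>A i a p y - A i a p x\<bar> <= s p / \<kappa> p" and
  dG: "\<forall>\<^sub>F p in F. ALL i a. ALL x:D p. \<bar>A i a p x\<bar> <= \<Gamma>" and
  dg: "\<forall>\<^sub>F p in F. ALL x:D p. ALL v::real^'n. \<gamma> * norm v <= norm (lcomb v (%i. \<chi> a. A i a p x))" and
  gc: "\<forall>\<^sub>F p in F. ALL j k. continuous_on (D p) (g j k p)" and
  gd: "\<forall>\<^sub>F p in F. ALL x:D p. ALL j k. \<bar>g j k p x - (SU a. A j a p x * A k a p x) - s p ^ 2 * H0 j k\<bar> <= \<sigma> * s p ^ 2" and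
  g2: "ev (%p x. ALL t:bx 1. ALL j k. \<bar>g j k p (x + t) + g j k p (x - t) - 2 * g j k p x\<bar> <= \<sigma> / 4 * (s p ^ 2 * e p ^ m))"
  using data unfolding stage_data_def A_def div_by_1 by (auto elim!: eventually_mono)
 have nb32: "nb x 2 \<subseteq> nb x 3" "nb x 1 \<subseteq> nb x 3" for x :: "real^'n" by (auto intro!: nb_mono simp del: subset_iff)
 have self: "x:nb x r" if "0 <= r" for x :: "real^'n" and r using that by (simp add: mem_nb)
 have U'd: "ev (%p x. ALL a. U' a p dif x & (ALL i. pder i (U' a p) x = conv \<phi> (A i a p) x))"
  using dU dd dc
 proof eventually_elim
  case (elim p)
  show ?case
  proof (intro ballI allI)
   fix x a assume x: "x:U p"
   have sub: "nb x 2 \<subseteq> D p" using elim(1) x nb32(1) by blast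
   have d: "u a p dif y" if "y:nb x 2" for y using elim(2) sub that by blast
   have c: "continuous_on (nb x 2) (pder i (u a p))" for i
    using elim(3) sub continuous_on_subset unfolding A_def by blast
   have cu: "continuous_on (nb x 2) (u a p)"
    by (intro continuous_at_imp_continuous_on ballI differentiable_imp_continuous_within d)
   show "U' a p dif x & (ALL i. pder i (U' a p) x = conv \<phi> (A i a p) x)"
    unfolding U'_def A_def using conv_pder_ker(1)[OF \<phi>(1) cu] conv_pder_fun[OF \<phi>(1) d c] by blast
  qed
 qed
 have cA: "symb (%p. 1) (%p. 1) (%p. conv \<phi> (A i a p))" for i a
 proof (rule symb_conv[OF _ \<phi>(1), where C=\<Gamma>])
  show "ev (%p x. continuous_on (nb x 2) (A i a p) & (ALL y:nb x 2. \<bar>A i a p y\<bar> <= \<Gamma> * \<bar>1\<bar>))"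
   using dU dc dG
  proof eventually_elim
   case (elim p)
   show ?case
   proof
    fix x assume x: "x:U p"
    have sub: "nb x 2 \<subseteq> D p" using elim(1) x nb32(1) by blast
    thus "continuous_on (nb x 2) (A i a p) & (ALL y:nb x 2. \<bar>A i a p y\<bar> <= \<Gamma> * \<bar>1\<bar>)"
     using elim(2,3) continuous_on_subset by (metis abs_one mult.right_neutral subsetD)
   qed
  qed
 qed
 interpret loc: symbols locF locU by (rule symbols_loc)
 let ?w = "%q :: 'p \<times> (real^'n). s (fst q) * e (fst q)"
 \<comment> \<open>Second derivatives and commutators see only differences of the gradient; the base
   point \<open>snd q\<close> supplies the value to subtract, leaving something of size
   \<open>s e\<close>.\<close>
 define A0 where "A0 = (%i a q y. A i a (fst q) y - A i a (fst q) (snd q))"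
 have A0: "\<forall>\<^sub>F q in locF. ALL x:locU q. continuous_on (nb x 2) (A0 i a q) & (ALL y:nb x 2. \<bar>A0 i a q y\<bar> <= 1 * \<bar>?w q\<bar>)" for i a
  unfolding eventually_locF using dU dc dosc s1 ev_k[of 1]
 proof eventually_elim
  case (elim p)
  show ?case
  proof (intro ballI conjI)
   fix x0 x assume x0: "x0:U p" and "x:locU (p, x0)"
   hence x: "x:ball x0 1" "x:U p" by (auto simp: locU_def)
   have sub: "nb x 2 \<subseteq> nb x0 3"
   proof
    fix y assume "y:nb x 2"
    moreover have "x:nb x0 1" using x(1) ball_nb by blast
    ultimately have "\<bar>y $ i - x $ i\<bar> <= 2" "\<bar>x $ i - x0 $ i\<bar> <= 1" for i by (simp_all add: mem_nb)
    hence "\<bar>y $ i - x0 $ i\<bar> <= 3" for i using abs_triangle_ineq[of "y $ i - x $ i" "x $ i - x0 $ i"] by (smt (verit))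
    thus "y:nb x0 3" by (simp add: mem_nb)
   qed
   have "continuous_on (nb x 2) (A i a p)" using elim(1,2) x0 sub continuous_on_subset by blast
   thus "continuous_on (nb x 2) (A0 i a (p, x0))" by (auto simp: A0_def intro!: continuous_intros)
   fix y assume "y:nb x 2"
   hence "\<bar>A i a p y - A i a p x0\<bar> <= s p / \<kappa> p" using elim(3) x0 sub by blast
   thus "\<bar>A0 i a (p, x0) y\<bar> <= 1 * \<bar>?w (p, x0)\<bar>" using elim(4,5) by (simp add: A0_def divide_inverse)
  qed
 qed
 have cA0: "loc.symb ?w (%q. 1) (%q. conv \<phi> (A0 i a q))" for i a
  by (rule loc.symb_conv[OF A0 \<phi>(1)])
 have cA0c: "\<forall>\<^sub>F q in locF. ALL x:locU q. continuous_on (nb x 1) (A i a (fst q)) & conv \<phi> (A0 i a q) x = conv \<phi> (A i a (fst q)) x - A i a (fst q) (snd q)" for i a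
  using A0[of i a]
 proof eventually_elim
  case (elim q)
  show ?case
  proof
   fix x assume x: "x:locU q"
   have c: "continuous_on (nb x 1) (A0 i a q)" using elim x nb_mono[of 1 2 x] continuous_on_subset by fastforce
   have "continuous_on (nb x 1) (%y. A0 i a q y + A i a (fst q) (snd q))" by (intro continuous_intros c)
   hence c': "continuous_on (nb x 1) (A i a (fst q))" by (simp add: A0_def)
   show "continuous_on (nb x 1) (A i a (fst q)) & conv \<phi> (A0 i a q) x = conv \<phi> (A i a (fst q)) x - A i a (fst q) (snd q)"
    unfolding A0_def using c' by (simp add: conv_linear[OF \<phi>(1)] conv_const[OF \<phi>(4)])
  qed
 qed
 have dcA: "symb (%p. s p * e p) (%p. 1) (%p. pder k (conv \<phi> (A i a p)))" for k i a
 proof (rule symb_localize)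
  have "loc.symb (%q. ?w q * 1) (%q. 1) (%q. pder k (conv \<phi> (A0 i a q)))" by (rule loc.symb_pder[OF cA0])
  hence "loc.symb ?w (%q. 1) (%q. pder k (conv \<phi> (A0 i a q)))" by simp
  moreover have "\<forall>\<^sub>F q in locF. ALL x:locU q. pder k (conv \<phi> (A0 i a q)) x = pder k (conv \<phi> (A i a (fst q))) x"
   using cA0c[of i a] loc.ev_open loc.symb_differentiable[OF cA0[of i a]]
  proof eventually_elim
   case (elim q)
   show ?case
   proof
    fix x assume x: "x:locU q"
    have eq: "conv \<phi> (A i a (fst q)) y = conv \<phi> (A0 i a q) y + A i a (fst q) (snd q)" if "y:locU q" for y
     using elim(1) that by simp
    have "pder k (conv \<phi> (A i a (fst q))) x = pder k (%y. conv \<phi> (A0 i a q) y + A i a (fst q) (snd q)) x"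
     by (rule pder_cong[OF elim(2) x eq])
    also have "... = pder k (conv \<phi> (A0 i a q)) x" using elim(3) x by (subst pder_add) auto
    finally show "pder k (conv \<phi> (A0 i a q)) x = pder k (conv \<phi> (A i a (fst q))) x" ..
   qed
  qed
  ultimately show "loc.symb ?w (%q. 1) (%q. pder k (conv \<phi> (A i a (fst q))))" by (rule loc.symb_cong)
 qed
 \<comment> \<open>Mollified Gram matrix minus Gram matrix of the mollified map; by
   \<open>conv_comm\<close> it is quadratic in the oscillation \<open>s e\<close> of the
   gradient.\<close>
 define com where "com = (%j k p x. SU a. conv \<phi> (%y. A j a p y * A k a p y) x - conv \<phi> (A j a p) x * conv \<phi> (A k a p) x)"
 have com: "symb (%p. s p ^ 2 * e p) (%p. 1) (com j k)" for j k unfolding com_def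
 proof (rule symb_sum, rule symb_localize)
  fix a
  let ?w2 = "%q :: 'p \<times> (real^'n). (s (fst q))\<^sup>2 * e (fst q)"
  have le: "\<forall>\<^sub>F q in locF. \<bar>?w q * ?w q\<bar> <= \<bar>?w2 q\<bar>"
   unfolding eventually_locF using ev_k[of 1]
  proof eventually_elim
   case (elim p)
   have "e p * e p <= e p * 1" using elim by (intro mult_left_mono) (auto simp: inverse_le_1_iff)
   hence "s p ^ 2 * (e p * e p) <= s p ^ 2 * e p" by (intro mult_left_mono) auto
   hence "\<bar>(s p)\<^sup>2 * (e p * e p)\<bar> <= \<bar>(s p)\<^sup>2 * e p\<bar>" using elim by (subst (1 2) abs_of_nonneg) auto
   thus ?case by (simp add: power2_eq_square mult_ac)
  qed
  have 1: "loc.symb ?w2 (%q. 1) (%q. conv \<phi> (%y. A0 j a q y * A0 k a q y))"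
  proof (rule loc.symb_mono1[OF loc.symb_conv[OF _ \<phi>(1), where C=1] le])
   show "\<forall>\<^sub>F q in locF. ALL x:locU q. continuous_on (nb x 2) (%y. A0 j a q y * A0 k a q y) & (ALL y:nb x 2. \<bar>A0 j a q y * A0 k a q y\<bar> <= 1 * \<bar>?w q * ?w q\<bar>)"
    using A0[of j a] A0[of k a]
   proof eventually_elim
    case (elim q)
    show ?case
    proof (intro ballI conjI)
     fix x assume x: "x:locU q"
     show "continuous_on (nb x 2) (%y. A0 j a q y * A0 k a q y)" using elim x by (intro continuous_on_mult) auto
     fix y assume "y:nb x 2"
     hence "\<bar>A0 j a q y\<bar> <= \<bar>?w q\<bar>" "\<bar>A0 k a q y\<bar> <= \<bar>?w q\<bar>" using elim x by auto
     thus "\<bar>A0 j a q y * A0 k a q y\<bar> <= 1 * \<bar>?w q * ?w q\<bar>"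
      unfolding abs_mult[of "A0 j a q y"] abs_mult[of "?w q" "?w q"] mult_1 by (intro mult_mono) auto
    qed
   qed
  qed simp
  have 2: "loc.symb ?w2 (%q. 1) (%q x. conv \<phi> (A0 j a q) x * conv \<phi> (A0 k a q) x)"
   by (rule loc.symb_mono1[OF loc.symb_mult[OF cA0 cA0] le]) simp
  show "loc.symb ?w2 (%q. 1) (%q x. conv \<phi> (%y. A j a (fst q) y * A k a (fst q) y) x - conv \<phi> (A j a (fst q)) x * conv \<phi> (A k a (fst q)) x)"
  proof (rule loc.symb_cong[OF loc.symb_diff[OF 1 2]])
   show "\<forall>\<^sub>F q in locF. ALL x:locU q. conv \<phi> (%y. A0 j a q y * A0 k a q y) x - conv \<phi> (A0 j a q) x * conv \<phi> (A0 k a q) x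
    = conv \<phi> (%y. A j a (fst q) y * A k a (fst q) y) x - conv \<phi> (A j a (fst q)) x * conv \<phi> (A k a (fst q)) x"
    using cA0c[of j a] cA0c[of k a]
   proof eventually_elim
    case (elim q)
    show ?case unfolding A0_def using elim by (intro ballI conv_comm[OF \<phi>(1,4)]) auto
   qed
  qed
 qed
 have sU: "slow s (%p. pder i (U' a p))" for i a
 proof (rule slowI)
  show "symb (%p. 1) (%p. 1) (%p. pder i (U' a p))"
   by (rule symb_cong[OF cA[of i a]]) (use U'd in \<open>auto elim!: eventually_mono\<close>)
  show "symb s (%p. 1) (%p. pder k (conv \<phi> (A i a p)))" for k
  proof (rule symb_mono1[OF dcA])
   show "\<forall>\<^sub>F p in F. \<bar>s p * e p\<bar> <= \<bar>s p\<bar>" using ev_k[of 1]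
   proof eventually_elim
    case (elim p)
    hence "\<bar>e p\<bar> <= 1" by (simp add: inverse_le_1_iff)
    thus ?case using mult_left_mono[of "\<bar>e p\<bar>" 1 "\<bar>s p\<bar>"] by (simp add: abs_mult)
   qed
  qed simp
  show "ev (%p x. pder k (conv \<phi> (A i a p)) x = pder k (pder i (U' a p)) x)" for k
   using U'd ev_open
  proof eventually_elim
   case (elim p)
   show ?case
   proof
    fix x assume x: "x:U p"
    show "pder k (conv \<phi> (A i a p)) x = pder k (pder i (U' a p)) x"
     by (rule pder_cong[OF elim(2) x]) (use elim(1) in simp)
   qed
  qed
 qed
 define \<Gamma>' where "\<Gamma>' = real CARD('m) * \<Gamma>"
 \<comment> \<open>Mollification moves gradient components by at most \<open>s / \<kappa>\<close>,
   so for large \<open>\<kappa>\<close> half of the immersion constant \<open>\<gamma>\<close>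
   survives.\<close>
 obtain c where c: "c > 0" and clow: "!!X :: 'n => real^'m. (ALL v::real^'n. \<gamma> / 2 * norm v <= norm (lcomb v X)) ==> (ALL i. norm (X i) <= \<Gamma>')
  ==> c <= norm (nrm \<psi> X)"
  using nrm_lower[OF \<psi>, of "\<gamma> / 2" \<Gamma>'] \<gamma> by auto
 have Aclose: "ev (%p x. ALL i a. continuous_on (nb x 1) (A i a p) & \<bar>conv \<phi> (A i a p) x - A i a p x\<bar> <= s p / \<kappa> p & \<bar>conv \<phi> (A i a p) x\<bar> <= \<Gamma>)"
  using dU dc dosc dG
 proof eventually_elim
  case (elim p)
  show ?case
  proof (intro ballI allI)
   fix x i a assume x: "x:U p"
   have sub: "nb x 1 \<subseteq> nb x 3" "nb x 1 \<subseteq> D p" using elim(1) x nb32(2) by blast+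
   have c: "continuous_on (nb x 1) (A i a p)" using elim(2) sub(2) continuous_on_subset by blast
   have o: "\<bar>A i a p y - A i a p x\<bar> <= s p / \<kappa> p" if "y:nb x 1" for y using elim(3) x sub(1) that by blast
   have g: "\<bar>A i a p y\<bar> <= \<Gamma>" if "y:nb x 1" for y using elim(4) sub(2) that by blast
   show "continuous_on (nb x 1) (A i a p) & \<bar>conv \<phi> (A i a p) x - A i a p x\<bar> <= s p / \<kappa> p & \<bar>conv \<phi> (A i a p) x\<bar> <= \<Gamma>"
    using conv_close[OF \<phi>(1,2,4) c o] conv_le[OF \<phi>(1,2,4) c g] c by blast
  qed
 qed
 have low: "ev (%p x. c <= norm (nrm \<psi> (%i. grad U' i p x)))"
  using dU U'd dg Aclose s1 ev_k[of "2 * real CARD('n) * real CARD('m) / \<gamma>"] ev_k[of 1]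
 proof eventually_elim
  case (elim p)
  show ?case
  proof
   fix x assume x: "x:U p"
   have xD: "x:D p" using elim(1) x self[of 3 x] by auto
   have gr: "grad U' i p x = (\<chi> a. conv \<phi> (A i a p) x)" for i using elim(2) x by (simp add: grad_def)
   have kk: "s p / \<kappa> p <= \<gamma> / (2 * real CARD('n) * real CARD('m))"
   proof -
    have "s p / \<kappa> p <= 1 / \<kappa> p" using elim by (intro divide_right_mono) auto
    also have "... <= \<gamma> / (2 * real CARD('n) * real CARD('m))" using elim \<gamma> by (simp add: field_simps)
    finally show ?thesis .
   qed
   show "c <= norm (nrm \<psi> (%i. grad U' i p x))"
   proof (rule clow; intro allI)
    fix v :: "real^'n"
    let ?X = "%i. (\<chi> a. A i a p x) :: real^'m"
    have d: "norm (grad U' i p x - ?X i) <= real CARD('m) * (s p / \<kappa> p)" for i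
    proof -
     have "norm (grad U' i p x - ?X i) <= (SU a. \<bar>(grad U' i p x - ?X i) $ a\<bar>)" by (rule norm_le_l1_cart)
     also have "... <= (SUM a:(UNIV::'m set). s p / \<kappa> p)" using elim(4) x by (intro sum_mono) (simp add: gr)
     finally show ?thesis by simp
    qed
    have "norm (lcomb v (%i. grad U' i p x - ?X i)) <= (SUM i:(UNIV::'n set). norm v * (real CARD('m) * (s p / \<kappa> p)))"
    proof (rule sum_norm_le)
     fix i show "norm (v $ i *\<^sub>R (grad U' i p x - ?X i)) <= norm v * (real CARD('m) * (s p / \<kappa> p))"
      unfolding norm_scaleR real_norm_def by (intro mult_mono d component_le_norm_cart) auto
    qed
    also have "... = real CARD('n) * real CARD('m) * (s p / \<kappa> p) * norm v" by simp
    also have "... <= real CARD('n) * real CARD('m) * (\<gamma> / (2 * real CARD('n) * real CARD('m))) * norm v"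
     using kk by (intro mult_right_mono mult_left_mono) auto
    also have "... = \<gamma> / 2 * norm v" by simp
    finally have 1: "norm (lcomb v (%i. grad U' i p x - ?X i)) <= \<gamma> / 2 * norm v" .
    have 2: "(SU i. v $ i *\<^sub>R grad U' i p x) = (SU i. v $ i *\<^sub>R ?X i) + (SU i. v $ i *\<^sub>R (grad U' i p x - ?X i))"
     by (simp add: scaleR_diff_right sum_subtractf)
    have "\<gamma> * norm v <= norm (lcomb v ?X)" using elim(3) xD by blast
    also have "... <= norm (lcomb v (%i. grad U' i p x)) + \<gamma> / 2 * norm v"
     using 1 norm_triangle_ineq4[of "SU i. v $ i *\<^sub>R grad U' i p x" "SU i. v $ i *\<^sub>R (grad U' i p x - ?X i)"] unfolding 2 by simp
    finally show "\<gamma> / 2 * norm v <= norm (lcomb v (%i. grad U' i p x))" by simp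
   next
    fix i
    have "norm (grad U' i p x) <= (SU a. \<bar>grad U' i p x $ a\<bar>)" by (rule norm_le_l1_cart)
    also have "... <= (SUM a:(UNIV::'m set). \<Gamma>)" using elim(4) x by (intro sum_mono) (simp add: gr)
    finally show "norm (grad U' i p x) <= \<Gamma>'" by (simp add: \<Gamma>'_def)
   qed
  qed
 qed
 define R where "R = (%j k p y. g j k p y - (SU a. A j a p y * A k a p y) - s p ^ 2 * H0 j k)"
 have Rb: "ev (%p x. continuous_on (nb x 2) (R j k p) & (ALL y:nb x 2. \<bar>R j k p y\<bar> <= \<sigma> * \<bar>(s p)\<^sup>2\<bar>))" for j k
  using dU dc gc gd
 proof eventually_elim
  case (elim p)
  show ?case
  proof (intro ballI conjI)
   fix x assume x: "x:U p"
   have sub: "nb x 2 \<subseteq> D p" using elim(1) x nb32(1) by blast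
   have cA: "continuous_on (nb x 2) (A i a p)" for i a using elim(2) sub continuous_on_subset by blast
   have cg: "continuous_on (nb x 2) (g j k p)" using elim(3) sub continuous_on_subset by blast
   show "continuous_on (nb x 2) (R j k p)" unfolding R_def by (intro continuous_intros cA cg)
   fix y assume "y:nb x 2"
   thus "\<bar>R j k p y\<bar> <= \<sigma> * \<bar>(s p)\<^sup>2\<bar>" using elim(4) sub by (auto simp: R_def)
  qed
 qed
 \<comment> \<open>\<open>R\<close> is the defect beyond \<open>s^2 H0\<close>, \<open>com\<close>
   passes from the mollified Gram matrix to that of \<open>U'\<close>, and \<open>1 - e^m\<close>
   reserves the defect of the next stage.\<close>
 define h where "h = (%j k p x. inverse (s p ^ 2) * conv \<phi> (R j k p) x + H0 j k * (1 - e p ^ m) + inverse (s p ^ 2) * com j k p x)"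
 have cR: "symb (%p. 1) (%p. 1) (%p x. inverse (s p ^ 2) * conv \<phi> (R j k p) x)" for j k
  by (rule symb_mono1[OF symb_scale[OF symb_conv[OF Rb \<phi>(1)]]]) (use s1 in \<open>auto elim!: eventually_mono\<close>)
 have ccom: "symb e (%p. 1) (%p x. inverse (s p ^ 2) * com j k p x)" for j k
  by (rule symb_mono1[OF symb_scale[OF com]]) (use s1 in \<open>auto elim!: eventually_mono simp: abs_mult mult.assoc[symmetric]\<close>)
 have em: "\<forall>\<^sub>F p in F. 0 <= e p ^ m & e p ^ m <= e p" using ev_k[of 1]
 proof eventually_elim
  case (elim p)
  have "e p ^ m <= e p ^ 1" using elim m by (intro power_decreasing) (auto simp: inverse_le_1_iff)
  thus ?case using elim by simp
 qed
 have ec: "\<forall>\<^sub>F p in F. e p <= t" if "0 < t" for t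
  using ev_k[of 1] ev_k[of "1 / t"] by eventually_elim (use that in \<open>simp add: field_simps\<close>)
 have cc: "symb (%p. 1) (%p. 1) (%p x. H0 j k * (1 - e p ^ m))" for j k :: 'n
 proof (rule symb_mono[OF symb_const[where l="%p. 1"], where c="\<bar>H0 j k\<bar>" and d=1])
  show "\<forall>\<^sub>F p in F. \<bar>H0 j k * (1 - e p ^ m)\<bar> <= \<bar>H0 j k\<bar> * \<bar>1\<bar>"
   using em ec[OF zero_less_one] by eventually_elim (auto simp: abs_mult intro!: mult_left_le)
 qed simp
 have com1: "symb (%p. 1) (%p. 1) (%p x. inverse (s p ^ 2) * com j k p x)" for j k
  using symb_epow[of 1 "%p. 1" "%p x. inverse (s p ^ 2) * com j k p x" 0] ccom[of j k] by simp
 have hs: "symb (%p. 1) (%p. 1) (h j k)" for j k unfolding h_def by (intro symb_add cR cc com1)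
 have hsym: "h j k = h k j" for j k
  using gsym[of j k] by (simp add: h_def R_def com_def H0_def mult.commute)
 have \<sigma>q: "0 < \<sigma> / (2 * CARD('n))" using \<sigma> by simp
 have hb: "ev (%p x. ALL j k. \<bar>h j k p x - H0 j k\<bar> <= 2 * \<sigma>)"
 proof -
  have "\<forall>\<^sub>F p in F. ALL j k. ALL x:U p. \<bar>inverse (s p ^ 2) * com j k p x\<bar> <= \<sigma> / 2"
   by (intro eventually_all_finite symb_small[OF ccom]) (use \<sigma> in simp)
  moreover have "\<forall>\<^sub>F p in F. ALL j k. ALL x:U p. continuous_on (nb x 2) (R j k p) & (ALL y:nb x 2. \<bar>R j k p y\<bar> <= \<sigma> * \<bar>(s p)\<^sup>2\<bar>)"
   by (intro eventually_all_finite Rb)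
  ultimately show ?thesis using s1 em ec[OF \<sigma>q]
  proof eventually_elim
   case (elim p)
   show ?case
   proof (intro ballI allI)
    fix x j k assume x: "x:U p"
    have sub: "nb x 1 \<subseteq> nb x 2" by (rule nb_mono) simp
    have "\<bar>conv \<phi> (R j k p) x\<bar> <= \<sigma> * s p ^ 2"
    proof (rule conv_le[OF \<phi>(1,2,4)])
     have "continuous_on (nb x 2) (R j k p)" using elim(2) x by blast
     thus "continuous_on (nb x 1) (R j k p)" using sub by (rule continuous_on_subset)
     fix y assume "y:nb x 1"
     hence "y:nb x 2" using sub by (rule subsetD[rotated])
     hence "\<bar>R j k p y\<bar> <= \<sigma> * \<bar>(s p)\<^sup>2\<bar>" using elim(2) x by blast
     thus "\<bar>R j k p y\<bar> <= \<sigma> * s p ^ 2" by simp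
    qed
    hence 1: "\<bar>inverse (s p ^ 2) * conv \<phi> (R j k p) x\<bar> <= \<sigma>"
     using elim(3) by (simp add: abs_mult field_simps)
    have "e p ^ m <= \<sigma> / (2 * CARD('n))" using elim by linarith
    moreover have "0 <= H0 j k" "H0 j k <= CARD('n)" by (auto simp: H0_def Suc_leI)
    ultimately have "H0 j k * e p ^ m <= CARD('n) * (\<sigma> / (2 * CARD('n)))" using elim by (intro mult_mono) auto
    hence 2: "\<bar>H0 j k * e p ^ m\<bar> <= \<sigma> / 2" using \<open>0 <= H0 j k\<close> elim by simp
    have "\<bar>inverse (s p ^ 2) * com j k p x\<bar> <= \<sigma> / 2" using elim(1) x by blast
    moreover have "h j k p x - H0 j k = inverse (s p ^ 2) * conv \<phi> (R j k p) x - H0 j k * e p ^ m + inverse (s p ^ 2) * com j k p x"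
     by (simp add: h_def algebra_simps)
    ultimately show "\<bar>h j k p x - H0 j k\<bar> <= 2 * \<sigma>" using 1 2 by linarith
   qed
  qed
 qed
 \<comment> \<open>The reason for \<open>\<sigma> <= 1 / (4 n)\<close>: an axis coefficient combines
   \<open>n\<close> entries of \<open>h\<close>, and their deviations must not add up to 1.\<close>
 have \<sigma>n: "CARD('n) * (2 * \<sigma>) <= 1/2" using \<sigma> by (simp add: field_simps)
 have n1: "1 <= real CARD('n)" by (simp add: Suc_leI)
 have \<sigma>2: "2 * \<sigma> <= 1/2" using mult_right_mono[OF n1, of "2 * \<sigma>"] \<sigma>n \<sigma>(1) by linarith
 have Lh: "ev (%p x. 1/4 <= Ldiag i (%j k. h j k p x))" for i using hb
 proof eventually_elim
  case (elim p)
  show ?case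
  proof
   fix x assume x: "x:U p"
   have "1 - CARD('n) * (2 * \<sigma>) <= Ldiag i (%j k. h j k p x)" by (rule Ldiag_close) (use elim x in blast)
   thus "1/4 <= Ldiag i (%j k. h j k p x)" using \<sigma>n by linarith
  qed
 qed
 have oh: "ev (%p x. 1/4 <= h j k p x)" if "j ~= k" for j k using hb
 proof eventually_elim
  case (elim p)
  show ?case
  proof
   fix x assume x: "x:U p"
   have "\<bar>h j k p x - 1\<bar> <= 2 * \<sigma>" using elim x that by (metis H0_def)
   thus "1/4 <= h j k p x" using \<sigma>2 by linarith
  qed
 qed
 have ud: "ev (%p x. U' a p dif x)" for a using U'd by eventually_elim blast
 let ?B = "secff \<psi> U' s" and ?L = "%p. \<kappa> p ^ (n + Suc m * N)"
 have Bs: "symb (%p. 1) (%p. 1) (?B j k)" for j k by (rule secff_symb[OF \<psi> s1 ud sU c low])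
 have Bsym: "?B j k = ?B k j" for j k by (rule secff_sym)
 have "EX f w E. adm ?L f & (ALL k. adm ?L (w k)) & (ALL j k. symb (%p. e p ^ Suc m) ?L (E j k)) &
  ev (%p x. ALL j k. TT ?B f w j k p x = h j k p x + E j k p x)"
  by (rule flat_stage[OF hs hsym Bs Bsym _ Lh oh n N]) simp_all
 then obtain f w E where f: "adm ?L f" and w: "!!k. adm ?L (w k)" and E: "!!j k. symb (%p. e p ^ Suc m) ?L (E j k)"
  and TT: "ev (%p x. ALL j k. TT ?B f w j k p x = h j k p x + E j k p x)" by blast
 have "EX v E. (ALL a. symb s ?L (%p x. v a p x - U' a p x)) &
  (ALL a i. symb s ?L (%p x. pder i (v a p) x - pder i (U' a p) x)) &
  (ALL j k. symb (%p. s p ^ 3) ?L (E j k)) & ev (%p x. (ALL a. v a p dif x) &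
   (ALL j k. gram (%a. v a p) j k x = gram (%a. U' a p) j k x
    + s p ^ 2 * TT ?B f w j k p x + E j k p x))"
  by (rule geo_step[OF \<psi> s1 ud sU c low ev_kpow f w])
 then obtain v E2 where v: "!!a. symb s ?L (%p x. v a p x - U' a p x)"
  and vp: "!!a i. symb s ?L (%p x. pder i (v a p) x - pder i (U' a p) x)"
  and E2: "!!j k. symb (%p. s p ^ 3) ?L (E2 j k)"
  and vd: "ev (%p x. (ALL a. v a p dif x) &
   (ALL j k. gram (%a. v a p) j k x = gram (%a. U' a p) j k x
    + s p ^ 2 * TT ?B f w j k p x + E2 j k p x))" by blast
 obtain c1 where c1: "c1 > 0" "ev (%p x. ALL a. \<bar>v a p x - U' a p x\<bar> <= c1 * \<bar>s p\<bar>)"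
  using symb_uniform[of s ?L "%a p x. v a p x - U' a p x", OF v] by blast
 obtain c2 where c2: "c2 > 0" "ev (%p x. ALL q. \<bar>pder (snd q) (v (fst q) p) x - pder (snd q) (U' (fst q) p) x\<bar> <= c2 * \<bar>s p\<bar>)"
  using symb_uniform[of s ?L "%q p x. pder (snd q) (v (fst q) p) x - pder (snd q) (U' (fst q) p) x", OF vp] by blast
 obtain c3 where c3: "c3 > 0" "ev (%p x. ALL q. \<bar>pder (fst q) (%x. pder (snd (snd q)) (v (fst (snd q)) p) x - pder (snd (snd q)) (U' (fst (snd q)) p) x) x\<bar> <= c3 * \<bar>s p * ?L p\<bar>)"
  using symb_uniform[of "%p. s p * ?L p" ?L "%q p. pder (fst q) (%x. pder (snd (snd q)) (v (fst (snd q)) p) x - pder (snd (snd q)) (U' (fst (snd q)) p) x)", OF symb_pder[OF vp]] by blast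
 obtain c4 where c4: "c4 > 0" "ev (%p x. ALL q. \<bar>pder (fst q) (pder (snd (snd q)) (U' (fst (snd q)) p)) x\<bar> <= c4 * \<bar>s p\<bar>)"
  using symb_uniform[of s "%p. 1" "%q p. pder (fst q) (pder (snd (snd q)) (U' (fst (snd q)) p))", OF slow_pder[OF sU]] by blast
 obtain c5 where c5: "c5 > 0" "ev (%p x. ALL q. \<bar>E (fst q) (snd q) p x\<bar> <= c5 * \<bar>e p ^ Suc m\<bar>)"
  using symb_uniform[of "%p. e p ^ Suc m" ?L "%q. E (fst q) (snd q)", OF E] by blast
 obtain c6 where c6: "c6 > 0" "ev (%p x. ALL q. \<bar>E2 (fst q) (snd q) p x\<bar> <= c6 * \<bar>s p ^ 3\<bar>)"
  using symb_uniform[of "%p. s p ^ 3" ?L "%q. E2 (fst q) (snd q)", OF E2] by blast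
 have vpd: "\<forall>\<^sub>F p in F. ALL q. ALL x:U p. (%x. pder (snd q) (v (fst q) p) x - pder (snd q) (U' (fst q) p) x) dif x"
  by (intro eventually_all_finite symb_differentiable[OF vp])
 have U'pd: "\<forall>\<^sub>F p in F. ALL q. ALL x:U p. pder (snd q) (U' (fst q) p) dif x"
  by (intro eventually_all_finite symb_differentiable[OF slow_symb[OF sU]])
 define C where "C = real CARD('n) * \<bar>\<Gamma>\<bar> * real CARD('n) + c1 + (c2 + 1) + (c3 + c4)"
 show ?thesis
 proof (rule exI[of _ C], goal_cases)
  case 1
  have t1: "0 < \<sigma> / (4 * c5)" "0 < \<sigma> / (4 * c6)" using \<sigma> c5 c6 by simp_all
  show ?case
   using c1(2) c2(2) c3(2) c4(2) c5(2) c6(2) vpd U'pd vd TT U'd Aclose dU dd dG gc g2 s01 ev_kpow[of "n + Suc m * N"] ev_k[of 1]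
    ec[OF t1(1)] ec[OF t1(2)]
  proof eventually_elim
   case (elim p)
   note e1 = elim(1) and e2 = elim(2) and e3 = elim(3) and e4 = elim(4) and e5 = elim(5) and e6 = elim(6) and e7 = elim(7)
    and e8 = elim(8) and e9 = elim(9) and e10 = elim(10) and e11 = elim(11) and e12 = elim(12) and e13 = elim(13) and e14 = elim(14)
    and e15 = elim(15) and e16 = elim(16) and e17 = elim(17) and e18 = elim(18) and e19 = elim(19) and e20 = elim(20) and e21 = elim(21) and e22 = elim(22)
   have sp: "0 < s p" "s p <= 1" "s p <= e p ^ Suc m" using e18 by auto
   have L1: "1 <= ?L p" by (rule e19)
   have ep: "0 < e p" "e p <= 1" using e20 by (auto simp: inverse_le_1_iff)
   show ?case
   proof (rule exI[of _ "%a. v a p"], intro ballI conjI allI)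
    fix x assume x: "x:U p"
    have sub: "nb x 1 \<subseteq> D p" "nb x 3 \<subseteq> D p" using e13 x nb32(2) by blast+
    have xD: "x:D p" using sub self[of 1 x] by auto
    have G0: "0 <= \<Gamma>" using e15 xD abs_ge_zero order_trans by blast
    have pU: "pder i (U' a p) x = conv \<phi> (A i a p) x" for i a using e11 x by blast
    fix a
    show "v a p dif x" using e9 x by blast
    have vU: "\<bar>v a p x - U' a p x\<bar> <= c1 * s p" using e1 x sp by simp
    have "\<bar>U' a p x - u a p x\<bar> <= real CARD('n) * \<Gamma> * real CARD('n)"
     unfolding U'_def
    proof (rule conv_close[OF \<phi>(1,2,4)])
     have ud: "u a p dif y" if "y:nb x 1" for y using e14 sub(1) that by blast
     show "continuous_on (nb x 1) (u a p)"
      by (intro continuous_at_imp_continuous_on ballI differentiable_imp_continuous_within ud)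
     fix y assume y: "y:nb x 1"
     have nn: "norm (y - x) <= real CARD('n)" using norm_nb[OF y] by simp
     have "\<bar>u a p y - u a p x\<bar> <= real CARD('n) * \<Gamma> * norm (y - x)"
     proof (rule mean_value_nb[where u="u a p" and x=x and r=1 and G=\<Gamma>, OF _ _ y])
      show "u a p dif z" if "z:nb x 1" for z by (rule ud[OF that])
      show "\<bar>pder i (u a p) z\<bar> <= \<Gamma>" if "z:nb x 1" for z i using e15 sub(1) that unfolding A_def by blast
     qed
     also have "... <= real CARD('n) * \<Gamma> * real CARD('n)" using nn G0 by (intro mult_left_mono) auto
     finally show "\<bar>u a p y - u a p x\<bar> <= real CARD('n) * \<Gamma> * real CARD('n)" .
    qed
    moreover have "c1 * s p <= c1" using c1(1) sp by (simp add: mult_left_le)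
    ultimately show "\<bar>v a p x - u a p x\<bar> <= C" using vU G0 c2(1) c3(1) c4(1) unfolding C_def by simp
    fix i
    have e7': "(%x. pder i (v a p) x - pder i (U' a p) x) dif x"
     using spec[OF e7, of "(a, i)"] x by simp
    have e8': "pder i (U' a p) dif x" using spec[OF e8, of "(a, i)"] x by simp
    have eq: "pder i (v a p) = (%x. (pder i (v a p) x - pder i (U' a p) x) + pder i (U' a p) x)" by simp
    show "pder i (v a p) dif x" using differentiable_add[OF e7' e8'] by simp
    have 1: "\<bar>pder i (v a p) x - pder i (U' a p) x\<bar> <= c2 * s p" using spec[OF bspec[OF e2 x], of "(a, i)"] sp by simp
    have 2: "\<bar>pder i (U' a p) x - pder i (u a p) x\<bar> <= s p"
    proof -
     have "\<bar>pder i (U' a p) x - A i a p x\<bar> <= s p / \<kappa> p" using e12 x pU by simp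
     also have "... <= s p" using e20 sp by (simp add: divide_le_eq mult_left_mono mult_le_cancel_left1)
     finally show ?thesis by (simp add: A_def)
    qed
    have K: "0 <= real CARD('n) * \<bar>\<Gamma>\<bar> * real CARD('n)" by simp
    have "c2 + 1 <= C" using K c1(1) c3(1) c4(1) unfolding C_def by linarith
    hence "(c2 + 1) * s p <= C * s p" using sp by (intro mult_right_mono) auto
    thus "\<bar>pder i (v a p) x - pder i (u a p) x\<bar> <= C * s p" using 1 2 by (simp add: distrib_right)
    fix k
    have 3: "pder k (pder i (v a p)) x = pder k (%x. pder i (v a p) x - pder i (U' a p) x) x + pder k (pder i (U' a p)) x"
     by (subst eq) (rule pder_add[OF e7' e8'])
    have 4: "\<bar>pder k (%x. pder i (v a p) x - pder i (U' a p) x) x\<bar> <= c3 * (s p * ?L p)"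
     using spec[OF bspec[OF e3 x], of "(k, a, i)"] sp L1 by simp
    have "\<bar>pder k (pder i (U' a p)) x\<bar> <= c4 * s p" using spec[OF bspec[OF e4 x], of "(k, a, i)"] sp by simp
    also have "... <= c4 * (s p * ?L p)" using L1 sp c4(1) by (intro mult_left_mono) (auto simp: mult_le_cancel_left1)
    finally have 5: "\<bar>pder k (pder i (U' a p)) x\<bar> <= c4 * (s p * ?L p)" .
    have "c3 + c4 <= C" using K c1(1) c2(1) unfolding C_def by linarith
    moreover have "0 <= s p * ?L p" using sp L1 by simp
    ultimately have "(c3 + c4) * (s p * ?L p) <= C * (s p * ?L p)" by (rule mult_right_mono)
    thus "\<bar>pder k (pder i (v a p)) x\<bar> <= C * s p * ?L p"
     using 3 4 5 by (simp add: distrib_right mult.assoc)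
   next
    fix x j k assume x: "x:U p"
    have sub: "nb x 1 \<subseteq> D p" "nb x 3 \<subseteq> D p" using e13 x nb32(2) by blast+
    have pU: "pder i (U' a p) x = conv \<phi> (A i a p) x" for i a using e11 x by blast
    have cA1: "continuous_on (nb x 1) (A i a p)" for i a using e12 x by blast
    have cg1: "continuous_on (nb x 1) (g j k p)" using e16 sub(1) continuous_on_subset by blast
    have cs: "continuous_on (nb x 1) (%y. SU a. A j a p y * A k a p y)" by (intro continuous_intros cA1)
    have cgs: "continuous_on (nb x 1) (%y. g j k p y - (SU a. A j a p y * A k a p y))" by (intro continuous_intros cg1 cs)
    have "conv \<phi> (R j k p) x = conv \<phi> (g j k p) x - conv \<phi> (%y. SU a. A j a p y * A k a p y) x - s p ^ 2 * H0 j k"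
     unfolding R_def by (simp add: conv_linear(2)[OF \<phi>(1)] cg1 cs cgs conv_const[OF \<phi>(4)])
    also have "conv \<phi> (%y. SU a. A j a p y * A k a p y) x = (SU a. conv \<phi> (%y. A j a p y * A k a p y) x)"
     by (rule conv_sum[OF \<phi>(1)]) (auto intro!: continuous_intros cA1)
    finally have cR: "conv \<phi> (R j k p) x = conv \<phi> (g j k p) x - (SU a. conv \<phi> (%y. A j a p y * A k a p y) x) - s p ^ 2 * H0 j k" .
    have "s p ^ 2 * h j k p x = conv \<phi> (R j k p) x + s p ^ 2 * (H0 j k * (1 - e p ^ m)) + com j k p x"
     using sp by (simp add: h_def distrib_left mult.assoc[symmetric])
    also have "... = conv \<phi> (g j k p) x - s p ^ 2 * e p ^ m * H0 j k - gram (%a. U' a p) j k x"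
     unfolding cR com_def pU by (simp add: sum_subtractf algebra_simps)
    finally have sh: "s p ^ 2 * h j k p x = conv \<phi> (g j k p) x - s p ^ 2 * e p ^ m * H0 j k - gram (%a. U' a p) j k x" .
    have gr: "gram (%a. v a p) j k x = gram (%a. U' a p) j k x
    + s p ^ 2 * TT ?B f w j k p x + E2 j k p x" using e9 x by blast
    have tt: "TT ?B f w j k p x = h j k p x + E j k p x" using e10 x by blast
    \<comment> \<open>Three errors are left: mollification of the metric, the flat remainder and the
      cubic geometric one. The last two have a spare factor \<open>e\<close> that beats
      \<open>c5\<close> and \<open>c6\<close>; each of the three takes a quarter of the allowance
      \<open>\<sigma>\<close>.\<close>
    have main: "g j k p x - gram (%a. v a p) j k x - s p ^ 2 * inverse (\<kappa> p) ^ m * H0 j k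
     = - (conv \<phi> (g j k p) x - g j k p x) - s p ^ 2 * E j k p x - E2 j k p x"
     unfolding gr tt distrib_left sh by simp
    let ?Z = "s p ^ 2 * e p ^ m"
    have Z: "0 <= ?Z" using ep by simp
    have b1: "\<bar>conv \<phi> (g j k p) x - g j k p x\<bar> <= \<sigma> / 4 * ?Z"
     by (rule conv_even[OF \<phi> cg1]) (use e17 x in blast)
    have "\<bar>E j k p x\<bar> <= c5 * e p ^ Suc m" using spec[OF bspec[OF e5 x], of "(j, k)"] ep by simp
    hence "\<bar>(s p)\<^sup>2 * E j k p x\<bar> <= s p ^ 2 * (c5 * e p ^ Suc m)" by (simp add: abs_mult mult_left_mono)
    also have "... = (c5 * e p) * ?Z" by simp
    also have "... <= \<sigma> / 4 * ?Z" using e21 c5(1) Z by (intro mult_right_mono) (auto simp: field_simps)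
    finally have b2: "\<bar>(s p)\<^sup>2 * E j k p x\<bar> <= \<sigma> / 4 * ?Z" .
    have "\<bar>E2 j k p x\<bar> <= c6 * s p ^ 3" using spec[OF bspec[OF e6 x], of "(j, k)"] sp by simp
    also have "... = c6 * (s p ^ 2 * s p)" by (simp add: power3_eq_cube power2_eq_square)
    also have "... <= c6 * (s p ^ 2 * e p ^ Suc m)" using sp c6(1) by (intro mult_left_mono) auto
    also have "... = (c6 * e p) * ?Z" by simp
    also have "... <= \<sigma> / 4 * ?Z" using e22 c6(1) Z by (intro mult_right_mono) (auto simp: field_simps)
    finally have b3: "\<bar>E2 j k p x\<bar> <= \<sigma> / 4 * ?Z" .
    have "0 <= \<sigma> / 4 * ?Z" using Z \<sigma> by simp
    thus "\<bar>g j k p x - gram (%a. v a p) j k x - s p ^ 2 * inverse (\<kappa> p) ^ m * H0 j k\<bar> <= \<sigma> * ?Z"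
     unfolding main using b1 b2 b3 by linarith
   qed
  qed
 qed
qed

end

section \<open>Uniform constants and rescaling of the stage\<close>

lemma shift_pder:
 fixes f :: "'n::finite rfun"
 assumes "f dif (c *\<^sub>R x + d)"
 shows "(%y. f (c *\<^sub>R y + d)) dif x" "pder i (%y. f (c *\<^sub>R y + d)) x = c * pder i f (c *\<^sub>R x + d)"
proof -
 have l: "((%y. c *\<^sub>R y + d) has_derivative (%v. c *\<^sub>R v)) (at x)" by (auto intro!: derivative_eq_intros)
 have h: "((%y. f (c *\<^sub>R y + d)) has_derivative (%v. SU i. (c *\<^sub>R v) $ i * pder i f (c *\<^sub>R x + d))) (at x)"
  by (rule has_derivative_compose[where s=UNIV, OF l pder_works[OF assms]])
 thus "(%y. f (c *\<^sub>R y + d)) dif x" by (rule differentiableI)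
 show "pder i (%y. f (c *\<^sub>R y + d)) x = c * pder i f (c *\<^sub>R x + d)"
  unfolding pder_eq[OF h] by (simp add: axis_def if_distrib[of "%q. _ * q * _"] if_distrib[of "%q. q * _"] cong: if_cong)
qed

lemmas rescale_diff = shift_pder(1)[where d=0, simplified] and rescale_pder = shift_pder(2)[where d=0, simplified]

type_synonym ('m, 'n) params =
 "(real^'n) set \<times> (real^'n) set \<times> ('m => 'n rfun) \<times> ('n => 'n => 'n rfun) \<times> real \<times> real"

context
 fixes \<gamma> \<sigma> :: real and m n N :: nat
 assumes mn: "CARD('m::finite) = CARD('n::finite) + 1" and \<gamma>: "0 < \<gamma>" and \<sigma>: "0 < \<sigma>" "\<sigma> <= 1 / (4 * CARD('n))" and m: "0 < m"
  and n: "n = CARD('n)" and N: "2 * N = n * (n - 1)"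
begin

text \<open>The whole tuple of data becomes the parameter of the symbol calculus, and the filter
  consists of admissible data with \<open>\<kappa>\<close> tending to infinity. What holds
  eventually along it holds with constants that are the same for all domains, maps and
  metrics.\<close>

lemma stage_uniform:
 shows "EX C \<kappa>0. ALL U D (u :: 'm::finite => real^'n::finite => real) g s \<kappa>. stage_data m \<gamma> \<Gamma> \<sigma> U D u g s \<kappa> 1 --> \<kappa>0 <= \<kappa> -->
 (EX v. improves \<sigma> U g u C (C * s) (C * s * \<kappa> ^ (n + Suc m * N)) (s^2 * inverse \<kappa> ^ m) v)"
proof -
 have "card (UNIV :: 'm set) = card (UNIV :: 'n option set)" using mn by (simp add: card_UNIV_option)
 then obtain \<psi> :: "'m => 'n option" where \<psi>: "bij \<psi>"
  using finite_same_card_bij[of "UNIV :: 'm set" "UNIV :: 'n option set"] by auto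
 define pU :: "('m, 'n) params => (real^'n) set"
  where "pU = (%(U,D,u,g,s,\<kappa>). U)"
 define pD :: "('m, 'n) params => (real^'n) set"
  where "pD = (%(U,D,u,g,s,\<kappa>). D)"
 define pu :: "'m => ('m, 'n) params => 'n rfun"
  where "pu = (%a (U,D,u,g,s,\<kappa>). u a)"
 \<comment> \<open>Nonsymmetric \<open>g\<close> are replaced by 0, because \<open>stage\<close>
   wants symmetry at every parameter and not just at the admissible ones.\<close>
 define pg :: "'n => 'n => ('m, 'n) params => 'n rfun"
  where "pg = (%j k (U,D,u,g,s,\<kappa>). if ALL j k. g j k = g k j then g j k else (%x. 0))"
 define ps :: "('m, 'n) params => real"
  where "ps = (%(U,D,u,g,s,\<kappa>). s)"
 define pk :: "('m, 'n) params => real"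
  where "pk = (%(U,D,u,g,s,\<kappa>). \<kappa>)"
 define data where "data = {p. stage_data m \<gamma> \<Gamma> \<sigma> (pU p) (pD p) (%a. pu a p) (%j k. pg j k p) (ps p) (pk p) 1}"
 define F where "F = inf (filtercomap pk at_top) (principal data)"
 have evF: "eventually P F \<longleftrightarrow> (EX \<kappa>0. ALL p:data. \<kappa>0 <= pk p --> P p)" for P
  unfolding F_def eventually_inf_principal eventually_filtercomap_at_top_linorder by blast
 interpret flat F pU pk
 proof
  show "\<forall>\<^sub>F p in F. open (pU p)" unfolding evF data_def stage_data_def by blast
  show "filterlim pk at_top F" unfolding filterlim_at_top evF by blast
 qed
 have d: "\<forall>\<^sub>F p in F. stage_data m \<gamma> \<Gamma> \<sigma> (pU p) (pD p) (%a. pu a p) (%j k. pg j k p) (ps p) (pk p) 1"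
  unfolding evF data_def by blast
 have gs: "pg j k = pg k j" for j k unfolding pg_def by (auto simp: fun_eq_iff split_beta)
 obtain C \<kappa>0 where C: "!!p. p:data ==> \<kappa>0 <= pk p ==> EX v. improves \<sigma> (pU p) (%j k. pg j k p) (%a. pu a p) C (C * ps p) (C * ps p * pk p ^ (n + Suc m * N)) (ps p ^ 2 * inverse (pk p) ^ m) v"
  using stage[OF d \<psi> \<gamma> \<sigma> m gs n N] unfolding evF by blast
 show ?thesis
 proof (rule exI[of _ C], rule exI[of _ \<kappa>0], intro allI impI, goal_cases)
  case (1 U D u g s \<kappa>)
  note sd = 1(1) and k = 1(2)
  let ?p = "(U,D,u,g,s,\<kappa>)"
  have sym: "ALL j k. g j k = g k j" using sd unfolding stage_data_def by blast
  have e: "pU ?p = U" "pD ?p = D" "!!a. pu a ?p = u a" "!!j k. pg j k ?p = g j k" "ps ?p = s" "pk ?p = \<kappa>"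
   using sym by (simp_all add: pU_def pD_def pu_def pg_def ps_def pk_def)
  have "?p:data" unfolding data_def using sd by (simp add: e)
  from C[OF this] k show ?case unfolding e by blast
 qed
qed

text \<open>Dilating domain and map by \<open>\<mu>\<close> preserves gradients, hence all metric
  quantities; it multiplies the values of the map by \<open>\<mu>\<close> and divides second
  derivatives by \<open>\<mu>\<close>. This reduces the mollification length to 1.\<close>

lemma stage_scaled:
 shows "EX C \<kappa>0. ALL U D (u :: 'm::finite => real^'n::finite => real) g s \<kappa> \<mu>. stage_data m \<gamma> \<Gamma> \<sigma> U D u g s \<kappa> \<mu> --> \<kappa>0 <= \<kappa> -->
 (EX v. improves \<sigma> U g u (C / \<mu>) (C * s) (C * s * \<kappa> ^ (n + Suc m * N) * \<mu>) (s^2 * inverse \<kappa> ^ m) v)"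
proof -
 obtain C \<kappa>0 where C: "!!U D (u :: 'm::finite => real^'n::finite => real) g s \<kappa>. stage_data m \<gamma> \<Gamma> \<sigma> U D u g s \<kappa> 1 ==> \<kappa>0 <= \<kappa> ==>
 (EX v. improves \<sigma> U g u C (C * s) (C * s * \<kappa> ^ (n + Suc m * N)) (s^2 * inverse \<kappa> ^ m) v)"
  using stage_uniform[of \<Gamma>] by blast
 show ?thesis
 proof (rule exI[of _ C], rule exI[of _ \<kappa>0], intro allI impI, goal_cases)
  case (1 U D u g s \<kappa> \<mu>)
  note sd = 1(1) and k = 1(2)
  have \<mu>: "0 < \<mu>" using sd by (simp add: stage_data_def)
  define c where "c = inverse \<mu>"
  have c: "0 < c" "c * \<mu> = 1" "\<mu> * c = 1" using \<mu> by (simp_all add: c_def)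
  have cc: "c *\<^sub>R \<mu> *\<^sub>R x = x" "\<mu> *\<^sub>R c *\<^sub>R x = x" for x :: "real^'n" using c by simp_all
  define U1 where "U1 = {x. c *\<^sub>R x:U}"
  define D1 where "D1 = {x. c *\<^sub>R x:D}"
  define u1 where "u1 = (%a x. \<mu> * u a (c *\<^sub>R x))"
  define g1 where "g1 = (%j k x. g j k (c *\<^sub>R x))"
  have ud: "u a dif y" if "y:D" for a y using sd that by (simp add: stage_data_def)
  have u1d: "u1 a dif x" and u1p: "pder i (u1 a) x = pder i (u a) (c *\<^sub>R x)" if "x:D1" for a i x
  proof -
   have d: "(%x. u a (c *\<^sub>R x)) dif x"
    and p: "pder i (%x. u a (c *\<^sub>R x)) x = c * pder i (u a) (c *\<^sub>R x)"
    using rescale_diff[OF ud] rescale_pder[OF ud] that by (auto simp: D1_def)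
   show "u1 a dif x" unfolding u1_def by (rule differentiable_mult[OF differentiable_const d])
   show "pder i (u1 a) x = pder i (u a) (c *\<^sub>R x)" unfolding u1_def pder_cmult[OF d] p using c by (simp flip: mult.assoc)
  qed
  have nbs: "c *\<^sub>R y:nb (c *\<^sub>R x) (r / \<mu>)" if "y:nb x r" for x y r
  proof -
   have "\<bar>c * (y $ i - x $ i)\<bar> <= c * r" for i using that c by (simp add: abs_mult mem_nb)
   thus ?thesis by (simp add: mem_nb c_def divide_inverse algebra_simps)
  qed
  have bxs: "c *\<^sub>R t:bx (1 / \<mu>)" if "t:bx 1" for t :: "real^'n"
   using that c \<mu> by (simp add: mem_bx abs_mult c_def divide_inverse)
  have U1D: "x:U1 ==> nb x 3 \<subseteq> D1" for x
  proof
   fix y assume "x:U1" "y:nb x 3"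
   hence "c *\<^sub>R x:U" "c *\<^sub>R y:nb (c *\<^sub>R x) (3 / \<mu>)" using nbs by (auto simp: U1_def)
   thus "y:D1" using sd by (auto simp: stage_data_def D1_def)
  qed
  have self: "x:nb x 3" for x :: "real^'n" by (simp add: mem_nb)
  have cs: "continuous_on A (%x. c *\<^sub>R x)" for A :: "(real^'n) set" by (intro continuous_intros)
  have "stage_data m \<gamma> \<Gamma> \<sigma> U1 D1 u1 g1 s \<kappa> 1"
   unfolding stage_data_def div_by_1
  proof (intro conjI)
   show "(0::real) < 1" by simp
   show "open U1"
   proof -
    have "open U" using sd by (simp add: stage_data_def)
    hence "open ((%x. c *\<^sub>R x) -` U)" using cs by (intro open_vimage) auto
    thus ?thesis by (simp add: U1_def vimage_def)
   qed
   show "ALL x:U1. nb x 3 \<subseteq> D1" using U1D by blast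
   show "ALL a. ALL x:D1. u1 a dif x" using u1d by blast
   show "ALL a i. continuous_on D1 (pder i (u1 a))"
   proof (intro allI)
    fix a i
    have "continuous_on D (pder i (u a))" using sd by (simp add: stage_data_def)
    hence "continuous_on D1 (%x. pder i (u a) (c *\<^sub>R x))"
     by (rule continuous_on_compose2[OF _ cs]) (auto simp: D1_def)
    thus "continuous_on D1 (pder i (u1 a))" by (rule continuous_on_eq) (simp add: u1p)
   qed
   show "ALL a i. ALL x:U1. ALL y:nb x 3. \<bar>pder i (u1 a) y - pder i (u1 a) x\<bar> <= s / \<kappa>"
   proof (intro allI ballI)
    fix a i x y assume x: "x:U1" and y: "y:nb x 3"
    have D: "x:D1" "y:D1" using U1D[OF x] y self by blast+
    have "\<bar>pder i (u a) (c *\<^sub>R y) - pder i (u a) (c *\<^sub>R x)\<bar> <= s / \<kappa>"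
     using sd nbs[OF y] x unfolding stage_data_def U1_def by blast
    thus "\<bar>pder i (u1 a) y - pder i (u1 a) x\<bar> <= s / \<kappa>" by (simp add: u1p D)
   qed
   show "ALL a i. ALL x:D1. \<bar>pder i (u1 a) x\<bar> <= \<Gamma>" using sd by (auto simp: stage_data_def u1p D1_def)
   show "ALL x:D1. ALL v::real^'n. \<gamma> * norm v <= norm (lcomb v (%i. \<chi> a. pder i (u1 a) x))"
    using sd by (auto simp: stage_data_def u1p D1_def)
   show "ALL j k. continuous_on D1 (g1 j k)"
   proof (intro allI)
    fix j k
    have "continuous_on D (g j k)" using sd by (simp add: stage_data_def)
    thus "continuous_on D1 (g1 j k)" unfolding g1_def
     by (rule continuous_on_compose2[OF _ cs]) (auto simp: D1_def)
   qed
   show "ALL j k. g1 j k = g1 k j" using sd by (auto simp: stage_data_def g1_def)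
   show "ALL x:D1. ALL j k. \<bar>g1 j k x - gram u1 j k x - s^2 * H0 j k\<bar> <= \<sigma> * s^2"
    using sd by (auto simp: stage_data_def u1p D1_def g1_def)
   show "ALL x:U1. ALL t:bx 1. ALL j k. \<bar>g1 j k (x + t) + g1 j k (x - t) - 2 * g1 j k x\<bar> <= \<sigma> / 4 * (s^2 * inverse \<kappa> ^ m)"
    using sd bxs by (auto simp: stage_data_def U1_def g1_def scaleR_add_right scaleR_diff_right)
   show "0 < s" "s * \<kappa> ^ Suc m <= 1" using sd by (simp_all add: stage_data_def)
  qed
  from C[OF this k] obtain v1
   where v1: "improves \<sigma> U1 g1 u1 C (C * s) (C * s * \<kappa> ^ (n + Suc m * N)) (s^2 * inverse \<kappa> ^ m) v1" ..
  define v where "v = (%a x. c * v1 a (\<mu> *\<^sub>R x))"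
  have in1: "\<mu> *\<^sub>R x:U1" if "x:U" for x using that cc by (simp add: U1_def)
  have vd: "v a dif x" and vp: "pder i (v a) x = pder i (v1 a) (\<mu> *\<^sub>R x)" if "x:U" for a i x
  proof -
   have d1: "v1 a dif (\<mu> *\<^sub>R x)" using bspec[OF v1 in1[OF that]] by blast
   note d = rescale_diff[OF d1] and p = rescale_pder[OF d1]
   show "v a dif x" unfolding v_def by (rule differentiable_mult[OF differentiable_const d])
   show "pder i (v a) x = pder i (v1 a) (\<mu> *\<^sub>R x)" unfolding v_def pder_cmult[OF d] p using c by (simp flip: mult.assoc)
  qed
  have oU: "open U" using sd by (simp add: stage_data_def)
  have vpp: "pder i (v a) dif x" "pder k (pder i (v a)) x = \<mu> * pder k (pder i (v1 a)) (\<mu> *\<^sub>R x)" if x: "x:U" for a i k x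
  proof -
   have d1: "pder i (v1 a) dif (\<mu> *\<^sub>R x)" using bspec[OF v1 in1[OF x]] by blast
   show "pder i (v a) dif x"
    using differentiable_cong_open[OF oU x, of "pder i (v a)" "%x. pder i (v1 a) (\<mu> *\<^sub>R x)"] vp rescale_diff[OF d1] by simp
   show "pder k (pder i (v a)) x = \<mu> * pder k (pder i (v1 a)) (\<mu> *\<^sub>R x)"
    using pder_cong[OF oU x, of "pder i (v a)" "%x. pder i (v1 a) (\<mu> *\<^sub>R x)" k] vp rescale_pder[OF d1] by simp
  qed
  show ?case
  proof (rule exI[of _ v], intro ballI conjI allI)
   fix x assume x: "x:U"
   note w = bspec[OF v1 in1[OF x]]
   have D1: "\<mu> *\<^sub>R x:D1" using U1D[OF in1[OF x]] self by blast
   fix a show "v a dif x" by (rule vd[OF x])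
   have "\<bar>v1 a (\<mu> *\<^sub>R x) - u1 a (\<mu> *\<^sub>R x)\<bar> <= C" using w by blast
   hence "c * \<bar>v1 a (\<mu> *\<^sub>R x) - \<mu> * u a x\<bar> <= c * C" using c by (simp add: u1_def cc)
   moreover have "c * \<bar>v1 a (\<mu> *\<^sub>R x) - \<mu> * u a x\<bar> = \<bar>v a x - u a x\<bar>"
   proof -
    have "c * \<bar>v1 a (\<mu> *\<^sub>R x) - \<mu> * u a x\<bar> = \<bar>c * (v1 a (\<mu> *\<^sub>R x) - \<mu> * u a x)\<bar>" using c by (simp add: abs_mult)
    also have "c * (v1 a (\<mu> *\<^sub>R x) - \<mu> * u a x) = v a x - u a x" using c by (simp add: v_def right_diff_distrib flip: mult.assoc)
    finally show ?thesis .
   qed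
   ultimately show "\<bar>v a x - u a x\<bar> <= C / \<mu>" by (simp add: c_def divide_inverse mult.commute)
   fix i show "pder i (v a) dif x" by (rule vpp(1)[OF x])
   show "\<bar>pder i (v a) x - pder i (u a) x\<bar> <= C * s" using w D1 by (simp add: vp[OF x] u1p c)
   fix k
   have "\<bar>pder k (pder i (v1 a)) (\<mu> *\<^sub>R x)\<bar> <= C * s * \<kappa> ^ (n + Suc m * N)" using w by blast
   hence "\<mu> * \<bar>pder k (pder i (v1 a)) (\<mu> *\<^sub>R x)\<bar> <= \<mu> * (C * s * \<kappa> ^ (n + Suc m * N))" using \<mu> by simp
   thus "\<bar>pder k (pder i (v a)) x\<bar> <= C * s * \<kappa> ^ (n + Suc m * N) * \<mu>"
    using \<mu> by (simp add: vpp(2)[OF x] abs_mult mult_ac)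
  next
   fix x j k assume x: "x:U"
   show "\<bar>g j k x - gram v j k x - s^2 * inverse \<kappa> ^ m * H0 j k\<bar> <= \<sigma> * (s^2 * inverse \<kappa> ^ m)"
    using bspec[OF v1 in1[OF x]] by (simp add: vp[OF x] g1_def c)
  qed
 qed
qed

end

section \<open>Iteration\<close>

lemma norm_comb:
 fixes v :: "real^'n" and X :: "'n => 'a::real_inner"
 shows "(norm (lcomb v X))\<^sup>2 = quad (%j k. X j \<bullet> X k) v"
 unfolding power2_norm_eq_inner inner_sum_left inner_sum_right
 by (simp add: mult.assoc mult.left_commute inner_commute)

lemma sum_abs_bound:
 fixes v :: "real^'n"
 assumes "!!j k. \<bar>e j k\<bar> <= t"
 shows "\<bar>quad e v\<bar> <= (real CARD('n))\<^sup>2 * t * norm v ^ 2"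
proof -
 have "\<bar>quad e v\<bar> <= (SUM j:(UNIV::'n set). SUM k:(UNIV::'n set). norm v * norm v * t)"
 proof (rule order_trans[OF sum_abs sum_mono], rule order_trans[OF sum_abs sum_mono])
  fix j k
  show "\<bar>v $ j * v $ k * e j k\<bar> <= norm v * norm v * t"
   unfolding abs_mult using assms component_le_norm_cart[of v] by (intro mult_mono) auto
 qed
 also have "... = (real CARD('n))\<^sup>2 * t * norm v ^ 2" by (simp add: power2_eq_square)
 finally show ?thesis .
qed

lemma H0_bound: "\<bar>H0 j (k::'n::finite)\<bar> <= real CARD('n)" by (simp add: H0_def Suc_leI)

text \<open>Gradient bounds are inherited from the metric: a diagonal Gram entry bounds the
  components, and the defect takes at most \<open>3 \<gamma>^2\<close> of the lower bound
  \<open>4 \<gamma>^2\<close>. So the bounds required by a stage do not deteriorate along the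
  iteration.\<close>

lemma defect_bounds:
 fixes p :: "'n::finite => 'm::finite => real" and G :: "'n => 'n => real" and \<gamma> :: real
 assumes d: "!!j k. \<bar>G j k - (SU a. p j a * p k a) - s^2 * H0 j k\<bar> <= \<sigma> * s^2" and \<sigma>: "\<sigma> <= 1"
  and up: "!!j. G j j <= \<Gamma>" and lo: "!!v::real^'n. 4 * \<gamma>^2 * norm v ^ 2 <= quad G v"
  and s: "(real CARD('n))\<^sup>2 * ((real CARD('n) + 1) * s^2) <= 3 * \<gamma>^2" and \<gamma>: "0 <= \<gamma>"
 shows "\<bar>p j a\<bar> <= \<Gamma> + 1" "\<gamma> * norm v <= norm (lcomb v (%i. \<chi> a. p i a))"
proof -
 let ?S = "%j k. SU a. p j a * p k a"
 have n1: "1 <= real CARD('n)" by (simp add: Suc_leI)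
 have \<sigma>s: "\<sigma> * s^2 <= s^2" using mult_right_mono[OF \<sigma>, of "s^2"] by simp
 have "\<bar>p j a\<bar>\<^sup>2 <= ?S j j"
  using member_le_sum[of a UNIV "%a. p j a * p j a"] by (simp add: power2_eq_square)
 also have "?S j j <= G j j"
 proof -
  have "s^2 <= s^2 * H0 j j" using mult_left_mono[OF n1, of "s^2"] by (simp add: H0_def)
  thus ?thesis using d[of j j] \<sigma>s by linarith
 qed
 also have "... <= \<Gamma>" by (rule up)
 finally have "\<bar>p j a\<bar>\<^sup>2 <= \<Gamma>" .
 moreover have "\<bar>p j a\<bar> <= \<bar>p j a\<bar>\<^sup>2 + 1"
  using sum_squares_ge_zero[of "\<bar>p j a\<bar> - 1" 0] zero_le_power2[of "2 * \<bar>p j a\<bar> - 1"] by (simp add: power2_eq_square algebra_simps)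
 ultimately show "\<bar>p j a\<bar> <= \<Gamma> + 1" by linarith
 have e: "\<bar>G j k - ?S j k\<bar> <= (real CARD('n) + 1) * s^2" for j k
 proof -
  have "\<bar>s\<^sup>2 * H0 j k\<bar> <= real CARD('n) * s^2" using mult_left_mono[OF H0_bound[of j k], of "s^2"] by (simp add: abs_mult mult.commute)
  thus ?thesis using d[of j k] \<sigma>s unfolding distrib_right mult_1 by linarith
 qed
 have "(\<chi> a. p j a) \<bullet> (\<chi> a. p k a) = ?S j k" for j k by (simp add: inner_vec_def)
 hence "(norm (lcomb v (%i. \<chi> a. p i a)))\<^sup>2 = quad ?S v" by (simp add: norm_comb)
 also have "... = quad G v - quad (%j k. G j k - ?S j k) v"
  by (simp add: right_diff_distrib sum_subtractf)
 also have "... >= 4 * \<gamma>^2 * norm v ^ 2 - 3 * \<gamma>^2 * norm v ^ 2"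
 proof -
  have "\<bar>quad (%j k. G j k - ?S j k) v\<bar> <= (real CARD('n))\<^sup>2 * ((real CARD('n) + 1) * s^2) * norm v ^ 2"
   by (rule sum_abs_bound[OF e])
  also have "... <= 3 * \<gamma>^2 * norm v ^ 2" using s by (intro mult_right_mono) auto
  finally show ?thesis using lo[of v] by linarith
 qed
 finally have "(\<gamma> * norm v)\<^sup>2 <= (norm (lcomb v (%i. \<chi> a. p i a)))\<^sup>2"
  by (simp add: power_mult_distrib algebra_simps)
 thus "\<gamma> * norm v <= norm (lcomb v (%i. \<chi> a. p i a))" by (rule power2_le_imp_le) simp
qed

definition thick :: "'a::metric_space set => real => 'a set" where
 "thick K r = {x. infdist x K < r}"

lemma open_thick: "open (thick K r)"
 unfolding thick_def by (intro open_Collect_less continuous_intros)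

lemma thick_mono: "r <= r' ==> thick K r \<subseteq> thick K r'" by (auto simp: thick_def)

lemma thick_near: "x:thick K r ==> dist x y <= t ==> y:thick K (r + t)"
 unfolding thick_def using infdist_triangle[of y K x] by (simp add: dist_commute)

lemma subset_thick: "0 < r ==> K \<subseteq> thick K r" by (auto simp: thick_def)

abbreviation c1_close :: "(real^'n) set => real => real => ('m => 'n rfun) => ('m => 'n rfun) => bool" where
 "c1_close W c d u v == ALL x:W. ALL a. \<bar>v a x - u a x\<bar> <= c & (ALL i. \<bar>pder i (v a) x - pder i (u a) x\<bar> <= d)"

definition state :: "('n => 'n => 'n::finite rfun) => real => (real^'n) set => real => real => ('m::finite => 'n rfun) => bool" where
 "state g \<sigma> W s B u \<longleftrightarrow> (ALL x:W. (ALL a. u a dif x & (ALL i. pder i (u a) dif x & (ALL k. \<bar>pder k (pder i (u a)) x\<bar> <= B))) &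
  (ALL j k. \<bar>g j k x - gram u j k x - s^2 * H0 j k\<bar> <= \<sigma> * s^2))"

text \<open>Bounds that depend on the metric alone and hence are the same at every stage.
  \<open>\<beta>\<close> is the order of its second differences: 2 for class \<open>C^{1,1}\<close>,
  1 for Lipschitz.\<close>

locale target =
 fixes K :: "(real^'n) set" and g :: "'n => 'n => 'n rfun" and \<rho>0 \<gamma> \<Gamma> Cg :: real and \<beta> :: nat
 assumes gcont: "!!j k. continuous_on UNIV (g j k)" and gsym: "!!j k. g j k = g k j"
  and gup: "!!x j. x:thick K \<rho>0 ==> g j j x <= \<Gamma>"
  and glo: "!!x v. x:thick K \<rho>0 ==> 4 * \<gamma>^2 * norm v ^ 2 <= quad (%j k. g j k x) v"
  and g2: "!!j k x t. norm t <= 1 ==> \<bar>g j k (x + t) + g j k (x - t) - 2 * g j k x\<bar> <= Cg * norm t ^ \<beta>"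
  and \<gamma>: "0 < \<gamma>" and Cg: "0 <= Cg" and \<rho>0: "0 < \<rho>0"
begin

abbreviation stage_cond :: "real => nat => nat => real => real => real => real => real => real => real => bool" where
 "stage_cond \<sigma> m n \<kappa>0 s B \<rho> \<rho>' \<kappa> \<mu> == \<kappa>0 <= \<kappa> & 0 < \<mu> & 0 < \<kappa> & 0 < s & s * \<kappa> ^ Suc m <= 1 &
  (real n)\<^sup>2 * ((real n + 1) * s^2) <= 3 * \<gamma>^2 & \<rho> <= \<rho>0 & 3 * real n / \<mu> <= \<rho> - \<rho>' &
  real n * B * (3 * real n / \<mu>) <= s / \<kappa> & real n / \<mu> <= 1 &
  Cg * (real n / \<mu>) ^ \<beta> <= \<sigma> / 4 * (s^2 * inverse \<kappa> ^ m) & 0 <= B"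

text \<open>The bound \<open>B\<close> on second derivatives is converted, over cubes of size
  \<open>3 / \<mu>\<close>, into the oscillation bound of \<open>stage_data\<close>. The price is
  that the neighbourhood of \<open>K\<close> shrinks from \<open>\<rho>\<close> to
  \<open>\<rho>'\<close>.\<close>

lemma one_stage:
 assumes mn: "CARD('m) = CARD('n) + 1" and \<sigma>: "0 < \<sigma>" "\<sigma> <= 1 / (4 * CARD('n))" and m: "0 < m"
  and n: "n = CARD('n)" and N: "2 * N = n * (n - 1)"
 shows "EX C>0. EX \<kappa>0. ALL (u :: 'm::finite => 'n::finite rfun) s B \<rho> \<rho>' \<kappa> \<mu>. state g \<sigma> (thick K \<rho>) s B u -->
  stage_cond \<sigma> m n \<kappa>0 s B \<rho> \<rho>' \<kappa> \<mu> -->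
  (EX v. state g \<sigma> (thick K \<rho>') (sqrt (s^2 * inverse \<kappa> ^ m)) (C * s * \<kappa> ^ (n + Suc m * N) * \<mu>) v &
   c1_close (thick K \<rho>') (C / \<mu>) (C * s) u v)"
proof -
 obtain C1 \<kappa>0 where C1: "!!U D (u :: 'm::finite => real^'n::finite => real) g s \<kappa> \<mu>. stage_data m \<gamma> (\<Gamma> + 1) \<sigma> U D u g s \<kappa> \<mu> ==> \<kappa>0 <= \<kappa> ==>
 (EX v. improves \<sigma> U g u (C1 / \<mu>) (C1 * s) (C1 * s * \<kappa> ^ (n + Suc m * N) * \<mu>) (s^2 * inverse \<kappa> ^ m) v)"
  using stage_scaled[OF mn \<gamma> \<sigma> m n N, of "\<Gamma> + 1"] by blast
 define C where "C = \<bar>C1\<bar> + 1"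
 have CC: "C1 <= C" "0 < C" by (simp_all add: C_def)
 show ?thesis
 proof (rule exI[of _ C], intro conjI CC, rule exI[of _ \<kappa>0], intro allI impI, elim conjE, goal_cases)
  case (1 u s B \<rho> \<rho>' \<kappa> \<mu>)
  note st = 1(1) and k = 1(2) and \<mu> = 1(3) and k0 = 1(4) and s = 1(5,6) and s3 = 1(7) and \<rho> = 1(8,9)
   and osc = 1(10) and n\<mu> = 1(11) and gg = 1(12) and B = 1(13)
  let ?U = "thick K \<rho>'" and ?D = "thick K \<rho>"
  have D0: "x:thick K \<rho>0" if "x:?D" for x using that \<rho> thick_mono by blast
  have nbU: "nb x (3 / \<mu>) \<subseteq> ?D" if "x:?U" for x
  proof
   fix y assume "y:nb x (3 / \<mu>)"
   hence "dist x y <= 3 * real n / \<mu>" using norm_nb[of y x "3 / \<mu>"] n by (simp add: dist_norm norm_minus_commute mult.commute)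
   thus "y:?D" using thick_near[OF that, of y "3 * real n / \<mu>"] \<rho> thick_mono[of "\<rho>' + 3 * real n / \<mu>" \<rho> K] by auto
  qed
  have \<sigma>1: "\<sigma> <= 1"
  proof -
   have "1 <= real CARD('n)" by (simp add: Suc_leI)
   hence "1 / (4 * real CARD('n)) <= 1" by (intro divide_le_eq_1_pos[THEN iffD2]) linarith+
   thus ?thesis using \<sigma> by linarith
  qed
  have s3': "(real CARD('n))\<^sup>2 * ((real CARD('n) + 1) * s^2) <= 3 * \<gamma>^2" using s3 n by simp
  have dd: "\<bar>g j k x - gram u j k x - s^2 * H0 j k\<bar> <= \<sigma> * s^2" if "x:?D" for x j k
   using st that unfolding state_def by blast
  have ud: "u a dif x" "pder i (u a) dif x" "\<bar>pder k (pder i (u a)) x\<bar> <= B" if "x:?D" for x a i k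
   using st that unfolding state_def by blast+
  have \<gamma>0: "0 <= \<gamma>" using \<gamma> by simp
  have bounds: "\<bar>pder i (u a) x\<bar> <= \<Gamma> + 1" "\<gamma> * norm v <= norm (lcomb v (%i. \<chi> a. pder i (u a) x))" if "x:?D" for x i a v
  proof -
   note db = defect_bounds[where G="%j k. g j k x" and p="%j a. pder j (u a) x" and \<Gamma>=\<Gamma>, OF dd[OF that] \<sigma>1 gup[OF D0[OF that]] glo[OF D0[OF that]] s3' \<gamma>0]
   show "\<bar>pder i (u a) x\<bar> <= \<Gamma> + 1" by (rule db(1))
   show "\<gamma> * norm v <= norm (lcomb v (%i. \<chi> a. pder i (u a) x))" by (rule db(2))
  qed
  have "stage_data m \<gamma> (\<Gamma> + 1) \<sigma> ?U ?D u g s \<kappa> \<mu>"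
   unfolding stage_data_def
  proof (intro conjI)
   show "ALL a i. continuous_on ?D (pder i (u a))"
    using ud(2) by (auto intro!: continuous_at_imp_continuous_on differentiable_imp_continuous_within)
   show "ALL a i. ALL x:?U. ALL y:nb x (3 / \<mu>). \<bar>pder i (u a) y - pder i (u a) x\<bar> <= s / \<kappa>"
   proof (intro allI ballI)
    fix a i x y assume x: "x:?U" and y: "y:nb x (3 / \<mu>)"
    have "\<bar>pder i (u a) y - pder i (u a) x\<bar> <= CARD('n) * B * norm (y - x)"
     by (rule mean_value_nb[OF _ _ y]) (use ud nbU[OF x] in blast)+
    also have "... <= real n * B * (3 * real n / \<mu>)"
     using norm_nb[OF y] n B by (intro mult_mono) (auto simp: mult.commute)
    finally show "\<bar>pder i (u a) y - pder i (u a) x\<bar> <= s / \<kappa>" using osc by linarith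
   qed
   show "ALL x:?U. ALL t:bx (1 / \<mu>). ALL j k. \<bar>g j k (x + t) + g j k (x - t) - 2 * g j k x\<bar> <= \<sigma> / 4 * (s^2 * inverse \<kappa> ^ m)"
   proof (intro allI ballI)
    fix x t :: "real^'n" and j k assume t: "t:bx (1 / \<mu>)"
    have "norm t <= (SU i. \<bar>t $ i\<bar>)" by (rule norm_le_l1_cart)
    also have "... <= (SUM i:(UNIV::'n set). 1 / \<mu>)" using t by (intro sum_mono) (simp add: mem_bx)
    finally have nt: "norm t <= real n / \<mu>" using n by simp
    hence "norm t <= 1" using n\<mu> by linarith
    hence "\<bar>g j k (x + t) + g j k (x - t) - 2 * g j k x\<bar> <= Cg * norm t ^ \<beta>" by (rule g2)
    also have "... <= Cg * (real n / \<mu>) ^ \<beta>" using nt Cg by (intro mult_left_mono power_mono) auto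
    finally show "\<bar>g j k (x + t) + g j k (x - t) - 2 * g j k x\<bar> <= \<sigma> / 4 * (s^2 * inverse \<kappa> ^ m)" using gg by linarith
   qed
   show "ALL j k. continuous_on ?D (g j k)" using gcont continuous_on_subset by blast
   show "ALL j k. g j k = g k j" using gsym by blast
  qed (use \<mu> open_thick nbU ud bounds dd s in auto)
  from C1[OF this k] obtain v
   where v: "improves \<sigma> ?U g u (C1 / \<mu>) (C1 * s) (C1 * s * \<kappa> ^ (n + Suc m * N) * \<mu>) (s^2 * inverse \<kappa> ^ m) v" ..
  have sq: "(sqrt (s^2 * inverse \<kappa> ^ m))\<^sup>2 = s^2 * inverse \<kappa> ^ m" using k0 by simp
  have l1: "C1 / \<mu> <= C / \<mu>" using CC \<mu> by (simp add: divide_right_mono)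
  have l2: "C1 * s <= C * s" using CC s by simp
  have l3: "C1 * s * \<kappa> ^ (n + Suc m * N) * \<mu> <= C * s * \<kappa> ^ (n + Suc m * N) * \<mu>"
   using CC s k0 \<mu> by (intro mult_right_mono) auto
  show ?case
  proof (rule exI[of _ v], intro conjI ballI allI)
   show "state g \<sigma> (thick K \<rho>') (sqrt (s^2 * inverse \<kappa> ^ m)) (C * s * \<kappa> ^ (n + Suc m * N) * \<mu>) v"
    unfolding state_def sq
   proof (intro ballI conjI allI)
    fix x a i k assume x: "x:?U"
    show "\<bar>pder k (pder i (v a)) x\<bar> <= C * s * \<kappa> ^ (n + Suc m * N) * \<mu>" using bspec[OF v x] l3 order_trans by blast
   qed (use v in blast)+
   fix x a i assume x: "x:?U"
   show "\<bar>v a x - u a x\<bar> <= C / \<mu>" using bspec[OF v x] l1 order_trans by blast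
   show "\<bar>pder i (v a) x - pder i (u a) x\<bar> <= C * s" using bspec[OF v x] l2 order_trans by blast
  qed
 qed
qed

end

section \<open>Convergence of the sequence of stages\<close>

lemma seq_limit:
 fixes z :: "nat => real"
 assumes d: "!!q. \<bar>z (Suc q) - z q\<bar> <= f q" and f: "summable f"
 obtains l where "z \<longlonglongrightarrow> l" "!!q. \<bar>l - z q\<bar> <= (\<Sum>r. f (r + q))"
proof -
 have s: "summable (%q. z (Suc (q + p)) - z (q + p))" "summable (%q. \<bar>z (Suc (q + p)) - z (q + p)\<bar>)" for p
  using summable_comparison_test'[of "%q. f (q + p)" 0 "%q. z (Suc (q + p)) - z (q + p)"]
   summable_comparison_test'[of "%q. f (q + p)" 0 "%q. \<bar>z (Suc (q + p)) - z (q + p)\<bar>"] d f summable_ignore_initial_segment[OF f]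
  by auto
 define l where "l = z 0 + (\<Sum>q. z (Suc q) - z q)"
 have tel: "(SUM q<k. z (Suc (q + p)) - z (q + p)) = z (k + p) - z p" for k p
  by (induction k) simp_all
 have lim: "(%k. z (k + p) - z p) \<longlonglongrightarrow> (\<Sum>q. z (Suc (q + p)) - z (q + p))" for p
  using summable_LIMSEQ[OF s(1)[of p]] by (simp add: tel)
 have "z \<longlonglongrightarrow> l"
  using tendsto_add[OF tendsto_const[of "z 0"] lim[of 0]] by (simp add: l_def)
 moreover have "\<bar>l - z p\<bar> <= (\<Sum>r. f (r + p))" for p
 proof -
  have "(%k. z (k + p) - z p) \<longlonglongrightarrow> l - z p"
   using tendsto_diff[OF LIMSEQ_ignore_initial_segment[OF \<open>z \<longlonglongrightarrow> l\<close>] tendsto_const] .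
  hence "l - z p = (\<Sum>q. z (Suc (q + p)) - z (q + p))" using lim LIMSEQ_unique by blast
  also have "\<bar>...\<bar> <= (\<Sum>q. \<bar>z (Suc (q + p)) - z (q + p)\<bar>)" by (rule summable_rabs[OF s(2)])
  also have "... <= (\<Sum>r. f (r + p))"
   using d by (intro suminf_le s summable_ignore_initial_segment f)
  finally show ?thesis .
 qed
 ultimately show ?thesis by (rule that)
qed

lemma c1_limit:
 fixes u :: "nat => 'n::finite rfun"
 assumes W: "open W" and d: "!!q x. x:W ==> u q dif x"
  and e: "!!q x. x:W ==> \<bar>u (Suc q) x - u q x\<bar> <= e q" "summable e"
  and f: "!!q x i. x:W ==> \<bar>pder i (u (Suc q)) x - pder i (u q) x\<bar> <= f q" "summable f"
 obtains v where "!!x. x:W ==> v dif x" "!!x. x:W ==> (%q. u q x) \<longlonglongrightarrow> v x"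
  "!!x i. x:W ==> (%q. pder i (u q) x) \<longlonglongrightarrow> pder i v x"
  "!!x q. x:W ==> \<bar>v x - u q x\<bar> <= (\<Sum>r. e (r + q))"
proof -
 define v where "v = (%x. lim (%q. u q x))"
 define P where "P = (%i x. lim (%q. pder i (u q) x))"
 have v: "(%q. u q x) \<longlonglongrightarrow> v x" "\<bar>v x - u q x\<bar> <= (\<Sum>r. e (r + q))" if xW: "x:W" for x q
 proof -
  obtain l where l: "(%q. u q x) \<longlonglongrightarrow> l" "!!q. \<bar>l - u q x\<bar> <= (\<Sum>r. e (r + q))"
   by (rule seq_limit[OF e(1)[OF xW] e(2)]) blast
  hence "v x = l" unfolding v_def by (simp add: limI)
  thus "(%q. u q x) \<longlonglongrightarrow> v x" "\<bar>v x - u q x\<bar> <= (\<Sum>r. e (r + q))" using l by auto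
 qed
 have P: "(%q. pder i (u q) x) \<longlonglongrightarrow> P i x" "\<bar>P i x - pder i (u q) x\<bar> <= (\<Sum>r. f (r + q))" if xW: "x:W" for x q i
 proof -
  obtain l where l: "(%q. pder i (u q) x) \<longlonglongrightarrow> l" "!!q. \<bar>l - pder i (u q) x\<bar> <= (\<Sum>r. f (r + q))"
   by (rule seq_limit[OF f(1)[where i=i, OF xW] f(2)]) blast
  hence "P i x = l" unfolding P_def by (simp add: limI)
  thus "(%q. pder i (u q) x) \<longlonglongrightarrow> P i x" "\<bar>P i x - pder i (u q) x\<bar> <= (\<Sum>r. f (r + q))" using l by auto
 qed
 have h: "(v has_derivative (%h. SU i. h $ i * P i x)) (at x)" if x: "x:W" for x
 proof -
  obtain r where r: "0 < r" "ball x r \<subseteq> W" using W x open_contains_ball by blast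
  have "EX g. ALL y:ball x r. (%q. u q y) \<longlonglongrightarrow> g y & (g has_derivative (%h. SU i. h $ i * P i y)) (at y within ball x r)"
  proof (rule has_derivative_sequence[where f'="%q y h. SU i. h $ i * pder i (u q) y"])
   show "(u q has_derivative (%h. SU i. h $ i * pder i (u q) y)) (at y within ball x r)" if "y:ball x r" for q y
    by (rule has_derivative_at_withinI[OF pder_works[OF d]]) (use that r in blast)
   fix \<epsilon> :: real assume \<epsilon>: "0 < \<epsilon>"
   hence "0 < \<epsilon> / CARD('n)" by simp
   then obtain N where N: "!!q. q >= N ==> norm (\<Sum>r. f (r + q)) < \<epsilon> / CARD('n)"
    using suminf_exist_split[OF _ f(2)] by blast
   have "norm ((SU i. h $ i * pder i (u q) y) - (SU i. h $ i * P i y)) <= \<epsilon> * norm h"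
    if "q >= N" "y:ball x r" for q y h
   proof -
    have yW: "y:W" using that r by blast
    have "norm ((SU i. h $ i * pder i (u q) y) - (SU i. h $ i * P i y)) = norm (SU i. h $ i * (pder i (u q) y - P i y))"
     by (simp add: right_diff_distrib sum_subtractf)
    also have "... <= (SUM i:(UNIV::'n set). norm h * (\<epsilon> / CARD('n)))"
    proof (rule sum_norm_le)
     fix i
     have "\<bar>pder i (u q) y - P i y\<bar> <= \<epsilon> / CARD('n)"
      using P(2)[OF yW, of i q] N[OF that(1)] by (simp add: abs_minus_commute)
     thus "norm (h $ i * (pder i (u q) y - P i y)) <= norm h * (\<epsilon> / CARD('n))"
      unfolding real_norm_def abs_mult using component_le_norm_cart[of h i] by (intro mult_mono) auto
    qed
    also have "... = \<epsilon> * norm h" by simp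
    finally show ?thesis .
   qed
   thus "\<forall>\<^sub>F q in sequentially. ALL y:ball x r. ALL h. norm ((SU i. h $ i * pder i (u q) y) - (SU i. h $ i * P i y)) <= \<epsilon> * norm h"
    unfolding eventually_sequentially by blast
  next
   show "(%q. u q x) \<longlonglongrightarrow> v x" by (rule v(1)[OF x])
  qed (use r in auto)
  then obtain g where g: "!!y. y:ball x r ==> (%q. u q y) \<longlonglongrightarrow> g y"
   "!!y. y:ball x r ==> (g has_derivative (%h. SU i. h $ i * P i y)) (at y within ball x r)" by blast
  have xr: "x:ball x r" using r by simp
  have "(g has_derivative (%h. SU i. h $ i * P i x)) (at x)"
   using g(2)[OF xr] by (simp only: at_within_open[OF xr open_ball])
  thus ?thesis
  proof (rule has_derivative_transform_within_open[OF _ open_ball xr])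
   fix y assume "y:ball x r"
   thus "g y = v y" using g(1) v(1)[of y] r LIMSEQ_unique by blast
  qed
 qed
 show ?thesis
 proof (rule that)
  fix x assume x: "x:W"
  show "v dif x" by (rule differentiableI[OF h[OF x]])
  show "(%q. u q x) \<longlonglongrightarrow> v x" by (rule v(1)[OF x])
  show "\<bar>v x - u q x\<bar> <= (\<Sum>r. e (r + q))" for q by (rule v(2)[OF x])
  fix i
  have "pder i v x = P i x"
   unfolding pder_eq[OF h[OF x]] by (simp add: axis_def if_distrib[of "%q. q * _"] cong: if_cong)
  thus "(%q. pder i (u q) x) \<longlonglongrightarrow> pder i v x" using P(1)[OF x] by simp
 qed
qed

lemma interpolate_le:
 fixes z P Q \<alpha> :: real
 assumes "0 <= z" "z <= P" "z <= Q" "0 < \<alpha>" "\<alpha> < 1"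
 shows "z <= P powr (1 - \<alpha>) * Q powr \<alpha>"
proof (cases "z = 0")
 case False
 hence "z = z powr (1 - \<alpha>) * z powr \<alpha>" using assms by (simp flip: powr_add)
 also have "... <= P powr (1 - \<alpha>) * Q powr \<alpha>"
  using assms by (intro mult_mono powr_mono2) auto
 finally show ?thesis .
qed simp

lemma ev_powr_ge: "0 < \<theta> ==> \<forall>\<^sub>F A in at_top. (c::real) <= A powr \<theta>"
proof -
 assume t: "0 < \<theta>"
 have "c <= A powr \<theta>" if "max 1 (\<bar>c\<bar> powr (1 / \<theta>)) <= A" for A
 proof -
  have "\<bar>c\<bar> = (\<bar>c\<bar> powr (1 / \<theta>)) powr \<theta>" using t by (simp add: powr_powr)
  also have "... <= A powr \<theta>" using that t by (intro powr_mono2) auto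
  finally show ?thesis by simp
 qed
 thus ?thesis unfolding eventually_at_top_linorder by blast
qed

lemma state_mono: "state g \<sigma> W s B u ==> B <= B' ==> state g \<sigma> W s B' u"
 unfolding state_def by (blast intro: order_trans)

abbreviation solution :: "('n => 'n => 'n::finite rfun) => ('m::finite => 'n rfun) => real => real => real
  => (real^'n) set => ('m => 'n rfun) => bool" where
 "solution g u \<epsilon> \<alpha> H W v == (ALL x:W. ALL a. v a dif x & \<bar>v a x - u a x\<bar> <= \<epsilon>) &
  (ALL x:W. ALL j k. gram v j k x = g j k x) &
  (ALL x y i a. closed_segment x y \<subseteq> W --> norm (x - y) <= 1 -->
    \<bar>pder i (v a) x - pder i (v a) y\<bar> <= H * norm (x - y) powr \<alpha>)"

context target
begin

text \<open>With \<open>T q = b^q\<close> the choices are \<open>s q = A^(- T q)\<close>,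
  \<open>\<kappa> q = A^(c T q)\<close> and \<open>\<mu> q = \<Lambda> A^(d T q)\<close>. Each
  condition on a stage becomes an inequality between exponents and a constant to be absorbed. The
  exponents and the lower bound on \<open>A\<close> are fixed before the map is given;
  \<open>\<Lambda>\<close> is chosen after it and takes care of the initial data.\<close>

theorem iterate:
 assumes mn: "CARD('m) = CARD('n) + 1" and n: "n = CARD('n)" and N: "2 * N = n * (n - 1)"
  and \<alpha>: "0 < \<alpha>" "\<alpha> * (1 + 2 * real N) < 1" and \<beta>: "1 <= \<beta>" "N = 0 ==> 2 <= \<beta>"
 shows "EX s1>0. ALL s (u :: 'm::finite => 'n::finite rfun) B \<rho> \<epsilon>. 0 < s --> s < s1 --> 0 < \<rho> --> \<rho> <= \<rho>0 --> 0 < \<epsilon> -->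
  state g (1 / (4 * CARD('n))) (thick K \<rho>) s B u -->
  (EX v H. solution g u \<epsilon> \<alpha> H (thick K (\<rho>/2)) v)"
proof -
 define \<sigma> where "\<sigma> = 1 / (4 * real CARD('n))"
 have \<sigma>: "0 < \<sigma>" "\<sigma> <= 1 / (4 * real CARD('n))" by (simp_all add: \<sigma>_def)
 have \<sigma>': "0 < \<sigma>" "\<sigma> <= 1 / real (4 * CARD('n))" by (simp_all add: \<sigma>_def)
 have n1: "1 <= real n" unfolding n by (simp add: Suc_leI)
 \<comment> \<open>Growth exponent of the frequencies: above \<open>1 + 2 N\<close> so that
   consecutive stages fit together, below \<open>1 / \<alpha>\<close> for Hoelder
   convergence.\<close>
 define d where "d = ((1 + 2 * real N) + 1 / \<alpha>) / 2"
 have "1 + 2 * real N < 1 / \<alpha>" using \<alpha> by (simp add: field_simps)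
 hence d1: "1 + 2 * real N < d" and d2: "d < 1 / \<alpha>" by (simp_all add: d_def)
 have d3: "1 < d" using d1 by simp
 have \<alpha>d: "\<alpha> * d < 1" using d2 \<alpha> by (simp add: field_simps)
 \<comment> \<open>Mollifying the metric costs \<open>\<mu>^-\<beta>\<close>, which has to stay
   below the square of the next \<open>s\<close>. For \<open>N > 0\<close> one has
   \<open>d > 3\<close> and the order 1 is enough; for \<open>N = 0\<close> only
   \<open>d > 1\<close> holds and the order 2 is called for.\<close>
 have d\<beta>: "2 < d * real \<beta>"
 proof (cases "N = 0")
  case True
  hence "2 <= real \<beta>" using \<beta>(2) by linarith
  hence "d * 2 <= d * real \<beta>" using d3 by (intro mult_left_mono) auto
  thus ?thesis using d3 by linarith
 next
  case False
  hence "1 <= real N" by simp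
  moreover have "d * 1 <= d * real \<beta>" using d3 \<beta>(1) by (intro mult_left_mono) auto
  ultimately show ?thesis using d1 by linarith
 qed
 have \<alpha>1: "\<alpha> < 1"
 proof -
  have "\<alpha> * 1 < \<alpha> * d" using d3 \<alpha>(1) by (intro mult_strict_left_mono)
  thus ?thesis using \<alpha>d by linarith
 qed
 define r1 where "r1 = (1 - \<alpha>) / (\<alpha> * (d - 1))"
 have r1: "1 < r1" using \<alpha>d d3 \<alpha>(1) by (simp add: r1_def field_simps)
 \<comment> \<open>Three caps on \<open>b - 1\<close>: the first gives
   \<open>c * Suc m <= 1\<close>, the second makes \<open>\<zeta>\<close> positive, the third leaves
   room for the error of the mollified metric.\<close>
 define t where "t = min (1/4) (min ((r1 - 1) / 2) ((d * real \<beta> / 2 - 1) / 2))"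
 have t: "t <= 1/4" "t <= (r1 - 1) / 2" "t <= (d * real \<beta> / 2 - 1) / 2" "0 < t"
 proof -
  show "t <= 1/4" unfolding t_def by (rule min.cobounded1)
  show "t <= (r1 - 1) / 2" unfolding t_def by (rule min.coboundedI2[OF min.cobounded1])
  show "t <= (d * real \<beta> / 2 - 1) / 2" unfolding t_def by (rule min.coboundedI2[OF min.cobounded2])
  show "0 < t" unfolding t_def using r1 d\<beta> by simp
 qed
 define b where "b = 1 + t"
 have b: "1 < b" "b <= 5/4" "b < r1" "2 * b < d * real \<beta>"
  using t r1 d\<beta> by (auto simp: b_def)
 define \<zeta> where "\<zeta> = (1 - \<alpha>) - \<alpha> * b * (d - 1)"
 have \<zeta>: "0 < \<zeta>"
 proof -
  have "b * (\<alpha> * (d - 1)) < 1 - \<alpha>" using b(3) \<alpha>(1) d3 by (simp add: r1_def pos_less_divide_eq)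
  thus ?thesis by (simp add: \<zeta>_def mult_ac)
 qed
 define D where "D = d - 1 - 2 * real N"
 have D: "0 < D" using d1 by (simp add: D_def)
 \<comment> \<open>The share \<open>c (b + n + N)\<close> of the cost does not grow with
   \<open>m\<close> apart from the factor \<open>c = 2 (b - 1) / m\<close>; a large \<open>m\<close>
   brings it below half of the margin \<open>(b - 1) D\<close>.\<close>
 obtain m where m0: "4 * (2 + real n + real N) / D < real m" using reals_Archimedean2 by blast
 have m: "0 < m"
 proof -
  have "0 <= 4 * (2 + real n + real N) / D" using D by simp
  thus ?thesis using m0 by (metis less_le_trans of_nat_0_less_iff not_le order_le_less_trans)
 qed
 \<comment> \<open>Forced by the requirement that \<open>s^2 / \<kappa>^m\<close> be the square of
   the next \<open>s\<close>; see \<open>sS\<close>.\<close>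
 define c where "c = 2 / real m * (b - 1)"
 have c: "0 < c" using m b by (simp add: c_def)
 have cm: "c * real m = 2 * (b - 1)" using m by (simp add: c_def)
 have cSm: "c * real (Suc m) <= 1"
 proof -
  have "real (Suc m) <= 2 * real m" using m by simp
  hence "c * real (Suc m) <= c * (2 * real m)" using c by (intro mult_left_mono) auto
  also have "... = 4 * (b - 1)" using cm by simp
  also have "... <= 1" using b by simp
  finally show ?thesis .
 qed
 define M where "M = n + Suc m * N"
 define \<theta> where "\<theta> = (b - 1) * D / 2"
 have \<theta>: "0 < \<theta>" using b D by (simp add: \<theta>_def)
 \<comment> \<open>The exponents in \<open>sB\<close>: second derivatives produced by one stage
   against those tolerated by the next. The surplus \<open>\<theta>\<close> pays for the constant
   \<open>3 n^2 C\<close>.\<close>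
 have exps: "\<theta> + (c * real M - 1 + d) <= b * (d - 1) - b * c"
 proof -
  have "4 * (2 + real n + real N) < real m * D" using m0 D by (simp add: field_simps)
  hence "(2 / real m) * (2 + real n + real N) <= D / 2" using m by (simp add: field_simps)
  moreover have "(2 / real m) * (b + real n + real N) <= (2 / real m) * (2 + real n + real N)"
   using b m by (intro mult_left_mono) auto
  ultimately have "(2 / real m) * (b + real n + real N) <= D / 2" by linarith
  hence "(b - 1) * ((2 / real m) * (b + real n + real N)) <= (b - 1) * (D / 2)" using b by (intro mult_left_mono) auto
  moreover have "c * (b + real n + real N) = (b - 1) * ((2 / real m) * (b + real n + real N))" by (simp only: c_def mult_ac)
  ultimately have 1: "c * (b + real n + real N) <= (b - 1) * (D / 2)" by (simp only:)
  have "c * real M = c * (real n + real N) + (c * real m) * real N" by (simp add: M_def algebra_simps)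
  hence "c * real M = c * (real n + real N) + 2 * (b - 1) * real N" unfolding cm .
  moreover have "(b - 1) * D = (b - 1) * (d - 1) - 2 * (b - 1) * real N" by (simp add: D_def algebra_simps)
  moreover have "b * (d - 1) = (d - 1) + (b - 1) * (d - 1)" by (simp add: algebra_simps)
  moreover have "c * (b + real n + real N) = b * c + c * (real n + real N)" by (simp add: algebra_simps)
  moreover have "(b - 1) * (D / 2) = (b - 1) * D / 2" by simp
  ultimately show ?thesis using 1 unfolding \<theta>_def by linarith
 qed
 obtain C \<kappa>0 where C: "0 < C" and step: "!!(u :: 'm::finite => 'n rfun) s B \<rho> \<rho>' \<kappa> \<mu>. state g \<sigma> (thick K \<rho>) s B u ==>
  stage_cond \<sigma> m n \<kappa>0 s B \<rho> \<rho>' \<kappa> \<mu> ==>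
  (EX v. state g \<sigma> (thick K \<rho>') (sqrt (s^2 * inverse \<kappa> ^ m)) (C * s * \<kappa> ^ M * \<mu>) v &
   c1_close (thick K \<rho>') (C / \<mu>) (C * s) u v)"
  using one_stage[OF mn \<sigma>' m n N] unfolding M_def by metis
 let ?P = "%A. 2 <= A & 2 <= A powr (b - 1) & max \<kappa>0 1 <= A powr c & 3 * real n ^ 2 * C <= A powr \<theta> &
   (real n)\<^sup>2 * (real n + 1) / (3 * \<gamma>^2) <= A powr 2"
 have "eventually ?P at_top"
 proof (intro eventually_conj)
  show "\<forall>\<^sub>F A in at_top. (2::real) <= A" by (rule eventually_ge_at_top)
  show "\<forall>\<^sub>F A in at_top. 2 <= A powr (b - 1)" by (rule ev_powr_ge) (use b in simp)
  show "\<forall>\<^sub>F A in at_top. max \<kappa>0 1 <= A powr c" by (rule ev_powr_ge[OF c])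
  show "\<forall>\<^sub>F A in at_top. 3 * real n ^ 2 * C <= A powr \<theta>" by (rule ev_powr_ge[OF \<theta>])
  show "\<forall>\<^sub>F A in at_top. real n ^ 2 * (real n + 1) / (3 * \<gamma>^2) <= A powr 2" by (rule ev_powr_ge) simp
 qed
 then obtain A0 where A0: "!!A. A0 <= A ==> ?P A" unfolding eventually_at_top_linorder by blast
 define s1 where "s1 = 1 / max A0 2"
 have s1: "0 < s1" by (simp add: s1_def)
 show ?thesis
 proof (rule exI[of _ s1], intro conjI s1 allI impI)
  fix s0 :: real and u0 :: "'m => 'n rfun" and B0 \<rho> \<epsilon> :: real
  assume s0: "0 < s0" "s0 < s1" and \<rho>: "0 < \<rho>" "\<rho> <= \<rho>0" and \<epsilon>: "0 < \<epsilon>"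
   and st0: "state g (1 / (4 * CARD('n))) (thick K \<rho>) s0 B0 u0"
  define A where "A = 1 / s0"
  have "max A0 2 < A" using s0 by (simp add: A_def s1_def pos_less_divide_eq mult.commute del: max_less_iff_conj)
  hence A: "2 <= A" "2 <= A powr (b - 1)" "max \<kappa>0 1 <= A powr c" "3 * real n ^ 2 * C <= A powr \<theta>"
   "real n ^ 2 * (real n + 1) / (3 * \<gamma>^2) <= A powr 2" using A0[of A] by auto
  have A1: "1 <= A" "0 < A" using A by auto
  have mono: "A powr x <= A powr y" if "x <= y" for x y using A1 that by (intro powr_mono) auto
  have pos: "0 < A powr x" for x using A1 by simp
  have mul: "A powr x * A powr y = A powr (x + y)" for x y by (simp add: powr_add)
  have pw: "(A powr x) ^ k = A powr (x * real k)" for x k using A1 by (simp add: powr_powr flip: powr_realpow)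
  have iv: "inverse (A powr x) = A powr (- x)" for x by (simp add: powr_minus)
  define T where "T = (%q::nat. b ^ q)"
  have T1: "1 <= T q" for q using b by (simp add: T_def)
  have TS: "T (Suc q) = b * T q" for q by (simp add: T_def)
  \<comment> \<open>Bernoulli's inequality degrades doubly exponential quantities to geometric ones,
    which is all that the convergence proofs use.\<close>
  have TB: "1 + real q * (b - 1) <= T q" for q
   using Bernoulli_inequality[of "b - 1" q] b by (simp add: T_def)
  have ATq: "2 ^ q <= A powr T q" for q
  proof -
   have "2 ^ q <= (A powr (b - 1)) ^ q" using A(2) by (intro power_mono) auto
   also have "... <= A powr T q" unfolding pw using TB[of q] by (intro mono) (simp add: mult.commute)
   finally show ?thesis .
  qed
  define p where "p = A powr (d - 1 - c)"
  \<comment> \<open>One summand for each demand on the starting frequency: the width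
    \<open>\<rho>\<close> of the neighbourhood, the tolerance \<open>\<epsilon>\<close>, the metric
    and the initial second derivatives.\<close>
  define \<Lambda> where "\<Lambda> = 1 + real n + 12 * real n / \<rho> + 2 * C / \<epsilon> + 4 * Cg * real n ^ \<beta> / \<sigma> + 3 * real n ^ 2 * \<bar>B0\<bar> / p"
  have nonneg: "0 <= 12 * real n / \<rho>" "0 <= 2 * C / \<epsilon>" "0 <= 4 * Cg * real n ^ \<beta> / \<sigma>" "0 <= 3 * real n ^ 2 * \<bar>B0\<bar> / p" "0 <= real n"
    using \<rho> C \<epsilon> Cg \<sigma> pos[of "d - 1 - c"] by (auto simp: p_def)
  have \<Lambda>: "1 <= \<Lambda>" "real n <= \<Lambda>" "12 * real n / \<rho> <= \<Lambda>" "2 * C / \<epsilon> <= \<Lambda>" "4 * Cg * real n ^ \<beta> / \<sigma> <= \<Lambda>" "3 * real n ^ 2 * \<bar>B0\<bar> / p <= \<Lambda>"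
   unfolding \<Lambda>_def using nonneg by linarith+
  define s where "s = (%q. A powr (- T q))"
  define \<kappa> where "\<kappa> = (%q. A powr (c * T q))"
  define \<mu> where "\<mu> = (%q. \<Lambda> * A powr (d * T q))"
  \<comment> \<open>The largest bound on second derivatives for which the oscillation over a cube of
    size \<open>3 / \<mu>\<close> is at most \<open>s / \<kappa>\<close>; that condition of
    \<open>stage_cond\<close> holds with equality.\<close>
  define B where "B = (%q. s q * \<mu> q / (3 * real n ^ 2 * \<kappa> q))"
  \<comment> \<open>The neighbourhoods shrink geometrically and keep half of their width in the
    limit.\<close>
  define R where "R = (%q. \<rho> / 2 * (1 + (1/2) ^ q))"
  have s0q: "s 0 = s0" using s0 A1 by (simp add: s_def T_def A_def powr_minus)
  have sp: "0 < s q" and kp: "0 < \<kappa> q" and \<mu>p: "0 < \<mu> q" for q using pos \<Lambda>(1) by (simp_all add: s_def \<kappa>_def \<mu>_def)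
  have Bp: "0 <= B q" for q unfolding B_def using sp \<mu>p kp by (simp add: less_imp_le)
  have k1: "max \<kappa>0 1 <= \<kappa> q" for q
  proof -
   have "c * 1 <= c * T q" using T1 c by (intro mult_left_mono) auto
   hence "A powr c <= \<kappa> q" unfolding \<kappa>_def by (intro mono) simp
   thus ?thesis using A(3) by linarith
  qed
  have sS: "s q ^ 2 * inverse (\<kappa> q) ^ m = (s (Suc q))\<^sup>2" for q
  proof -
   have "s q ^ 2 * inverse (\<kappa> q) ^ m = A powr (- T q * 2 - c * T q * real m)"
    unfolding s_def \<kappa>_def iv pw by (simp add: pw mul)
   also have "c * T q * real m = T q * (c * real m)" by simp
   also have "- T q * 2 - T q * (c * real m) = - T (Suc q) * 2" unfolding cm TS by (simp add: algebra_simps)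
   also have "A powr (- T (Suc q) * 2) = (s (Suc q))\<^sup>2" unfolding s_def by (simp add: pw)
   finally show ?thesis .
  qed
  have \<mu>2: "\<Lambda> * 2 ^ q <= \<mu> q" for q
  proof -
   have "1 * T q <= d * T q" using d3 T1[of q] by (intro mult_right_mono) auto
   hence "A powr T q <= A powr (d * T q)" by (intro mono) simp
   hence "2 ^ q <= A powr (d * T q)" using ATq[of q] by linarith
   thus ?thesis unfolding \<mu>_def using \<Lambda>(1) by (intro mult_left_mono) auto
  qed
  have s2: "s q <= (1/2) ^ q" for q
  proof -
   have "s q = inverse (A powr T q)" unfolding s_def iv by simp
   also have "... <= inverse (2 ^ q)" using ATq[of q] by (intro le_imp_inverse_le) auto
   finally show ?thesis by (simp add: power_one_over inverse_eq_divide)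
  qed
  have sB: "C * s q * \<kappa> q ^ M * \<mu> q <= B (Suc q)" for q
  proof -
   have \<Lambda>2: "0 < \<Lambda> * 2 ^ q" for q :: nat using \<Lambda>(1) by (intro mult_pos_pos zero_less_power) linarith+
   have e1: "(- T q + (c * T q * real M + d * T q)) = T q * (c * real M - 1 + d)" by (simp add: algebra_simps)
   have "C * s q * \<kappa> q ^ M * \<mu> q = C * \<Lambda> * A powr (T q * (c * real M - 1 + d))"
    unfolding s_def \<kappa>_def \<mu>_def pw e1[symmetric] mul[symmetric] by (simp add: mult_ac)
   moreover have "B (Suc q) * (3 * real n ^ 2) = \<Lambda> * A powr (T q * (b * (d - 1) - b * c))"
   proof -
    have e2: "T q * (b * (d - 1) - b * c) = - T (Suc q) + (d * T (Suc q) - c * T (Suc q))" unfolding TS by (simp add: algebra_simps)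
    have gen: "x / (a * k) * a = x * inverse k" if "a ~= 0" for x a k :: real using that by (simp add: field_simps)
    have n0: "real n ^ 2 ~= 0" using n1 by simp
    have "B (Suc q) * (3 * real n ^ 2) = s (Suc q) * \<mu> (Suc q) * inverse (\<kappa> (Suc q))"
     unfolding B_def by (rule gen) (use n0 in simp)
    also have "... = \<Lambda> * A powr (- T (Suc q) + (d * T (Suc q) - c * T (Suc q)))"
     unfolding s_def \<mu>_def \<kappa>_def iv diff_conv_add_uminus[of "d * _"] mul[symmetric] by (simp add: mult_ac)
    finally show ?thesis unfolding e2 .
   qed
   moreover have "3 * real n ^ 2 * (C * \<Lambda> * A powr (T q * (c * real M - 1 + d))) <= \<Lambda> * A powr (T q * (b * (d - 1) - b * c))"
   proof -
    have "\<theta> * 1 <= \<theta> * T q" using \<theta> T1 by (intro mult_left_mono) auto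
    hence "A powr \<theta> <= A powr (T q * \<theta>)" by (intro mono) (simp add: mult.commute)
    hence "3 * real n ^ 2 * C <= A powr (T q * \<theta>)" using A(4) by linarith
    hence "3 * real n ^ 2 * C * A powr (T q * (c * real M - 1 + d)) <= A powr (T q * \<theta>) * A powr (T q * (c * real M - 1 + d))"
     using pos by (intro mult_right_mono) (auto simp: less_imp_le)
    also have "... = A powr (T q * (\<theta> + (c * real M - 1 + d)))" unfolding mul by (simp add: algebra_simps)
    also have "... <= A powr (T q * (b * (d - 1) - b * c))" using exps T1[of q] by (intro mono mult_left_mono) auto
    finally show ?thesis using \<Lambda>(1) by (simp add: mult.left_commute mult.assoc)
   qed
   ultimately have "3 * real n ^ 2 * (C * s q * \<kappa> q ^ M * \<mu> q) <= B (Suc q) * (3 * real n ^ 2)" by (simp only:)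
   thus ?thesis using n1 by simp
  qed
  have stS: "EX v. state g \<sigma> (thick K (R (Suc q))) (s (Suc q)) (B (Suc q)) v &
   c1_close (thick K (R (Suc q))) (C / \<mu> q) (C * s q) u v"
   if st: "state g \<sigma> (thick K (R q)) (s q) (B q) u" for q and u :: "'m => 'n rfun"
  proof -
   have "EX v. state g \<sigma> (thick K (R (Suc q))) (sqrt (s q ^ 2 * inverse (\<kappa> q) ^ m)) (C * s q * \<kappa> q ^ M * \<mu> q) v &
   c1_close (thick K (R (Suc q))) (C / \<mu> q) (C * s q) u v"
   proof (rule step[OF st], intro conjI)
    show "\<kappa>0 <= \<kappa> q" using k1[of q] by simp
    show "0 < \<mu> q" "0 < \<kappa> q" "0 < s q" "0 <= B q" by (rule \<mu>p kp sp Bp)+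
    show "s q * \<kappa> q ^ Suc m <= 1"
    proof -
     have "s q * \<kappa> q ^ Suc m = A powr (T q * (c * real (Suc m) - 1))"
      unfolding s_def \<kappa>_def pw mul by (simp add: algebra_simps)
     also have "... <= A powr 0" using T1[of q] cSm by (intro mono mult_nonneg_nonpos) auto
     finally show ?thesis using A1 by simp
    qed
    show "real n ^ 2 * ((real n + 1) * s q ^ 2) <= 3 * \<gamma>^2"
    proof -
     have "s q ^ 2 = A powr (- T q * 2)" unfolding s_def by (simp add: pw)
     also have "... <= A powr (- 2)" using T1[of q] by (intro mono) auto
     also have "... = inverse (A powr 2)" by (simp add: iv)
     finally have 1: "s q ^ 2 <= inverse (A powr 2)" .
     have "real n ^ 2 * (real n + 1) <= 3 * \<gamma>^2 * A powr 2" using A(5) \<gamma> by (simp add: pos_divide_le_eq mult_ac)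
     hence "real n ^ 2 * (real n + 1) * inverse (A powr 2) <= 3 * \<gamma>^2" using pos[of 2] by (simp add: divide_inverse[symmetric] pos_divide_le_eq del: powr_numeral)
     moreover have "real n ^ 2 * (real n + 1) * s q ^ 2 <= real n ^ 2 * (real n + 1) * inverse (A powr 2)" using 1 by (intro mult_left_mono) auto
     ultimately show ?thesis by (simp add: mult.assoc)
    qed
    have "R q <= \<rho> / 2 * 2" unfolding R_def using \<rho> power_le_one[of "1/2::real" q] by (intro mult_left_mono) auto
    thus "R q <= \<rho>0" using \<rho> by simp
    have n\<mu>: "real n / \<mu> q <= \<rho> / 12 * (1/2) ^ q"
    proof -
     have "12 * real n <= \<rho> * \<Lambda>" using \<Lambda>(3) \<rho> by (simp add: pos_divide_le_eq mult.commute)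
     hence "12 * real n * 2 ^ q <= \<rho> * \<Lambda> * 2 ^ q" by (intro mult_right_mono) auto
     also have "... <= \<rho> * \<mu> q" using \<mu>2[of q] \<rho> by (simp add: mult.assoc)
     finally show ?thesis using \<mu>p[of q] by (simp add: field_simps power_one_over)
    qed
    have lin: "x <= \<rho> / 12 * (1/2) ^ q ==> 3 * x <= \<rho> / 4 * (1/2) ^ q" for x by simp
    have "R q - R (Suc q) = \<rho> / 4 * (1/2) ^ q" by (simp add: R_def algebra_simps)
    thus "3 * real n / \<mu> q <= R q - R (Suc q)" using lin[OF n\<mu>] by (metis times_divide_eq_right)
    show "real n * B q * (3 * real n / \<mu> q) <= s q / \<kappa> q"
     unfolding B_def using n1 \<mu>p[of q] kp[of q] by (simp add: field_simps power2_eq_square)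
    show n\<mu>1: "real n / \<mu> q <= 1"
    proof -
     have "\<Lambda> * 1 <= \<Lambda> * 2 ^ q" using \<Lambda>(1) by (intro mult_left_mono) auto
     hence "real n <= \<mu> q" using \<Lambda>(2) \<mu>2[of q] by linarith
     thus ?thesis using \<mu>p[of q] by simp
    qed
    show "Cg * (real n / \<mu> q) ^ \<beta> <= \<sigma> / 4 * (s q ^ 2 * inverse (\<kappa> q) ^ m)"
    proof -
     have "(real n / \<mu> q) ^ \<beta> = real n ^ \<beta> * inverse (\<Lambda> ^ \<beta>) * A powr (- (d * T q * real \<beta>))"
      unfolding \<mu>_def divide_inverse inverse_mult_distrib power_mult_distrib iv power_inverse pw by (simp add: mult_ac)
     also have "... <= real n ^ \<beta> * inverse \<Lambda> * A powr (- T (Suc q) * 2)"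
     proof (intro mult_mono)
      have "\<Lambda> ^ 1 <= \<Lambda> ^ \<beta>" using \<Lambda>(1) \<beta>(1) by (intro power_increasing) auto
      thus "inverse (\<Lambda> ^ \<beta>) <= inverse \<Lambda>" using \<Lambda>(1) by (intro le_imp_inverse_le) auto
      have "T q * (2 * b) <= T q * (d * real \<beta>)" using b(4) T1[of q] by (intro mult_left_mono) auto
      thus "A powr - (d * T q * real \<beta>) <= A powr (- T (Suc q) * 2)" unfolding TS by (intro mono) (simp add: mult_ac)
     qed (use \<Lambda>(1) in auto)
     also have "A powr (- T (Suc q) * 2) = (s (Suc q))\<^sup>2" unfolding s_def by (simp add: pw)
     finally have "Cg * (real n / \<mu> q) ^ \<beta> <= Cg * (real n ^ \<beta> * inverse \<Lambda> * (s (Suc q))\<^sup>2)" using Cg by (rule mult_left_mono)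
     also have "... = (Cg * real n ^ \<beta> * inverse \<Lambda>) * (s (Suc q))\<^sup>2" by simp
     also have "... <= (\<sigma> / 4) * (s (Suc q))\<^sup>2"
      using \<Lambda>(1,5) \<sigma>(1) by (intro mult_right_mono) (auto simp: field_simps)
     finally show ?thesis unfolding sS .
    qed
   qed
   then obtain v where v: "state g \<sigma> (thick K (R (Suc q))) (sqrt (s q ^ 2 * inverse (\<kappa> q) ^ m)) (C * s q * \<kappa> q ^ M * \<mu> q) v"
    "c1_close (thick K (R (Suc q))) (C / \<mu> q) (C * s q) u v" by blast
   have "sqrt (s q ^ 2 * inverse (\<kappa> q) ^ m) = s (Suc q)" unfolding sS using sp[of "Suc q"] by simp
   hence "state g \<sigma> (thick K (R (Suc q))) (s (Suc q)) (B (Suc q)) v"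
    using state_mono[OF _ sB[of q]] v(1) by simp
   thus ?thesis using v(2) by blast
  qed
  show "EX v H. solution g u0 \<epsilon> \<alpha> H (thick K (\<rho>/2)) v" proof -
   have sub: "thick K (\<rho>/2) \<subseteq> thick K (R q)" for q
    using \<rho> by (intro thick_mono) (simp add: R_def algebra_simps)
   have base: "state g \<sigma> (thick K (R 0)) (s 0) (B 0) u0"
   proof -
    have "s 0 * \<mu> 0 * inverse (\<kappa> 0) = \<Lambda> * (A powr (- 1) * A powr d * A powr (- c))"
     unfolding s_def \<mu>_def \<kappa>_def T_def iv by (simp only: power_0 mult_1_right mult.assoc mult.left_commute)
    also have "A powr (- 1) * A powr d * A powr (- c) = p" unfolding mul p_def by (simp add: algebra_simps)
    finally have "s 0 * \<mu> 0 * inverse (\<kappa> 0) = \<Lambda> * p" .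
    hence Bp0: "B 0 = \<Lambda> * p / (3 * real n ^ 2)"
     unfolding B_def by (metis divide_divide_eq_left divide_inverse mult.commute)
    have "\<bar>B0\<bar> * (3 * real n ^ 2) <= \<Lambda> * p"
     using \<Lambda>(6) pos[of "d - 1 - c"] unfolding p_def by (simp add: pos_divide_le_eq mult_ac)
    hence "\<bar>B0\<bar> <= B 0" unfolding Bp0 using n1 by (simp add: pos_le_divide_eq)
    hence BB: "B0 <= B 0" by linarith
    have "R 0 = \<rho>" by (simp add: R_def)
    thus ?thesis using state_mono[OF st0 BB] by (simp add: s0q \<sigma>_def)
   qed
   \<comment> \<open>The clause on \<open>q = 0\<close> makes the dependent choice start from the
     given map.\<close>
   have "EX u. ALL q. state g \<sigma> (thick K (R q)) (s q) (B q) (u q) & (q = 0 --> u q = u0) &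
    c1_close (thick K (R (Suc q))) (C / \<mu> q) (C * s q) (u q) (u (Suc q))"
   proof -
    have "EX u. ALL q. (state g \<sigma> (thick K (R q)) (s q) (B q) (u q) & (q = 0 --> u q = u0)) &
     c1_close (thick K (R (Suc q))) (C / \<mu> q) (C * s q) (u q) (u (Suc q))"
    proof (rule dependent_nat_choice)
     show "EX u. state g \<sigma> (thick K (R 0)) (s 0) (B 0) u & ((0::nat) = 0 --> u = u0)" using base by blast
     fix u q assume "state g \<sigma> (thick K (R q)) (s q) (B q) u & (q = 0 --> u = u0)"
     hence "state g \<sigma> (thick K (R q)) (s q) (B q) u" by simp
     from stS[OF this] show "EX v. (state g \<sigma> (thick K (R (Suc q))) (s (Suc q)) (B (Suc q)) v & (Suc q = 0 --> v = u0)) &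
      c1_close (thick K (R (Suc q))) (C / \<mu> q) (C * s q) u v" by simp
    qed
    thus ?thesis by simp
   qed
   then obtain u where us: "!!q. state g \<sigma> (thick K (R q)) (s q) (B q) (u q)" and u0: "u 0 = u0"
    and uC: "!!q x a. x:thick K (R (Suc q)) ==> \<bar>u (Suc q) a x - u q a x\<bar> <= C / \<mu> q"
    and uD: "!!q x a i. x:thick K (R (Suc q)) ==> \<bar>pder i (u (Suc q) a) x - pder i (u q a) x\<bar> <= C * s q" by blast
   let ?W = "thick K (\<rho>/2)"
   have ud: "u q a dif x" "pder i (u q a) dif x" "\<bar>pder k (pder i (u q a)) x\<bar> <= B q"
    "\<bar>g j k x - gram (u q) j k x - s q ^ 2 * H0 j k\<bar> <= \<sigma> * s q ^ 2"
    if "x:?W" for x a i j k q using us[of q] sub[of q] that unfolding state_def by blast+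
   have \<Lambda>2: "0 < \<Lambda> * 2 ^ q" for q :: nat using \<Lambda>(1) by (intro mult_pos_pos zero_less_power) linarith+
   have e1: "\<bar>u (Suc q) a x - u q a x\<bar> <= C / \<Lambda> * (1/2) ^ q" if "x:?W" for x a q
   proof -
    have "C / \<mu> q <= C / (\<Lambda> * 2 ^ q)"  by (rule divide_left_mono[OF \<mu>2 less_imp_le[OF C] mult_pos_pos[OF \<mu>p \<Lambda>2]])
    also have "C / (\<Lambda> * 2 ^ q) = C / \<Lambda> * (1/2) ^ q" by (simp add: power_divide)
    finally show ?thesis using uC[OF subsetD[OF sub[of "Suc q"] that], of a] by linarith
   qed
   have e2: "\<bar>pder i (u (Suc q) a) x - pder i (u q a) x\<bar> <= C * (1/2) ^ q" if "x:?W" for x a q i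
    using uD[OF subsetD[OF sub[of "Suc q"] that], of i a] mult_left_mono[OF s2[of q], of C] C by linarith
   have sm: "summable (%q. k * (1/2::real) ^ q)" for k by (intro summable_mult summable_geometric) simp
   have "EX v. (ALL x:?W. v dif x & (ALL i. (%q. pder i (u q a) x) \<longlonglongrightarrow> pder i v x) & \<bar>v x - u0 a x\<bar> <= \<epsilon>)" for a
   proof -
    have "(\<Sum>r. C / \<Lambda> * (1/2::real) ^ (r + 0)) = 2 * (C / \<Lambda>)"
     using sums_unique[OF sums_mult[OF geometric_sums[of "1/2::real"], of "C / \<Lambda>"]] by (simp add: mult.commute)
    also have "... <= \<epsilon>" using \<Lambda>(1,4) \<epsilon> by (simp add: field_simps)
    finally have sum: "(\<Sum>r. C / \<Lambda> * (1/2::real) ^ (r + 0)) <= \<epsilon>" .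
    show ?thesis
    proof (rule c1_limit[where u="%q. u q a" and W="?W", OF open_thick ud(1) e1 sm e2 sm])
     fix v assume v: "!!x. x:?W ==> v dif x"
      "!!x i. x:?W ==> (%q. pder i (u q a) x) \<longlonglongrightarrow> pder i v x"
      "!!x q. x:?W ==> \<bar>v x - u q a x\<bar> <= (\<Sum>r. C / \<Lambda> * (1/2) ^ (r + q))"
     have "\<bar>v x - u0 a x\<bar> <= \<epsilon>" if "x:?W" for x using v(3)[OF that, of 0] sum unfolding u0 by linarith
     thus ?thesis using v(1,2) by blast
    qed
   qed
   then obtain v where v: "!!a x. x:?W ==> v a dif x"
    "!!a x i. x:?W ==> (%q. pder i (u q a) x) \<longlonglongrightarrow> pder i (v a) x" "!!a x. x:?W ==> \<bar>v a x - u0 a x\<bar> <= \<epsilon>"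
    by metis
   have gram: "gram v j k x = g j k x" if x: "x:?W" for x j k
   proof -
    have s0': "s \<longlonglongrightarrow> 0"
    proof (rule tendsto_sandwich[OF _ _ tendsto_const])
     show "(%q. (1/2::real) ^ q) \<longlonglongrightarrow> 0" by (rule LIMSEQ_power_zero) simp
    qed (use s2 sp in \<open>auto simp: less_imp_le\<close>)
    have L1: "(%q. g j k x - gram (u q) j k x - s q ^ 2 * H0 j k)
     \<longlonglongrightarrow> g j k x - gram v j k x - 0^2 * H0 j k"
     by (intro tendsto_intros v(2)[OF x] s0')
    have "(%q. \<sigma> * s q ^ 2) \<longlonglongrightarrow> \<sigma> * 0^2" by (intro tendsto_intros s0')
    hence L0: "(%q. \<sigma> * s q ^ 2) \<longlonglongrightarrow> 0" by simp
    have L2: "(%q. g j k x - gram (u q) j k x - s q ^ 2 * H0 j k) \<longlonglongrightarrow> 0"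
     by (rule Lim_null_comparison[OF always_eventually L0]) (unfold real_norm_def, rule allI, rule ud(4)[OF x])
    show ?thesis using LIMSEQ_unique[OF L1 L2] by simp
   qed
   define \<eta> where "\<eta> = A powr (- (\<zeta> * (b - 1)))"
   define H1 where "H1 = (2 * C) powr (1 - \<alpha>) * (2 * real n * \<Lambda>) powr \<alpha>"
   have H1: "0 <= H1" by (simp add: H1_def)
   have \<eta>: "0 < \<eta>" "\<eta> < 1"
   proof -
    have "A powr (- (\<zeta> * (b - 1))) < A powr 0" using A b \<zeta> by (intro powr_less_mono) auto
    thus "0 < \<eta>" "\<eta> < 1" using A1 by (simp_all add: \<eta>_def)
   qed
   have BB: "B q <= \<Lambda> * A powr ((d - 1) * b * T q)" "B (Suc q) <= \<Lambda> * A powr ((d - 1) * b * T q)" for q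
   proof -
    have 1: "B q <= \<Lambda> * A powr ((d - 1) * T q)" for q
    proof -
     have "1 <= 3 * real n ^ 2" using one_le_power[OF n1, of 2] by linarith
     hence "1 * 1 <= 3 * real n ^ 2 * \<kappa> q" using k1[of q] by (intro mult_mono) auto
     hence d: "1 <= 3 * real n ^ 2 * \<kappa> q" by simp
     have "0 <= s q * \<mu> q" using sp[of q] \<mu>p[of q] by simp
     hence "B q <= s q * \<mu> q / 1" unfolding B_def by (rule divide_left_mono[OF d]) (use d in linarith)
     also have "... = \<Lambda> * A powr ((d - 1) * T q)" unfolding s_def \<mu>_def by (simp add: mul algebra_simps flip: powr_add)
     finally show ?thesis .
    qed
    show "B (Suc q) <= \<Lambda> * A powr ((d - 1) * b * T q)" using 1[of "Suc q"] by (simp add: TS mult.assoc)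
    have "(d - 1) * T q <= (d - 1) * b * T q" using d3 b T1[of q] by (intro mult_right_mono) auto
    from mult_left_mono[OF mono[OF this], of \<Lambda>] show "B q <= \<Lambda> * A powr ((d - 1) * b * T q)" using 1[of q] \<Lambda>(1) by linarith
   qed
   \<comment> \<open>A gradient increment is O(\<open>s q\<close>) and, by the mean value theorem
     along the segment, also O(\<open>A^((d - 1) b T q)\<close>) times the distance. The geometric
     mean with weights \<open>1 - \<alpha>\<close> and \<open>\<alpha>\<close> has the exponent
     \<open>- \<zeta> T q\<close>, so the increments are summable.\<close>
   have hol: "\<bar>pder i (v a) x - pder i (v a) y\<bar> <= (real n * B 0 + H1 * (1 / (1 - \<eta>))) * norm (x - y) powr \<alpha>"
    if seg: "closed_segment x y \<subseteq> ?W" and n1': "norm (x - y) <= 1" for x y i a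
   proof -
    let ?N = "norm (x - y)" let ?D = "%q. pder i (u q a) x - pder i (u q a) y"
    have xy: "x:?W" "y:?W" using seg by auto
    have mv: "\<bar>?D q\<bar> <= real n * B q * ?N" for q unfolding n
     by (rule mean_value_convex[OF convex_closed_segment[of x y] ud(2) ud(3)]) (use seg in auto)
    have w: "\<bar>?D (Suc q) - ?D q\<bar> <= H1 * ?N powr \<alpha> * \<eta> ^ q" for q
    proof -
     let ?z = "\<bar>?D (Suc q) - ?D q\<bar>" let ?Q = "2 * real n * \<Lambda> * A powr ((d - 1) * b * T q) * ?N"
     have z1: "?z <= 2 * C * s q"
      using uD[OF subsetD[OF sub[of "Suc q"] xy(1)], of i a] uD[OF subsetD[OF sub[of "Suc q"] xy(2)], of i a] by linarith
     have z2: "?z <= ?Q"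
     proof -
      have "real n * B r * ?N <= real n * (\<Lambda> * A powr ((d - 1) * b * T q)) * ?N" if "r:{q, Suc q}" for r
       using BB[of q] that by (intro mult_right_mono mult_left_mono) auto
      from this[of q] this[of "Suc q"] show ?thesis using mv[of q] mv[of "Suc q"] by (simp add: mult.assoc)
     qed
     have "?z <= (2 * C * s q) powr (1 - \<alpha>) * ?Q powr \<alpha>"
      by (rule interpolate_le[OF _ z1 z2 \<alpha>(1) \<alpha>1]) simp
     also have "... = H1 * ?N powr \<alpha> * A powr (- T q * (1 - \<alpha>) + (d - 1) * b * T q * \<alpha>)"
      unfolding H1_def powr_add s_def using C \<Lambda>(1) n1 A1
      by (simp add: powr_mult powr_powr mult_ac)
     also have "- T q * (1 - \<alpha>) + (d - 1) * b * T q * \<alpha> = - (\<zeta> * T q)" by (simp add: \<zeta>_def algebra_simps)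
     also have "A powr (- (\<zeta> * T q)) <= \<eta> ^ q"
     proof -
      have "\<zeta> * (real q * (b - 1)) <= \<zeta> * T q" using TB[of q] \<zeta> by (intro mult_left_mono) auto
      thus ?thesis unfolding \<eta>_def pw by (intro mono) (simp add: mult_ac)
     qed
     finally show ?thesis using H1 by (simp add: mult_left_mono)
    qed
    have N\<alpha>: "?N <= ?N powr \<alpha>" using powr_mono'[of \<alpha> 1 ?N] \<alpha>1 n1' by simp
    have ps: "(SUM r<q. \<eta> ^ r) <= 1 / (1 - \<eta>)" for q :: nat
     using sum_le_suminf[of "%r. \<eta> ^ r" "{..<q}"] suminf_geometric[of \<eta>] summable_geometric[of \<eta>] \<eta> by simp
    have "\<bar>?D q\<bar> <= real n * B 0 * ?N + H1 * ?N powr \<alpha> * (SUM r<q. \<eta> ^ r)" for q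
    proof (induction q)
     case 0 show ?case using mv[of 0] by simp
    next
     case (Suc q) thus ?case using w[of q] by (simp add: distrib_left)
    qed
    also have "real n * B 0 * ?N + H1 * ?N powr \<alpha> * (SUM r<q. \<eta> ^ r) <= real n * B 0 * ?N powr \<alpha> + H1 * ?N powr \<alpha> * (1 / (1 - \<eta>))" for q
     using N\<alpha> ps[of q] H1 Bp[of 0] n1 by (intro add_mono mult_left_mono) auto
    finally have bd: "\<bar>?D q\<bar> <= (real n * B 0 + H1 * (1 / (1 - \<eta>))) * ?N powr \<alpha>" for q by (simp add: algebra_simps)
    have "(%q. \<bar>?D q\<bar>) \<longlonglongrightarrow> \<bar>pder i (v a) x - pder i (v a) y\<bar>" by (intro tendsto_intros v(2) xy)
    thus ?thesis by (rule LIMSEQ_le_const2) (use bd in blast)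
   qed
   show ?thesis by (rule exI[of _ v], rule exI[of _ "real n * B 0 + H1 * (1 / (1 - \<eta>))"]) (use v gram hol in blast)
  qed
 qed
qed

end

section \<open>Spirals\<close>

text \<open>For spirals the parameter is the frequency \<open>p >= 1\<close> over a fixed open set;
  the principal filter turns eventual statements into statements for all such
  \<open>p\<close>.\<close>

locale patch =
 fixes W :: "(real^'n) set"
 assumes W: "open W"

sublocale patch \<subseteq> symbols "principal {1::real..}" "%_. W" using W by unfold_locales simp

context patch
begin

definition sm :: "'n::finite rfun => bool" where
 "sm f \<longleftrightarrow> symb (%_. 1) (%_. 1) (%_. f)"

lemma ev1 [simp]: "(\<forall>\<^sub>F p in principal {1::real..}. Q p) \<longleftrightarrow> (ALL p>=1. Q p)"
 by (auto simp: eventually_principal)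

lemma symb_fix:
 assumes "symb A L f" "1 <= q" shows "sm (f q)"
proof -
 have b: "bdd0 (%_. 1) (%_. f q)" if bb: "bdd0 A f" for A f
 proof -
  obtain C where "!!x. x:W ==> \<bar>f q x\<bar> <= C * \<bar>A q\<bar>" using bb assms(2) unfolding bdd0_def ev1 by blast
  thus ?thesis by (auto simp: bdd0_def intro!: exI[of _ "C * \<bar>A q\<bar>"])
 qed
 have "bddk k A L f ==> bddk k (%_. 1) (%_. 1) (%_. f q)" for k
 proof (induction k arbitrary: A f)
  case 0
  thus ?case using b by simp
 next
  case (Suc k)
  hence "bdd0 A f" by simp
  from b[OF this] have "bdd0 (%_. 1) (%_. f q)" .
  moreover have "bddk k (%_. 1) (%_. 1) (%_. pder i (f q))" for i
   using Suc.IH[of "%p. A p * L p" "%p. pder i (f p)"] Suc.prems by simp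
  ultimately show ?case using Suc.prems assms(2) by simp
 qed
 thus ?thesis using assms(1) by (simp add: sm_def symb_def)
qed

lemma sm_diff: "sm f ==> x:W ==> f dif x"
 using symb_differentiable[of "%_. 1" "%_. 1" "%_. f"] by (auto simp: sm_def)

lemma sm_pder: "sm f ==> sm (pder i f)"
 unfolding sm_def using symb_pder[of "%_. 1" "%_. 1" "%_. f" i] by simp

lemma sm_slow: "sm f ==> slow (%_. 1) (%_. f)"
 unfolding slow_def using sm_pder by (simp add: sm_def)

text \<open>The same normal oscillation with tangential corrector as in a stage, but with an
  amplitude that is not small. The corrector of doubled frequency then has first derivatives of
  order 1. Their products, of fourth order in the amplitude, form the error that no frequency
  removes; all the rest is O(\<open>1 / p\<close>).\<close>

lemma nash_step:
 fixes u :: "'m::finite => 'n::finite rfun" and \<psi> :: "'m => 'n option" and D \<delta> :: real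
 assumes \<psi>: "bij \<psi>" and u: "!!b. sm (u b)" and a: "sm a"
  and c: "0 < c" and low: "!!x. x:W ==> c <= norm (nrm \<psi> (%i. \<chi> b. pder i (u b) x))"
  and D: "!!x i. x:W ==> norm (cotan \<psi> (%i. \<chi> b. pder i (u b) x) i) <= D"
  and \<delta>: "!!x i. x:W ==> \<bar>a x * \<xi> $ i\<bar> <= \<delta>"
 shows "EX C. ALL p>=1. EX v. (ALL b. sm (v b)) & (ALL x:W. (ALL b. \<bar>v b x - u b x\<bar> <= C / p) &
  (ALL j k. \<bar>gram v j k x - gram u j k x - a x ^ 2 / 2 * (\<xi> $ j * \<xi> $ k)\<bar>
   <= (real CARD('n) * D * \<delta>^2)\<^sup>2 + C / p))"
proof -
 define X where "X = (%i x. \<chi> b. pder i (u b) x)"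
 define N where "N = (%b x. nu \<psi> (%i. X i x) $ b)"
 define T where "T = (%i b x. cotan \<psi> (%i. X i x) i $ b)"
 let ?L = "%p::real. p" and ?I = "%p::real. 1 / p"
 have X: "slow (%_. 1) (%_ x. X i x $ b)" for i b
  using sm_slow[OF sm_pder[OF u]] by (simp add: X_def)
 have lowX: "\<forall>\<^sub>F p in principal {1::real..}. ALL x:W. c <= norm (nrm \<psi> (%i. X i x))"
  using low by (simp add: X_def)
 have N: "slow (%_. 1) (%_. N b)" and T: "slow (%_. 1) (%_. T i b)" for i b
  unfolding N_def T_def using slow_frame[of "%_. 1" "%i _. X i", OF X c lowX] by auto
 have up: "symb (%_. 1) ?L (%_. h)" if "symb (%_. 1) (%_. 1) (%_. h)" for h
  by (rule symb_mono1[OF that]) auto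
 note slo = slow_symb slow_pder
 have N0: "symb (%_. 1) ?L (%_. N b)" "symb (%_. 1) ?L (%_. pder j (N b))"
  and T0: "symb (%_. 1) ?L (%_. T i b)" "symb (%_. 1) ?L (%_. pder j (T i b))"
  and u0: "symb (%_. 1) ?L (%_. u b)" "symb (%_. 1) ?L (%_. pder j (u b))"
  and a0: "symb (%_. 1) ?L (%_. a)" "symb (%_. 1) ?L (%_. pder j a)" for i j b
  by (intro up slo[OF N] slo[OF T] slo[OF sm_slow[OF u]] slo[OF sm_slow[OF a]])+
 have sc: "symb (%_. 1) ?L (%p x. sin (p * (x \<bullet> \<xi>)))" "symb (%_. 1) ?L (%p x. sin (2 * p * (x \<bullet> \<xi>)))"
  "symb (%_. 1) ?L (%p x. cos (p * (x \<bullet> \<xi>)))" "symb (%_. 1) ?L (%p x. cos (2 * p * (x \<bullet> \<xi>)))"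
  using symb_sin_cos[where c=1 and l="?L"] symb_sin_cos[where c=2 and l="?L"] by simp_all
 have I: "symb ?I ?L (%p x. 1 / p * f p x)" if "symb (%_. 1) ?L f" for f
  using symb_scale[OF that, of ?I] by simp
 have I0: "symb (%_. 1) ?L f" if "symb ?I ?L f" for f by (rule symb_mono1[OF that]) auto
 define f where "f = (%p x. 1 / p * (a x * sin (p * (x \<bullet> \<xi>))))"
 define w where "w = (%k p x. \<xi> $ k / 4 * (1 / (2 * p) * (a x * a x * sin (2 * p * (x \<bullet> \<xi>)))))"
 define f' where "f' = (%j p x. a x * \<xi> $ j * cos (p * (x \<bullet> \<xi>)) + 1 / p * (pder j a x * sin (p * (x \<bullet> \<xi>))))"
 \<comment> \<open>The map \<open>v\<close> contains \<open>- w\<close>, whose derivatives are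
   \<open>q0 + q1\<close>: \<open>q0\<close> is the part that does not decay with the frequency,
   \<open>q1\<close> is O(\<open>1 / p\<close>).\<close>
 define q0 where "q0 = (%k j p x. - (\<xi> $ k / 4 * (a x * a x * \<xi> $ j * cos (2 * p * (x \<bullet> \<xi>)))))"
 define q1 where "q1 = (%k j p x. 1 / p * (- (\<xi> $ k / 4) * (a x * pder j a x * sin (2 * p * (x \<bullet> \<xi>)))))"
 have aW: "a dif x" if "x:W" for x by (rule sm_diff[OF a that])
 have fd: "f p dif x" "pder j (f p) x = f' j p x" if "x:W" "1 <= p" for x p j
  unfolding f_def f'_def using phi_pder[OF aW[OF that(1)], of p] that(2) by auto
 have wd: "w k p dif x" "pder j (w k p) x = - (q0 k j p x + q1 k j p x)" if x: "x:W" and p: "1 <= p" for x p j k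
 proof -
  have aa: "(%x. a x * a x) dif x" by (intro differentiable_mult aW x)
  have p2: "2 * p ~= 0" using p by simp
  note P = phi_pder[where \<xi>=\<xi>, OF aa p2]
  show "w k p dif x" unfolding w_def by (rule differentiable_mult[OF differentiable_const P(1)])
  show "pder j (w k p) x = - (q0 k j p x + q1 k j p x)"
   unfolding w_def q0_def q1_def pder_cmult[OF P(1)] P(2) pder_mult[OF aW[OF x] aW[OF x]] using p by (simp add: field_simps)
 qed
 have f0: "symb ?I ?L f" unfolding f_def by (intro I symb_mult1 a0 sc)
 have f'0: "symb (%_. 1) ?L (f' j)" for j
  unfolding f'_def by (intro symb_add I0[OF I] symb_mult1 a0 sc symb_const1)
 have w0: "symb ?I ?L (w k)" for k
 proof -
  have "w k = (%p x. 1 / p * (\<xi> $ k / 8 * (a x * a x * sin (2 * p * (x \<bullet> \<xi>)))))" by (simp add: w_def fun_eq_iff)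
  thus ?thesis by (simp only:) (intro I symb_cmult symb_mult1 a0 sc)
 qed
 have q00: "symb (%_. 1) ?L (q0 k j)" for k j
  unfolding q0_def by (intro symb_uminus symb_cmult symb_mult1 a0 sc symb_const1)
 have q10: "symb ?I ?L (q1 k j)" for k j unfolding q1_def by (intro I symb_cmult symb_mult1 a0 sc)
 define P0 where "P0 = (%j b p x. SU i. q0 i j p x * T i b x)"
 define W' where "W' = (%j b p x. - (SU i. w i p x * pder j (T i b) x))"
 define Z where "Z = (%j b p x. W' j b p x + f p x * pder j (N b) x)"
 define Y where "Y = (%j b p x. (SU i. q1 i j p x * T i b x) + Z j b p x)"
 have P00: "symb (%_. 1) ?L (P0 j b)" for j b unfolding P0_def by (intro symb_sum symb_mult1 q00 T0)
 have W0: "symb ?I ?L (W' j b)" for j b unfolding W'_def by (intro symb_uminus symb_sum symb_mult2[OF w0] T0)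
 have Z0: "symb ?I ?L (Z j b)" for j b unfolding Z_def by (intro symb_add W0 symb_mult2[OF f0] N0)
 have Y0: "symb ?I ?L (Y j b)" for j b unfolding Y_def by (intro symb_add symb_sum Z0 symb_mult2[OF q10] T0)
 define v where "v = (%p b x. u b x + (f p x * N b x - (SU i. w i p x * T i b x)))"
 have vu: "symb ?I ?L (%p x. f p x * N b x - (SU i. w i p x * T i b x))" for b
  by (intro symb_diff symb_sum symb_mult2[OF f0] symb_mult2[OF w0] N0 T0)
 have vs: "symb (%_. 1) ?L (%p. v p b)" for b unfolding v_def by (intro symb_add u0 I0[OF vu])
 have Td: "T i b dif x" and Nd: "N b dif x" if "x:W" for i b x
  using symb_differentiable[OF T0(1)] symb_differentiable[OF N0(1)] that unfolding ev1 by blast+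
 have vd: "pder j (v p b) x = pder j (u b) x + (P0 j b p x + Y j b p x) + f' j p x * N b x" if x: "x:W" and p: "1 <= p" for j p b x
 proof -
  note d = fd[OF x p] wd[OF x p] Td[OF x] Nd[OF x]
  have wT: "(%x. w i p x * T i b x) dif x" for i by (intro differentiable_mult d)
  have d1: "(%x. SU i. w i p x * T i b x) dif x" by (intro differentiable_sum finite ballI wT)
  have d2: "(%x. f p x * N b x) dif x" by (intro differentiable_mult d)
  have d3: "(%x. f p x * N b x - (SU i. w i p x * T i b x)) dif x" by (rule differentiable_diff[OF d2 d1])
  show ?thesis unfolding v_def pder_add[OF sm_diff[OF u x] d3] pder_diff[OF d2 d1] pder_sum[OF finite wT]
    pder_mult[OF d(1) d(6)] pder_mult[OF d(3) d(5)] d(2) d(4) P0_def Y_def Z_def W'_def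
   by (simp add: sum.distrib sum_negf sum_subtractf algebra_simps)
 qed
 define R where "R = (%j k p x. 1 / p * (1 / p * (1 / 2 * (pder j a x * pder k a x) * (1 - cos (2 * p * (x \<bullet> \<xi>)))))
  + 1 / p * (sin (2 * p * (x \<bullet> \<xi>)) * (1 / 4 * a x * (\<xi> $ j * pder k a x + \<xi> $ k * pder j a x)))
  + f p x * (SU b. pder j (N b) x * pder k (u b) x + pder k (N b) x * pder j (u b) x)
  + (SU b. W' j b p x * pder k (u b) x + W' k b p x * pder j (u b) x)
  + (f' j p x * (SU b. N b x * Z k b p x) + f' k p x * (SU b. N b x * Z j b p x))
  + (SU b. P0 j b p x * Y k b p x + Y j b p x * P0 k b p x + Y j b p x * Y k b p x))"
 have R0: "symb ?I ?L (R j k)" for j k unfolding R_def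
  by (intro symb_add I I0[OF I] symb_sum symb_mult1[OF P00 Y0] symb_mult2[OF Y0 P00] symb_mult2[OF Y0 I0[OF Y0]]
    symb_mult2[OF f0] symb_mult2[OF W0] symb_mult1[OF f'0 symb_sum[OF symb_mult1[OF N0(1) Z0]]])
   (intro symb_sum symb_add symb_mult1 symb_diff symb_const1 sc a0 N0 u0)+
 have R: "(SU b. pder j (v p b) x * pder k (v p b) x) - gram u j k x - a x ^ 2 / 2 * (\<xi> $ j * \<xi> $ k)
  = (SU b. P0 j b p x * P0 k b p x) + R j k p x" if x: "x:W" and p: "1 <= p" for j k p x
 proof -
  let ?Xp = "%i. X i x"
  have n0: "nrm \<psi> ?Xp ~= 0" using low[OF x] c by (auto simp: X_def)
  define vec where "vec = (%F :: 'm => real. \<chi> b. F b)"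
  have in1: "vec F \<bullet> vec G = (SU b. F b * G b)" for F G by (simp add: vec_def inner_vec_def)
  define Pt where "Pt = (%j b. SU i. (q0 i j p x + q1 i j p x) * T i b x)"
  have Pt: "Pt j b + Z j b p x = P0 j b p x + Y j b p x" for j b
   by (simp add: Pt_def P0_def Y_def sum.distrib distrib_right)
  have Xv: "?Xp j = vec (%b. pder j (u b) x)" for j by (simp add: X_def vec_def)
  have "vec (%b. pder j (v p b) x) \<bullet> vec (%b. pder k (v p b) x) = ?Xp j \<bullet> ?Xp k + ((q0 k j p x + q1 k j p x) + (q0 j k p x + q1 j k p x)
     + f p x * (vec (%b. pder j (N b) x) \<bullet> ?Xp k + vec (%b. pder k (N b) x) \<bullet> ?Xp j) + f' j p x * f' k p x)
    + ((vec (%b. W' j b p x) \<bullet> ?Xp k + vec (%b. W' k b p x) \<bullet> ?Xp j) + f' j p x * (vec (%b. N b x) \<bullet> vec (%b. Z k b p x))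
     + f' k p x * (vec (%b. N b x) \<bullet> vec (%b. Z j b p x))
     + (vec (Pt j) + vec (%b. Z j b p x)) \<bullet> (vec (Pt k) + vec (%b. Z k b p x)))"
  proof (rule gram_expand[where T="cotan \<psi> ?Xp" and w'="%i j. q0 i j p x + q1 i j p x" and X="?Xp"])
   have Nn: "vec (%b. N b x) = nu \<psi> ?Xp" by (simp add: N_def vec_def)
   show "cotan \<psi> ?Xp i \<bullet> ?Xp j = (if i = j then 1 else 0)" for i j by (rule cotan_dual[OF \<psi> n0])
   show "cotan \<psi> ?Xp i \<bullet> vec (%b. N b x) = 0" for i unfolding Nn by (rule cotan_nu[OF \<psi> n0])
   show "vec (%b. N b x) \<bullet> vec (%b. N b x) = 1" unfolding Nn by (rule nu_unit[OF \<psi> n0])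
   show "vec (%b. N b x) \<bullet> ?Xp i = 0" for i unfolding Nn by (rule nu_orth[OF \<psi> n0])
   show "vec (Pt j) = (SU i. (q0 i j p x + q1 i j p x) *\<^sub>R cotan \<psi> ?Xp i)" for j
    by (simp add: Pt_def T_def vec_def vec_eq_iff)
   show "vec (%b. Z j b p x) = vec (%b. W' j b p x) + f p x *\<^sub>R vec (%b. pder j (N b) x)" for j
    by (simp add: Z_def vec_def vec_eq_iff)
   show "vec (%b. pder j (v p b) x) = ?Xp j + vec (Pt j) + vec (%b. Z j b p x) + f' j p x *\<^sub>R vec (%b. N b x)" for j
    using Pt[of j] by (simp add: vec_def X_def vec_eq_iff vd[OF x p] add.assoc)
  qed
  moreover have "(vec (Pt j) + vec (%b. Z j b p x)) \<bullet> (vec (Pt k) + vec (%b. Z k b p x)) = (SU b. P0 j b p x * P0 k b p x)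
    + (SU b. P0 j b p x * Y k b p x + Y j b p x * P0 k b p x + Y j b p x * Y k b p x)"
  proof -
   have "vec (Pt j) + vec (%b. Z j b p x) = vec (%b. P0 j b p x + Y j b p x)" for j
    using Pt[of j] by (simp add: vec_def vec_eq_iff)
   thus ?thesis by (simp add: in1 sum.distrib[symmetric] algebra_simps)
  qed
  moreover have "f' j p x * f' k p x = a x ^ 2 / 2 * (\<xi> $ j * \<xi> $ k) - ((q0 k j p x + q1 k j p x) + (q0 j k p x + q1 j k p x))
   + 1 / p * (1 / p * (1 / 2 * (pder j a x * pder k a x) * (1 - cos (2 * p * (x \<bullet> \<xi>)))))
  + 1 / p * (sin (2 * p * (x \<bullet> \<xi>)) * (1 / 4 * a x * (\<xi> $ j * pder k a x + \<xi> $ k * pder j a x)))"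
  proof -
   have p0: "p ~= 0" using p by simp
   note oe = osc_expand[OF aW[OF x] p0, of j \<xi> k 0]
   have w: "(%x. \<xi> $ k / 4 * (1 / (2 * p) * (a x * a x * sin (2 * p * (x \<bullet> \<xi>))))) = w k p"
    "(%x. 1 / p * (a x * sin (p * (x \<bullet> \<xi>)))) = f p" for k by (simp_all add: w_def f_def)
   have e1: "1 / p * (1 / p * (1 / 2 * (y * z) * (1 - c))) = y * z / (2 * p^2) + c * (- (y * z) / (2 * p^2))" for y z c :: real
    using p0 by (simp add: power2_eq_square field_simps)
   have e2: "1 / p * (c * (1 / 4 * y * z)) = c * (y / (4 * p) * z)" for y z c :: real
    using p0 by (simp add: field_simps)
   show ?thesis unfolding e1 e2 using oe[unfolded w fd(2)[OF x p] wd(2)[OF x p]] by simp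
  qed
  ultimately show ?thesis unfolding R_def Xv in1 sum.distrib by linarith
 qed
 obtain C1 where C1: "0 < C1" "!!b p x. 1 <= p ==> x:W ==> \<bar>f p x * N b x - (SU i. w i p x * T i b x)\<bar> <= C1 * \<bar>1 / p\<bar>"
  using symb_uniform[where f="%b p x. f p x * N b x - (SU i. w i p x * T i b x)", OF vu] unfolding ev1 by blast
 obtain C2 where C2: "0 < C2" "!!jk p x. 1 <= p ==> x:W ==> \<bar>R (fst jk) (snd jk) p x\<bar> <= C2 * \<bar>1 / p\<bar>"
  using symb_uniform[where f="%jk. R (fst jk) (snd jk)", OF R0] unfolding ev1 by blast
 define C where "C = C1 + C2"
 have PP: "\<bar>SU b. P0 j b p x * P0 k b p x\<bar> <= (real CARD('n) * D * \<delta>^2)\<^sup>2" if x: "x:W" for j k p x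
 proof -
  have P: "norm (\<chi> b. P0 j b p x) <= real CARD('n) * D * \<delta>^2" for j
  proof -
   have "(\<chi> b. P0 j b p x) = (SU i. q0 i j p x *\<^sub>R cotan \<psi> (%i. X i x) i)"
    by (simp add: P0_def T_def vec_eq_iff)
   also have "norm ... <= (SUM i:(UNIV::'n set). \<delta>^2 * D)"
   proof (rule sum_norm_le)
    fix i
    have "\<bar>q0 i j p x\<bar> = \<bar>a x * \<xi> $ i\<bar> * \<bar>a x * \<xi> $ j\<bar> * (\<bar>cos (2 * p * (x \<bullet> \<xi>))\<bar> / 4)" by (simp add: q0_def abs_mult)
    also have "... <= \<delta> * \<delta> * 1" using order_trans[OF abs_ge_zero \<delta>[OF x]] order_trans[OF abs_cos_le_one, of 4]
     by (intro mult_mono \<delta>[OF x]) auto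
    finally show "norm (q0 i j p x *\<^sub>R cotan \<psi> (%i. X i x) i) <= \<delta>^2 * D"
     unfolding norm_scaleR real_norm_def power2_eq_square using D[OF x] by (intro mult_mono) (auto simp: X_def)
   qed
   finally show ?thesis by (simp add: mult_ac)
  qed
  have "(SU b. P0 j b p x * P0 k b p x) = (\<chi> b. P0 j b p x) \<bullet> (\<chi> b. P0 k b p x)" by (simp add: inner_vec_def)
  also have "\<bar>...\<bar> <= norm (\<chi> b. P0 j b p x) * norm (\<chi> b. P0 k b p x)" by (rule Cauchy_Schwarz_ineq2)
  also have "... <= (real CARD('n) * D * \<delta>^2)\<^sup>2"
   unfolding power2_eq_square[of "_ * _ * _"] using P order_trans[OF norm_ge_zero P] by (intro mult_mono) auto
  finally show ?thesis .
 qed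
 show ?thesis
 proof (rule exI[of _ C], intro allI impI, goal_cases)
  case p: (1 p)
  have d: "C1 * \<bar>1 / p\<bar> <= C / p" "C2 * \<bar>1 / p\<bar> <= C / p" using p C1(1) C2(1) by (simp_all add: C_def divide_right_mono)
  show ?case
  proof (rule exI[of _ "v p"], intro conjI allI ballI)
   fix b show "sm (v p b)" by (rule symb_fix[OF vs p])
  next
   fix x b assume "x:W"
   thus "\<bar>v p b x - u b x\<bar> <= C / p" using C1(2)[OF p, of x b] d(1) by (simp add: v_def)
  next
   fix x j k assume x: "x:W"
   show "\<bar>(SU b. pder j (v p b) x * pder k (v p b) x) - gram u j k x - a x ^ 2 / 2 * (\<xi> $ j * \<xi> $ k)\<bar>
   <= (real CARD('n) * D * \<delta>^2)\<^sup>2 + C / p"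
    unfolding R[OF x p] using PP[OF x, of j p k] C2(2)[OF p x, of "(j, k)"] d(2) by simp
  qed
 qed
qed

end

section \<open>Many spirals: uniform frames and decomposition of metrics\<close>

lemma gram_inner: "gram u j k x = (\<chi> b. pder j (u b) x) \<bullet> (\<chi> b. pder k (u b) x)"
 by (simp add: inner_vec_def)

text \<open>The frames themselves serve as the parameter: \<open>slow_frame\<close>, applied to
  functions constant in \<open>x\<close>, bounds the dual frame uniformly over the set
  \<open>S\<close>.\<close>

lemma cotan_upper:
 fixes \<psi> :: "'m::finite => 'n::finite option" and \<gamma> \<Gamma> :: real
 assumes \<psi>: "bij \<psi>" and \<gamma>: "0 < \<gamma>"
 shows "EX D>0. ALL X. (ALL v::real^'n. \<gamma> * norm v <= norm (lcomb v X)) --> (ALL i. norm (X i) <= \<Gamma>)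
  --> (ALL i. norm (cotan \<psi> X i) <= D)"
proof -
 define S where "S = {X :: 'n => real^'m. (ALL v::real^'n. \<gamma> * norm v <= norm (lcomb v X)) & (ALL i. norm (X i) <= \<Gamma>)}"
 interpret symbols "principal S" "%_. UNIV :: (real^'n) set" by unfold_locales simp
 obtain c where c: "c > 0" "!!X. X:S ==> c <= norm (nrm \<psi> X)"
  using nrm_lower[OF \<psi> \<gamma>, of \<Gamma>] unfolding S_def by blast
 have X: "slow (%_. 1) (%X x. X i $ a)" for i a
 proof -
  have "symb (%_. 1) (%_. 1) (%X x. X i $ a)"
  proof (rule symb_mono[OF symb_const])
   have "\<bar>X i $ a\<bar> <= \<Gamma>" if "X:S" for X
    using component_le_norm_cart[of "X i" a] that unfolding S_def by (auto intro: order_trans)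
   thus "\<forall>\<^sub>F X in principal S. \<bar>X i $ a\<bar> <= \<Gamma> * \<bar>1\<bar>" by (simp add: eventually_principal)
   show "\<forall>\<^sub>F X in principal S. \<bar>1\<bar> <= 1 * \<bar>1::real\<bar>" by simp
  qed
  thus ?thesis by (simp add: slow_def symb_zero)
 qed
 have "symb (%_. 1) (%_. 1) (%X x. cotan \<psi> X i $ a)" for i a
  using slow_symb[OF slow_frame(2)[of "%_. 1" "%i X x. X i" c \<psi>, OF X c(1)]] c(2) by (simp add: eventually_principal)
 hence "EX C>0. ALL X:S. \<bar>cotan \<psi> X i $ a\<bar> <= C" for i a
  by (rule symbE) (auto simp: eventually_principal)
 hence "ALL ia. EX C>0. ALL X:S. \<bar>cotan \<psi> X (fst ia) $ snd ia\<bar> <= C" by blast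
 from choice[OF this] obtain C where C: "!!ia. C ia > 0" "!!ia X. X:S ==> \<bar>cotan \<psi> X (fst ia) $ snd ia\<bar> <= C ia" by blast
 define D where "D = 1 + (SU i. SU a. C (i, a))"
 have C0: "0 <= C ia" for ia using C(1)[of ia] by simp
 have s0: "0 <= (SU a. C (i, a))" for i by (intro sum_nonneg C0)
 have "0 < D" unfolding D_def using sum_nonneg[of UNIV "%i. SU a. C (i, a)"] s0 by (simp add: add_pos_nonneg)
 moreover have "norm (cotan \<psi> X i) <= D" if "X:S" for X i
 proof -
  have "norm (cotan \<psi> X i) <= (SU a. \<bar>cotan \<psi> X i $ a\<bar>)" by (rule norm_le_l1_cart)
  also have "... <= (SU a. C (i, a))" using C(2)[OF that] by (intro sum_mono) (metis fst_conv snd_conv)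
  also have "... <= (SU i. SU a. C (i, a))" by (rule member_le_sum) (auto simp: s0)
  finally show ?thesis by (simp add: D_def)
 qed
 ultimately show ?thesis unfolding S_def by blast
qed

text \<open>Cholesky decomposition: subtract the square of row \<open>i\<close> divided by the root
  of \<open>M i i\<close>. The rest vanishes in that row and is positive on the remaining indices,
  because its value at \<open>v\<close> is the value of \<open>M\<close> at
  \<open>v + axis i t\<close> for the minimising \<open>t\<close>.\<close>

lemma posdef_squares:
 fixes M :: "'n::finite => 'n => real"
 assumes "finite S" "!!j k. M j k = M k j" "!!j k. j ~: S ==> M j k = 0"
  and "!!v::real^'n. v ~= 0 ==> (ALL i. i ~: S --> v $ i = 0) ==> 0 < quad M v"
 shows "EX \<Xi> :: 'n => real^'n. ALL j k. M j k = (SUM i:S. \<Xi> i $ j * \<Xi> i $ k)"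
 using assms
proof (induction S arbitrary: M)
 case empty
 thus ?case by auto
next
 case (insert i S)
 have bil: "(SU j. SU k. axis i t $ j * v $ k * M j k) = t * (SU k. M i k * v $ k)" for t and v :: "real^'n"
 proof -
  have "(SU j. SU k. axis i t $ j * v $ k * M j k) = (SU j. if j = i then t * (SU k. M i k * v $ k) else 0)"
   by (intro sum.cong refl) (auto simp: axis_def sum_distrib_left mult_ac)
  thus ?thesis by simp
 qed
 have "(SU k. M i k * axis i 1 $ k) = (SU k. if k = i then M i i else 0)"
  by (intro sum.cong refl) (auto simp: axis_def)
 hence Mi: "(SU k. M i k * axis i 1 $ k) = M i i" by simp
 have p: "0 < M i i"
  using insert.prems(3)[of "axis i 1"] bil[of 1 "axis i 1"] Mi by (simp add: axis_eq_0_iff) (simp add: axis_def)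
 define \<xi> where "\<xi> = (\<chi> k. M i k / sqrt (M i i))"
 define M' where "M' = (%j k. M j k - \<xi> $ j * \<xi> $ k)"
 have \<xi>\<xi>: "\<xi> $ j * \<xi> $ k = M i j * M i k / M i i" for j k using p by (simp add: \<xi>_def)
 have "EX \<Xi> :: 'n => real^'n. ALL j k. M' j k = (SUM i:S. \<Xi> i $ j * \<Xi> i $ k)"
 proof (rule insert.IH)
  show "M' j k = M' k j" for j k using insert.prems(1) by (simp add: M'_def)
  show "M' j k = 0" if "j ~: S" for j k
  proof (cases "j = i")
   case True thus ?thesis using p by (simp add: M'_def \<xi>\<xi>)
  next
   case False
   hence "M j k = 0" "M i j = 0" using that insert.prems(1)[of i j] insert.prems(2)[of j] by auto
   thus ?thesis by (simp add: M'_def \<xi>\<xi>)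
  qed
  fix v :: "real^'n" assume v: "v ~= 0" "ALL i. i ~: S --> v $ i = 0"
  define A where "A = (SU k. M i k * v $ k)"
  define t where "t = - A / M i i"
  define w where "w = v + axis i t"
  have w0: "w ~= 0"
  proof
   assume "w = 0"
   hence w: "w $ k = 0" for k by simp
   have "v $ k = 0" for k using w[of k] v(2) insert.hyps(2) by (cases "k = i") (auto simp: w_def axis_def)
   thus False using v(1) by (simp add: vec_eq_iff)
  qed
  have "ALL k. k ~: insert i S --> w $ k = 0" using v by (auto simp: w_def axis_def)
  hence "0 < quad M w" using insert.prems(3)[OF w0] by blast
  also have "quad M w = quad M v + (2 * t * A + t^2 * M i i)"
  proof -
   have e1: "(SU j. SU k. v $ j * axis i t $ k * M j k) = (SU j. SU k. axis i t $ j * v $ k * M j k)"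
    by (subst sum.swap, intro sum.cong refl) (simp add: insert.prems(1)[symmetric] mult_ac)
   have e2: "(SU k. M i k * axis i t $ k) = (SU k. if k = i then t * M i i else 0)"
    by (intro sum.cong refl) (auto simp: axis_def)
   show ?thesis using bil[of t v] bil[of t "axis i t"] e1 e2
    by (simp add: w_def distrib_left distrib_right sum.distrib A_def power2_eq_square)
  qed
  also have "2 * t * A + t^2 * M i i = - (A * A / M i i)" using p by (simp add: t_def power2_eq_square field_simps)
  also have "A * A / M i i = quad (%j k. \<xi> $ j * \<xi> $ k) v"
   unfolding A_def \<xi>\<xi> sum_product sum_divide_distrib by (intro sum.cong refl) (simp add: mult_ac)
  finally show "0 < quad M' v" by (simp add: M'_def right_diff_distrib sum_subtractf add.assoc)
 qed
 then obtain \<Xi> :: "'n => real^'n" where \<Xi>: "!!j k. M' j k = (SUM i:S. \<Xi> i $ j * \<Xi> i $ k)" by blast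
 have "M j k = (SUM q:insert i S. (\<Xi>(i := \<xi>)) q $ j * (\<Xi>(i := \<xi>)) q $ k)" for j k
 proof -
  have "(SUM q:S. (\<Xi>(i := \<xi>)) q $ j * (\<Xi>(i := \<xi>)) q $ k) = M' j k"
   unfolding \<Xi> using insert.hyps(2) by (intro sum.cong refl) auto
  thus ?thesis using insert.hyps by (simp add: M'_def)
 qed
 thus ?case by blast
qed

context patch
begin

text \<open>Added squares only increase the form and the accumulated error stays below
  \<open>\<eta>\<close>, so every intermediate map obeys the bounds \<open>\<gamma>\<close> and
  \<open>\<Gamma>\<close>. Hence one constant \<open>D\<close> serves all spirals and the errors
  simply add up.\<close>

lemma nash_sum:
 fixes u :: "'m::finite => 'n::finite rfun" and \<psi> :: "'m => 'n option" and D \<delta> \<gamma> \<Gamma> \<eta> \<epsilon> :: real and a :: "'i => 'n rfun"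
 assumes \<psi>: "bij \<psi>" and u: "!!b. sm (u b)" and \<gamma>: "0 < \<gamma>" and \<Gamma>: "1 <= \<Gamma>"
  and D: "!!X :: 'n => real^'m. (!!v::real^'n. \<gamma> * norm v <= norm (lcomb v X)) ==> (!!i. norm (X i) <= \<Gamma>) ==> ALL i. norm (cotan \<psi> X i) <= D"
  and lo: "!!x v. x:W ==> 4 * \<gamma>^2 * norm v ^ 2 <= quad (%j k. gram u j k x) v"
  and \<eta>: "(real CARD('n))\<^sup>2 * \<eta> <= 3 * \<gamma>^2" "\<eta> <= 1" and I: "finite I"
  and a: "!!i. i:I ==> sm (a i)" "!!i x k. i:I ==> x:W ==> \<bar>a i x * \<xi> i $ k\<bar> <= \<delta>"
  and up: "!!x j. x:W ==> gram u j j x + (SUM i:I. a i x ^ 2 / 2 * (\<xi> i $ j * \<xi> i $ j)) + 1 <= \<Gamma>"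
  and \<epsilon>: "0 < \<epsilon>" "real (card I) * (real CARD('n) * D * \<delta>^2)\<^sup>2 + \<epsilon> <= \<eta>"
 shows "EX v. (ALL b. sm (v b)) & (ALL x:W. (ALL b. \<bar>v b x - u b x\<bar> <= \<epsilon>) &
  (ALL j k. \<bar>gram v j k x - gram u j k x - (SUM i:I. a i x ^ 2 / 2 * (\<xi> i $ j * \<xi> i $ k))\<bar> <= real (card I) * (real CARD('n) * D * \<delta>^2)\<^sup>2 + \<epsilon>))"
 using I a up \<epsilon>
proof (induction I arbitrary: \<epsilon>)
 case empty
 thus ?case using u by (intro exI[of _ u]) auto
next
 case (insert i I)
 let ?E = "(real CARD('n) * D * \<delta>^2)\<^sup>2"
 have E0: "0 <= ?E" by simp
 have cI: "real (card (insert i I)) = real (card I) + 1" using insert.hyps by simp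
 have sq: "0 <= a q x ^ 2 / 2 * (\<xi> q $ j * \<xi> q $ j)" for q x j by (rule mult_nonneg_nonneg[OF _ zero_le_square]) simp
 have "EX v. (ALL b. sm (v b)) & (ALL x:W. (ALL b. \<bar>v b x - u b x\<bar> <= \<epsilon>/2) &
  (ALL j k. \<bar>gram v j k x - gram u j k x - (SUM i:I. a i x ^ 2 / 2 * (\<xi> i $ j * \<xi> i $ k))\<bar> <= real (card I) * ?E + \<epsilon>/2))"
 proof (rule insert.IH)
  show "gram u j j x + (SUM i:I. a i x ^ 2 / 2 * (\<xi> i $ j * \<xi> i $ j)) + 1 <= \<Gamma>" if "x:W" for x j
   using insert.prems(3)[OF that, of j] sq[of i x j] insert.hyps by (simp add: algebra_simps)
  show "real (card I) * ?E + \<epsilon>/2 <= \<eta>" using insert.prems(4,5) E0 unfolding cI distrib_right by linarith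
 qed (use insert.prems in auto)
 then obtain v where v: "!!b. sm (v b)" "!!x b. x:W ==> \<bar>v b x - u b x\<bar> <= \<epsilon>/2"
  "!!x j k. x:W ==> \<bar>gram v j k x - gram u j k x - (SUM i:I. a i x ^ 2 / 2 * (\<xi> i $ j * \<xi> i $ k))\<bar> <= real (card I) * ?E + \<epsilon>/2" by blast
 have le\<eta>: "real (card I) * ?E + \<epsilon>/2 <= \<eta>" using insert.prems(4,5) E0 unfolding cI distrib_right by linarith
 let ?X = "%x i. \<chi> b. pder i (v b) x"
 have X1: "\<gamma> * norm t <= norm (lcomb t (?X x))" if x: "x:W" for x and t :: "real^'n"
 proof -
  define S where "S = (%j k. SUM i:I. a i x ^ 2 / 2 * (\<xi> i $ j * \<xi> i $ k))"
  have S: "0 <= quad S t"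
  proof -
   have "quad S t = (SU j. SU k. SUM i:I. a i x ^ 2 / 2 * ((t $ j * \<xi> i $ j) * (t $ k * \<xi> i $ k)))"
    unfolding S_def by (simp add: sum_distrib_left mult_ac)
   also have "... = (SUM i:I. a i x ^ 2 / 2 * (SU j. t $ j * \<xi> i $ j)\<^sup>2)"
   proof -
    have "(SU j. SU k. SUM i:I. a i x ^ 2 / 2 * ((t $ j * \<xi> i $ j) * (t $ k * \<xi> i $ k)))
     = (SUM i:I. SU j. SU k. a i x ^ 2 / 2 * ((t $ j * \<xi> i $ j) * (t $ k * \<xi> i $ k)))"
     by (subst sum.swap[of _ I], subst (2) sum.swap[of _ UNIV I]) (rule refl)
    moreover have "c * (SU j. f j)\<^sup>2 = (SU j. SU k. c * (f j * f k))" for c and f :: "'n => real"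
     unfolding power2_eq_square sum_product by (simp only: sum_distrib_left)
    ultimately show ?thesis by simp
   qed
   also have "0 <= ..." by (intro sum_nonneg mult_nonneg_nonneg) auto
   finally show ?thesis .
  qed
  have "\<bar>quad (%j k. gram v j k x - gram u j k x - S j k) t\<bar> <= (real CARD('n))\<^sup>2 * \<eta> * norm t ^ 2"
   unfolding S_def by (rule sum_abs_bound[OF order_trans[OF v(3)[OF x] le\<eta>]])
  also have "... <= 3 * \<gamma>^2 * norm t ^ 2" using \<eta>(1) by (intro mult_right_mono) auto
  finally have b: "\<bar>quad (%j k. gram v j k x - gram u j k x - S j k) t\<bar> <= 3 * \<gamma>^2 * norm t ^ 2" .
  have "(norm (lcomb t (?X x)))\<^sup>2 = quad (%j k. gram v j k x) t"
   unfolding norm_comb gram_inner ..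
  also have "... = quad (%j k. gram v j k x - gram u j k x - S j k) t +
   quad (%j k. gram u j k x) t + quad S t" by (simp add: sum.distrib[symmetric] algebra_simps)
  finally have "(\<gamma> * norm t)\<^sup>2 <= (norm (lcomb t (?X x)))\<^sup>2"
   using b S lo[OF x, of t] unfolding power_mult_distrib by linarith
  thus ?thesis by (rule power2_le_imp_le) simp
 qed
 have X2: "norm (?X x q) <= \<Gamma>" if x: "x:W" for x q
 proof -
  have "gram v q q x <= gram u q q x + (SUM i:I. a i x ^ 2 / 2 * (\<xi> i $ q * \<xi> i $ q)) + 1"
   using v(3)[OF x, of q q] le\<eta> \<eta>(2) by linarith
  also have "... <= \<Gamma>" using insert.prems(3)[OF x, of q] sq[of i x q] insert.hyps by (simp add: algebra_simps)
  also have "\<Gamma> <= \<Gamma>^2" using mult_left_mono[OF \<Gamma>, of \<Gamma>] \<Gamma> by (simp add: power2_eq_square)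
  finally have "(norm (?X x q))\<^sup>2 <= \<Gamma>^2" by (simp add: gram_inner power2_norm_eq_inner)
  thus ?thesis by (rule power2_le_imp_le) (use \<Gamma> in simp)
 qed
 obtain c where c0: "c > 0" and c1: "ALL X. (ALL v::real^'n. \<gamma> * norm v <= norm (lcomb v X)) --> (ALL i. norm (X i) <= \<Gamma>)
  --> c <= norm (nrm \<psi> X)" using nrm_lower[OF \<psi> \<gamma>, of \<Gamma>] by blast
 have c: "c <= norm (nrm \<psi> (?X x))" if x: "x:W" for x
  by (rule c1[rule_format, OF X1[OF x] X2[OF x]])
 have D': "norm (cotan \<psi> (?X x) q) <= D" if x: "x:W" for x q
  by (rule spec[OF D[of "?X x", OF X1[OF x] X2[OF x]]])
 obtain C where C: "!!p. 1 <= p ==> EX w. (ALL b. sm (w b)) & (ALL x:W. (ALL b. \<bar>w b x - v b x\<bar> <= C / p) &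
  (ALL j k. \<bar>gram w j k x - gram v j k x - a i x ^ 2 / 2 * (\<xi> i $ j * \<xi> i $ k)\<bar> <= ?E + C / p))"
  using nash_step[OF \<psi> v(1) insert.prems(1)[OF insertI1] c0 c D' insert.prems(2)[OF insertI1]] by auto
 define p where "p = max 1 (2 * C / \<epsilon>)"
 have p: "1 <= p" "2 * C / \<epsilon> <= p" by (simp_all add: p_def)
 have Cp: "C / p <= \<epsilon> / 2" using p insert.prems(4) by (simp add: field_simps)
 obtain w where w: "!!b. sm (w b)" "!!x b. x:W ==> \<bar>w b x - v b x\<bar> <= C / p"
  "!!x j k. x:W ==> \<bar>gram w j k x - gram v j k x - a i x ^ 2 / 2 * (\<xi> i $ j * \<xi> i $ k)\<bar> <= ?E + C / p" using C[OF p(1)] by blast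
 show ?case
 proof (rule exI[of _ w], intro conjI allI ballI w(1))
  fix x b assume x: "x:W"
  show "\<bar>w b x - u b x\<bar> <= \<epsilon>" using w(2)[OF x, of b] v(2)[OF x, of b] Cp by linarith
 next
  fix x j k assume x: "x:W"
  show "\<bar>gram w j k x - gram u j k x - (SUM i:insert i I. a i x ^ 2 / 2 * (\<xi> i $ j * \<xi> i $ k))\<bar> <= real (card (insert i I)) * ?E + \<epsilon>"
   unfolding cI sum.insert[OF insert.hyps] distrib_right using w(3)[OF x, of j k] v(3)[OF x, of j k] Cp by linarith
 qed
qed

end

lemma sm_smb:
 fixes W :: "(real^'n) set"
 shows "patch W ==> smb f ==> patch.sm W f"
proof -
 assume "patch W"
 then interpret patch W .
 have "Un.bddk k (%_. 1) (%_. 1) (%_. f) ==> bddk k (%_. 1) (%_. 1) (%_. f)" for k and f :: "'n rfun"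
 proof (induction k arbitrary: f)
  case 0
  thus ?case by (auto simp: bdd0_def Un.bdd0_def eventually_principal)
 next
  case (Suc k)
  hence "bdd0 (%_. 1) (%_. f)" by (auto simp: bdd0_def Un.bdd0_def eventually_principal)
  thus ?case using Suc by (simp add: eventually_principal)
 qed
 thus "smb f ==> patch.sm W f" by (simp add: smb_def sm_def symb_def Un.symb_def)
qed

lemma sm_Un:
 assumes p: "patch A" "patch B" and s: "patch.sm A f" "patch.sm B f" and AB: "W \<subseteq> A \<union> B" "patch W"
 shows "patch.sm W f"
proof -
 interpret A: patch A by fact
 interpret B: patch B by fact
 interpret patch W by fact
 have b: "bdd0 (%_. 1) (%_. f)" if bA: "A.bdd0 (%_. 1) (%_. f)" and bB: "B.bdd0 (%_. 1) (%_. f)" for f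
 proof -
  obtain C where C: "ALL p>=1::real. ALL x:A. \<bar>f x\<bar> <= C * \<bar>1\<bar>" using bA unfolding A.bdd0_def A.ev1 by blast
  obtain D where D: "ALL p>=1::real. ALL x:B. \<bar>f x\<bar> <= D * \<bar>1\<bar>" using bB unfolding B.bdd0_def B.ev1 by blast
  have "ALL x:W. \<bar>f x\<bar> <= max C D" using AB(1) C[rule_format, of 1] D[rule_format, of 1] by (auto simp: le_max_iff_disj)
  thus ?thesis by (auto simp: bdd0_def)
 qed
 have "A.bddk k (%_. 1) (%_. 1) (%_. f) ==> B.bddk k (%_. 1) (%_. 1) (%_. f) ==> bddk k (%_. 1) (%_. 1) (%_. f)" for k f
 proof (induction k arbitrary: f)
  case (Suc k)
  thus ?case using b AB(1) by (simp add: subset_iff) blast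
 qed (simp add: b)
 thus ?thesis using s by (simp add: A.sm_def B.sm_def sm_def A.symb_def B.symb_def symb_def)
qed

lemma sm_mono: "patch A ==> patch.sm A f ==> W \<subseteq> A ==> patch W ==> patch.sm W f"
 using sm_Un[of A A f W] by simp

text \<open>Bumps divided by the root of the sum of their squares. That sum is at least
  \<open>c\<close> on \<open>K\<close>, and the open set where it exceeds \<open>c / 2\<close> is
  taken as \<open>W\<close>, so that all derivatives of the quotients are bounded there.\<close>

lemma partition_squares:
 fixes K :: "(real^'n) set" and r :: "'n rfun"
 assumes K: "compact K" and r: "!!z. z:K ==> 0 < r z"
 obtains Z W and a :: "real^'n => 'n rfun" where "finite Z" "Z \<subseteq> K" "patch W" "K \<subseteq> W" "!!z. patch.sm W (a z)"
  "!!x. x:W ==> (SUM z:Z. a z x ^ 2) = 1" "!!z x. a z x ~= 0 ==> x:nb z (r z)"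
proof -
 define b :: "real^'n => 'n rfun" where
  "b = (%z x. PROD i:UNIV. fle 0 ((r z + z $ i) + (-1) * x $ i) * fle 0 ((r z - z $ i) + 1 * x $ i))"
 have bs: "smb (b z)" for z unfolding b_def by (intro smb_prod smb_mult smb_fle)
 have fp: "fle 0 t > 0 \<longleftrightarrow> t > 0" "fle 0 t >= 0" "fle 0 t ~= 0 \<longleftrightarrow> t > 0" for t by (auto simp: fle_def)
 have bp: "b z z > 0" if "z:K" for z
  unfolding b_def using r[OF that] by (intro prod_pos ballI mult_pos_pos) (auto simp: fp)
 have bn: "x:nb z (r z)" if "b z x ~= 0" for z x
 proof -
  have "\<bar>x $ i - z $ i\<bar> <= r z" for i
  proof -
   have "fle 0 ((r z + z $ i) + (-1) * x $ i) * fle 0 ((r z - z $ i) + 1 * x $ i) ~= 0"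
    using that unfolding b_def by (simp add: prod_zero_iff)
   thus ?thesis by (simp add: fp abs_le_iff)
  qed
  thus ?thesis by (simp add: mem_nb)
 qed
 have op: "open {x. b z x > 0}" for z using smb_cont[OF bs, of UNIV] by (intro open_Collect_less) auto
 obtain Z where Z: "Z \<subseteq> K" "finite Z" "K \<subseteq> (UN z:Z. {x. b z x > 0})"
  by (rule compactE_image[OF K(1), of K "%z. {x. b z x > 0}"]) (use op bp in auto)
 define S where "S = (%x. SUM z:Z. b z x * b z x)"
 have Sp: "0 < S x" if xK: "x:K" for x
 proof -
  obtain z where "z:Z" "b z x > 0" using Z(3) xK by blast
  thus ?thesis unfolding S_def by (intro sum_pos2[OF Z(2)]) auto
 qed
 have SC: "continuous_on A S" for A unfolding S_def by (intro continuous_intros smb_cont bs)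
 then obtain c where c: "c > 0" "!!x. x:K ==> c <= S x"
 proof (cases "K = {}")
  case False
  then obtain y where "y:K" "!!x. x:K ==> S y <= S x"
   using continuous_attains_inf[OF K(1) _ SC] by blast
  thus ?thesis using that Sp by blast
 qed (use that[of 1] in simp)
 define W where "W = {x. c / 2 < S x}"
 have pW: "patch W" unfolding W_def using SC[of UNIV] by unfold_locales (intro open_Collect_less; simp)
 interpret patch W by (rule pW)
 have S: "symb (%_. 1) (%_. 1) (%_. S)"
  unfolding S_def by (intro symb_sum symb_mult1) (use sm_smb[OF pW bs] in \<open>auto simp: sm_def\<close>)
 have Sc: "\<forall>\<^sub>F p in principal {1::real..}. ALL x:W. c / 2 <= S x" by (auto simp: W_def)
 have rS: "symb (%_. 1) (%_. 1) (%_ x. inverse (sqrt (S x)))"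
  by (rule symb_inverse[OF symb_sqrt[OF S _ Sc], of "sqrt (c / 2)"]) (use c in \<open>auto simp: W_def\<close>)
 define a where "a = (%z x. b z x * inverse (sqrt (S x)))"
 show ?thesis
 proof (rule that[OF Z(2,1) pW])
  show "K \<subseteq> W" using c by (force simp: W_def)
  show "sm (a z)" for z
   unfolding sm_def a_def by (intro symb_mult1 rS) (use sm_smb[OF pW bs] in \<open>simp add: sm_def\<close>)
  show "x:nb z (r z)" if "a z x ~= 0" for z x using that bn by (auto simp: a_def)
  fix x assume "x:W"
  hence S0: "0 < S x" using c by (auto simp: W_def)
  have "a z x ^ 2 = b z x * b z x / S x" for z
  proof -
   have "(inverse (sqrt (S x)))\<^sup>2 = inverse (S x)" unfolding power_inverse real_sqrt_pow2[OF less_imp_le[OF S0]] ..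
   thus ?thesis unfolding a_def power_mult_distrib power2_eq_square[of "b z x"] divide_inverse by simp
  qed
  hence "(SUM z:Z. a z x ^ 2) = S x / S x" unfolding S_def sum_divide_distrib by (simp only:)
  thus "(SUM z:Z. a z x ^ 2) = 1" using S0 by simp
 qed
qed

context patch
begin

lemma sm_bound: "sm f ==> EX C>0. ALL x:W. \<bar>f x\<bar> <= C"
 unfolding sm_def by (erule symbE) auto

text \<open>\<open>h\<close> is frozen at finitely many points, each value is split by
  \<open>posdef_squares\<close>, and the pieces are weighted by the partition; the error is the
  oscillation of \<open>h\<close> over a cube. The factor \<open>sqrt 2\<close> in the amplitudes
  compensates the half in \<open>a^2 / 2\<close>.\<close>

lemma decompose:
 fixes h :: "'n => 'n => 'n::finite rfun"
 assumes K: "compact K" "W \<subseteq> K" and h: "!!j k. continuous_on K (h j k)" "!!j k x. h j k x = h k j x"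
  and pos: "!!x v::real^'n. x:K ==> v ~= 0 ==> 0 < quad (%j k. h j k x) v" and \<eta>: "0 < \<eta>"
 shows "EX (I :: ((real^'n) \<times> 'n) set) a (\<xi> :: _ => real^'n). finite I & (ALL i:I. sm (a i)) &
  (ALL x:W. ALL j k. \<bar>h j k x - (SUM i:I. a i x ^ 2 / 2 * (\<xi> i $ j * \<xi> i $ k))\<bar> <= \<eta>)"
proof -
 have "EX r>0. ALL x:K. ALL y:K. dist x y < r --> \<bar>h j k x - h j k y\<bar> < \<eta>" for j k
  using compact_uniformly_continuous[OF h(1) K(1)] \<eta> unfolding uniformly_continuous_on_def dist_real_def by (metis dist_commute)
 hence "ALL jk. EX r>0. ALL x:K. ALL y:K. dist x y < r --> \<bar>h (fst jk) (snd jk) x - h (fst jk) (snd jk) y\<bar> < \<eta>" by blast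
 from choice[OF this] obtain r' where r': "!!jk. r' jk > (0::real)"
  "!!jk x y. x:K ==> y:K ==> dist x y < r' jk ==> \<bar>h (fst jk) (snd jk) x - h (fst jk) (snd jk) y\<bar> < \<eta>" by blast
 define r0 where "r0 = Min (range r')"
 have r0: "0 < r0" unfolding r0_def using r'(1) by (subst Min_gr_iff) auto
 have r0': "r0 <= r' jk" for jk unfolding r0_def by (rule Min_le) auto
 have osc: "\<bar>h j k x - h j k y\<bar> < \<eta>" if "x:K" "y:K" "dist x y < r0" for j k x y
  using r'(2)[OF that(1,2) less_le_trans[OF that(3) r0'], of "(j, k)"] by simp
 define r where "r = r0 / (2 * CARD('n))"
 have r: "0 < r" "CARD('n) * r < r0" using r0 by (simp_all add: r_def)
 obtain Z W1 and b :: "real^'n => 'n rfun" where Z: "finite Z" "Z \<subseteq> K" and W1: "patch W1" "K \<subseteq> W1" and b: "!!z. patch.sm W1 (b z)"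
  "!!x. x:W1 ==> (SUM z:Z. b z x ^ 2) = 1" "!!z x. b z x ~= 0 ==> x:nb z r"
  using partition_squares[OF K(1) r(1)] by metis
 have bn: "dist x z < r0" if "b z x ~= 0" for z x
  using norm_nb[OF b(3)[OF that]] r(2) by (simp add: dist_norm)
 have pW: "patch W" by unfold_locales
 have "EX \<Xi> :: 'n => real^'n. ALL j k. h j k z = (SU i. \<Xi> i $ j * \<Xi> i $ k)" if "z:K" for z
  by (rule posdef_squares) (use that h(2) pos in auto)
 then obtain \<Xi> :: "real^'n => 'n => real^'n" where \<Xi>: "!!z j k. z:K ==> h j k z = (SU i. \<Xi> z i $ j * \<Xi> z i $ k)"
  by metis
 define a where "a = (%(z, i::'n) x. sqrt 2 * b z x)"
 have asm: "sm (a zi)" for zi unfolding sm_def a_def case_prod_beta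
  by (intro symb_cmult) (use sm_mono[OF W1(1) b(1) _ pW] W1(2) K(2) in \<open>auto simp: sm_def\<close>)
 show ?thesis
 proof (rule exI[of _ "Z \<times> UNIV"], rule exI[of _ a], rule exI[of _ "%(z, i). \<Xi> z i"], intro conjI ballI allI)
  show "finite (Z \<times> (UNIV :: 'n set))" using Z by simp
  show "sm (a i)" for i by (rule asm)
  fix x j k assume "x:W"
  hence x: "x:K" using K by blast
  have aa: "(a (z, i) x)\<^sup>2 / 2 = b z x ^ 2" for z i by (simp add: a_def power_mult_distrib)
  have "(SUM i:Z \<times> UNIV. a i x ^ 2 / 2 * ((case i of (z, i) => \<Xi> z i) $ j * (case i of (z, i) => \<Xi> z i) $ k))
   = (SUM z:Z. SU i. b z x ^ 2 * (\<Xi> z i $ j * \<Xi> z i $ k))"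
   unfolding sum.cartesian_product by (intro sum.cong refl, clarify, simp only: aa prod.case)
  also have "... = (SUM z:Z. b z x ^ 2 * h j k z)"
   by (intro sum.cong refl) (simp only: \<Xi>[OF subsetD[OF Z(2)]] sum_distrib_left)
  finally have e0: "(SUM i:Z \<times> UNIV. a i x ^ 2 / 2 * ((case i of (z, i) => \<Xi> z i) $ j * (case i of (z, i) => \<Xi> z i) $ k))
   = (SUM z:Z. b z x ^ 2 * h j k z)" .
  have one: "(SUM z:Z. b z x ^ 2 * t) = t" for t using b(2) x W1(2) by (simp flip: sum_distrib_right add: subset_iff)
  have e: "h j k x - (SUM i:Z \<times> UNIV. a i x ^ 2 / 2 * ((case i of (z, i) => \<Xi> z i) $ j * (case i of (z, i) => \<Xi> z i) $ k))
   = (SUM z:Z. b z x ^ 2 * (h j k x - h j k z))"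
   unfolding e0 right_diff_distrib sum_subtractf one ..
  have "\<bar>SUM z:Z. b z x ^ 2 * (h j k x - h j k z)\<bar> <= (SUM z:Z. b z x ^ 2 * \<eta>)"
  proof (rule order_trans[OF sum_abs sum_mono])
   fix z assume z: "z:Z"
   show "\<bar>(b z x)\<^sup>2 * (h j k x - h j k z)\<bar> <= b z x ^ 2 * \<eta>"
   proof (cases "b z x = 0")
    case False
    hence "\<bar>h j k x - h j k z\<bar> <= \<eta>" using osc[OF x _ bn] z Z(2) by (meson less_imp_le subsetD)
    thus ?thesis unfolding abs_mult by (intro mult_mono) auto
   qed simp
  qed
  also have "... = \<eta>" by (rule one)
  finally show "\<bar>h j k x - (SUM i:Z \<times> UNIV. a i x ^ 2 / 2 * ((case i of (z, i) => \<Xi> z i) $ j * (case i of (z, i) => \<Xi> z i) $ k))\<bar> <= \<eta>"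
   unfolding e .
 qed
qed

text \<open>Every square is cut into \<open>N\<close> equal copies with amplitudes scaled by
  \<open>1 / sqrt N\<close>. The errors of fourth order then add up to \<open>N\<close> times
  \<open>1 / N^2\<close>, which a large \<open>N\<close> makes small.\<close>

lemma nash:
 fixes u :: "'m::finite => 'n::finite rfun" and \<gamma> :: real
 assumes mn: "CARD('m) = CARD('n) + 1" and u: "!!b. sm (u b)" and \<gamma>: "0 < \<gamma>"
  and lo: "!!x v. x:W ==> 4 * \<gamma>^2 * norm v ^ 2 <= quad (%j k. gram u j k x) v"
  and K: "compact K" "W \<subseteq> K" and h: "!!j k. continuous_on K (h j k)" "!!j k x. h j k x = h k j x"
  and pos: "!!x v::real^'n. x:K ==> v ~= 0 ==> 0 < quad (%j k. h j k x) v"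
  and \<eta>: "0 < \<eta>" and \<epsilon>: "0 < \<epsilon>"
 shows "EX v :: 'm => 'n rfun. (ALL b. sm (v b)) &
  (ALL x:W. (ALL b. \<bar>v b x - u b x\<bar> <= \<epsilon>) & (ALL j k. \<bar>gram v j k x - gram u j k x - h j k x\<bar> <= \<eta>))"
proof -
 have "CARD('m) = CARD('n option)" using mn by (simp add: card_UNIV_option)
 then obtain \<psi> :: "'m => 'n option" where \<psi>: "bij \<psi>" using finite_same_card_bij[of "UNIV :: 'm set" "UNIV :: 'n option set"] by auto
 let ?n = "real CARD('n)"
 \<comment> \<open>Half of \<open>\<eta>\<close> is left for \<open>decompose\<close>; the other two
   caps are the demands of \<open>nash_sum\<close>.\<close>
 define \<eta>1 where "\<eta>1 = min (\<eta> / 2) (min 1 (3 * \<gamma>^2 / ?n^2))"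
 have \<eta>1: "0 < \<eta>1" "\<eta>1 <= \<eta> / 2" "\<eta>1 <= 1" "?n^2 * \<eta>1 <= 3 * \<gamma>^2"
 proof -
  have "\<eta>1 <= 3 * \<gamma>^2 / ?n^2" by (simp add: \<eta>1_def)
  thus "?n^2 * \<eta>1 <= 3 * \<gamma>^2" by (simp add: pos_le_divide_eq mult.commute)
 qed (use \<eta> \<gamma> in \<open>auto simp: \<eta>1_def\<close>)
 obtain I :: "((real^'n) \<times> 'n) set" and a and \<xi> :: "_ => real^'n" where I: "finite I" and a: "!!i. i:I ==> sm (a i)"
  and dec: "!!x j k. x:W ==> \<bar>h j k x - (SUM i:I. a i x ^ 2 / 2 * (\<xi> i $ j * \<xi> i $ k))\<bar> <= \<eta> / 2"
  using decompose[OF K h pos, of "\<eta> / 2"] \<eta> by fastforce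
 have "ALL i. EX C>0. i:I --> (ALL x:W. \<bar>a i x\<bar> <= C)" using sm_bound[OF a] by (metis zero_less_one)
 from choice[OF this] obtain C where C: "!!i. C i > 0" "!!i x. i:I ==> x:W ==> \<bar>a i x\<bar> <= C i" by blast
 define A where "A = (SUM i:I. C i * norm (\<xi> i))"
 have A0: "0 <= A" unfolding A_def using C(1) by (intro sum_nonneg mult_nonneg_nonneg) (auto simp: less_imp_le)
 have aA: "\<bar>a i x * \<xi> i $ k\<bar> <= A" if "i:I" "x:W" for i x k
 proof -
  have "\<bar>a i x * \<xi> i $ k\<bar> <= C i * norm (\<xi> i)"
   unfolding abs_mult using C that component_le_norm_cart[of "\<xi> i" k] by (intro mult_mono) (auto simp: less_imp_le)
  also have "... <= A" unfolding A_def using C(1) that I by (intro member_le_sum) (auto simp: less_imp_le)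
  finally show ?thesis .
 qed
 have "ALL bj. EX C>0. ALL x:W. \<bar>pder (snd bj) (u (fst bj)) x\<bar> <= C" using sm_bound[OF sm_pder[OF u]] by blast
 from choice[OF this] obtain G where G: "!!bj. G bj > 0" "!!bj x. x:W ==> \<bar>pder (snd bj) (u (fst bj)) x\<bar> <= G bj" by blast
 define \<Gamma> where "\<Gamma> = 1 + (SU bj. G bj * G bj) + card I * A^2"
 have G0: "0 <= (SU bj. G bj * G bj)" by (intro sum_nonneg) simp
 hence \<Gamma>1: "1 <= \<Gamma>" by (simp add: \<Gamma>_def)
 obtain D where D: "D > 0" and D1: "ALL X :: 'n => real^'m. (ALL v::real^'n. \<gamma> * norm v <= norm (lcomb v X)) --> (ALL i. norm (X i) <= \<Gamma>)
  --> (ALL i. norm (cotan \<psi> X i) <= D)"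
  using cotan_upper[OF \<psi> \<gamma>, of \<Gamma>] by blast
 define Q where "Q = real (card I) * (?n * D * A^2)\<^sup>2"
 have Q0: "0 <= Q" by (simp add: Q_def)
 obtain N :: nat where N0: "2 * Q / \<eta>1 < real N" using reals_Archimedean2 by blast
 hence N: "0 < real N" using Q0 \<eta>1(1) by (smt (verit) divide_nonneg_pos)
 define J where "J = I \<times> {..<N}"
 define s where "s = 1 / sqrt (real N)"
 have s: "s^2 = 1 / N" "0 < s" using N by (simp_all add: s_def power_divide)
 have sum: "(SUM i:J. (s * a (fst i) x)\<^sup>2 / 2 * (\<xi> (fst i) $ j * \<xi> (fst i) $ k)) = (SUM i:I. a i x ^ 2 / 2 * (\<xi> i $ j * \<xi> i $ k))" for x j k
  unfolding J_def sum.cartesian_product[symmetric, where g="%i l. (s * a i x)\<^sup>2 / 2 * (\<xi> i $ j * \<xi> i $ k)", unfolded case_prod_beta]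
  using N by (simp add: power_mult_distrib s(1))
 define \<epsilon>1 where "\<epsilon>1 = min \<epsilon> (\<eta>1 / 2)"
 have \<epsilon>1: "0 < \<epsilon>1" "\<epsilon>1 <= \<epsilon>" "\<epsilon>1 <= \<eta>1 / 2" using \<epsilon> \<eta>1 by (auto simp: \<epsilon>1_def)
 have E: "real (card J) * (?n * D * (s * A)\<^sup>2)\<^sup>2 + \<epsilon>1 <= \<eta>1"
 proof -
  have "real (card J) * (?n * D * (s * A)\<^sup>2)\<^sup>2 = Q / N"
   using N by (simp add: J_def card_cartesian_product Q_def power_mult_distrib s(1)) (simp add: power2_eq_square power4_eq_xxxx field_simps)
  also have "... <= \<eta>1 / 2" using N0 N \<eta>1(1) by (simp add: field_simps)
  finally show ?thesis using \<epsilon>1(3) by linarith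
 qed
 have "EX v. (ALL b. sm (v b)) & (ALL x:W. (ALL b. \<bar>v b x - u b x\<bar> <= \<epsilon>1) &
  (ALL j k. \<bar>gram v j k x - gram u j k x - (SUM i:J. (s * a (fst i) x)\<^sup>2 / 2 * (\<xi> (fst i) $ j * \<xi> (fst i) $ k))\<bar> <= real (card J) * (?n * D * (s * A)\<^sup>2)\<^sup>2 + \<epsilon>1))"
 proof (rule nash_sum[where \<psi>=\<psi> and \<gamma>=\<gamma> and \<Gamma>=\<Gamma> and \<eta>=\<eta>1])
  show "finite J" using I by (simp add: J_def)
  show "sm (%x. s * a (fst i) x)" if "i:J" for i
   using a[of "fst i"] that unfolding sm_def J_def by (intro symb_cmult) auto
  show "\<bar>s * a (fst i) x * \<xi> (fst i) $ k\<bar> <= s * A" if "i:J" "x:W" for i x k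
  proof -
   have "s * \<bar>a (fst i) x * \<xi> (fst i) $ k\<bar> <= s * A" using aA[of "fst i" x k] that s(2) by (intro mult_left_mono) (auto simp: J_def)
   thus ?thesis using s(2) by (simp add: abs_mult mult.assoc)
  qed
  fix x j assume x: "x:W"
  have "gram u j j x <= (SU bj. G bj * G bj)"
  proof -
   have "gram u j j x <= (SU b. G (b, j) * G (b, j))"
    using G(2)[OF x, of "(_, j)"] by (intro sum_mono) (metis abs_ge_zero abs_mult_self_eq fst_conv snd_conv mult_mono')
   also have "... = (SUM bj:(%b. (b, j)) ` UNIV. G bj * G bj)" by (subst sum.reindex) (auto simp: inj_on_def)
   also have "... <= (SU bj. G bj * G bj)" by (intro sum_mono2) auto
   finally show ?thesis .
  qed
  moreover have "(SUM i:I. a i x ^ 2 / 2 * (\<xi> i $ j * \<xi> i $ j)) <= (SUM i:I. A^2)"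
  proof (rule sum_mono)
   fix i assume "i:I"
   hence "\<bar>a i x * \<xi> i $ j\<bar>\<^sup>2 <= A^2" using aA x by (intro power_mono) auto
   moreover have "a i x ^ 2 / 2 * (\<xi> i $ j * \<xi> i $ j) = \<bar>a i x * \<xi> i $ j\<bar>\<^sup>2 / 2" by (simp add: power2_eq_square mult_ac)
   ultimately show "a i x ^ 2 / 2 * (\<xi> i $ j * \<xi> i $ j) <= A^2" using zero_le_power2[of "\<bar>a i x * \<xi> i $ j\<bar>"] by linarith
  qed
  ultimately show "gram u j j x + (SUM i:J. (s * a (fst i) x)\<^sup>2 / 2 * (\<xi> (fst i) $ j * \<xi> (fst i) $ j)) + 1 <= \<Gamma>"
   unfolding sum \<Gamma>_def by simp
 next
  show "ALL i. norm (cotan \<psi> X i) <= D" if "!!v::real^'n. \<gamma> * norm v <= norm (lcomb v X)" "!!i. norm (X i) <= \<Gamma>" for X :: "'n => real^'m"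
   by (rule D1[rule_format, THEN allI]) (rule that)+
 qed (rule \<psi> u \<gamma> \<Gamma>1 lo \<eta>1 \<epsilon>1 E | assumption)+
 then obtain v where v: "!!b. sm (v b)" "!!x b. x:W ==> \<bar>v b x - u b x\<bar> <= \<epsilon>1"
  "!!x j k. x:W ==> \<bar>gram v j k x - gram u j k x - (SUM i:I. a i x ^ 2 / 2 * (\<xi> i $ j * \<xi> i $ k))\<bar> <= real (card J) * (?n * D * (s * A)\<^sup>2)\<^sup>2 + \<epsilon>1"
  unfolding sum by blast
 show ?thesis
 proof (rule exI[of _ v], intro conjI allI ballI v(1))
  show "\<bar>v b x - u b x\<bar> <= \<epsilon>" if "x:W" for x b using v(2)[OF that, of b] \<epsilon>1(2) by linarith
  show "\<bar>gram v j k x - gram u j k x - h j k x\<bar> <= \<eta>" if "x:W" for x j k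
   using v(3)[OF that, of j k] dec[OF that, of j k] E \<eta>1(2) by linarith
 qed
qed

end

section \<open>Smooth approximation\<close>

lemma sm_rescale:
 fixes W :: "(real^'n) set" and c :: real
 assumes A: "patch A" "patch.sm A f" and pW: "patch W" and sub: "!!x. x:W ==> c *\<^sub>R x:A"
 shows "patch.sm W (%x. f (c *\<^sub>R x))"
proof -
 interpret A: patch A by fact
 interpret patch W by fact
 have b: "bdd0 (%_. 1) (%_ x. f (c *\<^sub>R x))" if "A.bdd0 (%_. 1) (%_. f)" for f
  using that sub unfolding A.bdd0_def bdd0_def ev1 by blast
 have m: "bddk k (%_. 1) (%_. 1) (%_ x. c * g x)" if "bddk k (%_. 1) (%_. 1) (%_. g)" for k g
  using bddk_mono[OF _ bddk_mult[OF bddk_const[of k "%_. c"] that], where c="\<bar>c\<bar>" and d=1] by simp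
 have "A.bddk k (%_. 1) (%_. 1) (%_. f) ==> bddk k (%_. 1) (%_. 1) (%_ x. f (c *\<^sub>R x))" for k f
 proof (induction k arbitrary: f)
  case (Suc k)
  hence d: "f dif (c *\<^sub>R x)" if "x:W" for x using sub[OF that] unfolding A.bddk.simps A.ev1 by fastforce
  have "bddk k (%_. 1) (%_. 1) (%_. pder i (%x. f (c *\<^sub>R x)))" for i
   by (rule bddk_cong[OF _ m[OF Suc.IH[of "pder i f"]]]) (use Suc.prems rescale_pder[OF d] in auto)
  thus ?case using Suc.prems b rescale_diff[OF d] by simp
 qed (simp add: b)
 thus ?thesis using A(2) by (simp add: A.sm_def sm_def A.symb_def symb_def)
qed

text \<open>A uniform interior cone condition: a shift along \<open>d\<close> carries the part of
  \<open>K\<close> near \<open>p\<close> into \<open>\<Omega>\<close>, with room proportional to the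
  length of the shift.\<close>

definition cone_dir :: "(real^'n) set => (real^'n) set => real^'n => real^'n => real => bool" where
 "cone_dir \<Omega> K p d r \<longleftrightarrow> 0 < r & (ALL x:K \<inter> ball p r. ALL s. ALL d':ball d r. 0 < s --> s <= r --> x + s *\<^sub>R d':\<Omega>)"

context
 fixes \<Omega> K :: "(real^'n) set" and f :: "'n rfun" and f' :: "'n => 'n rfun"
 assumes \<Omega>: "open \<Omega>" "\<Omega> \<subseteq> K" and K: "compact K" and f: "continuous_on K f" and f': "!!i. continuous_on K (f' i)"
  and d: "!!x. x:\<Omega> ==> f dif x" "!!x i. x:\<Omega> ==> pder i f x = f' i x"
begin

text \<open>Shifting \<open>f\<close> inwards and mollifying at a much smaller scale gives a smooth function on a
  full neighbourhood of the part of \<open>K\<close> near \<open>z\<close>.\<close>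

lemma smooth_local:
 assumes cone: "cone_dir \<Omega> K z e r" and \<eta>: "0 < \<eta>"
 shows "EX w \<rho>. 0 < \<rho> & patch.sm {x. EX y:K \<inter> ball z r. dist x y < \<rho>} w &
  (ALL x:K \<inter> ball z r. \<bar>w x - f x\<bar> <= \<eta> & (ALL i. \<bar>pder i w x - f' i x\<bar> <= \<eta>))"
proof -
 let ?n = "real CARD('n)"
 have r: "0 < r" using cone by (simp add: cone_dir_def)
 have uc: "EX \<tau>>0. ALL x:K. ALL y:K. dist y x < \<tau> --> \<bar>g y - g x\<bar> <= \<eta>" if "continuous_on K g" for g :: "'n rfun"
  using compact_uniformly_continuous[OF that K] \<eta> unfolding uniformly_continuous_on_def dist_real_def by (meson less_imp_le)
 obtain \<tau>0 where \<tau>0: "\<tau>0 > 0" "!!x y. x:K ==> y:K ==> dist y x < \<tau>0 ==> \<bar>f y - f x\<bar> <= \<eta>" using uc[OF f] by blast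
 have "ALL i. EX \<tau>>0. ALL x:K. ALL y:K. dist y x < \<tau> --> \<bar>f' i y - f' i x\<bar> <= \<eta>" using uc[OF f'] by blast
 from choice[OF this] obtain \<tau>1 where \<tau>1: "!!i. \<tau>1 i > 0" "!!i x y. x:K ==> y:K ==> dist y x < \<tau>1 i ==> \<bar>f' i y - f' i x\<bar> <= \<eta>" by blast
 define \<tau> where "\<tau> = min \<tau>0 (Min (range \<tau>1))"
 have \<tau>: "0 < \<tau>" "\<tau> <= \<tau>0" "!!i. \<tau> <= \<tau>1 i" unfolding \<tau>_def using \<tau>0(1) \<tau>1(1) by (auto simp: min.coboundedI2)
 define s where "s = min r (\<tau> / (2 * (norm e + r)))"
 have ne: "0 < norm e + r" using r by (simp add: add_nonneg_pos)
 have s: "0 < s" "s <= r" "s * (norm e + r) < \<tau>"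
 proof -
  have "s <= \<tau> / (2 * (norm e + r))" by (simp add: s_def)
  hence "s * (norm e + r) <= \<tau> / (2 * (norm e + r)) * (norm e + r)" using ne by (intro mult_right_mono) auto
  also have "... = \<tau> / 2" using ne by (simp add: field_simps)
  also have "... < \<tau>" using \<tau>(1) by simp
  finally show "s * (norm e + r) < \<tau>" .
 qed (use r \<tau> ne in \<open>auto simp: s_def\<close>)
 \<comment> \<open>After a shift by \<open>s e\<close> the cone condition leaves a ball of radius
   \<open>s r\<close>. Half of it is spent on a cube of radius \<open>2 \<delta>\<close>, half on
   the margin \<open>\<rho>\<close> around \<open>K\<close>.\<close>
 define \<delta> where "\<delta> = s * r / (4 * ?n)"
 have \<delta>: "0 < \<delta>" "2 * \<delta> * ?n = s * r / 2" using s r by (simp_all add: \<delta>_def field_simps)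
 define \<rho> where "\<rho> = s * r / 2"
 have \<rho>: "0 < \<rho>" using s r by (simp add: \<rho>_def)
 define N where "N = {x. EX y:K \<inter> ball z r. dist x y < \<rho>}"
 have "N = (UN y:K \<inter> ball z r. ball y \<rho>)" by (auto simp: N_def dist_commute)
 hence pN: "patch N" by unfold_locales (simp add: open_UN)
 have inO: "\<delta> *\<^sub>R Y + s *\<^sub>R e:\<Omega>" if x: "\<delta> *\<^sub>R X:N" and Y: "Y:nb X 2" for X Y :: "real^'n"
 proof -
  obtain y where y: "y:K" "y:ball z r" "dist (\<delta> *\<^sub>R X) y < \<rho>" using x by (auto simp: N_def)
  define q where "q = (1 / s) *\<^sub>R (\<delta> *\<^sub>R Y - y)"
  have "norm (\<delta> *\<^sub>R Y - y) <= norm (\<delta> *\<^sub>R (Y - X)) + norm (\<delta> *\<^sub>R X - y)"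
   using norm_triangle_ineq[of "\<delta> *\<^sub>R (Y - X)" "\<delta> *\<^sub>R X - y"] by (simp add: algebra_simps)
  also have "norm (\<delta> *\<^sub>R (Y - X)) <= s * r / 2"
  proof -
   have "\<delta> * norm (Y - X) <= \<delta> * (?n * 2)" by (rule mult_left_mono[OF norm_nb[OF Y] less_imp_le[OF \<delta>(1)]])
   also have "\<delta> * (?n * 2) = s * r / 2" using \<delta>(2) by (simp only: mult_ac)
   finally show ?thesis using \<delta>(1) by simp
  qed
  also have "s * r / 2 + norm (\<delta> *\<^sub>R X - y) < s * r" using y(3) by (simp add: \<rho>_def dist_norm)
  finally have "norm q < r" unfolding q_def norm_scaleR using s(1) by (simp add: pos_divide_less_eq mult.commute)
  hence "e + q:ball e r" by (simp add: dist_norm)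
  moreover have "y + s *\<^sub>R (e + q) = \<delta> *\<^sub>R Y + s *\<^sub>R e" using s(1) by (simp add: q_def algebra_simps)
  ultimately show ?thesis using cone y s(1,2) unfolding cone_dir_def by (metis IntI)
 qed
 obtain \<psi> :: "'n rfun" where \<psi>: "kern \<psi>" "!!x. 0 <= \<psi> x" "(\<psi> has_integral 1) (bx 1)" by (rule ex_mollifier) (rule that, assumption+)
 define F where "F = (%Y. f (\<delta> *\<^sub>R Y + s *\<^sub>R e))"
 define w where "w = (%x. conv \<psi> F (inverse \<delta> *\<^sub>R x))"
 have dc: "\<delta> *\<^sub>R inverse \<delta> *\<^sub>R x = x" for x :: "real^'n" using \<delta>(1) by simp
 have aff: "continuous_on A (%Y. \<delta> *\<^sub>R Y + s *\<^sub>R e)" for A :: "(real^'n) set" by (intro continuous_intros)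
 have cF: "continuous_on (nb X 2) (%Y. g (\<delta> *\<^sub>R Y + s *\<^sub>R e))" if "\<delta> *\<^sub>R X:N" "continuous_on K g" for X and g :: "'n rfun"
  by (rule continuous_on_compose2[OF that(2) aff]) (use inO[OF that(1)] \<Omega> in blast)
 define A where "A = {X. \<delta> *\<^sub>R X:N}"
 have "open ((%X::real^'n. \<delta> *\<^sub>R X) -` N)" using pN by (intro open_vimage continuous_intros) (simp add: patch_def)
 hence pA: "patch A" by unfold_locales (simp add: A_def vimage_def)
 interpret A: patch A by (rule pA)
 obtain M where M: "!!x. x:K ==> \<bar>f x\<bar> <= M"
  using compact_imp_bounded[OF compact_continuous_image[OF f K]] unfolding bounded_iff by auto
 have "A.sm (conv \<psi> F)" unfolding A.sm_def
 proof (rule A.symb_conv[OF _ \<psi>(1), where C=M])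
  show "\<forall>\<^sub>F p in principal {1::real..}. ALL x:A. continuous_on (nb x 2) F & (ALL y:nb x 2. \<bar>F y\<bar> <= M * \<bar>1\<bar>)"
   unfolding A.ev1 using cF[OF _ f] M[OF subsetD[OF \<Omega>(2) inO]] by (auto simp: A_def F_def)
 qed
 hence smw: "patch.sm N w" unfolding w_def
  by (rule sm_rescale[OF pA _ pN]) (simp only: A_def mem_Collect_eq dc)
 have near: "dist (\<delta> *\<^sub>R Y + s *\<^sub>R e) (\<delta> *\<^sub>R X) < \<tau>" if Y: "Y:nb X 1" for X Y :: "real^'n"
 proof -
  have "norm (\<delta> *\<^sub>R Y + s *\<^sub>R e - \<delta> *\<^sub>R X) <= norm (\<delta> *\<^sub>R (Y - X)) + norm (s *\<^sub>R e)"
   using norm_triangle_ineq[of "\<delta> *\<^sub>R (Y - X)" "s *\<^sub>R e"] by (simp add: algebra_simps)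
  also have "... <= \<delta> * ?n + s * norm e" using norm_nb[OF Y] \<delta>(1) s(1) by simp
  also have "... <= s * (norm e + r)"
  proof -
   have "0 < \<delta> * ?n" using \<delta>(1) by simp
   moreover have "4 * (\<delta> * ?n) = s * r" using \<delta>(2) by (simp add: mult_ac)
   ultimately show ?thesis unfolding distrib_left by linarith
  qed
  finally show ?thesis using s(3) by (simp add: dist_norm)
 qed
 have close: "\<bar>conv \<psi> (%Y. g (\<delta> *\<^sub>R Y + s *\<^sub>R e)) (inverse \<delta> *\<^sub>R x) - g x\<bar> <= \<eta>"
  if x: "x:K \<inter> ball z r" and g: "continuous_on K g" and u: "!!y. y:K ==> dist y x < \<tau> ==> \<bar>g y - g x\<bar> <= \<eta>" for x and g :: "'n rfun"
 proof -
  let ?X = "inverse \<delta> *\<^sub>R x"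
  have X: "\<delta> *\<^sub>R ?X:N" using x \<rho> unfolding dc by (auto simp: N_def intro!: bexI[of _ x])
  note c = continuous_on_subset[OF cF[OF X g] nb_mono[of 1 2]]
  have "\<bar>conv \<psi> (%Y. g (\<delta> *\<^sub>R Y + s *\<^sub>R e) - g x) ?X\<bar> <= \<eta>"
  proof (rule conv_le[OF \<psi>])
   show "continuous_on (nb ?X 1) (%Y. g (\<delta> *\<^sub>R Y + s *\<^sub>R e) - g x)" using c by (intro continuous_intros) auto
   fix Y assume Y: "Y:nb ?X 1"
   hence "\<delta> *\<^sub>R Y + s *\<^sub>R e:K" using inO[OF X] nb_mono[of 1 2] \<Omega> by fastforce
   thus "\<bar>g (\<delta> *\<^sub>R Y + s *\<^sub>R e) - g x\<bar> <= \<eta>" using near[OF Y] unfolding dc by (rule u)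
  qed
  thus ?thesis using conv_linear(2)[OF \<psi>(1), of ?X "%Y. g (\<delta> *\<^sub>R Y + s *\<^sub>R e)" "%_. g x"] c conv_const[OF \<psi>(3)] by simp
 qed
 have "\<bar>w x - f x\<bar> <= \<eta>" if "x:K \<inter> ball z r" for x
  unfolding w_def F_def using that \<tau>0(2) \<tau>(2) by (intro close f) (auto intro: less_le_trans)
 moreover have "\<bar>pder i w x - f' i x\<bar> <= \<eta>" if x: "x:K \<inter> ball z r" for x i
 proof -
  let ?X = "inverse \<delta> *\<^sub>R x"
  have X: "\<delta> *\<^sub>R ?X:N" using x \<rho> unfolding dc by (auto simp: N_def intro!: bexI[of _ x])
  have Fd: "F dif Y" "pder i F Y = \<delta> * f' i (\<delta> *\<^sub>R Y + s *\<^sub>R e)" if "Y:nb ?X 2" for Y i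
   unfolding F_def using shift_pder[OF d(1)[OF inO[OF X that]]] d(2)[OF inO[OF X that]] by auto
  have cf: "continuous_on (nb ?X 2) (pder i F)" for i
   by (rule continuous_on_eq[OF continuous_on_mult[OF continuous_on_const[of _ \<delta>] cF[OF X f'[of i]]]]) (simp add: Fd)
  have "pder i w x = inverse \<delta> * pder i (conv \<psi> F) ?X"
   unfolding w_def by (rule rescale_pder, rule A.sm_diff) (use \<open>A.sm (conv \<psi> F)\<close> X in \<open>auto simp: A_def\<close>)
  also have "pder i (conv \<psi> F) ?X = conv \<psi> (pder i F) ?X" by (rule conv_pder_fun[OF \<psi>(1) Fd(1) cf])
  also have "... = conv \<psi> (%Y. \<delta> * f' i (\<delta> *\<^sub>R Y + s *\<^sub>R e)) ?X"
  proof -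
   have "\<psi> t * pder i F (?X - t) = \<psi> t * (\<delta> * f' i (\<delta> *\<^sub>R (?X - t) + s *\<^sub>R e))" if "t:bx 1" for t
    using Fd(2) minus_in_box[OF that, of ?X] nb_mono[of 1 2 ?X] by fastforce
   thus ?thesis unfolding conv_def by (rule integral_cong)
  qed
  also have "inverse \<delta> * ... = conv \<psi> (%Y. f' i (\<delta> *\<^sub>R Y + s *\<^sub>R e)) ?X"
   unfolding conv_cmult using \<delta>(1) by simp
  finally show ?thesis
   using close[OF x f'[of i]] \<tau>1(2)[of x _ i] \<tau>(3)[of i] x by (auto intro: less_le_trans)
 qed
 ultimately show ?thesis using smw \<rho> unfolding N_def by blast
qed

text \<open>The local approximations are glued by the squares of a partition. As the derivatives of
  these squares sum to 0, the derivative of the glued function sees only the differences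
  \<open>w z - f\<close>, times at most \<open>D\<close>; hence
  \<open>\<eta>1 = \<eta> / (1 + D)\<close>.\<close>

lemma smooth_approx:
 assumes cone: "!!p. p:K ==> EX e r. cone_dir \<Omega> K p e r" and \<eta>: "0 < \<eta>"
 shows "EX W v. patch W & K \<subseteq> W & patch.sm W v & (ALL x:K. \<bar>v x - f x\<bar> <= \<eta> & (ALL i. \<bar>pder i v x - f' i x\<bar> <= \<eta>))"
proof -
 let ?n = "real CARD('n)"
 obtain e r where er: "!!p. p:K ==> cone_dir \<Omega> K p (e p) (r p)" using cone by metis
 have r: "0 < r p" if "p:K" for p using er[OF that] by (simp add: cone_dir_def)
 define r1 where "r1 = (%p. r p / (4 * ?n))"
 have r1: "0 < r1 p" if "p:K" for p using r[OF that] by (simp add: r1_def)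
 obtain Z W1 and a :: "real^'n => 'n rfun" where Z: "finite Z" "Z \<subseteq> K" and W1: "patch W1" "K \<subseteq> W1" and a: "!!z. patch.sm W1 (a z)"
  "!!x. x:W1 ==> (SUM z:Z. a z x ^ 2) = 1" "!!z x. a z x ~= 0 ==> x:nb z (r1 z)"
  by (rule partition_squares[where r=r1, OF K r1]) (assumption, rule that, assumption+)
 interpret W1: patch W1 by (rule W1)
 define q where "q = (%z x. a z x * a z x)"
 have qs: "W1.sm (q z)" for z
  using a(1)[of z] unfolding W1.sm_def q_def by (rule W1.symb_mult1[OF _ ]) (use a(1) in \<open>simp add: W1.sm_def\<close>)
 have q1: "(SUM z:Z. q z x) = 1" if "x:W1" for x using a(2)[OF that] by (simp add: q_def power2_eq_square)
 have qd: "q z dif x" if "x:W1" for z x by (rule W1.sm_diff[OF qs that])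
 have q0: "(SUM z:Z. pder i (q z) x) = 0" if "x:W1" for x i
 proof -
  have "(SUM z:Z. pder i (q z) x) = pder i (%x. SUM z:Z. q z x) x" by (rule pder_sum[symmetric]) (use Z qd that in auto)
  also have "... = pder i (%x. 1) x" by (rule pder_cong[of W1]) (use W1.W that q1 in auto)
  finally show ?thesis by simp
 qed
 have "ALL zi. EX C>0. ALL x:W1. \<bar>pder (snd zi) (q (fst zi)) x\<bar> <= C" using W1.sm_bound[OF W1.sm_pder[OF qs]] by blast
 from choice[OF this] obtain C where C: "!!zi. C zi > 0" "!!zi x. x:W1 ==> \<bar>pder (snd zi) (q (fst zi)) x\<bar> <= C zi" by blast
 define D where "D = (SUM z:Z. SU i. C (z, i))"
 have Cz: "C (z, i) <= (SU i. C (z, i))" for z i using C(1) by (intro member_le_sum) (auto simp: less_imp_le)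
 have D0: "0 <= D" unfolding D_def using C(1) by (intro sum_nonneg) (auto simp: less_imp_le)
 define \<eta>1 where "\<eta>1 = \<eta> / (1 + D)"
 have \<eta>1: "0 < \<eta>1" "\<eta>1 * (1 + D) = \<eta>" using \<eta> D0 by (simp_all add: \<eta>1_def)
 have le: "\<eta>1 * 1 <= \<eta>1 * (1 + D)" using \<eta>1(1) D0 by (intro mult_left_mono) auto
 have "ALL z:K. EX w \<rho>. 0 < \<rho> & patch.sm {x. EX y:K \<inter> ball z (r z). dist x y < \<rho>} w &
  (ALL x:K \<inter> ball z (r z). \<bar>w x - f x\<bar> <= \<eta>1 & (ALL i. \<bar>pder i w x - f' i x\<bar> <= \<eta>1))"
  using smooth_local[OF er \<eta>1(1)] by blast
 from bchoice[OF this] obtain w where "ALL z:K. EX \<rho>. 0 < \<rho> & patch.sm {x. EX y:K \<inter> ball z (r z). dist x y < \<rho>} (w z) &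
  (ALL x:K \<inter> ball z (r z). \<bar>w z x - f x\<bar> <= \<eta>1 & (ALL i. \<bar>pder i (w z) x - f' i x\<bar> <= \<eta>1))" by blast
 from bchoice[OF this] obtain \<rho> where \<rho>: "!!z. z:K ==> 0 < \<rho> z"
  and w: "!!z. z:K ==> patch.sm {x. EX y:K \<inter> ball z (r z). dist x y < \<rho> z} (w z)"
  "!!z x. z:K ==> x:K \<inter> ball z (r z) ==> \<bar>w z x - f x\<bar> <= \<eta>1 & (ALL i. \<bar>pder i (w z) x - f' i x\<bar> <= \<eta>1)" by blast
 define N where "N = (%z. {x. EX y:K \<inter> ball z (r z). dist x y < \<rho> z})"
 have wN: "patch.sm (N z) (w z)" if "z:K" for z using w(1)[OF that] by (simp add: N_def)
 have pN: "patch (N z)" for z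
 proof -
  have "N z = (UN y:K \<inter> ball z (r z). ball y (\<rho> z))" by (auto simp: N_def dist_commute)
  thus ?thesis by unfold_locales (simp add: open_UN)
 qed
 have nbr: "x:ball z (r z / 2)" if "z:K" "x:nb z (r1 z)" for x z
  using norm_nb[OF that(2)] r[OF that(1)] by (simp add: r1_def dist_norm norm_minus_commute)
 define W where "W = W1 \<inter> (INT z:Z. {x. EX y:K. dist x y < min (\<rho> z) (r z / 2)})"
 have "{x. EX y:K. dist x y < t} = (UN y:K. ball y t)" for t by (auto simp: dist_commute)
 hence op: "open {x. EX y:K. dist x y < t}" for t by (simp add: open_UN)
 hence pW: "patch W" unfolding W_def using W1.W Z(1) by unfold_locales (intro open_Int open_INT ballI op)
 interpret patch W by (rule pW)
 have KW: "K \<subseteq> W"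
 proof
  fix x assume x: "x:K"
  have "dist x x < min (\<rho> z) (r z / 2)" if "z:Z" for z using \<rho>[of z] r[of z] Z(2) that by auto
  thus "x:W" unfolding W_def using W1(2) x by blast
 qed
 \<comment> \<open>\<open>w z\<close> is controlled on \<open>N z\<close> only, but the cutoff
   vanishes off the cube around \<open>z\<close>. The two open sets cover \<open>W\<close>, since
   its points are close enough to \<open>K\<close>.\<close>
 have trm: "patch.sm W (%x. q z x * w z x)" if z: "z:Z" for z
 proof -
  have zK: "z:K" using z Z by blast
  let ?A = "W \<inter> N z" and ?B = "W - nb z (r1 z)"
  have pA: "patch ?A" and pB: "patch ?B" using W pN[of z] closed_nb by (auto simp: patch_def open_Int open_Diff)
  interpret A: patch ?A by (rule pA)
  interpret B: patch ?B by (rule pB)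
  have "A.sm (q z)" "A.sm (w z)"
   using sm_mono[OF W1(1) qs _ pA] sm_mono[OF pN wN[OF zK] _ pA] by (auto simp: W_def)
  hence sA: "A.sm (%x. q z x * w z x)" unfolding A.sm_def by (rule A.symb_mult1)
  have sB: "B.sm (%x. q z x * w z x)"
   unfolding B.sm_def by (rule B.symb_cong[OF B.symb_zero]) (use a(3) in \<open>auto simp: q_def\<close>)
  have "x:N z" if xW: "x:W" and xn: "x:nb z (r1 z)" for x
  proof -
   obtain y where y: "y:K" "dist x y < \<rho> z" "dist x y < r z / 2" using xW z unfolding W_def by auto
   have "dist z y <= dist z x + dist x y" by (rule dist_triangle)
   hence "y:ball z (r z)" using nbr[OF zK xn] y(3) by simp
   thus ?thesis using y by (auto simp: N_def)
  qed
  hence "W \<subseteq> ?A \<union> ?B" by blast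
  thus ?thesis by (rule sm_Un[OF pA pB sA sB _ pW])
 qed
 define v where "v = (%x. SUM z:Z. q z x * w z x)"
 have vs: "sm v" unfolding v_def sm_def by (rule symb_sum) (use trm in \<open>simp add: sm_def\<close>)
 have tz: "\<bar>w z x - f x\<bar> <= \<eta>1 & (ALL i. \<bar>pder i (w z) x - f' i x\<bar> <= \<eta>1)" if "z:Z" "x:K" "x:nb z (r1 z)" for z x
 proof -
  have "z:K" using that Z by blast
  thus ?thesis using w(2)[of z x] nbr[of z x] that r[of z] by (auto simp: dist_commute)
 qed
 have dz: "pder i (%x. q z x * w z x) x = pder i (q z) x * w z x + q z x * pder i (w z) x & (x ~: nb z (r1 z) --> pder i (q z) x = 0)"
  if z: "z:Z" and x: "x:K" for z x i
 proof (cases "x:nb z (r1 z)")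
  case True
  have zK: "z:K" using z Z by blast
  have "x:ball z (r z)" using nbr[OF zK True] r[OF zK] by simp
  hence "x:N z" using x \<rho>[OF zK] by (auto simp: N_def intro!: bexI[of _ x])
  hence "w z dif x" using patch.sm_diff[OF pN wN[OF zK]] by blast
  moreover have "q z dif x" using qd W1(2) x by blast
  ultimately show ?thesis using True by (simp add: pder_mult)
 next
  case False
  have o: "open (- nb z (r1 z))" by (rule open_Compl[OF closed_nb])
  have z0: "q z y = 0" if "y:- nb z (r1 z)" for y using a(3)[of z y] that by (auto simp: q_def)
  have "pder i (q z) x = 0" "pder i (%x. q z x * w z x) x = 0"
   using pder_cong[OF o, of x "q z" "%_. 0" i] pder_cong[OF o, of x "%x. q z x * w z x" "%_. 0" i] z0 False by auto
  thus ?thesis using z0 False by simp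
 qed
 have qn: "0 <= q z x" for z x by (simp add: q_def)
 have qz: "q z x = 0" if "x ~: nb z (r1 z)" for z x using a(3)[of z x] that by (auto simp: q_def)
 have avg: "\<bar>SUM z:Z. q z x * h z\<bar> <= \<eta>1" if "x:K" "!!z. z:Z ==> x:nb z (r1 z) ==> \<bar>h z\<bar> <= \<eta>1" for x and h
 proof -
  have "\<bar>SUM z:Z. q z x * h z\<bar> <= (SUM z:Z. q z x * \<eta>1)"
  proof (rule order_trans[OF sum_abs sum_mono])
   fix z assume "z:Z"
   thus "\<bar>q z x * h z\<bar> <= q z x * \<eta>1"
    using that(2) qn qz by (cases "x:nb z (r1 z)") (auto simp: abs_mult mult_left_mono)
  qed
  also have "... = \<eta>1" using q1 that(1) W1(2) by (simp flip: sum_distrib_right add: subset_iff)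
  finally show ?thesis .
 qed
 have "\<bar>v x - f x\<bar> <= \<eta>" if x: "x:K" for x
 proof -
  have "(SUM z:Z. q z x * f x) = f x" using q1 x W1(2) by (simp flip: sum_distrib_right add: subset_iff)
  hence "v x - f x = (SUM z:Z. q z x * (w z x - f x))" by (simp add: v_def right_diff_distrib sum_subtractf)
  thus ?thesis using avg[OF x, of "%z. w z x - f x"] tz[OF _ x] \<eta>1(2) le by simp
 qed
 moreover have "\<bar>pder i v x - f' i x\<bar> <= \<eta>" if x: "x:K" for x i
 proof -
  have xW: "x:W" and xW1: "x:W1" using KW W1(2) x by auto
  have "pder i v x = (SUM z:Z. pder i (%x. q z x * w z x) x)"
   unfolding v_def by (rule pder_sum) (use Z sm_diff[OF trm xW] in auto)
  also have "... = (SUM z:Z. pder i (q z) x * w z x) + (SUM z:Z. q z x * pder i (w z) x)"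
   using dz[OF _ x] by (simp add: sum.distrib)
  finally have e: "pder i v x = (SUM z:Z. pder i (q z) x * w z x) + (SUM z:Z. q z x * pder i (w z) x)" .
  have "pder i v x - f' i x = (SUM z:Z. pder i (q z) x * (w z x - f x)) + (SUM z:Z. q z x * (pder i (w z) x - f' i x))"
  proof -
   have "(SUM z:Z. pder i (q z) x * f x) = 0" "(SUM z:Z. q z x * f' i x) = f' i x"
    using q0[OF xW1, of i] q1[OF xW1] by (simp_all flip: sum_distrib_right)
   thus ?thesis unfolding e by (simp add: right_diff_distrib sum_subtractf)
  qed
  moreover have "\<bar>SUM z:Z. pder i (q z) x * (w z x - f x)\<bar> <= D * \<eta>1"
  proof -
   have "\<bar>SUM z:Z. pder i (q z) x * (w z x - f x)\<bar> <= (SUM z:Z. (SU i. C (z, i)) * \<eta>1)"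
   proof (rule order_trans[OF sum_abs sum_mono])
    fix z assume z: "z:Z"
    have s0: "0 <= (SU i. C (z, i))" using C(1) by (intro sum_nonneg) (auto simp: less_imp_le)
    have "\<bar>pder i (q z) x\<bar> <= (SU i. C (z, i))" using C(2)[OF xW1, of "(z, i)"] Cz[of z i] by simp
    thus "\<bar>pder i (q z) x * (w z x - f x)\<bar> <= (SU i. C (z, i)) * \<eta>1"
     using dz[OF z x, of i] tz[OF z x] s0 \<eta>1(1) unfolding abs_mult
     by (cases "x:nb z (r1 z)") (auto intro!: mult_mono)
   qed
   thus ?thesis by (simp add: D_def sum_distrib_right)
  qed
  moreover have "\<bar>SUM z:Z. q z x * (pder i (w z) x - f' i x)\<bar> <= \<eta>1" 
   by (rule avg[OF x]) (use tz[OF _ x] in blast)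
  moreover have "D * \<eta>1 + \<eta>1 = \<eta>" using \<eta>1(2) by (simp add: algebra_simps)
  ultimately show ?thesis by linarith
 qed
 ultimately show ?thesis using pW KW vs by blast
qed

end

section \<open>From a smooth strictly short map to an isometric one\<close>

lemma quad_diff: "quad (%j k. M j k - N j k) v = quad M v - quad N v"
 by (simp add: right_diff_distrib sum_subtractf)

lemma posdef_nbhd:
 fixes M :: "'n::finite => 'n => 'n rfun"
 assumes K: "compact K" "K ~= {}" "open W" "K \<subseteq> W" and M: "!!j k. continuous_on W (M j k)" and \<delta>: "0 < \<delta>"
  and lo: "!!x v. x:K ==> \<delta> * norm v ^ 2 <= quad (%j k. M j k x) v"
 shows "EX \<rho>>0. thick K \<rho> \<subseteq> W & (ALL x:thick K \<rho>. ALL v. \<delta> / 2 * norm v ^ 2 <= quad (%j k. M j k x) v)"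
proof -
 let ?n = "real CARD('n)"
 define t where "t = \<delta> / (2 * ?n^2)"
 have t: "0 < t" "?n^2 * t = \<delta> / 2" using \<delta> by (simp_all add: t_def)
 define O' where "O' = (%y. \<Inter>j k. W \<inter> M j k -` ball (M j k y) t)"
 have "open (O' y)" for y unfolding O'_def
  by (intro open_INT ballI finite continuous_open_preimage[OF M] K open_ball)
 hence "open (UN y:K. O' y)" by blast
 moreover have "K \<subseteq> (UN y:K. O' y)" using K t by (auto simp: O'_def)
 ultimately obtain e where e: "0 < e" "(UN x:K. ball x e) \<subseteq> (UN y:K. O' y)"
  using compact_subset_open_imp_ball_epsilon_subset[OF K(1)] by blast
 have "x:W & (ALL v. \<delta> / 2 * norm v ^ 2 <= quad (%j k. M j k x) v)" if x: "x:thick K e" for x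
 proof -
  obtain z where "z:K" "infdist x K = dist x z" using infdist_attains_inf[of K x] K compact_imp_closed by blast
  hence "x:(UN x:K. ball x e)" using x by (auto simp: thick_def dist_commute)
  then obtain y where y: "y:K" "x:O' y" using e by blast
  have c: "\<bar>M j k y - M j k x\<bar> <= t" for j k using y(2) by (auto simp: O'_def dist_real_def less_imp_le)
  have "\<delta> / 2 * norm v ^ 2 <= quad (%j k. M j k x) v" for v
  proof -
   have "\<bar>quad (%j k. M j k y - M j k x) v\<bar> <= \<delta> / 2 * norm v ^ 2"
    unfolding t(2)[symmetric] by (rule sum_abs_bound[OF c])
   thus ?thesis using lo[OF y(1), of v] unfolding quad_diff by linarith
  qed
  thus ?thesis using y(2) by (auto simp: O'_def)
 qed
 thus ?thesis using e(1) by blast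
qed

text \<open>Near \<open>K\<close> both positivity bounds persist with half their constants. A small
  \<open>s\<close> then keeps \<open>g - gram v0 - s^2 H0\<close> positive definite, so
  \<open>nash\<close> can add it; what remains of the defect is close to \<open>s^2 H0\<close>, the
  starting point of \<open>iterate\<close>.\<close>

theorem solve:
 fixes K W :: "(real^'n) set" and g :: "'n => 'n => 'n rfun" and v0 :: "'m::finite => 'n rfun" and \<delta> \<gamma> Cg \<alpha> \<epsilon> :: real
 assumes mn: "CARD('m) = CARD('n) + 1" and N: "2 * N = CARD('n) * (CARD('n) - 1)"
  and \<alpha>: "0 < \<alpha>" "\<alpha> * (1 + 2 * real N) < 1" and \<beta>: "1 <= \<beta>" "N = 0 ==> 2 <= \<beta>"
  and K: "compact K" "K ~= {}" and gcont: "!!j k. continuous_on UNIV (g j k)" and gsym: "!!j k. g j k = g k j"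
  and g2: "!!j k x t. norm t <= 1 ==> \<bar>g j k (x + t) + g j k (x - t) - 2 * g j k x\<bar> <= Cg * norm t ^ \<beta>" and Cg: "0 <= Cg"
  and W: "patch W" "K \<subseteq> W" and v0: "!!a. patch.sm W (v0 a)" and \<gamma>: "0 < \<gamma>" and \<delta>: "0 < \<delta>" and \<epsilon>: "0 < \<epsilon>"
  and lo: "!!x v. x:K ==> 8 * \<gamma>^2 * norm v ^ 2 <= quad (%j k. gram v0 j k x) v"
  and short: "!!x v. x:K ==> \<delta> * norm v ^ 2 <= quad (%j k. g j k x - gram v0 j k x) v"
 shows "EX \<rho> v H. 0 < \<rho> & solution g v0 \<epsilon> \<alpha> H (thick K \<rho>) v"
proof -
 let ?n = "real CARD('n)"
 have n1: "1 <= ?n" by (simp add: Suc_leI)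
 interpret W: patch W by fact
 have pc: "continuous_on A (pder i (v0 a))" if "A \<subseteq> W" for i a A
  using W.sm_diff[OF W.sm_pder[OF v0]] that by (intro continuous_at_imp_continuous_on ballI differentiable_imp_continuous_within) auto
 hence gc: "continuous_on A (gram v0 j k)" if "A \<subseteq> W" for j k A
  using that by (intro continuous_intros) auto
 have \<gamma>2: "0 < 8 * \<gamma>^2" using \<gamma> by simp
 obtain \<rho>1 where \<rho>1: "0 < \<rho>1" "thick K \<rho>1 \<subseteq> W" "!!x v. x:thick K \<rho>1 ==> 8 * \<gamma>^2 / 2 * norm v ^ 2 <= quad (%j k. gram v0 j k x) v"
  using posdef_nbhd[OF K W.W W(2) gc[OF order_refl] \<gamma>2 lo] by blast
 have gc': "continuous_on W (%x. g j k x - gram v0 j k x)" for j k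
  by (intro continuous_intros gc continuous_on_subset[OF gcont]) auto
 obtain \<rho>2 where \<rho>2: "0 < \<rho>2" "!!x v. x:thick K \<rho>2 ==> \<delta> / 2 * norm v ^ 2 <= quad (%j k. g j k x - gram v0 j k x) v"
  using posdef_nbhd[OF K W.W W(2) gc' \<delta> short] by blast
 \<comment> \<open>Halved so that the closed neighbourhood \<open>K'\<close>, on which compactness
   is used, lies in both open ones.\<close>
 define \<rho>0 where "\<rho>0 = min \<rho>1 \<rho>2 / 2"
 have \<rho>0: "0 < \<rho>0" "\<rho>0 < \<rho>1" "\<rho>0 < \<rho>2" using \<rho>1 \<rho>2 by (auto simp: \<rho>0_def)
 define K' where "K' = {x. infdist x K <= \<rho>0}"
 have K': "compact K'" unfolding K'_def using compact_infdist_le[OF K(2,1) \<rho>0(1)] .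
 have sub: "thick K \<rho>0 \<subseteq> K'" "K' \<subseteq> thick K \<rho>1" "K' \<subseteq> thick K \<rho>2" "K' \<subseteq> W"
  using \<rho>0 \<rho>1 by (auto simp: K'_def thick_def)
 have pP: "patch (thick K \<rho>0)" by unfold_locales (rule open_thick)
 interpret P: patch "thick K \<rho>0" by (rule pP)
 have lo0: "4 * \<gamma>^2 * norm v ^ 2 <= quad (%j k. gram v0 j k x) v" if "x:thick K \<rho>0" for x v
  using \<rho>1(3)[of x v] sub that by (auto simp: subset_iff)
 have "EX B. ALL x:K'. \<bar>g j j x\<bar> <= B" for j
  using compact_imp_bounded[OF compact_continuous_image[OF continuous_on_subset[OF gcont] K']] unfolding bounded_iff by fastforce
 then obtain B0 where B0: "!!j x. x:K' ==> \<bar>g j j x\<bar> <= B0 j" by metis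
 define \<Gamma> where "\<Gamma> = Max (range B0)"
 interpret target K g \<rho>0 \<gamma> \<Gamma> Cg \<beta>
 proof (unfold_locales; (rule gcont gsym g2 \<gamma> Cg \<rho>0 | assumption)?)
  show "g j j x <= \<Gamma>" if "x:thick K \<rho>0" for x j
  proof -
   have "g j j x <= B0 j" using B0[of x j] sub(1) that by fastforce
   also have "... <= \<Gamma>" unfolding \<Gamma>_def by (rule Max_ge) auto
   finally show ?thesis .
  qed
  fix x v assume x: "x:thick K \<rho>0"
  have "\<delta> / 2 * norm v ^ 2 <= quad (%j k. g j k x) v - quad (%j k. gram v0 j k x) v"
   using \<rho>2(2)[of x v] sub x unfolding quad_diff by blast
  thus "4 * \<gamma>^2 * norm v ^ 2 <= quad (%j k. g j k x) v" using lo0[OF x, of v] \<delta> by (smt (verit) divide_nonneg_nonneg mult_nonneg_nonneg zero_le_power2)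
 qed
 obtain s1 where s1: "0 < s1" and it: "!!s (u :: 'm => 'n rfun) B \<rho> \<epsilon>. 0 < s ==> s < s1 ==> 0 < \<rho> ==> \<rho> <= \<rho>0 ==> 0 < \<epsilon> ==>
  state g (1 / real (4 * CARD('n))) (thick K \<rho>) s B u ==>
  (EX v H. solution g u \<epsilon> \<alpha> H (thick K (\<rho>/2)) v)"
  using iterate[OF mn refl N \<alpha> \<beta>] by blast
 define s where "s = min (s1 / 2) (min 1 (\<delta> / (4 * ?n ^ 3)))"
 have s: "0 < s" "s < s1" "s <= 1" "?n ^ 3 * s <= \<delta> / 4"
 proof -
  have "s <= \<delta> / (4 * ?n ^ 3)" by (simp add: s_def)
  hence "?n ^ 3 * s <= ?n ^ 3 * (\<delta> / (4 * ?n ^ 3))" by (intro mult_left_mono) auto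
  thus "?n ^ 3 * s <= \<delta> / 4" by simp
  show "s < s1" using s1 by (simp add: s_def min_less_iff_disj)
 qed (use s1 \<delta> in \<open>auto simp: s_def\<close>)
 have s2: "?n^2 * (?n * s^2) <= \<delta> / 4"
 proof -
  have "s^2 <= s" using s(1,3) by (simp add: power2_eq_square mult_left_le)
  hence "?n ^ 3 * s^2 <= ?n ^ 3 * s" by (intro mult_left_mono) auto
  moreover have "?n^2 * (?n * s^2) = ?n ^ 3 * s^2" by (simp add: power2_eq_square power3_eq_cube)
  ultimately show ?thesis using s(4) by linarith
 qed
 define h where "h = (%j k x. g j k x - gram v0 j k x - s^2 * H0 j k)"
 have pos: "0 < quad (%j k. h j k x) v" if x: "x:K'" and v: "v ~= 0" for x v
 proof -
  have e: "\<bar>s\<^sup>2 * H0 j k\<bar> <= ?n * s^2" for j k :: 'n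
   using mult_left_mono[OF H0_bound[of j k], of "s^2"] by (simp add: abs_mult mult.commute)
  have "\<bar>quad (%j k. s^2 * H0 j k) v\<bar> <= ?n^2 * (?n * s^2) * norm v ^ 2" by (rule sum_abs_bound[OF e])
  also have "... <= \<delta> / 4 * norm v ^ 2" using s2 by (rule mult_right_mono) simp
  finally have "\<bar>quad (%j k. s^2 * H0 j k) v\<bar> <= \<delta> / 4 * norm v ^ 2" .
  moreover have "\<delta> / 2 * norm v ^ 2 <= quad (%j k. g j k x - gram v0 j k x) v" using \<rho>2(2) sub x by blast
  moreover have "0 < \<delta> / 4 * norm v ^ 2" using \<delta> v by simp
  ultimately show ?thesis unfolding h_def quad_diff[where M="%j k. g j k x - gram v0 j k x"] by simp
 qed
 have hc: "continuous_on K' (h j k)" for j k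
  unfolding h_def by (intro continuous_intros gc sub continuous_on_subset[OF gcont]) auto
 have hs: "h j k x = h k j x" for j k x by (simp add: h_def gsym[of j k] H0_def mult.commute)
 define \<sigma> where "\<sigma> = 1 / real (4 * CARD('n))"
 have \<sigma>: "0 < \<sigma> * s^2" using s(1) by (simp add: \<sigma>_def)
 have \<epsilon>2: "0 < \<epsilon> / 2" using \<epsilon> by simp
 obtain u :: "'m => 'n rfun" where u: "!!b. P.sm (u b)" "!!x b. x:thick K \<rho>0 ==> \<bar>u b x - v0 b x\<bar> <= \<epsilon> / 2"
  "!!x j k. x:thick K \<rho>0 ==> \<bar>gram u j k x - gram v0 j k x - h j k x\<bar> <= \<sigma> * s^2"
  using P.nash[OF mn sm_mono[OF W(1) v0 _ pP] \<gamma> lo0 K' sub(1) hc hs pos \<sigma> \<epsilon>2] sub(1,4) by blast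
 have "ALL q. EX C>0. ALL x:thick K \<rho>0. \<bar>pder (fst q) (pder (fst (snd q)) (u (snd (snd q)))) x\<bar> <= C"
  using P.sm_bound[OF P.sm_pder[OF P.sm_pder[OF u(1)]]] by blast
 from choice[OF this] obtain C where C: "!!q x. x:thick K \<rho>0 ==> \<bar>pder (fst q) (pder (fst (snd q)) (u (snd (snd q)))) x\<bar> <= C q" by blast
 define B where "B = Max (range C)"
 have B: "\<bar>pder k (pder i (u a)) x\<bar> <= B" if "x:thick K \<rho>0" for k i a x
 proof -
  have "\<bar>pder k (pder i (u a)) x\<bar> <= C (k, i, a)" using C[OF that, of "(k, i, a)"] by simp
  also have "... <= B" unfolding B_def by (rule Max_ge) auto
  finally show ?thesis .
 qed
 have "state g \<sigma> (thick K \<rho>0) s B u" unfolding state_def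
 proof (intro ballI conjI allI)
  fix x assume x: "x:thick K \<rho>0"
  show "u a dif x" "pder i (u a) dif x" for a i
   using P.sm_diff[OF u(1) x] P.sm_diff[OF P.sm_pder[OF u(1)] x] by auto
  show "\<bar>pder k (pder i (u a)) x\<bar> <= B" for k i a by (rule B[OF x])
  show "\<bar>g j k x - gram u j k x - s^2 * H0 j k\<bar> <= \<sigma> * s^2" for j k
   using u(3)[OF x, of j k] unfolding h_def by linarith
 qed
 from it[OF s(1,2) \<rho>0(1) order_refl \<epsilon>2 this[unfolded \<sigma>_def]]
 obtain v H where v: "!!x a. x:thick K (\<rho>0/2) ==> v a dif x & \<bar>v a x - u a x\<bar> <= \<epsilon> / 2"
   "ALL x:thick K (\<rho>0/2). ALL j k. gram v j k x = g j k x"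
   "ALL x y i a. closed_segment x y \<subseteq> thick K (\<rho>0/2) --> norm (x - y) <= 1 -->
     \<bar>pder i (v a) x - pder i (v a) y\<bar> <= H * norm (x - y) powr \<alpha>" by blast
 have "\<bar>v a x - v0 a x\<bar> <= \<epsilon>" if x: "x:thick K (\<rho>0/2)" for x a
 proof -
  have "x:thick K \<rho>0" using thick_mono[of "\<rho>0/2" \<rho>0 K] x \<rho>0(1) by auto
  thus ?thesis using v(1)[OF x, of a] u(2)[of x a] by linarith
 qed
 thus ?thesis using v \<rho>0(1) by (intro exI[of _ "\<rho>0/2"] exI[of _ v] exI[of _ H]) auto
qed

section \<open>Smooth domains and extension of the metric\<close>

lemma component_pder:
 fixes f :: "real^'n => 'b::real_normed_vector" and l :: "'b => real"
 assumes "bounded_linear l" "f dif x"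
 shows "(%x. l (f x)) dif x" "pder i (%x. l (f x)) x = l (frechet_derivative f (at x) (axis i 1))"
proof -
 have "((%x. l (f x)) has_derivative (%v. l (frechet_derivative f (at x) v))) (at x)"
  using bounded_linear.has_derivative[OF assms(1)] assms(2) frechet_derivative_works by blast
 thus "(%x. l (f x)) dif x" "pder i (%x. l (f x)) x = l (frechet_derivative f (at x) (axis i 1))"
  by (auto intro: differentiableI simp: pder_eq)
qed

text \<open>Near \<open>p\<close> the \<open>j\<close>-th coordinate \<open>\<phi>\<close> of the
  boundary chart is positive exactly in \<open>\<Omega>\<close>. Its gradient at \<open>p\<close> is
  not 0, because the chart has a differentiable inverse. Along directions close to the gradient
  \<open>\<phi>\<close> strictly increases, so points of the closure are pushed inside.\<close>

lemma cone_frontier: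
 fixes \<Omega> :: "(real^'n) set"
 assumes \<Omega>: "open \<Omega>" "smooth_boundary \<Omega>" and p: "p:frontier \<Omega>"
 shows "EX e r. cone_dir \<Omega> (closure \<Omega>) p e r"
proof -
 obtain U V and P Q :: "real^'n => real^'n" and j where U: "open U" "p:U" and V: "open V" and h: "homeomorphism U V P Q"
  and sP: "smooth_on U P" and sQ: "smooth_on V Q" and in': "P ` (U \<inter> \<Omega>) = {y:V. y $ j > 0}"
  and bd: "P ` (U \<inter> frontier \<Omega>) = {y:V. y $ j = 0}"
  using bspec[OF \<Omega>(2)[unfolded smooth_boundary_def] p] by (elim exE conjE) (rule that, assumption+)
 have QP: "x:U ==> Q (P x) = x" and PQ: "y:V ==> P (Q y) = y" and PV: "x:U ==> P x:V" for x y
  using h unfolding homeomorphism_def by auto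
 define \<phi> where "\<phi> = (%x. P x $ j)"
 have "Ck 1 U U P" "Ck 1 V V Q" using sP sQ unfolding smooth_on_def by blast+
 hence dP: "x:U ==> P dif x" and cP: "continuous_on U (pd U i P)" and dQ: "y:V ==> Q dif y" for x y i
  by auto
 note bl = bounded_linear_vec_nth[of j]
 have d\<phi>: "\<phi> dif x" "pder i \<phi> x = pd U i P x $ j" if "x:U" for x i
  using component_pder[OF bl dP[OF that]] that unfolding \<phi>_def by (auto simp: pd_def bdry_ext_def)
 have c\<phi>: "continuous_on U (pder i \<phi>)" for i
  by (rule continuous_on_eq[OF continuous_on_component[OF cP[of i], of j]]) (simp add: d\<phi>)
 define e where "e = (\<chi> i. pder i \<phi> p)"
 have e0: "e ~= 0"
 proof
  assume "e = 0"
  hence z: "pder i \<phi> p = 0" for i by (simp add: e_def vec_eq_iff)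
  have pv: "P p:V" "Q (P p) = p" using U PV QP by auto
  obtain Q' where Q': "(Q has_derivative Q') (at (P p))" using dQ[OF pv(1)] unfolding differentiable_def by blast
  have "(\<phi> has_derivative (%v. 0)) (at (Q (P p)))" using pder_works[OF d\<phi>(1)[OF U(2)]] z pv by simp
  from has_derivative_compose[OF Q' this] have "((%y. \<phi> (Q y)) has_derivative (%v. 0)) (at (P p))" .
  hence "((%y. y $ j) has_derivative (%v. 0)) (at (P p))"
   by (rule has_derivative_transform_within_open[OF _ V pv(1)]) (simp add: \<phi>_def PQ)
  moreover have "((%y. y $ j) has_derivative (%v. v $ j)) (at (P p))" by (rule bounded_linear_imp_has_derivative[OF bl])
  ultimately have "(%v::real^'n. 0) = (%v. v $ j)" by (rule has_derivative_unique)
  from fun_cong[OF this, of "axis j 1"] show False by (simp add: axis_def)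
 qed
 \<comment> \<open>Directional derivative as a continuous function of point and direction, so that
   its positivity at \<open>(p, e)\<close> spreads to neighbourhoods of both.\<close>
 define G where "G = (%(x, d). SU i. d $ i * pder i \<phi> x)"
 have cG: "continuous_on (U \<times> UNIV) G" unfolding G_def case_prod_beta
  by (intro continuous_intros continuous_on_compose2[OF c\<phi> continuous_on_fst[OF continuous_on_id]]) auto
 have "open ((U \<times> UNIV) \<inter> G -` {0<..})" using U by (intro continuous_open_preimage[OF cG] open_Times) auto
 moreover have "(p, e):(U \<times> UNIV) \<inter> G -` {0<..}"
 proof -
  have "G (p, e) = e \<bullet> e" by (simp add: G_def e_def inner_vec_def)
  thus ?thesis using e0 U by simp
 qed
 ultimately obtain r0 where r0: "0 < r0" "ball (p, e) r0 \<subseteq> (U \<times> UNIV) \<inter> G -` {0<..}" by (meson openE)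
 have G: "x:U" "0 < G (x, d)" if "dist p x < r0 / 2" "dist e d < r0 / 2" for x d
 proof -
  have "dist (p, e) (x, d) <= dist p x + dist e d" unfolding dist_Pair_Pair by (rule sqrt_sum_squares_le_sum) auto
  hence "(x, d):ball (p, e) r0" using that by simp
  thus "x:U" "0 < G (x, d)" using r0 by auto
 qed
 define r where "r = min (r0 / 4) (r0 / (4 * (norm e + r0)))"
 have n0: "0 < norm e + r0" using r0(1) by (simp add: add_nonneg_pos)
 have r: "0 < r" "r <= r0 / 4" "r * (norm e + r0) <= r0 / 4"
 proof -
  have "r <= r0 / (4 * (norm e + r0))" by (simp add: r_def)
  hence "r * (norm e + r0) <= r0 / (4 * (norm e + r0)) * (norm e + r0)" using n0 by (intro mult_right_mono) auto
  also have "... = r0 / 4" using n0 by (simp add: field_simps)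
  finally show "r * (norm e + r0) <= r0 / 4" .
  show "r <= r0 / 4" unfolding r_def by (rule min.cobounded1)
 qed (use r0 n0 in \<open>auto simp: r_def\<close>)
 have "x + s *\<^sub>R d:\<Omega>" if x: "x:closure \<Omega>" "x:ball p r" and d: "d:ball e r" and s: "0 < s" "s <= r" for x d s
 proof -
  have nd: "norm d <= norm e + r0" using d r(2) r0(1) norm_triangle_ineq4[of e "e - d"] by (simp add: dist_norm)
  have near: "dist p (x + t *\<^sub>R d) < r0 / 2" if t: "0 <= t" "t <= s" for t
  proof -
   have "t * norm d <= r * (norm e + r0)" using t s nd by (intro mult_mono) auto
   hence "norm (t *\<^sub>R d) <= r0 / 4" using t r(3) by simp
   moreover have "dist p (x + t *\<^sub>R d) <= dist p x + norm (t *\<^sub>R d)" using dist_triangle[of p "x + t *\<^sub>R d" x] by (simp add: dist_norm)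
   ultimately show ?thesis using x(2) r(2) by simp
  qed
  have de: "dist e d < r0 / 2" using d r(2) r0(1) by simp
  have "\<phi> (x + 0 *\<^sub>R d) < \<phi> (x + s *\<^sub>R d)"
  proof (rule DERIV_pos_imp_increasing[OF s(1)])
   fix t assume t: "0 <= t" "t <= s"
   have l: "((%t. x + t *\<^sub>R d) has_derivative (%h. h *\<^sub>R d)) (at t)" by (auto intro!: derivative_eq_intros)
   have "((%t. \<phi> (x + t *\<^sub>R d)) has_derivative (%h. SU i. (h *\<^sub>R d) $ i * pder i \<phi> (x + t *\<^sub>R d))) (at t)"
    by (rule has_derivative_compose[OF l pder_works[OF d\<phi>(1)[OF G(1)[OF near[OF t] de]]]])
   moreover have "(%h. SU i. (h *\<^sub>R d) $ i * pder i \<phi> (x + t *\<^sub>R d)) = (*) (G (x + t *\<^sub>R d, d))"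
    by (simp add: G_def fun_eq_iff sum_distrib_left mult_ac)
   ultimately have "DERIV (%t. \<phi> (x + t *\<^sub>R d)) t :> G (x + t *\<^sub>R d, d)" by (simp add: has_field_derivative_def)
   thus "EX y. DERIV (%t. \<phi> (x + t *\<^sub>R d)) t :> y & y > 0" using G(2)[OF near[OF t] de] by blast
  qed
  moreover have "0 <= \<phi> x"
  proof -
   have xU: "x:U" using G(1)[OF near[of 0] de] s by simp
   have "x:\<Omega> | x:frontier \<Omega>" using x(1) \<Omega>(1) by (auto simp: frontier_def interior_open)
   thus ?thesis using in' bd xU unfolding \<phi>_def by (metis (mono_tags, lifting) IntI imageI less_imp_le mem_Collect_eq order_refl)
  qed
  ultimately have pos: "0 < \<phi> (x + s *\<^sub>R d)" by simp
  have yU: "x + s *\<^sub>R d:U" using G(1)[OF near[of s] de] s by simp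
  hence "P (x + s *\<^sub>R d):P ` (U \<inter> \<Omega>)" unfolding in' using pos PV by (simp add: \<phi>_def)
  then obtain w where "w:U" "w:\<Omega>" "P (x + s *\<^sub>R d) = P w" by blast
  thus ?thesis using QP yU by metis
 qed
 thus ?thesis using r(1) unfolding cone_dir_def by blast
qed

lemma cone_domain:
 fixes \<Omega> :: "(real^'n) set"
 assumes \<Omega>: "open \<Omega>" "smooth_boundary \<Omega>" and p: "p:closure \<Omega>"
 shows "EX e r. cone_dir \<Omega> (closure \<Omega>) p e r"
proof (cases "p:\<Omega>")
 case True
 then obtain t where t: "0 < t" "ball p t \<subseteq> \<Omega>" using \<Omega>(1) by (meson openE)
 define r where "r = min (t / 2) 1"
 have r: "0 < r" "r <= t / 2" "r <= 1" using t by (auto simp: r_def)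
 have "x + s *\<^sub>R d:\<Omega>" if "x:ball p r" "d:ball 0 r" "0 < s" "s <= r" for x s d
 proof -
  have "s * norm d <= 1 * r" using that r by (intro mult_mono) auto
  moreover have "dist p (x + s *\<^sub>R d) <= dist p x + norm (s *\<^sub>R d)" using dist_triangle[of p "x + s *\<^sub>R d" x] by (simp add: dist_norm)
  ultimately have "x + s *\<^sub>R d:ball p t" using that r by simp
  thus ?thesis using t by blast
 qed
 thus ?thesis using r(1) unfolding cone_dir_def by blast
next
 case False
 thus ?thesis using cone_frontier[OF \<Omega>] p \<Omega>(1) by (auto simp: frontier_def interior_open)
qed

text \<open>The segment between two close points may leave \<open>\<Omega>\<close>. Pushing both
  inwards by a step proportional to their distance gives a path of three segments inside
  \<open>\<Omega>\<close>, of length comparable to the distance. For points far apart the sup bound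
  \<open>M\<close> is enough.\<close>

lemma lipschitz_domain:
 fixes f :: "'n::finite rfun"
 assumes \<Omega>: "open \<Omega>" "\<Omega> \<subseteq> K" and K: "compact K" and cone: "!!p. p:K ==> EX e r. cone_dir \<Omega> K p e r"
  and d: "!!x. x:\<Omega> ==> f dif x" and G: "!!x i. x:\<Omega> ==> \<bar>pder i f x\<bar> <= G" and M: "!!x. x:\<Omega> ==> \<bar>f x\<bar> <= M"
 shows "EX L>=0. ALL x:\<Omega>. ALL y:\<Omega>. \<bar>f x - f y\<bar> <= L * norm (x - y)"
proof -
 let ?n = "real CARD('n)"
 obtain e r where er: "!!p. p:K ==> cone_dir \<Omega> K p (e p) (r p)" using cone by metis
 have r: "0 < r p" if "p:K" for p using er[OF that] by (simp add: cone_dir_def)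
 define L where "L = (%p. ?n * \<bar>G\<bar> * (4 * norm (e p) / r p + 1))"
 have L0: "0 <= L p" if "p:K" for p using r[OF that] by (simp add: L_def)
 have G': "\<bar>pder i f x\<bar> <= \<bar>G\<bar>" if "x:\<Omega>" for x i using G[OF that, of i] by linarith
 have loc: "\<bar>f x - f y\<bar> <= L p * norm (x - y)"
  if p: "p:K" and x: "x:\<Omega>" "x:ball p (r p)" and y: "y:\<Omega>" "y:ball p (r p)" and xy: "2 * norm (x - y) <= r p * r p" for p x y
 proof (cases "x = y")
  case False
  define s where "s = 2 * norm (x - y) / r p"
  have s: "0 < s" "s <= r p" "norm (x - y) / s < r p" using False xy r[OF p] by (simp_all add: s_def pos_divide_le_eq)
  have inO: "z + t *\<^sub>R d:\<Omega>" if "z:\<Omega>" "z:ball p (r p)" "0 < t" "t <= s" "d:ball (e p) (r p)" for z t d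
   using er[OF p] that s(2) \<Omega>(2) unfolding cone_dir_def by fastforce
  have eb: "e p:ball (e p) (r p)" using r[OF p] by simp
  have seg: "\<bar>f (z + s *\<^sub>R e p) - f z\<bar> <= ?n * \<bar>G\<bar> * norm (z + s *\<^sub>R e p - z)" if z: "z:\<Omega>" "z:ball p (r p)" for z
  proof -
   have "closed_segment z (z + s *\<^sub>R e p) \<subseteq> \<Omega>"
   proof
    fix q assume "q:closed_segment z (z + s *\<^sub>R e p)"
    then obtain u where u: "0 <= u" "u <= 1" "q = (1 - u) *\<^sub>R z + u *\<^sub>R (z + s *\<^sub>R e p)" by (auto simp: closed_segment_def)
    hence q: "q = z + (u * s) *\<^sub>R e p" by (simp add: algebra_simps)
    show "q:\<Omega>"
    proof (cases "u = 0")
     case False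
     thus ?thesis unfolding q using u s(1) by (intro inO z eb) (auto simp: mult_left_le_one_le)
    qed (use q z in simp)
   qed
   thus ?thesis using d G' by (intro mean_value_convex[OF convex_closed_segment]) auto
  qed
  have mid: "\<bar>f (y + s *\<^sub>R e p) - f (x + s *\<^sub>R e p)\<bar> <= ?n * \<bar>G\<bar> * norm (y + s *\<^sub>R e p - (x + s *\<^sub>R e p))"
  proof -
   have "closed_segment (x + s *\<^sub>R e p) (y + s *\<^sub>R e p) \<subseteq> \<Omega>"
   proof
    fix q assume "q:closed_segment (x + s *\<^sub>R e p) (y + s *\<^sub>R e p)"
    then obtain u where u: "0 <= u" "u <= 1" "q = (1 - u) *\<^sub>R (x + s *\<^sub>R e p) + u *\<^sub>R (y + s *\<^sub>R e p)" by (auto simp: closed_segment_def)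
    hence q: "q = x + s *\<^sub>R (e p + (u / s) *\<^sub>R (y - x))" using s(1) by (simp add: algebra_simps)
    have "norm ((u / s) *\<^sub>R (y - x)) = u * (norm (x - y) / s)" using u s(1) by (simp add: norm_minus_commute)
    also have "... <= 1 * (norm (x - y) / s)" using u s(1) by (intro mult_right_mono) auto
    finally have "e p + (u / s) *\<^sub>R (y - x):ball (e p) (r p)" using s(3) by (simp add: dist_norm)
    thus "q:\<Omega>" unfolding q using s by (intro inO x) auto
   qed
   thus ?thesis using d G' by (intro mean_value_convex[OF convex_closed_segment]) auto
  qed
  have n: "norm (z + s *\<^sub>R e p - z) = s * norm (e p)" "norm (y + s *\<^sub>R e p - (x + s *\<^sub>R e p)) = norm (x - y)" for z
   using s(1) by (simp_all add: norm_minus_commute)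
  have "\<bar>f x - f y\<bar> <= ?n * \<bar>G\<bar> * (s * norm (e p)) + ?n * \<bar>G\<bar> * norm (x - y) + ?n * \<bar>G\<bar> * (s * norm (e p))"
   using seg[OF x] seg[OF y] mid unfolding n by linarith
  also have "... = L p * norm (x - y)" using r[OF p] by (simp add: L_def s_def field_simps)
  finally show ?thesis .
 qed simp
 define \<rho> where "\<rho> = (%p. min (r p / 2) (r p * r p / 4))"
 have \<rho>: "0 < \<rho> p" if "p:K" for p using r[OF that] by (simp add: \<rho>_def)
 obtain Z where Z: "Z \<subseteq> K" "finite Z" "K \<subseteq> (UN p:Z. ball p (\<rho> p))"
  by (rule compactE_image[OF K, of K "%p. ball p (\<rho> p)"]) (use \<rho> in auto)
 define \<delta> where "\<delta> = Min (insert 1 (\<rho> ` Z))"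
 have \<delta>: "0 < \<delta>" "!!p. p:Z ==> \<delta> <= \<rho> p" using Z \<rho> unfolding \<delta>_def by (auto simp: Min_gr_iff)
 define L1 where "L1 = (SUM p:Z. L p) + 2 * \<bar>M\<bar> / \<delta>"
 have Ls: "0 <= (SUM p:Z. L p)" using L0 Z by (intro sum_nonneg) auto
 have "\<bar>f x - f y\<bar> <= L1 * norm (x - y)" if x: "x:\<Omega>" and y: "y:\<Omega>" for x y
 proof (cases "norm (x - y) < \<delta>")
  case True
  obtain p where p: "p:Z" "dist p x < \<rho> p" using Z(3) x \<Omega>(2) by (auto simp: subset_iff)
  have xy: "norm (x - y) < \<rho> p" using \<delta>(2)[OF p(1)] True by simp
  have pK: "p:K" using p Z by blast
  have \<rho>r: "\<rho> p <= r p / 2" "\<rho> p <= r p * r p / 4" by (auto simp: \<rho>_def)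
  have "dist p y <= dist p x + dist x y" by (rule dist_triangle)
  hence yb: "y:ball p (r p)" using p(2) xy \<rho>r by (simp add: dist_norm)
  have xb: "x:ball p (r p)" using p(2) \<rho>r r[OF pK] by simp
  have "\<bar>f x - f y\<bar> <= L p * norm (x - y)" by (rule loc[OF pK x xb y yb]) (use xy \<rho>r zero_le_square[of "r p"] in linarith)
  also have "... <= L1 * norm (x - y)"
  proof (rule mult_right_mono)
   have "L p <= (SUM p:Z. L p)" using p Z L0 by (intro member_le_sum) auto
   moreover have "0 <= 2 * \<bar>M\<bar> / \<delta>" using \<delta>(1) by simp
   ultimately show "L p <= L1" unfolding L1_def by linarith
  qed simp
  finally show ?thesis .
 next
  case False
  have "\<bar>f x - f y\<bar> <= 2 * \<bar>M\<bar> / \<delta> * \<delta>" using M[OF x] M[OF y] \<delta>(1) by simp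
  also have "... <= L1 * norm (x - y)" using False \<delta>(1) Ls by (intro mult_mono) (auto simp: L1_def)
  finally show ?thesis .
 qed
 moreover have "0 <= L1" unfolding L1_def using Ls \<delta>(1) by simp
 ultimately show ?thesis by blast
qed

text \<open>McShane's extension formula.\<close>

lemma lipschitz_extend:
 fixes f :: "'n::finite rfun"
 assumes L: "0 <= L" "!!x y. x:\<Omega> ==> y:\<Omega> ==> \<bar>f x - f y\<bar> <= L * norm (x - y)" and ne: "\<Omega> ~= {}"
 shows "EX F. (ALL x:\<Omega>. F x = f x) & (ALL x y. \<bar>F x - F y\<bar> <= L * norm (x - y))"
proof -
 obtain z0 where z0: "z0:\<Omega>" using ne by blast
 define F where "F = (%x. INF z\<in>\<Omega>. f z + L * norm (x - z))"
 have bd: "bdd_below ((%z. f z + L * norm (x - z)) ` \<Omega>)" for x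
 proof (rule bdd_belowI2)
  fix z assume z: "z:\<Omega>"
  have "L * norm (z - z0) <= L * (norm (x - z) + norm (x - z0))"
   using L(1) norm_triangle_ineq4[of "x - z0" "x - z"] by (intro mult_left_mono) (simp_all add: add.commute)
  thus "f z0 - L * norm (x - z0) <= f z + L * norm (x - z)" using L(2)[OF z z0] by (simp add: algebra_simps)
 qed
 have le: "F x <= F y + L * norm (x - y)" for x y
 proof -
  have "F x - L * norm (x - y) <= F y" unfolding F_def[of, THEN fun_cong, of y]
  proof (rule cINF_greatest[OF ne])
   fix z assume z: "z:\<Omega>"
   have "F x <= f z + L * norm (x - z)" unfolding F_def by (rule cINF_lower[OF bd z])
   also have "L * norm (x - z) <= L * (norm (x - y) + norm (y - z))"
    using L(1) norm_triangle_ineq[of "x - y" "y - z"] by (intro mult_left_mono) simp_all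
   finally show "F x - L * norm (x - y) <= f z + L * norm (y - z)" by (simp add: algebra_simps)
  qed
  thus ?thesis by simp
 qed
 have "F x = f x" if x: "x:\<Omega>" for x
 proof (rule antisym)
  show "F x <= f x" using cINF_lower[OF bd x, of x] by (simp add: F_def)
  show "f x <= F x" unfolding F_def
  proof (rule cINF_greatest[OF ne])
   fix z assume "z:\<Omega>"
   thus "f x <= f z + L * norm (x - z)" using L(2)[OF x, of z] by linarith
  qed
 qed
 moreover have "\<bar>F x - F y\<bar> <= L * norm (x - y)" for x y using le[of x y] le[of y x] by (simp add: norm_minus_commute)
 ultimately show ?thesis by blast
qed

text \<open>In dimension one an affine continuation past the end points preserves the class \<open>C\<^sup>1\<^sup>,\<^sup>1\<close>.\<close>

lemma line_extend:
 fixes f :: "'n::finite rfun" and i :: 'n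
 assumes n: "CARD('n) = 1" and \<Omega>: "open \<Omega>" "connected \<Omega>" "\<Omega> ~= {}" and K: "compact K" "K = closure \<Omega>"
  and f: "continuous_on K f" "continuous_on K f'" and d: "!!x. x:\<Omega> ==> f dif x" "!!x. x:\<Omega> ==> pder i f x = f' x"
  and d': "!!x. x:\<Omega> ==> f' dif x" "!!x. x:\<Omega> ==> \<bar>pder i f' x\<bar> <= B"
 shows "EX F. (ALL x:K. F x = f x) & continuous_on UNIV F & (ALL x t. \<bar>F (x + t) + F (x - t) - 2 * F x\<bar> <= 4 * \<bar>B\<bar> * norm t ^ 2)"
proof -
 have "is_singleton (UNIV :: 'n set)" using n by (simp add: is_singleton_altdef)
 hence all: "j = i" for j by (metis UNIV_I is_singletonE singletonD)
 have U: "(UNIV :: 'n set) = {i}" using all by blast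
 have nrm: "norm x = \<bar>x $ i\<bar>" for x :: "real^'n" by (simp add: norm_vec_def L2_set_def U)
 have inn: "x \<bullet> y = x $ i * y $ i" for x y :: "real^'n" by (simp add: inner_vec_def U)
 have cv: "convex \<Omega>" using connected_convex_1_gen[of \<Omega>] \<Omega>(2) n by simp
 hence cK: "convex K" "closed K" "K ~= {}" using K \<Omega>(3) by (auto simp: convex_closure compact_imp_closed)
 define B' where "B' = \<bar>B\<bar>"
 have B': "0 <= B'" "!!j x. x:\<Omega> ==> \<bar>pder j f' x\<bar> <= B'" using d'(2) all unfolding B'_def by (auto, metis abs_ge_self order_trans)
 have l1: "\<bar>f' q - f' p\<bar> <= B' * \<bar>q $ i - p $ i\<bar>" if "p:\<Omega>" "q:\<Omega>" for p q
  using mean_value_convex[OF cv d'(1) B'(2) that] n by (simp add: nrm)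
 have l2: "\<bar>f q - f p - (q $ i - p $ i) * f' p\<bar> <= B' * (q $ i - p $ i)\<^sup>2" if p: "p:\<Omega>" and q: "q:\<Omega>" for p q
 proof -
  have sg: "closed_segment p q \<subseteq> \<Omega>" using cv p q by (simp add: closed_segment_subset)
  have li: "((%z. (z $ i - p $ i) * f' p) has_derivative (%v. v $ i * f' p)) (at z)" for z
   by (auto intro!: derivative_eq_intros bounded_linear_imp_has_derivative bounded_linear_vec_nth)
  have ld: "(%z. (z $ i - p $ i) * f' p) dif z" for z using li by (rule differentiableI)
  have lp: "pder j (%z. (z $ i - p $ i) * f' p) z = f' p" for z j using pder_eq[OF li] all[of j] by (simp add: axis_def)
  have "\<bar>(f q - (q $ i - p $ i) * f' p) - (f p - (p $ i - p $ i) * f' p)\<bar> <= CARD('n) * (B' * \<bar>q $ i - p $ i\<bar>) * norm (q - p)"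
  proof (rule mean_value_convex[OF convex_closed_segment[of p q]])
   fix z j assume z: "z:closed_segment p q"
   hence zO: "z:\<Omega>" using sg by blast
   show "(%z. f z - (z $ i - p $ i) * f' p) dif z" by (rule differentiable_diff[OF d(1)[OF zO] ld])
   have "pder j (%z. f z - (z $ i - p $ i) * f' p) z = f' z - f' p"
    using pder_diff[OF d(1)[OF zO] ld, of j] lp[of j z] d(2)[OF zO] all[of j] by simp
   also have "\<bar>...\<bar> <= B' * norm (z - p)" using l1[OF p zO] by (simp add: nrm)
   also have "... <= B' * norm (q - p)" using B'(1) segment_bound[OF z] by (intro mult_left_mono) (auto simp: norm_minus_commute)
   finally show "\<bar>pder j (%z. f z - (z $ i - p $ i) * f' p) z\<bar> <= B' * \<bar>q $ i - p $ i\<bar>" by (simp add: nrm)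
  qed auto
  thus ?thesis using n by (simp add: nrm power2_eq_square mult.assoc abs_mult_self_eq)
 qed
 have cfst: "continuous_on (K \<times> K) (%z. h (fst z))" "continuous_on (K \<times> K) (%z. h (snd z))" if "continuous_on K h" for h :: "'n rfun"
  by (rule continuous_on_compose2[OF that], auto intro: continuous_intros)+
 have KK: "closure (\<Omega> \<times> \<Omega>) = K \<times> K" using K closure_Times by blast
 have ext: "h (p, q) <= 0" if "p:K" "q:K" "continuous_on (K \<times> K) h" "!!p q. p:\<Omega> ==> q:\<Omega> ==> h (p, q) <= 0" for h :: "_ => real" and p q
  using continuous_le_on_closure[of "\<Omega> \<times> \<Omega>" h "(p, q)" 0] that unfolding KK by auto
 have L1: "\<bar>f' q - f' p\<bar> <= B' * \<bar>q $ i - p $ i\<bar>" if "p:K" "q:K" for p q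
  using ext[OF that, of "%z. \<bar>f' (snd z) - f' (fst z)\<bar> - B' * \<bar>snd z $ i - fst z $ i\<bar>"] l1
  by (force intro!: continuous_intros cfst f)
 have L2: "\<bar>f q - f p - (q $ i - p $ i) * f' p\<bar> <= B' * (q $ i - p $ i)\<^sup>2" if "p:K" "q:K" for p q
  using ext[OF that, of "%z. \<bar>f (snd z) - f (fst z) - (snd z $ i - fst z $ i) * f' (fst z)\<bar> - B' * (snd z $ i - fst z $ i)\<^sup>2"] l2
  by (force intro!: continuous_intros cfst f)
 define c where "c = closest_point K"
 have cin: "c x:K" for x unfolding c_def using cK by (intro closest_point_in_set) auto
 have cc: "continuous_on A c" for A unfolding c_def using cK by (intro continuous_on_closest_point) auto
 define F where "F = (%x. f (c x) + (x $ i - c x $ i) * f' (c x))"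
 have Fd: "\<bar>F y - F x - (y $ i - x $ i) * f' (c x)\<bar> <= 2 * B' * (y $ i - x $ i)\<^sup>2" for x y
 proof -
  define p q where "p = c x $ i" and "q = c y $ i"
  have o1: "(x $ i - p) * (q - p) <= 0" using closest_point_dot[OF cK(1,2) cin[of y], of x] by (simp add: inn c_def p_def q_def)
  have o2: "(y $ i - q) * (p - q) <= 0" using closest_point_dot[OF cK(1,2) cin[of x], of y] by (simp add: inn c_def p_def q_def)
  \<comment> \<open>Either both points project to the same point of \<open>K\<close>, or the two
    projections lie between them.\<close>
  have key: "\<bar>q - p\<bar> <= \<bar>y $ i - x $ i\<bar> & (q = p | \<bar>y $ i - q\<bar> <= \<bar>y $ i - x $ i\<bar>)"
  proof (cases p q rule: linorder_cases)
   case less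
   hence "x $ i <= p" "q <= y $ i" using o1 o2 by (auto simp: mult_le_0_iff)
   thus ?thesis using less by auto
  next
   case greater
   hence "p <= x $ i" "y $ i <= q" using o1 o2 by (auto simp: mult_le_0_iff)
   thus ?thesis using greater by auto
  qed simp
  have e: "F y - F x - (y $ i - x $ i) * f' (c x) = (f (c y) - f (c x) - (q - p) * f' (c x)) + (y $ i - q) * (f' (c y) - f' (c x))"
   by (simp add: F_def p_def q_def algebra_simps)
  have "\<bar>f (c y) - f (c x) - (q - p) * f' (c x)\<bar> <= B' * (q - p)\<^sup>2" using L2[OF cin cin] by (simp add: p_def q_def)
  also have "... <= B' * (y $ i - x $ i)\<^sup>2" using key B'(1) by (intro mult_left_mono) (auto simp: abs_le_square_iff)
  finally have a: "\<bar>f (c y) - f (c x) - (q - p) * f' (c x)\<bar> <= B' * (y $ i - x $ i)\<^sup>2" .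
  have "\<bar>(y $ i - q) * (f' (c y) - f' (c x))\<bar> <= \<bar>y $ i - q\<bar> * (B' * \<bar>q - p\<bar>)"
   unfolding abs_mult using L1[OF cin[of x] cin[of y]] by (intro mult_left_mono) (auto simp: p_def q_def)
  also have "... <= B' * (y $ i - x $ i)\<^sup>2"
  proof (cases "q = p")
   case False
   hence "\<bar>y $ i - q\<bar> * \<bar>q - p\<bar> <= \<bar>y $ i - x $ i\<bar> * \<bar>y $ i - x $ i\<bar>" using key by (intro mult_mono) auto
   hence "B' * (\<bar>y $ i - q\<bar> * \<bar>q - p\<bar>) <= B' * (y $ i - x $ i)\<^sup>2" using B'(1) by (intro mult_left_mono) (simp_all add: power2_eq_square abs_mult_self_eq)
   thus ?thesis by (simp only: mult.left_commute)
  qed (use B' in simp)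
  finally show ?thesis unfolding e using a by linarith
 qed
 have "\<bar>F (x + t) + F (x - t) - 2 * F x\<bar> <= 4 * B' * norm t ^ 2" for x t
  using Fd[of "x + t" x] Fd[of "x - t" x] by (simp add: nrm)
 moreover have "continuous_on UNIV F"
  unfolding F_def by (intro continuous_intros continuous_on_compose2[OF f(1) cc] continuous_on_compose2[OF f(2) cc] cc) (use cin in auto)
 moreover have "F x = f x" if "x:K" for x using that by (simp add: F_def c_def closest_point_self)
 ultimately show ?thesis unfolding B'_def by blast
qed

text \<open>The extension keeps just the control of second differences that mollifying the metric
  needs: order 2 in dimension one by \<open>line_extend\<close>, order 1 from the Lipschitz bound
  otherwise.\<close>

lemma metric_extend:
 fixes f :: "'n::finite rfun"
 assumes \<Omega>: "open \<Omega>" "connected \<Omega>" "\<Omega> ~= {}" and K: "compact K" "K = closure \<Omega>" and cone: "!!p. p:K ==> EX e r. cone_dir \<Omega> K p e r"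
  and f: "continuous_on K f" "!!i. continuous_on K (f' i)" and d: "!!x. x:\<Omega> ==> f dif x" "!!x i. x:\<Omega> ==> pder i f x = f' i x"
  and d': "!!x i. x:\<Omega> ==> f' i dif x" "!!i. continuous_on K (f'' i)" "!!x i. x:\<Omega> ==> pder i (f' i) x = f'' i x"
 shows "EX F C. 0 <= C & (ALL x:K. F x = f x) & continuous_on UNIV F &
  (ALL x t. norm t <= 1 --> \<bar>F (x + t) + F (x - t) - 2 * F x\<bar> <= C * norm t ^ (if CARD('n) = 1 then 2 else 1))"
proof -
 have bd: "EX B. ALL x:K. \<bar>h x\<bar> <= B" if "continuous_on K h" for h :: "'n rfun"
  using compact_imp_bounded[OF compact_continuous_image[OF that K(1)]] unfolding bounded_iff by auto
 have sub: "\<Omega> \<subseteq> K" using K(2) closure_subset by blast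
 show ?thesis
 proof (cases "CARD('n) = 1")
  case True
  obtain B where B: "!!x. x:K ==> \<bar>f'' undefined x\<bar> <= B" using bd[OF d'(2)] by blast
  have d2: "\<bar>pder undefined (f' undefined) x\<bar> <= B" if "x:\<Omega>" for x using B d'(3) sub that by auto
  from line_extend[OF True \<Omega> K f(1) f(2)[of undefined] d(1) d(2)[of _ undefined] d'(1) d2]
  obtain F where F: "ALL x:K. F x = f x" "continuous_on UNIV F" "ALL x t. \<bar>F (x + t) + F (x - t) - 2 * F x\<bar> <= 4 * \<bar>B\<bar> * norm t ^ 2" by blast
  thus ?thesis using True by (intro exI[of _ F] exI[of _ "4 * \<bar>B\<bar>"]) auto
 next
  case False
  obtain M where M: "!!x. x:K ==> \<bar>f x\<bar> <= M" using bd[OF f(1)] by blast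
  have "ALL i. EX B. ALL x:K. \<bar>f' i x\<bar> <= B" using bd[OF f(2)] by blast
  from choice[OF this] obtain B where B: "!!i x. x:K ==> \<bar>f' i x\<bar> <= B i" by blast
  have G: "\<bar>pder i f x\<bar> <= Max (range B)" if "x:\<Omega>" for i x
  proof -
   have "\<bar>pder i f x\<bar> <= B i" using B d(2) sub that by auto
   also have "... <= Max (range B)" by (rule Max_ge) auto
   finally show ?thesis .
  qed
  obtain L where L: "0 <= L" "!!x y. x:\<Omega> ==> y:\<Omega> ==> \<bar>f x - f y\<bar> <= L * norm (x - y)"
   using lipschitz_domain[OF \<Omega>(1) sub K(1) cone d(1) G M[OF subsetD[OF sub]]] by blast
  obtain F where F: "!!x. x:\<Omega> ==> F x = f x" "!!x y. \<bar>F x - F y\<bar> <= L * norm (x - y)"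
   using lipschitz_extend[OF L \<Omega>(3)] by blast
  have "L-lipschitz_on UNIV F" using F(2) L(1) by (auto simp: lipschitz_on_def dist_norm)
  hence cF: "continuous_on UNIV F" by (rule lipschitz_on_continuous_on)
  have "F x - f x = 0" if "x:closure \<Omega>" for x
   by (rule continuous_constant_on_closure[OF _ _ that])
    (use F(1) f(1) K(2) continuous_on_subset[OF cF] in \<open>auto intro!: continuous_intros\<close>)
  hence "ALL x:K. F x = f x" using K(2) by auto
  moreover have "\<bar>F (x + t) + F (x - t) - 2 * F x\<bar> <= 2 * L * norm t ^ 1" for x t
   using F(2)[of "x + t" x] F(2)[of "x - t" x] by simp
  ultimately show ?thesis using False cF L(1) by (intro exI[of _ F] exI[of _ "2 * L"]) auto
 qed
qed

lemma posdef_compact: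
 fixes M :: "'n::finite => 'n => 'n rfun"
 assumes K: "compact K" "K ~= {}" and M: "!!j k. continuous_on K (M j k)"
  and pos: "!!x v. x:K ==> v ~= 0 ==> 0 < quad (%j k. M j k x) v"
 shows "EX c>0. ALL x:K. ALL v. c * norm v ^ 2 <= quad (%j k. M j k x) v"
proof -
 let ?S = "K \<times> sphere (0::real^'n) 1"
 have c: "continuous_on ?S (%z. quad (%j k. M j k (fst z)) (snd z))"
  by (intro continuous_intros continuous_on_compose2[OF M]) auto
 have "compact ?S" "?S ~= {}" using K by (auto intro: compact_Times)
 from continuous_attains_inf[OF this c] obtain z where z: "z:?S"
  "!!y. y:?S ==> quad (%j k. M j k (fst z)) (snd z) <= quad (%j k. M j k (fst y)) (snd y)" by blast
 define c where "c = quad (%j k. M j k (fst z)) (snd z)"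
 have "0 < c" unfolding c_def using z(1) by (intro pos) auto
 moreover have "c * norm v ^ 2 <= quad (%j k. M j k x) v" if x: "x:K" for x v
 proof (cases "v = 0")
  case False
  define w where "w = (1 / norm v) *\<^sub>R v"
  have "(x, w):?S" using x False by (simp add: w_def)
  hence "c <= quad (%j k. M j k x) w" unfolding c_def using z(2)[of "(x, w)"] by simp
  hence "c * norm v ^ 2 <= quad (%j k. M j k x) w * norm v ^ 2" by (intro mult_right_mono) auto
  also have "... = quad (%j k. M j k x) v"
   unfolding sum_distrib_right using False by (intro sum.cong refl) (simp add: w_def power2_eq_square)
  finally show ?thesis .
 qed simp
 ultimately show ?thesis by blast
qed

section \<open>Derivatives up to the boundary and the induced metric\<close>

lemma bdry_ext_eq:
 assumes x: "x:closure W" and F: "continuous_on (closure W) F" and e: "!!x. x:W ==> F x = f x"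
 shows "bdry_ext W f x = F x"
proof (cases "x:W")
 case False
 hence l: "at x within W ~= bot" using x by (simp add: closure_def trivial_limit_within)
 have "(F \<longlongrightarrow> F x) (at x within closure W)" using F x by (simp add: continuous_on_def)
 hence "(F \<longlongrightarrow> F x) (at x within W)" by (rule tendsto_within_subset[OF _ closure_subset])
 hence "(f \<longlongrightarrow> F x) (at x within W)"
  by (rule Lim_transform_eventually) (auto simp: eventually_at_filter e)
 thus ?thesis using False tendsto_Lim[OF l] by (simp add: bdry_ext_def)
qed (simp add: bdry_ext_def e)

lemma pd_in: "x:W ==> pd W i f x = frechet_derivative f (at x) (axis i 1)"
 by (simp add: pd_def bdry_ext_def)

lemma Jac_pd:
 fixes u :: "real^'n => real^'m"
 assumes u: "Ck_closure 1 W u" and x: "x:closure W"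
 shows "Jac W u x = (\<chi> a i. pd W i u x $ a)" unfolding Jac_def
proof (rule bdry_ext_eq[OF x])
 have "continuous_on (closure W) (pd W i u)" for i using u by simp
 thus "continuous_on (closure W) (%x. \<chi> a i. pd W i u x $ a)" by (intro continuous_on_vec_lambda continuous_on_component)
 show "(\<chi> a i. pd W i u x $ a) = jacobian u (at x)" if "x:W" for x
  using that by (simp add: jacobian_def matrix_def pd_def bdry_ext_def vec_eq_iff)
qed

lemma
 fixes u :: "real^'n => real^'m"
 assumes u: "Ck_closure 1 W u" and x: "x:closure W"
 shows induced_entry: "induced W u x $ j $ k = (SU a. pd W j u x $ a * pd W k u x $ a)"
  and Jac_quad: "(norm (Jac W u x *v v))\<^sup>2 = quad (%j k. SU a. pd W j u x $ a * pd W k u x $ a) v"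
proof -
 show "induced W u x $ j $ k = (SU a. pd W j u x $ a * pd W k u x $ a)"
  by (simp add: induced_def Jac_pd[OF u x] matrix_matrix_mult_def transpose_def)
 have "Jac W u x *v v = (SU i. v $ i *\<^sub>R pd W i u x)"
  by (simp add: Jac_pd[OF u x] matrix_vector_mult_def vec_eq_iff mult.commute)
 thus "(norm (Jac W u x *v v))\<^sup>2 = quad (%j k. SU a. pd W j u x $ a * pd W k u x $ a) v"
  by (simp only: norm_comb) (simp add: inner_vec_def)
qed

lemma quad_matrix: "v \<bullet> (A *v v) = quad (%j k. A $ j $ k) v" for A :: "real^'n^'n"
 by (simp add: inner_vec_def matrix_vector_mult_def sum_distrib_left mult_ac)

theorem theorem1p1:
  fixes \<Omega> :: "(real^'n) set"
    and g :: "real^'n \<Rightarrow> real^'n^'n"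
    and ubar :: "real^'n \<Rightarrow> real^'m"
    and \<epsilon> \<alpha> :: real
  assumes "CARD('m) = CARD('n) + 1"
    and "smooth_bounded_domain \<Omega>"
    and "simply_connected \<Omega>"
    and "C2_metric \<Omega> g"
    and "immersion \<Omega> ubar"
    and "short \<Omega> g ubar"
    and "\<epsilon> > 0"
    and "0 < \<alpha>"
    and "\<alpha> < 1 / (1 + real CARD('n) ^ 2 - real CARD('n))"
  shows "\<exists>u :: real^'n \<Rightarrow> real^'m.
           immersion \<Omega> u \<and> C1_holder_closure \<alpha> \<Omega> u \<and>
           (\<forall>x\<in>closure \<Omega>. induced \<Omega> u x = g x) \<and>
           (SUP x\<in>closure \<Omega>. norm (u x - ubar x)) < \<epsilon>"
proof -
 let ?n = "real CARD('n)" and ?m = "real CARD('m)"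
 define K where "K = closure \<Omega>"
 have \<Omega>: "open \<Omega>" "connected \<Omega>" "\<Omega> ~= {}" "bounded \<Omega>" "smooth_boundary \<Omega>" using assms(2) by (auto simp: smooth_bounded_domain_def)
 have K: "compact K" "K ~= {}" "\<Omega> \<subseteq> K" using \<Omega> closure_subset by (auto simp: K_def compact_closure)
 have n1: "1 <= ?n" and m1: "1 <= ?m" by (simp_all add: Suc_leI)
 have cone: "EX e r. cone_dir \<Omega> K p e r" if "p:K" for p using cone_domain[OF \<Omega>(1,5)] that by (simp add: K_def)
 have bd: "EX B. ALL x:K. \<bar>h x\<bar> <= B" if "continuous_on K h" for h :: "'n rfun"
  using compact_imp_bounded[OF compact_continuous_image[OF that K(1)]] unfolding bounded_iff by auto
 have bl: "bounded_linear (%A::real^'n^'n. A $ j $ k)" for j k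
  by (rule bounded_linear_compose[OF bounded_linear_vec_nth bounded_linear_vec_nth])
 have Kg: "g x:Sym_pos" if "x:K" for x using assms(4) that by (auto simp: C2_metric_def K_def)
 have gC: "continuous_on K g" "!!x. x:\<Omega> ==> g dif x" "!!i. continuous_on K (pd \<Omega> i g)"
  "!!i x. x:\<Omega> ==> pd \<Omega> i g dif x" "!!i k. continuous_on K (pd \<Omega> k (pd \<Omega> i g))"
  using assms(4) by (auto simp: C2_metric_def K_def numeral_2_eq_2)
 define \<beta> :: nat where "\<beta> = (if CARD('n) = 1 then 2 else 1)"
 have "EX F C. 0 <= C & (ALL x:K. F x = g x $ j $ k) & continuous_on UNIV F &
  (ALL x t. norm t <= 1 --> \<bar>F (x + t) + F (x - t) - 2 * F x\<bar> <= C * norm t ^ \<beta>)" for j k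
  unfolding \<beta>_def
 proof (rule metric_extend[OF \<Omega>(1,2,3) K(1) K_def cone, where f'="%i x. pd \<Omega> i g x $ j $ k" and f''="%i x. pd \<Omega> i (pd \<Omega> i g) x $ j $ k"])
 qed (use component_pder[OF bl gC(2)] component_pder[OF bl gC(4)] in \<open>auto simp: pd_in intro!: continuous_on_component gC\<close>)
 hence "ALL jk. EX F C. 0 <= C & (ALL x:K. F x = g x $ fst jk $ snd jk) & continuous_on UNIV F &
  (ALL x t. norm t <= 1 --> \<bar>F (x + t) + F (x - t) - 2 * F x\<bar> <= C * norm t ^ \<beta>)" by blast
 from choice[OF this] obtain F where "ALL jk. EX C. 0 <= C & (ALL x:K. F jk x = g x $ fst jk $ snd jk) & continuous_on UNIV (F jk) &
  (ALL x t. norm t <= 1 --> \<bar>F jk (x + t) + F jk (x - t) - 2 * F jk x\<bar> <= C * norm t ^ \<beta>)" by blast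
 from choice[OF this] obtain C where C: "ALL jk. 0 <= C jk & (ALL x:K. F jk x = g x $ fst jk $ snd jk) & continuous_on UNIV (F jk) &
  (ALL x t. norm t <= 1 --> \<bar>F jk (x + t) + F jk (x - t) - 2 * F jk x\<bar> <= C jk * norm t ^ \<beta>)" ..
 note Cs = spec[OF C]
 note C0 = Cs[THEN conjunct1] and FK = Cs[THEN conjunct2, THEN conjunct1, rule_format] and Fc = Cs[THEN conjunct2, THEN conjunct2, THEN conjunct1]
  and F2 = Cs[THEN conjunct2, THEN conjunct2, THEN conjunct2, rule_format]
 \<comment> \<open>The entries were extended one by one, so symmetry outside \<open>K\<close> is
   restored by averaging.\<close>
 define G where "G = (%j k x. (F (j, k) x + F (k, j) x) / 2)"
 define Cg where "Cg = (SU jk. C jk)"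
 have Cle: "C jk <= Cg" for jk unfolding Cg_def using C0 by (intro member_le_sum) auto
 have Gsym: "G j k = G k j" for j k by (simp add: G_def add.commute)
 have gsym: "g x $ j $ k = g x $ k $ j" if "x:K" for x j k
 proof -
  have "transpose (g x) $ j $ k = g x $ j $ k" using Kg[OF that] by (simp add: Sym_pos_def)
  thus ?thesis by (simp add: transpose_def)
 qed
 have GK: "G j k x = g x $ j $ k" if "x:K" for x j k using FK[OF that] gsym[OF that, of j k] by (simp add: G_def)
 have Gc: "continuous_on A (G j k)" for j k A
  unfolding G_def by (intro continuous_intros continuous_on_subset[OF Fc]) auto
 have G2: "\<bar>G j k (x + t) + G j k (x - t) - 2 * G j k x\<bar> <= Cg * norm t ^ \<beta>" if t: "norm t <= 1" for j k x t
 proof -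
  have b: "\<bar>F jk (x + t) + F jk (x - t) - 2 * F jk x\<bar> <= Cg * norm t ^ \<beta>" for jk
   using F2[OF t, of jk x] mult_right_mono[OF Cle[of jk], of "norm t ^ \<beta>"] by simp
  have e: "G j k (x + t) + G j k (x - t) - 2 * G j k x = ((F (j, k) (x + t) + F (j, k) (x - t) - 2 * F (j, k) x) + (F (k, j) (x + t) + F (k, j) (x - t) - 2 * F (k, j) x)) / 2"
   by (simp add: G_def add_divide_distrib diff_divide_distrib)
  have "\<bar>(a + b) / 2\<bar> <= c" if "\<bar>a\<bar> <= c" "\<bar>b\<bar> <= c" for a b c :: real using that by (simp add: abs_le_iff field_simps)
  from this[OF b b] show ?thesis unfolding e .
 qed
 have uC: "Ck_closure 1 \<Omega> ubar" and inj: "!!x. x:K ==> inj ((*v) (Jac \<Omega> ubar x))" using assms(5) by (auto simp: immersion_def K_def)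
 define q where "q = (%a i x. pd \<Omega> i ubar x $ a)"
 have uc: "continuous_on K (%x. ubar x $ a)" and qc: "continuous_on K (q a i)" and ud: "x:\<Omega> ==> ubar dif x" for a i x
  using uC unfolding q_def K_def by (auto intro!: continuous_on_component)
 define g0 where "g0 = (%j k x. SU a. q a j x * q a k x)"
 have g0c: "continuous_on K (g0 j k)" for j k unfolding g0_def by (intro continuous_intros qc)
 have g0J: "(norm (Jac \<Omega> ubar x *v v))\<^sup>2 = quad (%j k. g0 j k x) v" if "x:K" for x v
  using Jac_quad[OF uC] that by (simp add: g0_def q_def K_def)
 have g0pos: "0 < quad (%j k. g0 j k x) v" if "x:K" "v ~= 0" for x v
 proof -
  have "Jac \<Omega> ubar x *v v ~= 0" using injD[OF inj[OF that(1)], of v 0] that(2) by auto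
  thus ?thesis unfolding g0J[OF that(1), symmetric] by simp
 qed
 obtain c0 where c0: "0 < c0" "!!x v. x:K ==> c0 * norm v ^ 2 <= quad (%j k. g0 j k x) v" using posdef_compact[OF K(1,2) g0c g0pos] by blast
 have Gpos: "0 < quad (%j k. G j k x) v" if "x:K" "v ~= 0" for x v
  using Kg[OF that(1)] that(2) unfolding GK[OF that(1)] Sym_pos_def by (simp add: quad_matrix)
 obtain c1 where c1: "0 < c1" "!!x v. x:K ==> c1 * norm v ^ 2 <= quad (%j k. G j k x) v" using posdef_compact[OF K(1,2) Gc Gpos] by blast
 have sh: "quad (%j k. g0 j k x) v <= quad (%j k. G j k x) v" if "x:K" for x v
 proof -
  have "v \<bullet> (induced \<Omega> ubar x *v v) <= v \<bullet> (g x *v v)" using assms(6) that by (simp add: short_def qf_le_def K_def)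
  moreover have "induced \<Omega> ubar x $ j $ k = g0 j k x" for j k using induced_entry[OF uC] that by (simp add: g0_def q_def K_def)
  ultimately show ?thesis by (simp add: quad_matrix GK[OF that])
 qed
 have "ALL a. EX B. ALL x:K. \<bar>ubar x $ a\<bar> <= B" using bd[OF uc] by blast
 from choice[OF this] obtain Mb where Mb: "!!a x. x:K ==> \<bar>ubar x $ a\<bar> <= Mb a" by blast
 define M where "M = Max (range Mb)"
 have M: "\<bar>ubar x $ a\<bar> <= M" if "x:K" for x a
  unfolding M_def by (rule order_trans[OF Mb[OF that] Max_ge]) auto
 have "ALL ai. EX B. ALL x:K. \<bar>q (fst ai) (snd ai) x\<bar> <= B" using bd[OF qc] by blast
 from choice[OF this] obtain Qb where Qb: "!!ai x. x:K ==> \<bar>q (fst ai) (snd ai) x\<bar> <= Qb ai" by blast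
 define Q where "Q = Max (range Qb)"
 have Q: "\<bar>q a i x\<bar> <= Q" if "x:K" for x a i
  unfolding Q_def by (rule order_trans[OF Qb[OF that, of "(a, i)", simplified] Max_ge]) auto
 have Q0: "0 <= Q" and M0: "0 <= M" using K(2) Q M by (meson abs_ge_zero all_not_in_conv order_trans)+
 \<comment> \<open>Scaling \<open>ubar\<close> by \<open>1 - \<tau>\<close> makes it strictly short
   with gap at least \<open>\<tau> c1\<close>. Three displacements (scaling, smoothing, iteration)
   may each use \<open>\<epsilon> / (6 m)\<close> per component, together
   \<open>\<epsilon> / 2\<close>; this keeps the supremum strictly below
   \<open>\<epsilon>\<close>.\<close>
 define \<tau> where "\<tau> = min (1/2) (\<epsilon> / (6 * ?m * (M + 1)))"
 have \<tau>: "0 < \<tau>" "\<tau> <= 1/2" "\<tau> * M <= \<epsilon> / (6 * ?m)"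
 proof -
  have "\<tau> <= \<epsilon> / (6 * ?m * (M + 1))" by (simp add: \<tau>_def)
  hence "\<tau> * (M + 1) <= \<epsilon> / (6 * ?m * (M + 1)) * (M + 1)" using M0 by (intro mult_right_mono) auto
  also have "... = \<epsilon> / (6 * ?m)" using M0 by simp
  finally show "\<tau> * M <= \<epsilon> / (6 * ?m)" using \<open>0 < \<epsilon>\<close> M0 m1 unfolding \<tau>_def by (smt (verit) divide_nonneg_nonneg distrib_left mult_nonneg_nonneg)
 qed (use \<open>0 < \<epsilon>\<close> M0 m1 in \<open>auto simp: \<tau>_def\<close>)
 define l where "l = 1 - \<tau>"
 have l: "1/2 <= l" "l <= 1" using \<tau> by (simp_all add: l_def)
 define c2 where "c2 = min (c0 / 4) (\<tau> * c1)"
 have c2: "0 < c2" "c2 <= c0 / 4" "c2 <= \<tau> * c1" using c0 c1 \<tau> by (auto simp: c2_def)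
 \<comment> \<open>The last bound keeps the Gram matrix of the smoothed map within
   \<open>c2 / 2\<close> of \<open>l^2 g0\<close> as a quadratic form, so that half of
   \<open>c2\<close> remains both for shortness and for immersion.\<close>
 define \<eta> where "\<eta> = min (min 1 (\<epsilon> / (6 * ?m))) (c2 / (2 * (?n^2 * (?m * (2 * Q + 1)))))"
 have \<eta>: "0 < \<eta>" "\<eta> <= 1" "\<eta> <= \<epsilon> / (6 * ?m)" "?n^2 * (?m * (2 * Q + 1) * \<eta>) <= c2 / 2"
 proof -
  have p: "0 < ?n^2 * (?m * (2 * Q + 1))" using n1 m1 Q0 by (intro mult_pos_pos) auto
  have "\<eta> <= c2 / (2 * (?n^2 * (?m * (2 * Q + 1))))" by (simp add: \<eta>_def)
  hence "\<eta> * (?n^2 * (?m * (2 * Q + 1))) <= c2 / (2 * (?n^2 * (?m * (2 * Q + 1)))) * (?n^2 * (?m * (2 * Q + 1)))" using p by (intro mult_right_mono) auto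
  also have "... = c2 / 2" using p by (simp add: field_simps)
  finally show "?n^2 * (?m * (2 * Q + 1) * \<eta>) <= c2 / 2" by (simp only: mult_ac)
  show "0 < \<eta>" unfolding \<eta>_def using p c2 \<open>0 < \<epsilon>\<close> m1 by (auto intro!: divide_pos_pos)
 qed (auto simp: \<eta>_def min.coboundedI1)
 have "EX W v. patch W & K \<subseteq> W & patch.sm W v & (ALL x:K. \<bar>v x - l * ubar x $ a\<bar> <= \<eta> & (ALL i. \<bar>pder i v x - l * q a i x\<bar> <= \<eta>))" for a
 proof (rule smooth_approx[OF \<Omega>(1) K(3,1) _ _ _ _ cone \<eta>(1)])
  show "continuous_on K (%x. l * ubar x $ a)" "continuous_on K (%x. l * q a i x)" for i by (intro continuous_intros uc qc)+
  fix x assume x: "x:\<Omega>"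
  note cp = component_pder[OF bounded_linear_vec_nth[of a] ud[OF x]]
  show "(%x. l * ubar x $ a) dif x" by (rule differentiable_mult[OF differentiable_const cp(1)])
  show "pder i (%x. l * ubar x $ a) x = l * q a i x" for i
   unfolding pder_cmult[OF cp(1)] cp(2) by (simp add: q_def pd_in[OF x])
 qed
 hence "ALL a. EX W v. patch W & K \<subseteq> W & patch.sm W v & (ALL x:K. \<bar>v x - l * ubar x $ a\<bar> <= \<eta> & (ALL i. \<bar>pder i v x - l * q a i x\<bar> <= \<eta>))" by blast
 from choice[OF this] obtain Wa where "ALL a. EX v. patch (Wa a) & K \<subseteq> Wa a & patch.sm (Wa a) v & (ALL x:K. \<bar>v x - l * ubar x $ a\<bar> <= \<eta> & (ALL i. \<bar>pder i v x - l * q a i x\<bar> <= \<eta>))" by blast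
 from choice[OF this] obtain v0 where Wa: "!!a. patch (Wa a)" "!!a. K \<subseteq> Wa a" "!!a. patch.sm (Wa a) (v0 a)"
  and v0: "!!a x. x:K ==> \<bar>v0 a x - l * ubar x $ a\<bar> <= \<eta>" "!!a x i. x:K ==> \<bar>pder i (v0 a) x - l * q a i x\<bar> <= \<eta>" by blast
 define W where "W = (\<Inter>a. Wa a)"
 have W: "patch W" "K \<subseteq> W" using Wa(1,2) unfolding W_def patch_def by (auto intro!: open_INT)
 have v0s: "patch.sm W (v0 a)" for a by (rule sm_mono[OF Wa(1,3) _ W(1)]) (auto simp: W_def)
 have gd: "\<bar>gram v0 j k x - l^2 * g0 j k x\<bar> <= ?m * (2 * Q + 1) * \<eta>" if x: "x:K" for x j k
 proof -
  have "gram v0 j k x - l^2 * g0 j k x = (SU a. pder j (v0 a) x * pder k (v0 a) x - (l * q a j x) * (l * q a k x))"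
   by (simp add: g0_def sum_subtractf sum_distrib_left power2_eq_square mult_ac)
  also have "\<bar>...\<bar> <= (SUM a:(UNIV::'m set). (2 * Q + 1) * \<eta>)"
  proof (rule order_trans[OF sum_abs sum_mono])
   fix a
   define A B where "A = pder j (v0 a) x - l * q a j x" and "B = pder k (v0 a) x - l * q a k x"
   have AB: "\<bar>A\<bar> <= \<eta>" "\<bar>B\<bar> <= \<eta>" using v0(2)[OF x] by (simp_all add: A_def B_def)
   have lq: "\<bar>l * q a i x\<bar> <= Q" for i
    using mult_mono[of "\<bar>l\<bar>" 1 "\<bar>q a i x\<bar>" Q] l Q[OF x] Q0 by (simp add: abs_mult)
   have "pder j (v0 a) x * pder k (v0 a) x - (l * q a j x) * (l * q a k x) = A * (l * q a k x) + (l * q a j x) * B + A * B"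
    by (simp add: A_def B_def algebra_simps)
   also have "\<bar>...\<bar> <= \<eta> * Q + Q * \<eta> + \<eta> * 1"
   proof -
    have "\<bar>A * (l * q a k x)\<bar> <= \<eta> * Q" "\<bar>(l * q a j x) * B\<bar> <= Q * \<eta>" "\<bar>A * B\<bar> <= \<eta> * 1"
     unfolding abs_mult[of A] abs_mult[of _ B] using AB lq \<eta> Q0 by (intro mult_mono; simp)+
    thus ?thesis by linarith
   qed
   finally show "\<bar>pder j (v0 a) x * pder k (v0 a) x - (l * q a j x) * (l * q a k x)\<bar> <= (2 * Q + 1) * \<eta>" by (simp add: algebra_simps)
  qed
  finally show ?thesis by (simp add: mult.assoc)
 qed
 have qd: "\<bar>quad (%j k. gram v0 j k x) v - l^2 * quad (%j k. g0 j k x) v\<bar> <= c2 / 2 * norm v ^ 2" if x: "x:K" for x v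
 proof -
  have "\<bar>quad (%j k. gram v0 j k x - l^2 * g0 j k x) v\<bar> <= ?n^2 * (?m * (2 * Q + 1) * \<eta>) * norm v ^ 2" by (rule sum_abs_bound[OF gd[OF x]])
  also have "... <= c2 / 2 * norm v ^ 2" using \<eta>(4) by (rule mult_right_mono) simp
  finally show ?thesis unfolding quad_diff by (simp add: sum_distrib_left mult_ac)
 qed
 define \<gamma> where "\<gamma> = sqrt (c2 / 16)"
 have \<gamma>: "0 < \<gamma>" "8 * \<gamma>^2 = c2 / 2" using c2 by (simp_all add: \<gamma>_def)
 have lo: "8 * \<gamma>^2 * norm v ^ 2 <= quad (%j k. gram v0 j k x) v" if x: "x:K" for x v
 proof -
  have "1 / 4 <= l^2" using mult_mono[OF l(1) l(1)] l by (simp add: power2_eq_square)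
  hence "1 / 4 * (c0 * norm v ^ 2) <= l^2 * quad (%j k. g0 j k x) v" using c0 x by (intro mult_mono) auto
  moreover have "c2 * norm v ^ 2 <= c0 / 4 * norm v ^ 2" using c2(2) by (rule mult_right_mono) simp
  ultimately have "c2 * norm v ^ 2 <= l^2 * quad (%j k. g0 j k x) v" by simp
  thus ?thesis using qd[OF x, of v] unfolding \<gamma>(2) by linarith
 qed
 have c22: "0 < c2 / 2" using c2 by simp
 have strict: "c2 / 2 * norm v ^ 2 <= quad (%j k. G j k x - gram v0 j k x) v" if x: "x:K" for x v
 proof -
  have l2: "l^2 <= l" using l by (simp add: power2_eq_square mult_left_le)
  have g00: "0 <= quad (%j k. g0 j k x) v" using order_trans[OF _ c0(2)[OF x, of v]] c0(1) by simp
  have "l^2 * quad (%j k. g0 j k x) v <= l * quad (%j k. G j k x) v" using l2 sh[OF x, of v] g00 l by (intro mult_mono) auto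
  moreover have "\<tau> * (c1 * norm v ^ 2) <= \<tau> * quad (%j k. G j k x) v" using c1(2)[OF x, of v] \<tau> by (intro mult_left_mono) auto
  moreover have "quad (%j k. G j k x) v = l * quad (%j k. G j k x) v + \<tau> * quad (%j k. G j k x) v" by (simp add: l_def left_diff_distrib)
  moreover have "c2 * norm v ^ 2 <= \<tau> * c1 * norm v ^ 2" using c2(3) by (rule mult_right_mono) simp
  ultimately have "c2 * norm v ^ 2 <= quad (%j k. G j k x) v - l^2 * quad (%j k. g0 j k x) v" unfolding mult.assoc by linarith
  thus ?thesis using qd[OF x, of v] unfolding quad_diff by linarith
 qed
 define N where "N = CARD('n) * (CARD('n) - 1) div 2"
 have "even (CARD('n) * (CARD('n) - 1))" by simp
 hence N: "2 * N = CARD('n) * (CARD('n) - 1)" by (simp add: N_def)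
 have NR: "1 + 2 * real N = 1 + ?n ^ 2 - ?n"
 proof -
  have "2 * real N = real (CARD('n) * (CARD('n) - 1))" using N by (metis of_nat_mult of_nat_numeral)
  thus ?thesis using n1 by (simp add: of_nat_diff power2_eq_square algebra_simps)
 qed
 have \<alpha>: "\<alpha> * (1 + 2 * real N) < 1"
 proof -
  have "0 < 1 + 2 * real N" by (simp add: add_pos_nonneg)
  thus ?thesis using assms(9) unfolding NR by (simp add: pos_less_divide_eq)
 qed
 have \<beta>: "1 <= \<beta>" "N = 0 ==> 2 <= \<beta>"
 proof -
  assume "N = 0"
  hence "CARD('n) - 1 = 0" using N by simp
  hence "CARD('n) = 1" using zero_less_card_finite[where 'a='n] by linarith
  thus "2 <= \<beta>" by (simp add: \<beta>_def)
 qed (simp add: \<beta>_def)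
 have Cg0: "0 <= Cg" unfolding Cg_def using C0 by (intro sum_nonneg) auto
 have \<epsilon>6: "0 < \<epsilon> / (6 * ?m)" using \<open>0 < \<epsilon>\<close> m1 by simp
 have "EX \<rho> v H. 0 < \<rho> & (ALL x:thick K \<rho>. ALL a. v a dif x & \<bar>v a x - v0 a x\<bar> <= \<epsilon> / (6 * ?m)) &
    (ALL x:thick K \<rho>. ALL j k. gram v j k x = G j k x) &
    (ALL x y i a. closed_segment x y \<subseteq> thick K \<rho> --> norm (x - y) <= 1 -->
     \<bar>pder i (v a) x - pder i (v a) y\<bar> <= H * norm (x - y) powr \<alpha>)"
  by (rule solve[OF assms(1) N assms(8) \<alpha> \<beta> K(1,2) Gc Gsym G2 Cg0 W v0s \<gamma>(1) c22 \<epsilon>6 lo strict])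
 then obtain \<rho> H and v :: "'m => 'n rfun" where \<rho>: "0 < \<rho>"
  and v': "ALL x:thick K \<rho>. ALL a. v a dif x & \<bar>v a x - v0 a x\<bar> <= \<epsilon> / (6 * ?m)"
  and vg': "ALL x:thick K \<rho>. ALL j k. gram v j k x = G j k x"
  and vH': "ALL x y i a. closed_segment x y \<subseteq> thick K \<rho> --> norm (x - y) <= 1 --> \<bar>pder i (v a) x - pder i (v a) y\<bar> <= H * norm (x - y) powr \<alpha>"
  by (elim exE conjE) (rule that, assumption+)
 note v = v'[rule_format] and vg = vg'[rule_format] and vH = vH'[rule_format]
 have KT: "K \<subseteq> thick K \<rho>" by (rule subset_thick[OF \<rho>])
 define r where "r = min \<rho> 1"
 have r: "0 < r" "r <= \<rho>" "r <= 1" using \<rho> by (auto simp: r_def)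
 \<comment> \<open>\<open>K\<close> may fail to be convex. A short segment starting in it can leave
   it, but it stays in the neighbourhood, where the Hoelder estimate is available.\<close>
 have seg: "closed_segment x y \<subseteq> thick K \<rho>" if "x:K" "norm (x - y) < r" for x y
 proof
  fix z assume "z:closed_segment x y"
  hence "dist z x <= norm (x - y)" using segment_bound(1) by (metis dist_norm norm_minus_commute)
  moreover have "infdist z K <= dist z x" by (rule infdist_le[OF that(1)])
  ultimately show "z:thick K \<rho>" using that(2) r by (simp add: thick_def)
 qed
 define u where "u = (%x. \<chi> a. v a x)"
 have pc: "continuous_on K (pder i (v a))" for i a unfolding continuous_on_def
 proof
  fix x assume x: "x:K"
  have "((%y. H * norm (x - y) powr \<alpha>) \<longlongrightarrow> H * norm (x - x) powr \<alpha>) (at x within K)"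
   using assms(8) by (intro tendsto_intros) auto
  hence lim: "((%y. H * norm (x - y) powr \<alpha>) \<longlongrightarrow> 0) (at x within K)" by simp
  have "\<forall>\<^sub>F y in at x within K. dist y x < r" using r(1) by (auto simp: eventually_at)
  hence "\<forall>\<^sub>F y in at x within K. norm (pder i (v a) y - pder i (v a) x) <= H * norm (x - y) powr \<alpha>"
  proof eventually_elim
   case (elim y)
   hence "norm (x - y) < r" by (simp add: dist_norm norm_minus_commute)
   thus ?case using vH[OF seg[OF x], of y i a] r(3) by (simp add: abs_minus_commute)
  qed
  from Lim_null_comparison[OF this lim] show "(pder i (v a) \<longlongrightarrow> pder i (v a) x) (at x within K)" by (simp add: LIM_zero_iff)
 qed
 have du: "(u has_derivative (%h. \<chi> a. SU i. h $ i * pder i (v a) x)) (at x)" if "x:thick K \<rho>" for x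
  unfolding u_def by (subst has_derivative_componentwise_within) (use pder_works v[OF that] in \<open>auto simp: Basis_vec_def inner_axis\<close>)
 have uK: "pd \<Omega> i u x = (\<chi> a. pder i (v a) x)" if "x:K" for x i unfolding pd_def
 proof (rule bdry_ext_eq)
  show "x:closure \<Omega>" using that by (simp add: K_def)
  show "continuous_on (closure \<Omega>) (%x. \<chi> a. pder i (v a) x)" using pc by (intro continuous_on_vec_lambda) (simp add: K_def)
  fix y assume "y:\<Omega>"
  hence "y:thick K \<rho>" using K(3) KT by blast
  hence "frechet_derivative u (at y) = (%h. \<chi> a. SU i. h $ i * pder i (v a) y)" by (rule frechet_derivative_at[symmetric, OF du])
  thus "(\<chi> a. pder i (v a) y) = frechet_derivative u (at y) (axis i 1)"
   by (simp add: axis_def if_distrib[of "%q. q * _"] cong: if_cong)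
 qed
 have C1: "Ck_closure 1 \<Omega> u"
 proof -
  have "continuous_on K u" using du KT by (intro continuous_at_imp_continuous_on ballI has_derivative_continuous) blast
  moreover have "continuous_on K (pd \<Omega> i u)" for i
   by (rule continuous_on_eq[OF continuous_on_vec_lambda[OF pc]]) (simp add: uK)
  moreover have "u dif x" if "x:\<Omega>" for x using du K(3) KT that by (blast intro: differentiableI)
  ultimately show ?thesis by (simp add: K_def)
 qed
 have gu: "(SU a. pd \<Omega> j u x $ a * pd \<Omega> k u x $ a) = g x $ j $ k" if "x:K" for x j k
  using vg[of x j k] GK[OF that] KT that by (auto simp: uK)
 have ind: "induced \<Omega> u x = g x" if "x:K" for x
  using induced_entry[OF C1] gu[OF that] that by (simp add: vec_eq_iff K_def)
 have imm: "immersion \<Omega> u" unfolding immersion_def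
 proof (intro conjI C1 ballI)
  fix x assume "x:closure \<Omega>"
  hence x: "x:K" by (simp add: K_def)
  have J: "(norm (Jac \<Omega> u x *v w))\<^sup>2 = quad (%j k. G j k x) w" for w
   using Jac_quad[OF C1] x by (simp add: gu GK K_def)
  show "inj ((*v) (Jac \<Omega> u x))"
  proof (rule injI)
   fix w w' assume "Jac \<Omega> u x *v w = Jac \<Omega> u x *v w'"
   hence "Jac \<Omega> u x *v (w - w') = 0" by (simp add: matrix_vector_mult_diff_distrib)
   hence "quad (%j k. G j k x) (w - w') = 0" using J[of "w - w'"] by simp
   thus "w = w'" using Gpos[OF x, of "w - w'"] by (cases "w - w' = 0") auto
  qed
 qed
 have hol: "holder_on \<alpha> (closure \<Omega>) (pd \<Omega> i u)" for i
 proof -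
  have "ALL a. EX B. ALL x:K. \<bar>pder i (v a) x\<bar> <= B" using bd[OF pc] by blast
  from choice[OF this] obtain B where B: "!!a x. x:K ==> \<bar>pder i (v a) x\<bar> <= B a" by blast
  \<comment> \<open>The second summand covers pairs of points at distance at least \<open>r\<close>,
    for which only the sup bound \<open>B\<close> is used.\<close>
  define C where "C = (%a. \<bar>H\<bar> + 2 * B a / r powr \<alpha>)"
  have rp: "0 < r powr \<alpha>" using r by simp
  have B0: "0 <= B a" for a using B K(2) by (meson abs_ge_zero all_not_in_conv order_trans)
  have comp: "\<bar>pder i (v a) x - pder i (v a) y\<bar> <= C a * dist x y powr \<alpha>" if x: "x:K" and y: "y:K" for a x y
  proof (cases "norm (x - y) < r")
   case True
   have "\<bar>pder i (v a) x - pder i (v a) y\<bar> <= H * norm (x - y) powr \<alpha>" using vH[OF seg[OF x True]] True r(3) by simp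
   also have "... <= C a * norm (x - y) powr \<alpha>" using B0[of a] rp by (intro mult_right_mono) (auto simp: C_def intro!: add_increasing2)
   finally show ?thesis by (simp add: dist_norm)
  next
   case False
   have "\<bar>pder i (v a) x - pder i (v a) y\<bar> <= 2 * B a / r powr \<alpha> * r powr \<alpha>" using B[OF x, of a] B[OF y, of a] rp by simp
   also have "... <= C a * norm (x - y) powr \<alpha>"
    using False B0[of a] rp r(1) assms(8) by (intro mult_mono powr_mono2) (auto simp: C_def)
   finally show ?thesis by (simp add: dist_norm)
  qed
  have "dist (pd \<Omega> i u x) (pd \<Omega> i u y) <= (SU a. C a) * dist x y powr \<alpha>" if x: "x:K" and y: "y:K" for x y
  proof -
   have "dist (pd \<Omega> i u x) (pd \<Omega> i u y) <= (SU a. \<bar>(pd \<Omega> i u x - pd \<Omega> i u y) $ a\<bar>)" unfolding dist_norm by (rule norm_le_l1_cart)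
   also have "... <= (SU a. C a * dist x y powr \<alpha>)" using comp[OF x y] by (intro sum_mono) (simp add: uK x y)
   finally show ?thesis by (simp add: sum_distrib_right)
  qed
  thus ?thesis unfolding holder_on_def K_def by blast
 qed
 have close: "norm (u x - ubar x) <= \<epsilon> / 2" if x: "x:K" for x
 proof -
  have "norm (u x - ubar x) <= (SU a. \<bar>(u x - ubar x) $ a\<bar>)" by (rule norm_le_l1_cart)
  also have "... <= (SUM a:(UNIV::'m set). \<epsilon> / (6 * ?m) + \<epsilon> / (6 * ?m) + \<epsilon> / (6 * ?m))"
  proof (rule sum_mono)
   fix a
   have "\<bar>v a x - v0 a x\<bar> <= \<epsilon> / (6 * ?m)" using v[of x a] KT x by blast
   moreover have "\<bar>v0 a x - l * ubar x $ a\<bar> <= \<epsilon> / (6 * ?m)" using v0(1)[OF x, of a] \<eta>(3) by linarith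
   moreover have "\<bar>l * ubar x $ a - ubar x $ a\<bar> <= \<epsilon> / (6 * ?m)"
   proof -
    have "l * ubar x $ a - ubar x $ a = - (\<tau> * ubar x $ a)" by (simp add: l_def algebra_simps)
    hence "\<bar>l * ubar x $ a - ubar x $ a\<bar> = \<tau> * \<bar>ubar x $ a\<bar>" using \<tau>(1) by (simp add: abs_mult)
    also have "... <= \<tau> * M" using M[OF x, of a] \<tau>(1) by (intro mult_left_mono) auto
    finally show ?thesis using \<tau>(3) by linarith
   qed
   moreover have "\<bar>a - b\<bar> <= e ==> \<bar>b - c\<bar> <= e ==> \<bar>c - d\<bar> <= e ==> \<bar>a - d\<bar> <= e + e + e" for a b c d e :: real by linarith
   ultimately have "\<bar>v a x - ubar x $ a\<bar> <= \<epsilon> / (6 * ?m) + \<epsilon> / (6 * ?m) + \<epsilon> / (6 * ?m)" by blast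
   thus "\<bar>(u x - ubar x) $ a\<bar> <= \<epsilon> / (6 * ?m) + \<epsilon> / (6 * ?m) + \<epsilon> / (6 * ?m)" by (simp add: u_def)
  qed
  also have "... = \<epsilon> / 2" by simp
  finally show ?thesis .
 qed
 have "(SUP x\<in>closure \<Omega>. norm (u x - ubar x)) <= \<epsilon> / 2"
  by (rule cSUP_least) (use close K in \<open>auto simp: K_def\<close>)
 also have "... < \<epsilon>" using \<open>0 < \<epsilon>\<close> by simp
 finally show ?thesis using imm C1 hol ind unfolding C1_holder_closure_def K_def by blast
qed

end
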